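(* Let $Q$ be a finite quiver with vertex set $I$, let $V=\{V_i\}_{i\in I}$ be a collection of finite dimensional $\mathbb{C}$-vector spaces, and let $\mathcal{O}\subset \mathfrak{sg}(V)\simeq\mathfrak{g}(V)^*$ be a closed $\mathrm{Ad}\,G(V)$-orbit such that the group $G(V)$ acts freely on the subvariety $\mu^{-1}(\mathcal{O})\subset \mathscr{R}(\overline{Q},V)$. Then the symplectic variety $\mathscr{R}_{\mathcal{O}}(\overline{Q},V)=\mu^{-1}(\mathcal{O})/G(V)$ can be embedded as a coadjoint orbit in the dual $\mathfrak{L}(Q)^*$ of the infinite dimensional Lie algebra $\mathfrak{L}(Q)$ canonically attached to $Q$ (and not depending on $V$), in such a way that the symplectic structure on $\mathscr{R}_{\mathcal{O}}(\overline{Q},V)$ corresponds to the Kirillov–Kostant symplectic structure on the coadjoint orbit.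
   Context: **Representations.** The double $\overline{Q}$ of $Q$ is obtained by adding a reverse arrow $a^*$ for every arrow $a\in Q$. $\mathscr{R}(\overline{Q},V)$ is the vector space of representations $\varrho$ of $\overline{Q}$ in $V$: each arrow with tail $i$ and head $j$ is assigned a linear map $V_i\to V_j$. $G(V)=\left(\prod_i GL(V_i)\right)/\mathbb{C}^*$ (quotient by diagonal scalars) acts by conjugation, and $\mathfrak{g}(V)=(\bigoplus_i\mathfrak{gl}(V_i))/\mathbb{C}$ is its Lie algebra. Via the pairing $(x,y)\mapsto\sum_i\mathrm{tr}(x_iy_i)$ one identifies $\mathfrak{g}(V)^*$ with $\mathfrak{sg}(V)=\{x\in\bigoplus_i\mathfrak{gl}(V_i):\sum_i\mathrm{tr}(x_i)=0\}$. $\mathscr{R}(\overline{Q},V)\simeq T^*\mathscr{R}(Q,V)$ (via the trace pairing) carries its canonical symplectic structure. In terms of matrix entries its Poisson bracket is $\{F,G\}=\sum_{a\in Q}\sum_{p,q}\left(\frac{\partial F}{\partial a_{pq}}\frac{\partial G}{\partial a^*_{qp}}-\frac{\partial F}{\partial a^*_{qp}}\frac{\partial G}{\partial a_{pq}}\right)$. The moment map $\mu:\mathscr{R}(\overline{Q},V)\to\mathfrak{sg}(V)$ is $$\mu(\varrho)_i=\sum_{a\in Q,\ \mathrm{head}(a)=i}\varrho(a)\varrho(a^* )-\sum_{a\in Q,\ \mathrm{tail}(a)=i}\varrho(a^* )\varrho(a).$$ **Affine quiver variety.** Let $\mathscr{I}\subset\mathbb{C}[\mathscr{R}(\overline{Q},V)]$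 be the defining ideal of $\mu^{-1}(\mathcal{O})$. Under the freeness hypothesis $\mathscr{R}_{\mathcal{O}}(\overline{Q},V)=\mu^{-1}(\mathcal{O})/G(V)=\mathrm{Spec}\left(\mathbb{C}[\mathscr{R}(\overline{Q},V)]^{G(V)}/\mathscr{I}^{G(V)}\right)$ is a smooth affine variety with the symplectic structure given by symplectic reduction. The corresponding Poisson bracket on its coordinate ring is the one induced from the bracket on $\mathbb{C}[\mathscr{R}(\overline{Q},V)]^{G(V)}$. **The Lie algebra $\mathfrak{L}(Q)$.** Let $A$ be the path algebra over $\mathbb{C}$ of $\overline{Q}$ (including the constant paths $1_i$, $i\in I$, with arrows multiplied as composition of maps). As a vector space $\mathfrak{L}(Q)=A/[A,A]$, where $[A,A]$ is the $\mathbb{C}$-linear span of all commutators. It has a basis of closed paths up to cyclic rotation. For a closed path $f=c_1c_2\cdots c_n$ and an arrow $c$ put $\frac{\partial f}{\partial c}=\sum_{k:\,c_k=c}c_{k+1}\cdots c_nc_1\cdots c_{k-1}\in A$ (zero for constant paths), extended linearly. The Lie bracket is $$\{f,g\}=\sum_{a\in Q}\left(\frac{\partial f}{\partial a}\cdot\frac{\partial g}{\partial a^*}-\frac{\partial f}{\partial a^*}\cdot\frac{\partial g}{\partial a}\right)\bmod [A,A].$$ **Embedded as a coadjoint orbit.** For a smooth affine symplectic variety $X$ and a Lie algebra $\mathfrak{L}$ (possibly infinite dimensional, $\mathfrak{L}^*$ being the full linear dual), this means that there is an injective map $\phi:X\to\mathfrak{L}^*$ such that: (a) for each $f\in\mathfrak{L}$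 the function $\phi^*f:x\mapsto\phi(x)(f)$ is regular on $X$, and $f\mapsto\phi^*f$ is a Lie algebra homomorphism from $\mathfrak{L}$ to $\mathbb{C}[X]$ with the Poisson bracket (compatibility with the Kirillov–Kostant structure); (b) at every $x\in X$ the differential $d\phi_x:T_xX\to\mathfrak{L}^*$ is injective, with image equal to the tangent space $\{\mathrm{ad}^*_f\,\phi(x):f\in\mathfrak{L}\}$ to the coadjoint orbit (infinitesimal transitivity). *)

theory Defs
  imports
    "HOL-Analysis.Derivative"
    "HOL-Library.Poly_Mapping"
    "HOL-Library.FuncSet"
    "HOL-Algebra.Group_Action"
    "HOL-Algebra.Product_Groups"
    "Graph_Theory.Arc_Walk"
    "Jordan_Normal_Form.Matrix"
begin

section \<open>Quivers and representations\<close>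

text \<open>
  A finite quiver is a \<open>fin_digraph\<close> (loops and multiple arrows are allowed). In the double,
  \<open>Inl a\<close> is the arrow \<open>a\<close> and \<open>Inr a\<close> is the reverse arrow \<open>a*\<close>.
\<close>

definition double :: "('v, 'e) pre_digraph \<Rightarrow> ('v, 'e + 'e) pre_digraph" where
  "double Q = \<lparr>verts = verts Q,
               arcs = Inl ` arcs Q \<union> Inr ` arcs Q,
               tail = case_sum (tail Q) (head Q),
               head = case_sum (head Q) (tail Q)\<rparr>"

text \<open>
  The vector space at the vertex \<open>i\<close> is \<open>\<complex>\<^sup>n\<close> with \<open>n = d i\<close>, so a representation is a family of
  matrices. A linear map from the tail to the head of \<open>c\<close> is a matrix with \<open>d (head c)\<close> rows and
  \<open>d (tail c)\<close> columns.
\<close>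

definition mat_families :: "'k set \<Rightarrow> ('k \<Rightarrow> nat) \<Rightarrow> ('k \<Rightarrow> nat) \<Rightarrow> ('k \<Rightarrow> complex mat) set" where
  "mat_families K nr nc = (\<Pi>\<^sub>E k\<in>K. carrier_mat (nr k) (nc k))"

definition row_dim :: "('v, 'e) pre_digraph \<Rightarrow> ('v \<Rightarrow> nat) \<Rightarrow> 'e + 'e \<Rightarrow> nat" where
  "row_dim Q d c = d (head (double Q) c)"

definition col_dim :: "('v, 'e) pre_digraph \<Rightarrow> ('v \<Rightarrow> nat) \<Rightarrow> 'e + 'e \<Rightarrow> nat" where
  "col_dim Q d c = d (tail (double Q) c)"

definition rep_space :: "('v, 'e) pre_digraph \<Rightarrow> ('v \<Rightarrow> nat) \<Rightarrow> ('e + 'e \<Rightarrow> complex mat) set" where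
  "rep_space Q d = mat_families (arcs (double Q)) (row_dim Q d) (col_dim Q d)"

definition mat_trace :: "complex mat \<Rightarrow> complex" where
  "mat_trace M = (\<Sum>p<dim_row M. M $$ (p, p))"

definition sg :: "('v, 'e) pre_digraph \<Rightarrow> ('v \<Rightarrow> nat) \<Rightarrow> ('v \<Rightarrow> complex mat) set" where
  "sg Q d = {x \<in> mat_families (verts Q) d d. (\<Sum>i\<in>verts Q. mat_trace (x i)) = 0}"

subsection \<open>The group $G(V)$ and its actions\<close>

abbreviation gl_ring :: "nat \<Rightarrow> complex mat ring" where
  "gl_ring n \<equiv> ring_mat TYPE(complex) n ()"

definition GL_product :: "('v, 'e) pre_digraph \<Rightarrow> ('v \<Rightarrow> nat) \<Rightarrow> ('v \<Rightarrow> complex mat) monoid" where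
  "GL_product Q d = product_group (verts Q) (\<lambda>i. units_of (gl_ring (d i)))"

definition scalar_family :: "('v, 'e) pre_digraph \<Rightarrow> ('v \<Rightarrow> nat) \<Rightarrow> complex \<Rightarrow> 'v \<Rightarrow> complex mat" where
  "scalar_family Q d z = (\<lambda>i\<in>verts Q. z \<cdot>\<^sub>m 1\<^sub>m (d i))"

definition gauge_group :: "('v, 'e) pre_digraph \<Rightarrow> ('v \<Rightarrow> nat) \<Rightarrow> ('v \<Rightarrow> complex mat) set monoid" where
  "gauge_group Q d = GL_product Q d Mod {scalar_family Q d z | z. z \<noteq> 0}"

definition conj_rep :: "('v, 'e) pre_digraph \<Rightarrow> ('v \<Rightarrow> nat) \<Rightarrow> ('v \<Rightarrow> complex mat) \<Rightarrow>
    ('e + 'e \<Rightarrow> complex mat) \<Rightarrow> ('e + 'e \<Rightarrow> complex mat)" where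
  "conj_rep Q d g \<rho> = (\<lambda>c\<in>arcs (double Q).
     g (head (double Q) c) * \<rho> c * inv\<^bsub>gl_ring (d (tail (double Q) c))\<^esub> g (tail (double Q) c))"

definition conj_gl :: "('v, 'e) pre_digraph \<Rightarrow> ('v \<Rightarrow> nat) \<Rightarrow> ('v \<Rightarrow> complex mat) \<Rightarrow>
    ('v \<Rightarrow> complex mat) \<Rightarrow> ('v \<Rightarrow> complex mat)" where
  "conj_gl Q d g x = (\<lambda>i\<in>verts Q. g i * x i * inv\<^bsub>gl_ring (d i)\<^esub> g i)"

text \<open>
  Scalars act trivially by conjugation, so all representatives of a coset in \<open>gauge_group Q d\<close>
  act in the same way and the image below is a singleton.
\<close>

definition coset_act :: "('g \<Rightarrow> 'x \<Rightarrow> 'x) \<Rightarrow> 'g set \<Rightarrow> 'x \<Rightarrow> 'x" where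
  "coset_act act U x = the_elem ((\<lambda>g. act g x) ` U)"

definition rep_act :: "('v, 'e) pre_digraph \<Rightarrow> ('v \<Rightarrow> nat) \<Rightarrow> ('v \<Rightarrow> complex mat) set \<Rightarrow>
    ('e + 'e \<Rightarrow> complex mat) \<Rightarrow> ('e + 'e \<Rightarrow> complex mat)" where
  "rep_act Q d = coset_act (conj_rep Q d)"

definition Ad :: "('v, 'e) pre_digraph \<Rightarrow> ('v \<Rightarrow> nat) \<Rightarrow> ('v \<Rightarrow> complex mat) set \<Rightarrow>
    ('v \<Rightarrow> complex mat) \<Rightarrow> ('v \<Rightarrow> complex mat)" where
  "Ad Q d = coset_act (conj_gl Q d)"

definition acts_freely :: "('g, 'm) monoid_scheme \<Rightarrow> ('g \<Rightarrow> 'x \<Rightarrow> 'x) \<Rightarrow> 'x set \<Rightarrow> bool" where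
  "acts_freely G act E \<longleftrightarrow> (\<forall>x\<in>E. stabilizer G act x = {\<one>\<^bsub>G\<^esub>})"

definition moment_map :: "('v, 'e) pre_digraph \<Rightarrow> ('v \<Rightarrow> nat) \<Rightarrow>
    ('e + 'e \<Rightarrow> complex mat) \<Rightarrow> ('v \<Rightarrow> complex mat)" where
  "moment_map Q d \<rho> = (\<lambda>i\<in>verts Q.
     finsum (gl_ring (d i)) (\<lambda>a. \<rho> (Inl a) * \<rho> (Inr a)) {a \<in> arcs Q. head Q a = i}
   - finsum (gl_ring (d i)) (\<lambda>a. \<rho> (Inr a) * \<rho> (Inl a)) {a \<in> arcs Q. tail Q a = i})"

definition moment_preimage :: "('v, 'e) pre_digraph \<Rightarrow> ('v \<Rightarrow> nat) \<Rightarrow> ('v \<Rightarrow> complex mat) set \<Rightarrow>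
    ('e + 'e \<Rightarrow> complex mat) set" where
  "moment_preimage Q d \<O> = {\<rho> \<in> rep_space Q d. moment_map Q d \<rho> \<in> \<O>}"

subsection \<open>Polynomial functions and the Poisson bracket\<close>

text \<open>
  Polynomials in the matrix entries are represented by the functions they define; this is
  faithful because \<open>\<complex>\<close> is infinite.
\<close>

inductive_set polynomial_functions ::
    "'k set \<Rightarrow> ('k \<Rightarrow> nat) \<Rightarrow> ('k \<Rightarrow> nat) \<Rightarrow> (('k \<Rightarrow> complex mat) \<Rightarrow> complex) set"
  for K nr nc where
    const: "(\<lambda>_. z) \<in> polynomial_functions K nr nc"
  | entry: "\<lbrakk>k \<in> K; p < nr k; q < nc k\<rbrakk> \<Longrightarrow> (\<lambda>x. x k $$ (p, q)) \<in> polynomial_functions K nr nc"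
  | add: "\<lbrakk>F \<in> polynomial_functions K nr nc; G \<in> polynomial_functions K nr nc\<rbrakk>
      \<Longrightarrow> (\<lambda>x. F x + G x) \<in> polynomial_functions K nr nc"
  | mult: "\<lbrakk>F \<in> polynomial_functions K nr nc; G \<in> polynomial_functions K nr nc\<rbrakk>
      \<Longrightarrow> (\<lambda>x. F x * G x) \<in> polynomial_functions K nr nc"

definition zariski_closed_in_sg ::
    "('v, 'e) pre_digraph \<Rightarrow> ('v \<Rightarrow> nat) \<Rightarrow> ('v \<Rightarrow> complex mat) set \<Rightarrow> bool" where
  "zariski_closed_in_sg Q d Z \<longleftrightarrow>
     (\<exists>P \<subseteq> polynomial_functions (verts Q) d d. Z = {x \<in> sg Q d. \<forall>p\<in>P. p x = 0})"

definition entry_deriv :: "('v, 'e) pre_digraph \<Rightarrow> ('v \<Rightarrow> nat) \<Rightarrow> 'e + 'e \<Rightarrow> nat \<Rightarrow> nat \<Rightarrow>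
    (('e + 'e \<Rightarrow> complex mat) \<Rightarrow> complex) \<Rightarrow> ('e + 'e \<Rightarrow> complex mat) \<Rightarrow> complex" where
  "entry_deriv Q d c p q F \<rho> =
     deriv (\<lambda>z. F (\<rho>(c := Matrix.mat (row_dim Q d c) (col_dim Q d c)
                            (\<lambda>(r, s). if r = p \<and> s = q then z else \<rho> c $$ (r, s)))))
           (\<rho> c $$ (p, q))"

definition rep_poisson :: "('v, 'e) pre_digraph \<Rightarrow> ('v \<Rightarrow> nat) \<Rightarrow>
    (('e + 'e \<Rightarrow> complex mat) \<Rightarrow> complex) \<Rightarrow> (('e + 'e \<Rightarrow> complex mat) \<Rightarrow> complex) \<Rightarrow>
    ('e + 'e \<Rightarrow> complex mat) \<Rightarrow> complex" where
  "rep_poisson Q d F G \<rho> =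
     (\<Sum>a\<in>arcs Q. \<Sum>p<d (head Q a). \<Sum>q<d (tail Q a).
        entry_deriv Q d (Inl a) p q F \<rho> * entry_deriv Q d (Inr a) q p G \<rho>
      - entry_deriv Q d (Inr a) q p F \<rho> * entry_deriv Q d (Inl a) p q G \<rho>)"

definition invariant_polynomials :: "('v, 'e) pre_digraph \<Rightarrow> ('v \<Rightarrow> nat) \<Rightarrow>
    (('e + 'e \<Rightarrow> complex mat) \<Rightarrow> complex) set" where
  "invariant_polynomials Q d =
     {F \<in> polynomial_functions (arcs (double Q)) (row_dim Q d) (col_dim Q d).
        \<forall>U\<in>carrier (gauge_group Q d). \<forall>\<rho>\<in>rep_space Q d. F (rep_act Q d U \<rho>) = F \<rho>}"

section \<open>The affine quiver variety\<close>

text \<open>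
  A Poisson variety is given by its closed points, its coordinate ring (as functions on the
  points, \<open>undefined\<close> elsewhere) and the Poisson bracket on the coordinate ring.
\<close>

record 'x poisson_variety =
  points :: "'x set"
  regular :: "('x \<Rightarrow> complex) set"
  poisson :: "('x \<Rightarrow> complex) \<Rightarrow> ('x \<Rightarrow> complex) \<Rightarrow> ('x \<Rightarrow> complex)"

definition quiver_points :: "('v, 'e) pre_digraph \<Rightarrow> ('v \<Rightarrow> nat) \<Rightarrow> ('v \<Rightarrow> complex mat) set \<Rightarrow>
    ('e + 'e \<Rightarrow> complex mat) set set" where
  "quiver_points Q d \<O> = orbits (gauge_group Q d) (moment_preimage Q d \<O>) (rep_act Q d)"

text \<open>
  The invariant polynomials representing a function \<open>h\<close> on the quotient. Two of them differ by
  an invariant polynomial vanishing on the preimage of \<open>\<O>\<close>, so \<open>quiver_regular\<close> below is the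
  quotient of the ring of invariants by the invariant part of the ideal of the preimage.
\<close>

definition lifts :: "('v, 'e) pre_digraph \<Rightarrow> ('v \<Rightarrow> nat) \<Rightarrow> ('v \<Rightarrow> complex mat) set \<Rightarrow>
    (('e + 'e \<Rightarrow> complex mat) set \<Rightarrow> complex) \<Rightarrow> (('e + 'e \<Rightarrow> complex mat) \<Rightarrow> complex) set" where
  "lifts Q d \<O> h =
     {F \<in> invariant_polynomials Q d. \<forall>x\<in>quiver_points Q d \<O>. \<forall>\<rho>\<in>x. F \<rho> = h x}"

definition quiver_regular :: "('v, 'e) pre_digraph \<Rightarrow> ('v \<Rightarrow> nat) \<Rightarrow> ('v \<Rightarrow> complex mat) set \<Rightarrow>
    (('e + 'e \<Rightarrow> complex mat) set \<Rightarrow> complex) set" where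
  "quiver_regular Q d \<O> = {h \<in> extensional (quiver_points Q d \<O>). lifts Q d \<O> h \<noteq> {}}"

text \<open>
  The bracket of two regular functions is computed on invariant lifts; its value is the common
  value for all lifts and all points of the orbit.
\<close>

definition quiver_poisson :: "('v, 'e) pre_digraph \<Rightarrow> ('v \<Rightarrow> nat) \<Rightarrow> ('v \<Rightarrow> complex mat) set \<Rightarrow>
    (('e + 'e \<Rightarrow> complex mat) set \<Rightarrow> complex) \<Rightarrow> (('e + 'e \<Rightarrow> complex mat) set \<Rightarrow> complex) \<Rightarrow>
    (('e + 'e \<Rightarrow> complex mat) set \<Rightarrow> complex)" where
  "quiver_poisson Q d \<O> h k = (\<lambda>x\<in>quiver_points Q d \<O>.
     THE z. \<forall>F\<in>lifts Q d \<O> h. \<forall>G\<in>lifts Q d \<O> k. \<forall>\<rho>\<in>x. rep_poisson Q d F G \<rho> = z)"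

definition quiver_variety :: "('v, 'e) pre_digraph \<Rightarrow> ('v \<Rightarrow> nat) \<Rightarrow> ('v \<Rightarrow> complex mat) set \<Rightarrow>
    ('e + 'e \<Rightarrow> complex mat) set poisson_variety" where
  "quiver_variety Q d \<O> = \<lparr>points = quiver_points Q d \<O>,
                           regular = quiver_regular Q d \<O>,
                           poisson = quiver_poisson Q d \<O>\<rparr>"

section \<open>The Lie algebra of the quiver\<close>

text \<open>
  The path $c_1 c_2 \cdots c_n$ is encoded as \<open>(i, [c\<^sub>1, \<dots>, c\<^sub>n])\<close>, where \<open>i\<close> is its end point,
  i.e. the head of \<open>c\<^sub>1\<close>; the constant path at \<open>i\<close> is \<open>(i, [])\<close>. Since arrows compose as maps,
  \<open>c\<^sub>n\<close> is traversed first, hence the \<open>rev\<close>.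
\<close>

type_synonym ('v, 'e) path = "'v \<times> ('e + 'e) list"
type_synonym ('v, 'e) path_comb = "('v, 'e) path \<Rightarrow>\<^sub>0 complex"

definition paths :: "('v, 'e) pre_digraph \<Rightarrow> ('v, 'e) path set" where
  "paths Q = {(i, cs). \<exists>j. pre_digraph.awalk (double Q) j (rev cs) i}"

definition path_source :: "('v, 'e) pre_digraph \<Rightarrow> ('v, 'e) path \<Rightarrow> 'v" where
  "path_source Q p = (if snd p = [] then fst p else tail (double Q) (last (snd p)))"

definition path_algebra :: "('v, 'e) pre_digraph \<Rightarrow> ('v, 'e) path_comb set" where
  "path_algebra Q = {f. Poly_Mapping.keys f \<subseteq> paths Q}"

definition path_scale :: "complex \<Rightarrow> ('v, 'e) path_comb \<Rightarrow> ('v, 'e) path_comb" where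
  "path_scale z f = Poly_Mapping.map ((*) z) f"

definition path_mult :: "('v, 'e) pre_digraph \<Rightarrow>
    ('v, 'e) path_comb \<Rightarrow> ('v, 'e) path_comb \<Rightarrow> ('v, 'e) path_comb" where
  "path_mult Q f g = (\<Sum>p\<in>Poly_Mapping.keys f. \<Sum>q\<in>Poly_Mapping.keys g.
     if path_source Q p = fst q
     then Poly_Mapping.single (fst p, snd p @ snd q)
            (Poly_Mapping.lookup f p * Poly_Mapping.lookup g q)
     else 0)"

lemma lookup_path_scale: "Poly_Mapping.lookup (path_scale z f) p = z * Poly_Mapping.lookup f p"
  by (simp add: path_scale_def Poly_Mapping.map.rep_eq when_def)

lemma vector_space_path_scale: "vector_space path_scale"
  by unfold_locales
    (rule poly_mapping_eqI, simp add: lookup_path_scale Poly_Mapping.lookup_add algebra_simps)+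

definition commutator_span :: "('v, 'e) pre_digraph \<Rightarrow> ('v, 'e) path_comb set" where
  "commutator_span Q = module.span path_scale
     {path_mult Q f g - path_mult Q g f | f g. f \<in> path_algebra Q \<and> g \<in> path_algebra Q}"

definition cyclic_deriv :: "('v, 'e) pre_digraph \<Rightarrow> 'e + 'e \<Rightarrow>
    ('v, 'e) path_comb \<Rightarrow> ('v, 'e) path_comb" where
  "cyclic_deriv Q c f = (\<Sum>p\<in>{p \<in> Poly_Mapping.keys f. path_source Q p = fst p}.
     \<Sum>k\<in>{k. k < length (snd p) \<and> snd p ! k = c}.
       Poly_Mapping.single (tail (double Q) c, drop (Suc k) (snd p) @ take k (snd p))
         (Poly_Mapping.lookup f p))"

definition path_bracket :: "('v, 'e) pre_digraph \<Rightarrow>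
    ('v, 'e) path_comb \<Rightarrow> ('v, 'e) path_comb \<Rightarrow> ('v, 'e) path_comb" where
  "path_bracket Q f g = (\<Sum>a\<in>arcs Q.
     path_mult Q (cyclic_deriv Q (Inl a) f) (cyclic_deriv Q (Inr a) g)
   - path_mult Q (cyclic_deriv Q (Inr a) f) (cyclic_deriv Q (Inl a) g))"

definition commutator_rel :: "('v, 'e) pre_digraph \<Rightarrow>
    (('v, 'e) path_comb \<times> ('v, 'e) path_comb) set" where
  "commutator_rel Q =
     {(f, g). f \<in> path_algebra Q \<and> g \<in> path_algebra Q \<and> f - g \<in> commutator_span Q}"

record 'l lie_algebra =
  lie_carrier :: "'l set"
  lie_add :: "'l \<Rightarrow> 'l \<Rightarrow> 'l"
  lie_scale :: "complex \<Rightarrow> 'l \<Rightarrow> 'l"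
  lie_bracket :: "'l \<Rightarrow> 'l \<Rightarrow> 'l"

text \<open>
  The operations on classes are those of representatives, in the style of \<open>UN_equiv_class2\<close>: all
  the classes in each union coincide. Non-closed paths are commutators, so they are zero in the
  quotient; accordingly \<open>cyclic_deriv\<close> ignores them.
\<close>

definition quiver_lie_algebra ::
    "('v, 'e) pre_digraph \<Rightarrow> ('v, 'e) path_comb set lie_algebra" where
  "quiver_lie_algebra Q = \<lparr>
     lie_carrier = path_algebra Q // commutator_rel Q,
     lie_add = (\<lambda>X Y. \<Union>f\<in>X. \<Union>g\<in>Y. commutator_rel Q `` {f + g}),
     lie_scale = (\<lambda>z X. \<Union>f\<in>X. commutator_rel Q `` {path_scale z f}),
     lie_bracket = (\<lambda>X Y. \<Union>f\<in>X. \<Union>g\<in>Y. commutator_rel Q `` {path_bracket Q f g})\<rparr>"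

section \<open>Embedding as a coadjoint orbit\<close>

definition lie_dual :: "'l lie_algebra \<Rightarrow> ('l \<Rightarrow> complex) set" where
  "lie_dual L = {\<xi> \<in> extensional (lie_carrier L).
     (\<forall>f\<in>lie_carrier L. \<forall>g\<in>lie_carrier L. \<xi> (lie_add L f g) = \<xi> f + \<xi> g) \<and>
     (\<forall>z. \<forall>f\<in>lie_carrier L. \<xi> (lie_scale L z f) = z * \<xi> f)}"

definition coad :: "'l lie_algebra \<Rightarrow> 'l \<Rightarrow> ('l \<Rightarrow> complex) \<Rightarrow> ('l \<Rightarrow> complex)" where
  "coad L f \<xi> = (\<lambda>g\<in>lie_carrier L. - \<xi> (lie_bracket L f g))"

text \<open>The Zariski tangent space: derivations of the coordinate ring at a point.\<close>

definition tangent_space :: "'x poisson_variety \<Rightarrow> 'x \<Rightarrow> (('x \<Rightarrow> complex) \<Rightarrow> complex) set" where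
  "tangent_space X x = {\<delta> \<in> extensional (regular X).
     (\<forall>h\<in>regular X. \<forall>k\<in>regular X. \<delta> (\<lambda>y\<in>points X. h y + k y) = \<delta> h + \<delta> k) \<and>
     (\<forall>z. \<forall>h\<in>regular X. \<delta> (\<lambda>y\<in>points X. z * h y) = z * \<delta> h) \<and>
     (\<forall>h\<in>regular X. \<forall>k\<in>regular X. \<delta> (\<lambda>y\<in>points X. h y * k y) = h x * \<delta> k + k x * \<delta> h)}"

definition pullback :: "'x poisson_variety \<Rightarrow> ('x \<Rightarrow> 'l \<Rightarrow> complex) \<Rightarrow> 'l \<Rightarrow> 'x \<Rightarrow> complex" where
  "pullback X \<phi> f = (\<lambda>x\<in>points X. \<phi> x f)"

text \<open>
  The elements \<open>f\<close> of \<open>L\<close> are the linear coordinates on the dual of \<open>L\<close>, so the differential of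
  \<open>\<phi>\<close> sends a derivation \<open>\<delta>\<close> to the functional taking \<open>f\<close> to \<open>\<delta>\<close> of the pullback of \<open>f\<close>.
\<close>

definition differential :: "'x poisson_variety \<Rightarrow> 'l lie_algebra \<Rightarrow> ('x \<Rightarrow> 'l \<Rightarrow> complex) \<Rightarrow>
    (('x \<Rightarrow> complex) \<Rightarrow> complex) \<Rightarrow> ('l \<Rightarrow> complex)" where
  "differential X L \<phi> \<delta> = (\<lambda>f\<in>lie_carrier L. \<delta> (pullback X \<phi> f))"

definition pullback_lie_hom ::
    "'x poisson_variety \<Rightarrow> 'l lie_algebra \<Rightarrow> ('x \<Rightarrow> 'l \<Rightarrow> complex) \<Rightarrow> bool" where
  "pullback_lie_hom X L \<phi> \<longleftrightarrow>
     (\<forall>f\<in>lie_carrier L. pullback X \<phi> f \<in> regular X) \<and>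
     (\<forall>f\<in>lie_carrier L. \<forall>g\<in>lie_carrier L.
        pullback X \<phi> (lie_add L f g) = (\<lambda>x\<in>points X. pullback X \<phi> f x + pullback X \<phi> g x)) \<and>
     (\<forall>z. \<forall>f\<in>lie_carrier L.
        pullback X \<phi> (lie_scale L z f) = (\<lambda>x\<in>points X. z * pullback X \<phi> f x)) \<and>
     (\<forall>f\<in>lie_carrier L. \<forall>g\<in>lie_carrier L.
        pullback X \<phi> (lie_bracket L f g) = poisson X (pullback X \<phi> f) (pullback X \<phi> g))"

definition embedded_as_coadjoint_orbit ::
    "'x poisson_variety \<Rightarrow> 'l lie_algebra \<Rightarrow> ('x \<Rightarrow> 'l \<Rightarrow> complex) \<Rightarrow> bool" where
  "embedded_as_coadjoint_orbit X L \<phi> \<longleftrightarrow>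
     \<phi> \<in> points X \<rightarrow> lie_dual L \<and> inj_on \<phi> (points X) \<and>
     pullback_lie_hom X L \<phi> \<and>
     (\<forall>x\<in>points X.
        inj_on (differential X L \<phi>) (tangent_space X x) \<and>
        differential X L \<phi> ` tangent_space X x = (\<lambda>f. coad L f (\<phi> x)) ` lie_carrier L)"

end

theory Submission
  imports Defs "HOL-Library.Function_Algebras" "Jordan_Normal_Form.Schur_Decomposition"
begin

text \<open>
  The embedding sends a representation \<open>\<rho>\<close> to its character \<open>f \<mapsto> tr \<rho>(f)\<close>, and the brackets match
  because the Hamiltonian vector field of \<open>tr \<rho>(g)\<close> is given by the cyclic derivatives of \<open>g\<close>. Let
  \<open>\<rho>\<close> lie over the orbit. An invariant subspace would let \<open>\<rho>\<close> degenerate to a point with nontrivial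
  stabilizer, still over the orbit as the orbit is closed; so \<open>\<rho>\<close> is irreducible, and by Schur and
  Burnside the path algebra maps onto all matrices. Hence the character determines \<open>\<rho>\<close> up to
  conjugation. Near \<open>\<rho>\<close> every invariant polynomial is a quotient of polynomials in traces, so a
  tangent vector is determined by the functional \<open>\<psi>\<close> that it induces on traces. By a Gram determinant
  \<open>\<psi>\<close> vanishes on products of two elements of the kernel of \<open>\<rho>\<close>, so it is the trace of a derivation
  into matrices, that is, the derivative of the character in some direction. A closed orbit consists of
  diagonalizable matrices; as \<open>\<psi>\<close> respects the equations of the orbit, the direction can be changed by
  an infinitesimal conjugation into the kernel of \<open>d\<mu>\<close>, which consists of Hamiltonian directions.
\<close>

section \<open>Linear algebra of functions on a finite set\<close>

text \<open>The coordinate ring consists of functions on the preimage of the orbit, so a tangent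
  vector has to respect every invariant polynomial that vanishes there, and no generators of that
  ideal are known. The tangent space is squeezed between two tests instead. From above, the
  relations tr(f p(\<mu>)) = 0, where p has the distinct eigenvalues of the orbit as simple roots,
  already force a tangent vector to be Hamiltonian. From below, every Hamiltonian direction is the
  velocity of a curve inside a fibre of \<mu>, so it kills whatever vanishes over the orbit. The
  same curves make the Poisson bracket independent of the chosen lifts.

  Invariants H are compared with traces through an identity D H = P, where D and P are trace
  polynomials and D is nonzero at the given point. By the quotient rule one element f of the path
  algebra then has the same derivative as H under all point derivations at once. D and P come from a
  Laplacian pairing a vector w with a covector \<xi>: it contracts \<xi> f w to tr f, and its powers
  send powers of a single coordinate product to nonzero constants.\<close>

definition fun_scale :: "complex \<Rightarrow> ('k \<Rightarrow> complex) \<Rightarrow> ('k \<Rightarrow> complex)" where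
  "fun_scale c f = (\<lambda>x. c * f x)"

interpretation fun_vs: vector_space fun_scale
  by unfold_locales (auto simp: fun_scale_def algebra_simps fun_eq_iff)

interpretation fun_dual: vector_space_pair fun_scale "(*) :: complex \<Rightarrow> complex \<Rightarrow> complex"
  by unfold_locales (auto simp: algebra_simps)

interpretation fun_endo: vector_space_pair fun_scale fun_scale
  by unfold_locales

lemma sum_fun_apply: "(\<Sum>i\<in>A. f i) x = (\<Sum>i\<in>A. f i x)"
  for f :: "'a \<Rightarrow> 'k \<Rightarrow> 'b::comm_monoid_add"
  by (induction A rule: infinite_finite_induct) auto

lemma fun_expand:
  assumes "finite K" "\<And>k. k \<notin> K \<Longrightarrow> y k = 0"
  shows "y = (\<Sum>k\<in>K. fun_scale (y k) (\<lambda>j. if j = k then 1 else 0))"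
proof
  fix j
  have "(\<Sum>k\<in>K. fun_scale (y k) (\<lambda>j. if j = k then 1 else 0)) j = (\<Sum>k\<in>K. if j = k then y k else 0)"
    unfolding sum_fun_apply fun_scale_def by (intro sum.cong) auto
  also have "\<dots> = y j" using assms by (auto simp: sum.delta)
  finally show "y j = (\<Sum>k\<in>K. fun_scale (y k) (\<lambda>j. if j = k then 1 else 0)) j" by simp
qed

lemma linear_functional_expand:
  assumes "finite K" "\<And>k. k \<notin> K \<Longrightarrow> y k = 0" "Vector_Spaces.linear fun_scale (*) g"
  shows "g y = (\<Sum>k\<in>K. g (\<lambda>j. if j = k then 1 else 0) * y k)"
proof -
  interpret g: Vector_Spaces.linear fun_scale "(*)" g by fact
  have "g y = g (\<Sum>k\<in>K. fun_scale (y k) (\<lambda>j. if j = k then 1 else 0))"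
    by (rule arg_cong[OF fun_expand[OF assms(1,2)]])
  also have "\<dots> = (\<Sum>k\<in>K. y k * g (\<lambda>j. if j = k then 1 else 0))"
    by (simp add: g.sum g.scale)
  finally show ?thesis by (simp add: mult.commute)
qed

text \<open>A basis of W stays independent after adding y, so some linear functional is 1 at y and 0
  on W; its coefficients on K are its values at the delta functions. Images of linear maps are later
  identified by finding what annihilates them.\<close>

lemma separating_functional:
  fixes W :: "('k \<Rightarrow> complex) set"
  assumes K: "finite K" and W: "fun_vs.subspace W"
    and sW: "\<And>w k. w \<in> W \<Longrightarrow> k \<notin> K \<Longrightarrow> w k = 0"
    and sy: "\<And>k. k \<notin> K \<Longrightarrow> y k = 0" and y: "y \<notin> W"
  shows "\<exists>u. (\<forall>w\<in>W. (\<Sum>k\<in>K. u k * w k) = 0) \<and> (\<Sum>k\<in>K. u k * y k) \<noteq> 0"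
proof -
  obtain B where B: "B \<subseteq> W" "fun_vs.independent B" "W \<subseteq> fun_vs.span B"
    using fun_vs.maximal_independent_subset by blast
  have sp: "fun_vs.span B = W"
    using B W fun_vs.span_minimal by blast
  have yB: "y \<notin> B" using B y by blast
  have ind: "fun_vs.independent (insert y B)"
    using fun_vs.independent_insert[of y B] B(2) sp y by simp
  obtain g where g: "Vector_Spaces.linear fun_scale (*) g"
    and gv: "\<forall>x\<in>insert y B. g x = (if x = y then 1 else 0)"
    using fun_dual.linear_independent_extend[OF ind, of "\<lambda>x. if x = y then 1 else (0::complex)"] by blast
  have g0: "g w = 0" if "w \<in> W" for w
  proof -
    have gb: "\<forall>x\<in>B. g x = 0" using gv yB by auto
    have z: "Vector_Spaces.linear fun_scale (*) (\<lambda>_::'k\<Rightarrow>complex. 0::complex)"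
      by unfold_locales auto
    show ?thesis
      using fun_dual.linear_eq_on[OF g z, of w B] gb that sp by auto
  qed
  define u where "u k = g (\<lambda>j. if j = k then 1 else 0)" for k
  have "\<forall>w\<in>W. (\<Sum>k\<in>K. u k * w k) = 0"
  proof
    fix w assume w: "w \<in> W"
    show "(\<Sum>k\<in>K. u k * w k) = 0"
      using linear_functional_expand[OF K sW[OF w] g] g0[OF w] unfolding u_def by simp
  qed
  moreover have "(\<Sum>k\<in>K. u k * y k) \<noteq> 0"
    using linear_functional_expand[OF K sy g] gv unfolding u_def by simp
  ultimately show ?thesis by blast
qed

section \<open>Polynomial functions of coordinates\<close>

text \<open>Kept apart from \<open>polynomial_functions\<close>: these are polynomials in a vector
  and a covector, on which the Laplacian acts while a representation is held fixed.\<close>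

inductive_set Pol :: "(('k \<Rightarrow> complex) \<Rightarrow> complex) set" where
  const: "(\<lambda>_. c) \<in> Pol"
| coord: "(\<lambda>z. z k) \<in> Pol"
| add: "F \<in> Pol \<Longrightarrow> G \<in> Pol \<Longrightarrow> (\<lambda>z. F z + G z) \<in> Pol"
| mult: "F \<in> Pol \<Longrightarrow> G \<in> Pol \<Longrightarrow> (\<lambda>z. F z * G z) \<in> Pol"

lemma Pol_sum: "(\<And>i. i \<in> A \<Longrightarrow> F i \<in> Pol) \<Longrightarrow> (\<lambda>z. \<Sum>i\<in>A. F i z) \<in> Pol"
  by (induction A rule: infinite_finite_induct) (auto intro: Pol.intros)

definition pd :: "'k \<Rightarrow> (('k \<Rightarrow> complex) \<Rightarrow> complex) \<Rightarrow> ('k \<Rightarrow> complex) \<Rightarrow> complex" where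
  "pd k F z = deriv (\<lambda>s. F (z(k := s))) (z k)"

text \<open>\<open>deriv\<close> obeys the sum and product rules only for differentiable functions;
  the rules for \<open>pd\<close> below take that hypothesis from here.\<close>

lemma Pol_slice: "F \<in> Pol \<Longrightarrow> (\<lambda>s. F (z(k := s))) field_differentiable (at s0)"
proof (induction F rule: Pol.induct)
  case (coord j)
  show ?case by (cases "j = k") auto
qed (auto intro: derivative_intros)

lemma pd_const: "pd k (\<lambda>_. c) = (\<lambda>_. 0)"
  by (simp add: pd_def fun_eq_iff)

lemma pd_coord: "pd k (\<lambda>z. z j) = (\<lambda>_. if j = k then 1 else 0)"
  by (auto simp: pd_def fun_eq_iff)

lemma pd_add: "F \<in> Pol \<Longrightarrow> G \<in> Pol \<Longrightarrow> pd k (\<lambda>z. F z + G z) = (\<lambda>z. pd k F z + pd k G z)"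
  by (simp add: pd_def fun_eq_iff Pol_slice deriv_add)

lemma pd_mult: "F \<in> Pol \<Longrightarrow> G \<in> Pol \<Longrightarrow> pd k (\<lambda>z. F z * G z) = (\<lambda>z. F z * pd k G z + pd k F z * G z)"
  by (simp add: pd_def fun_eq_iff Pol_slice deriv_mult)

lemma pd_sum: "(\<And>i. i \<in> A \<Longrightarrow> F i \<in> Pol) \<Longrightarrow> pd k (\<lambda>z. \<Sum>i\<in>A. F i z) = (\<lambda>z. \<Sum>i\<in>A. pd k (F i) z)"
  by (induction A rule: infinite_finite_induct) (auto simp: pd_const pd_add Pol_sum)

lemma Pol_pd: "F \<in> Pol \<Longrightarrow> pd k F \<in> Pol"
proof (induction F rule: Pol.induct)
  case (const c)
  show ?case unfolding pd_const by (rule Pol.const)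
next
  case (coord j)
  show ?case unfolding pd_coord by (rule Pol.const)
next
  case (add F G)
  then show ?case unfolding pd_add[OF add.hyps] by (intro Pol.add)
next
  case (mult F G)
  then show ?case unfolding pd_mult[OF mult.hyps] by (intro Pol.add Pol.mult)
qed

text \<open>Pairs of vectors \<open>w\<close>, \<open>\<xi>\<close> are encoded as \<open>z\<close> with \<open>z (Inl x) = w x\<close> and
  \<open>z (Inr x) = \<xi> x\<close>.\<close>

definition Lap :: "'i set \<Rightarrow> (('i + 'i \<Rightarrow> complex) \<Rightarrow> complex) \<Rightarrow> ('i + 'i \<Rightarrow> complex) \<Rightarrow> complex" where
  "Lap I F z = (\<Sum>x\<in>I. pd (Inl x) (pd (Inr x) F) z)"

lemma Pol_Lap: "F \<in> Pol \<Longrightarrow> Lap I F \<in> Pol"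
  unfolding Lap_def[abs_def] by (intro Pol_sum Pol_pd)

lemma Lap_add:
  assumes "F \<in> Pol" "G \<in> Pol"
  shows "Lap I (\<lambda>z. F z + G z) = (\<lambda>z. Lap I F z + Lap I G z)"
  unfolding Lap_def pd_add[OF assms] pd_add[OF assms[THEN Pol_pd]] sum.distrib ..

text \<open>Leibniz rule for a second-order operator. The cross terms pair a gradient in the vector
  with a gradient in the covector; \<open>WW_gradient\<close> will control them.\<close>

lemma Lap_mult:
  assumes "F \<in> Pol" "G \<in> Pol"
  shows "Lap I (\<lambda>z. F z * G z) = (\<lambda>z. Lap I F z * G z + F z * Lap I G z
    + (\<Sum>x\<in>I. pd (Inl x) F z * pd (Inr x) G z) + (\<Sum>x\<in>I. pd (Inl x) G z * pd (Inr x) F z))"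
proof -
  note P = assms assms[THEN Pol_pd]
  have "pd (Inl x) (pd (Inr x) (\<lambda>z. F z * G z)) = (\<lambda>z. (F z * pd (Inl x) (pd (Inr x) G) z + pd (Inl x) F z * pd (Inr x) G z)
      + (pd (Inr x) F z * pd (Inl x) G z + pd (Inl x) (pd (Inr x) F) z * G z))" for x
    by (simp only: pd_mult[OF assms] pd_add[OF Pol.mult[OF P(1) P(4)] Pol.mult[OF P(3) P(2)]]
        pd_mult[OF P(1) P(4)] pd_mult[OF P(3) P(2)])
  then show ?thesis
    unfolding Lap_def by (simp add: fun_eq_iff sum.distrib sum_distrib_left sum_distrib_right ac_simps)
qed

lemma Lap_const: "Lap I (\<lambda>_. c) = (\<lambda>_. 0)"
  by (simp add: Lap_def pd_const fun_eq_iff)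

lemma Lap_cmult: "F \<in> Pol \<Longrightarrow> Lap I (\<lambda>z. c * F z) = (\<lambda>z. c * Lap I F z)"
  by (simp add: Lap_mult Pol.const Lap_const pd_const)

lemma Lap_funpow_cmult: "F \<in> Pol \<Longrightarrow> (Lap I ^^ k) F \<in> Pol \<and> (Lap I ^^ k) (\<lambda>z. c * F z) = (\<lambda>z. c * (Lap I ^^ k) F z)"
  by (induction k) (auto simp: Lap_cmult Pol_Lap)

lemma Pol_power: "F \<in> Pol \<Longrightarrow> (\<lambda>z. F z ^ k) \<in> Pol"
  by (induction k) (auto intro: Pol.intros)

lemma pd_power: "F \<in> Pol \<Longrightarrow> pd k (\<lambda>z. F z ^ n) = (\<lambda>z. of_nat n * F z ^ (n - 1) * pd k F z)"
proof (induction n)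
  case (Suc n)
  then show ?case
    by (cases n) (auto simp: pd_mult Pol_power Pol.intros fun_eq_iff algebra_simps)
qed (simp add: pd_const)

text \<open>Only the index b contributes. The derivative in the covector brings down a factor n + 1
  and leaves degree n + 1 in the vector, so the second derivative brings down the same factor
  again.\<close>

lemma Lap_power:
  assumes "finite I" "b \<in> I"
  shows "Lap I (\<lambda>z. (z (Inl b) * z (Inr b)) ^ Suc n) = (\<lambda>z. of_nat (Suc n) ^ 2 * (z (Inl b) * z (Inr b)) ^ n)"
proof
  fix z :: "'a + 'a \<Rightarrow> complex"
  have P: "(\<lambda>z::'a + 'a \<Rightarrow> complex. z (Inl b) * z (Inr b)) \<in> Pol" by (intro Pol.intros)
  have 1: "pd (Inr x) (\<lambda>z. (z (Inl b) * z (Inr b)) ^ Suc n)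
     = (\<lambda>z. if x = b then of_nat (Suc n) * (z (Inl b) * z (Inr b)) ^ n * z (Inl b) else 0)" for x
    using pd_power[OF P, of "Inr x" "Suc n"]
    by (auto simp: fun_eq_iff pd_mult Pol.intros pd_coord)
  have 2: "pd (Inl b) (\<lambda>z. of_nat (Suc n) * (z (Inl b) * z (Inr b)) ^ n * z (Inl b)) z
     = of_nat (Suc n) ^ 2 * (z (Inl b) * z (Inr b)) ^ n"
  proof -
    have P2: "(\<lambda>z. of_nat (Suc n) * (z (Inl b) * z (Inr b)) ^ n) \<in> Pol"
      by (intro Pol.intros(1,4) Pol_power[OF P])
    have q: "pd (Inl b) (\<lambda>z. of_nat (Suc n) * (z (Inl b) * z (Inr b)) ^ n) = 
        (\<lambda>z. of_nat (Suc n) * (of_nat n * (z (Inl b) * z (Inr b)) ^ (n - 1) * z (Inr b)))"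
      using pd_mult[OF Pol.const[of "of_nat (Suc n)"] Pol_power[OF P, of n], of "Inl b"]
      by (auto simp: pd_const pd_power[OF P] pd_mult Pol.intros pd_coord)
    have "pd (Inl b) (\<lambda>z. of_nat (Suc n) * (z (Inl b) * z (Inr b)) ^ n * z (Inl b)) z =
      of_nat (Suc n) * (z (Inl b) * z (Inr b)) ^ n + of_nat (Suc n) * (of_nat n * (z (Inl b) * z (Inr b)) ^ (n - 1) * z (Inr b)) * z (Inl b)"
      by (subst pd_mult[OF P2 Pol.coord], subst q) (simp add: pd_coord)
    also have "\<dots> = of_nat (Suc n) ^ 2 * (z (Inl b) * z (Inr b)) ^ n"
      by (cases n) (simp_all add: algebra_simps power2_eq_square)
    finally show ?thesis .
  qed
  have "Lap I (\<lambda>z. (z (Inl b) * z (Inr b)) ^ Suc n) z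
     = (\<Sum>x\<in>I. if x = b then of_nat (Suc n) ^ 2 * (z (Inl b) * z (Inr b)) ^ n else 0)"
    unfolding Lap_def 1 by (intro sum.cong refl) (auto simp: 2 pd_const simp del: of_nat_Suc)
  then show "Lap I (\<lambda>z. (z (Inl b) * z (Inr b)) ^ Suc n) z = of_nat (Suc n) ^ 2 * (z (Inl b) * z (Inr b)) ^ n"
    using assms by simp
qed

text \<open>The constant is the square of n!. Being nonzero, it will keep a denominator from
  vanishing at the given point.\<close>

lemma Lap_funpow_power:
  assumes "finite I" "b \<in> I"
  shows "\<exists>c. c \<noteq> 0 \<and> (Lap I ^^ n) (\<lambda>z. (z (Inl b) * z (Inr b)) ^ n) = (\<lambda>_. c)"
proof (induction n)
  case 0
  show ?case by (auto intro!: exI[of _ 1])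
next
  case (Suc n)
  then obtain c where c: "c \<noteq> 0" "(Lap I ^^ n) (\<lambda>z. (z (Inl b) * z (Inr b)) ^ n) = (\<lambda>_. c)" by blast
  have P: "(\<lambda>z::'a + 'a \<Rightarrow> complex. (z (Inl b) * z (Inr b)) ^ n) \<in> Pol" by (intro Pol.intros Pol_power)
  have "(Lap I ^^ Suc n) (\<lambda>z. (z (Inl b) * z (Inr b)) ^ Suc n) =
     (Lap I ^^ n) (Lap I (\<lambda>z. (z (Inl b) * z (Inr b)) ^ Suc n))"
    by (simp add: funpow_swap1)
  also have "\<dots> = (\<lambda>_. of_nat (Suc n) ^ 2 * c)"
    unfolding Lap_power[OF assms] using Lap_funpow_cmult[OF P, where I = I and k = n] c(2) by simp
  finally show ?case using c(1)
    by (intro exI[of _ "of_nat (Suc n) ^ 2 * c"]) (simp del: of_nat_Suc)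
qed

section \<open>Function algebras and determinants\<close>

text \<open>Polynomials, invariants, and expressions in traces, vectors and covectors all form such
  algebras, so closure under determinants and cofactors is proved once for all of them.\<close>

definition fun_alg :: "('x \<Rightarrow> complex) set \<Rightarrow> bool" where
  "fun_alg C \<longleftrightarrow> (\<forall>c. (\<lambda>_. c) \<in> C) \<and> (\<forall>F\<in>C. \<forall>G\<in>C. (\<lambda>x. F x + G x) \<in> C \<and> (\<lambda>x. F x * G x) \<in> C)"

lemma fun_alg_const: "fun_alg C \<Longrightarrow> (\<lambda>_. c) \<in> C"
  and fun_alg_add: "fun_alg C \<Longrightarrow> F \<in> C \<Longrightarrow> G \<in> C \<Longrightarrow> (\<lambda>x. F x + G x) \<in> C"
  and fun_alg_mult: "fun_alg C \<Longrightarrow> F \<in> C \<Longrightarrow> G \<in> C \<Longrightarrow> (\<lambda>x. F x * G x) \<in> C"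
  by (auto simp: fun_alg_def)

lemma fun_alg_sum: "fun_alg C \<Longrightarrow> (\<And>i. i \<in> A \<Longrightarrow> F i \<in> C) \<Longrightarrow> (\<lambda>x. \<Sum>i\<in>A. F i x) \<in> C"
  by (induction A rule: infinite_finite_induct) (auto intro: fun_alg_const fun_alg_add)

lemma fun_alg_prod: "fun_alg C \<Longrightarrow> (\<And>i. i \<in> A \<Longrightarrow> F i \<in> C) \<Longrightarrow> (\<lambda>x. \<Prod>i\<in>A. F i x) \<in> C"
  by (induction A rule: infinite_finite_induct) (auto intro: fun_alg_const fun_alg_mult)

lemma fun_alg_power: "fun_alg C \<Longrightarrow> F \<in> C \<Longrightarrow> (\<lambda>x. F x ^ n) \<in> C"
  by (induction n) (auto intro: fun_alg_const fun_alg_mult)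

lemma fun_alg_det:
  assumes C: "fun_alg C" and M: "\<And>x. M x \<in> carrier_mat n n"
    and e: "\<And>i j. i < n \<Longrightarrow> j < n \<Longrightarrow> (\<lambda>x. M x $$ (i, j)) \<in> C"
  shows "(\<lambda>x. det (M x)) \<in> C"
proof -
  have "(\<lambda>x. det (M x)) = (\<lambda>x. \<Sum>p\<in>{p. p permutes {0..<n}}. signof p * (\<Prod>i\<in>{0..<n}. M x $$ (i, p i)))"
    using det_def'[OF M] by (auto simp: fun_eq_iff atLeast0LessThan)
  also have "\<dots> \<in> C"
    by (intro fun_alg_sum[OF C] fun_alg_mult[OF C] fun_alg_const[OF C] fun_alg_prod[OF C] e)
       (auto dest: permutes_in_image)
  finally show ?thesis .
qed

lemma fun_alg_cofactor:
  assumes C: "fun_alg C" and M: "\<And>x. M x \<in> carrier_mat n n"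
    and e: "\<And>i j. i < n \<Longrightarrow> j < n \<Longrightarrow> (\<lambda>x. M x $$ (i, j)) \<in> C" and "i < n" "j < n"
  shows "(\<lambda>x. cofactor (M x) i j) \<in> C"
proof -
  have d: "(\<lambda>x. det (mat_delete (M x) i j)) \<in> C"
  proof (rule fun_alg_det[OF C, where n = "n - 1"])
    show "mat_delete (M x) i j \<in> carrier_mat (n - 1) (n - 1)" for x
      by (rule mat_delete_carrier[OF M])
    fix k l assume kl: "k < n - 1" "l < n - 1"
    have "mat_delete (M x) i j $$ (k, l) = M x $$ (if k < i then k else Suc k, if l < j then l else Suc l)" for x
    proof -
      have "dim_row (M x) = n" "dim_col (M x) = n" using M[of x] by auto
      then show ?thesis
        unfolding mat_delete_def using kl by simp
    qed
    moreover have "(\<lambda>x. M x $$ (if k < i then k else Suc k, if l < j then l else Suc l)) \<in> C"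
      by (rule e) (use kl in auto)
    ultimately show "(\<lambda>x. mat_delete (M x) i j $$ (k, l)) \<in> C" by simp
  qed
  show ?thesis
    unfolding cofactor_def by (rule fun_alg_mult[OF C fun_alg_const[OF C] d])
qed

section \<open>Square matrices over a finite index set\<close>

definition mscale :: "complex \<Rightarrow> ('i \<Rightarrow> 'i \<Rightarrow> complex) \<Rightarrow> ('i \<Rightarrow> 'i \<Rightarrow> complex)" where
  "mscale c A = (\<lambda>x y. c * A x y)"

definition munit :: "'i \<Rightarrow> 'i \<Rightarrow> ('i \<Rightarrow> 'i \<Rightarrow> complex)" where
  "munit a b = (\<lambda>x y. if x = a \<and> y = b then 1 else 0)"

lemma mscale_apply [simp]: "mscale c A x y = c * A x y"
  by (simp add: mscale_def)

lemma sum_fun_apply2: "(\<Sum>i\<in>A. f i) x y = (\<Sum>i\<in>A. f i x y)"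
  for f :: "'a \<Rightarrow> 'k \<Rightarrow> 'l \<Rightarrow> 'b::comm_monoid_add"
  by (simp add: sum_fun_apply)

locale fmat =
  fixes I :: "'i set"
  assumes finI: "finite I"
begin

definition mm :: "('i \<Rightarrow> 'i \<Rightarrow> complex) \<Rightarrow> ('i \<Rightarrow> 'i \<Rightarrow> complex) \<Rightarrow> ('i \<Rightarrow> 'i \<Rightarrow> complex)"
    (infixl "\<diamond>" 70) where
  "A \<diamond> B = (\<lambda>x y. \<Sum>z\<in>I. A x z * B z y)"

definition tr :: "('i \<Rightarrow> 'i \<Rightarrow> complex) \<Rightarrow> complex" where
  "tr A = (\<Sum>x\<in>I. A x x)"

definition om :: "'i \<Rightarrow> 'i \<Rightarrow> complex" where
  "om = (\<lambda>x y. if x = y \<and> x \<in> I then 1 else 0)"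

text \<open>Matrices are functions on the whole type that vanish off I x I, so equality of matrices
  is plain equality of functions.\<close>

definition fm :: "('i \<Rightarrow> 'i \<Rightarrow> complex) set" where
  "fm = {A. \<forall>x y. A x y \<noteq> 0 \<longrightarrow> x \<in> I \<and> y \<in> I}"

lemma fm_zero: "A \<in> fm \<Longrightarrow> x \<notin> I \<Longrightarrow> A x y = 0" "A \<in> fm \<Longrightarrow> y \<notin> I \<Longrightarrow> A x y = 0"
  by (auto simp: fm_def)

lemma fmI: "(\<And>x y. x \<notin> I \<or> y \<notin> I \<Longrightarrow> A x y = 0) \<Longrightarrow> A \<in> fm"
  unfolding fm_def by blast

lemma fm_eqI: "A \<in> fm \<Longrightarrow> B \<in> fm \<Longrightarrow> (\<And>x y. x \<in> I \<Longrightarrow> y \<in> I \<Longrightarrow> A x y = B x y) \<Longrightarrow> A = B"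
  by (intro ext) (metis fm_zero)

lemma mm_assoc: "A \<diamond> B \<diamond> C = A \<diamond> (B \<diamond> C)"
proof (intro ext)
  fix x y
  have "(A \<diamond> B \<diamond> C) x y = (\<Sum>z\<in>I. \<Sum>u\<in>I. A x u * B u z * C z y)"
    by (simp add: mm_def sum_distrib_right)
  also have "\<dots> = (\<Sum>u\<in>I. \<Sum>z\<in>I. A x u * B u z * C z y)" by (rule sum.swap)
  also have "\<dots> = (A \<diamond> (B \<diamond> C)) x y" by (simp add: mm_def sum_distrib_left mult.assoc)
  finally show "(A \<diamond> B \<diamond> C) x y = (A \<diamond> (B \<diamond> C)) x y" .
qed

lemma mm_add_left: "(A + B) \<diamond> C = A \<diamond> C + B \<diamond> C"
  and mm_add_right: "A \<diamond> (B + C) = A \<diamond> B + A \<diamond> C"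
  and mm_diff_left: "(A - B) \<diamond> C = A \<diamond> C - B \<diamond> C"
  and mm_diff_right: "A \<diamond> (B - C) = A \<diamond> B - A \<diamond> C"
  and mm_scale_left: "mscale c A \<diamond> B = mscale c (A \<diamond> B)"
  and mm_scale_right: "A \<diamond> mscale c B = mscale c (A \<diamond> B)"
  and mm_zero_left: "0 \<diamond> A = 0"
  and mm_zero_right: "A \<diamond> 0 = 0"
  by (auto simp: mm_def fun_eq_iff algebra_simps sum.distrib sum_subtractf sum_distrib_left)

lemma mm_sum_left: "(\<Sum>i\<in>S. A i) \<diamond> B = (\<Sum>i\<in>S. A i \<diamond> B)"
  by (intro ext, simp add: mm_def sum_fun_apply2 sum_distrib_right) (rule sum.swap)

lemma mm_sum_right: "B \<diamond> (\<Sum>i\<in>S. A i) = (\<Sum>i\<in>S. B \<diamond> A i)"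
  by (intro ext, simp add: mm_def sum_fun_apply2 sum_distrib_left) (rule sum.swap)

lemma fm_add: "A \<in> fm \<Longrightarrow> B \<in> fm \<Longrightarrow> A + B \<in> fm"
  and fm_diff: "A \<in> fm \<Longrightarrow> B \<in> fm \<Longrightarrow> A - B \<in> fm"
  and fm_scale: "A \<in> fm \<Longrightarrow> mscale c A \<in> fm"
  and fm_0: "0 \<in> fm"
  and fm_om: "om \<in> fm"
  and fm_munit: "a \<in> I \<Longrightarrow> b \<in> I \<Longrightarrow> munit a b \<in> fm"
  by (auto intro!: fmI simp: fm_zero om_def munit_def)

lemma fm_mm: "A \<in> fm \<Longrightarrow> B \<in> fm \<Longrightarrow> A \<diamond> B \<in> fm"
  by (intro fmI) (auto simp: mm_def fm_zero)

lemma fm_sum: "(\<And>i. i \<in> S \<Longrightarrow> A i \<in> fm) \<Longrightarrow> (\<Sum>i\<in>S. A i) \<in> fm"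
  by (induction S rule: infinite_finite_induct) (auto simp: fm_0 fm_add)

lemma assumes A: "A \<in> fm"
  shows mm_om_left: "om \<diamond> A = A" and mm_om_right: "A \<diamond> om = A"
proof -
  have "(om \<diamond> A) x y = A x y" "(A \<diamond> om) x y = A x y" for x y
  proof -
    have "(om \<diamond> A) x y = (\<Sum>z\<in>I. if x = z then A x y else 0)"
      unfolding mm_def om_def by (intro sum.cong) auto
    then show "(om \<diamond> A) x y = A x y" using finI A by (auto simp: fm_zero)
    have "(A \<diamond> om) x y = (\<Sum>z\<in>I. if z = y then A x y else 0)"
      unfolding mm_def om_def by (intro sum.cong) auto
    then show "(A \<diamond> om) x y = A x y" using finI A by (auto simp: fm_zero)
  qed
  then show "om \<diamond> A = A" "A \<diamond> om = A" by (intro ext, simp)+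
qed

lemma tr_add: "tr (A + B) = tr A + tr B"
  and tr_diff: "tr (A - B) = tr A - tr B"
  and tr_scale: "tr (mscale c A) = c * tr A"
  and tr_0: "tr 0 = 0"
  by (auto simp: tr_def sum.distrib sum_subtractf sum_distrib_left)

lemma tr_sum: "tr (\<Sum>i\<in>S. A i) = (\<Sum>i\<in>S. tr (A i))"
  by (simp add: tr_def sum_fun_apply2) (rule sum.swap)

lemma tr_comm: "tr (A \<diamond> B) = tr (B \<diamond> A)"
proof -
  have "tr (A \<diamond> B) = (\<Sum>x\<in>I. \<Sum>z\<in>I. A x z * B z x)" by (simp add: tr_def mm_def)
  also have "\<dots> = (\<Sum>z\<in>I. \<Sum>x\<in>I. A x z * B z x)" by (rule sum.swap)
  finally show ?thesis by (simp add: tr_def mm_def mult.commute)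
qed

lemma tr_om: "tr om = of_nat (card I)"
  by (simp add: tr_def om_def)

lemma munit_mm: "b \<in> I \<Longrightarrow> munit a b \<diamond> A = (\<lambda>x y. if x = a then A b y else 0)"
proof (intro ext)
  fix x y assume b: "b \<in> I"
  have "(munit a b \<diamond> A) x y = (\<Sum>z\<in>I. if z = b then (if x = a then A b y else 0) else 0)"
    unfolding mm_def munit_def by (intro sum.cong) auto
  then show "(munit a b \<diamond> A) x y = (if x = a then A b y else 0)" using finI b by simp
qed

lemma mm_munit: "a \<in> I \<Longrightarrow> A \<diamond> munit a b = (\<lambda>x y. if y = b then A x a else 0)"
proof (intro ext)
  fix x y assume a: "a \<in> I"
  have "(A \<diamond> munit a b) x y = (\<Sum>z\<in>I. if z = a then (if y = b then A x a else 0) else 0)"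
    unfolding mm_def munit_def by (intro sum.cong) auto
  then show "(A \<diamond> munit a b) x y = (if y = b then A x a else 0)" using finI a by simp
qed

lemma munit_munit: "b \<in> I \<Longrightarrow> munit a b \<diamond> munit c d = (if b = c then munit a d else 0)"
  by (simp add: munit_mm) (auto simp: fun_eq_iff munit_def)

lemma tr_mm_munit: "a \<in> I \<Longrightarrow> b \<in> I \<Longrightarrow> tr (A \<diamond> munit a b) = A b a"
  using finI by (simp add: mm_munit tr_def)

lemma tr_munit: "a \<in> I \<Longrightarrow> b \<in> I \<Longrightarrow> tr (munit a b) = (if a = b then 1 else 0)"
proof -
  assume "a \<in> I" "b \<in> I"
  then have "tr (munit a b) = (\<Sum>x\<in>I. if x = a then (if a = b then 1 else 0) else 0)"
    unfolding tr_def munit_def by (intro sum.cong) auto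
  then show ?thesis using finI \<open>a \<in> I\<close> by simp
qed

lemma fm_expand: "A \<in> fm \<Longrightarrow> A = (\<Sum>x\<in>I. \<Sum>y\<in>I. mscale (A x y) (munit x y))"
proof (intro ext)
  fix u v assume A: "A \<in> fm"
  have "(\<Sum>x\<in>I. \<Sum>y\<in>I. mscale (A x y) (munit x y)) u v
      = (\<Sum>x\<in>I. \<Sum>y\<in>I. if x = u then (if y = v then A u v else 0) else 0)"
    unfolding sum_fun_apply2 by (intro sum.cong) (auto simp: munit_def)
  also have "\<dots> = (\<Sum>x\<in>I. if x = u then (\<Sum>y\<in>I. if y = v then A u v else 0) else 0)"
    by (intro sum.cong) auto
  also have "\<dots> = A u v" using finI A by (auto simp: fm_zero)
  finally show "A u v = (\<Sum>x\<in>I. \<Sum>y\<in>I. mscale (A x y) (munit x y)) u v" by simp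
qed

lemma om_expand: "om = (\<Sum>x\<in>I. munit x x)"
proof (intro ext)
  fix u v
  have "(\<Sum>x\<in>I. munit x x) u v = (\<Sum>x\<in>I. if x = u then (if u = v then 1 else 0) else 0)"
    unfolding sum_fun_apply2 by (intro sum.cong) (auto simp: munit_def)
  also have "\<dots> = om u v" using finI by (auto simp: om_def)
  finally show "om u v = (\<Sum>x\<in>I. munit x x) u v" by simp
qed

lemma tr_nondegenerate: "A \<in> fm \<Longrightarrow> (\<And>B. B \<in> fm \<Longrightarrow> tr (A \<diamond> B) = 0) \<Longrightarrow> A = 0"
proof (rule fm_eqI)
  fix x y assume "A \<in> fm" "\<And>B. B \<in> fm \<Longrightarrow> tr (A \<diamond> B) = 0" "x \<in> I" "y \<in> I"
  then show "A x y = 0 x y" using tr_mm_munit[of y x A] fm_munit[of y x] by simp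
qed (auto simp: fm_0)

lemma tr_nondegenerate2:
  assumes "A \<in> fm" "B \<in> fm" "\<And>C. C \<in> fm \<Longrightarrow> tr (A \<diamond> C) = tr (B \<diamond> C)" shows "A = B"
proof -
  have "A - B = 0" by (rule tr_nondegenerate) (use assms in \<open>auto simp: fm_diff mm_diff_left tr_diff\<close>)
  then show ?thesis by simp
qed

text \<open>The trace form is nondegenerate: an entry of Y is the value of h at the matrix unit with
  exchanged indices.\<close>

lemma functional_tr:
  assumes add: "\<And>A B. A \<in> fm \<Longrightarrow> B \<in> fm \<Longrightarrow> h (A + B) = h A + (h B :: complex)"
    and sc: "\<And>c A. A \<in> fm \<Longrightarrow> h (mscale c A) = c * h A"
  shows "\<exists>Y\<in>fm. \<forall>A\<in>fm. h A = tr (Y \<diamond> A)"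
proof -
  have h0: "h 0 = 0" using sc[OF fm_0, of 0] by (simp add: mscale_def zero_fun_def)
  have hsum: "h (\<Sum>i\<in>S. A i) = (\<Sum>i\<in>S. h (A i))" if "\<And>i. i \<in> S \<Longrightarrow> A i \<in> fm" for S :: "'i set" and A
    using that by (induction S rule: infinite_finite_induct) (auto simp: h0 add fm_sum)
  define Y where "Y = (\<lambda>x y. if x \<in> I \<and> y \<in> I then h (munit y x) else 0)"
  have Y: "Y \<in> fm" by (auto simp: Y_def intro!: fmI)
  have "h A = tr (Y \<diamond> A)" if A: "A \<in> fm" for A
  proof -
    have "h A = h (\<Sum>x\<in>I. \<Sum>y\<in>I. mscale (A x y) (munit x y))"
      by (rule arg_cong[OF fm_expand[OF A]])
    also have "\<dots> = (\<Sum>x\<in>I. \<Sum>y\<in>I. A x y * h (munit x y))"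
      by (simp add: hsum fm_sum fm_scale fm_munit sc)
    also have "\<dots> = (\<Sum>y\<in>I. \<Sum>x\<in>I. Y y x * A x y)"
      by (subst sum.swap) (auto simp: Y_def mult.commute intro!: sum.cong)
    finally show ?thesis by (simp add: tr_def mm_def)
  qed
  then show ?thesis using Y by blast
qed

text \<open>Burnside's theorem via Jacobson's density argument, applied to the standard basis vectors:
  an element of the algebra can be chosen with prescribed columns.\<close>

lemma burnside:
  assumes fm: "AA \<subseteq> fm" and one: "om \<in> AA"
    and add: "\<And>A B. A \<in> AA \<Longrightarrow> B \<in> AA \<Longrightarrow> A + B \<in> AA"
    and scale: "\<And>c A. A \<in> AA \<Longrightarrow> mscale c A \<in> AA"
    and mult: "\<And>A B. A \<in> AA \<Longrightarrow> B \<in> AA \<Longrightarrow> A \<diamond> B \<in> AA"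
    and irr: "\<And>v w. (\<exists>x\<in>I. v x \<noteq> 0) \<Longrightarrow> \<exists>A\<in>AA. \<forall>y\<in>I. (\<Sum>z\<in>I. A y z * v z) = (w y::complex)"
    and schur: "\<And>X. X \<in> fm \<Longrightarrow> (\<And>A. A \<in> AA \<Longrightarrow> X \<diamond> A = A \<diamond> X) \<Longrightarrow> \<exists>c. X = mscale c om"
    and M: "M \<in> fm"
  shows "M \<in> AA"
proof -
  have zero: "0 \<in> AA"
    using scale[OF one, of 0] by (simp add: mscale_def zero_fun_def)
  have diff: "A - B \<in> AA" if "A \<in> AA" "B \<in> AA" for A B
  proof -
    have "A + mscale (-1) B = A - B" by (auto simp: fun_eq_iff)
    then show ?thesis using add[OF that(1) scale[OF that(2), of "-1"]] by simp
  qed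
  have sumA: "(\<Sum>i\<in>S. A i) \<in> AA" if "\<And>i. i \<in> S \<Longrightarrow> A i \<in> AA" for S :: "'i set" and A
    using that by (induction S rule: infinite_finite_induct) (auto simp: zero add)
  have "\<exists>A\<in>AA. \<forall>x\<in>S. \<forall>y\<in>I. A y x = Y y x" if "S \<subseteq> I" for S Y
    using finite_subset[OF that finI] that
  proof (induction S arbitrary: Y rule: finite_induct)
    case empty
    then show ?case using zero by auto
  next
    case (insert x0 S)
    have x0: "x0 \<in> I" and S: "S \<subseteq> I" using insert by auto
    note IH = insert.IH[OF S]
    show ?case
    \<comment> \<open>Either some element kills the columns in S but not column x0, and transporting
      that column by \<open>irr\<close> corrects a solution for S; or column x0 is determined by the
      columns in S, which will be contradictory.\<close>
    proof (cases "\<exists>N\<in>AA. (\<forall>x\<in>S. \<forall>y\<in>I. N y x = 0) \<and> (\<exists>y\<in>I. N y x0 \<noteq> 0)")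
      case True
      then obtain N where N: "N \<in> AA" "\<And>x y. x \<in> S \<Longrightarrow> y \<in> I \<Longrightarrow> N y x = 0" "\<exists>y\<in>I. N y x0 \<noteq> 0" by blast
      obtain A where A: "A \<in> AA" "\<And>x y. x \<in> S \<Longrightarrow> y \<in> I \<Longrightarrow> A y x = Y y x" using IH[of Y] by blast
      obtain B where B: "B \<in> AA" "\<And>y. y \<in> I \<Longrightarrow> (\<Sum>z\<in>I. B y z * N z x0) = Y y x0 - A y x0"
        using irr[of "\<lambda>y. N y x0" "\<lambda>y. Y y x0 - A y x0"] N(3) by blast
      have "A + B \<diamond> N \<in> AA" using A B N mult add by blast
      moreover have "(A + B \<diamond> N) y x = Y y x" if "x \<in> insert x0 S" "y \<in> I" for x y
      proof (cases "x = x0")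
        case True
        then show ?thesis using B(2)[OF that(2)] by (simp add: mm_def)
      next
        case False
        then have "x \<in> S" using that by auto
        then show ?thesis using A(2)[OF _ that(2)] N(2) by (simp add: mm_def)
      qed
      ultimately show ?thesis by blast
    next
      case False
      then have van: "N y x0 = 0" if "N \<in> AA" "\<And>x y. x \<in> S \<Longrightarrow> y \<in> I \<Longrightarrow> N y x = 0" "y \<in> I" for N y
        using that by blast
      have agree: "N y x0 = N' y x0" if "N \<in> AA" "N' \<in> AA" "\<And>x y. x \<in> S \<Longrightarrow> y \<in> I \<Longrightarrow> N y x = N' y x" "y \<in> I" for N N' y
        using van[of "N - N'" y] diff[OF that(1,2)] that(3,4) by simp
      have "\<forall>j z. \<exists>A\<in>AA. \<forall>x\<in>S. \<forall>y\<in>I. A y x = (if x = j \<and> y = z then 1 else 0)"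
        by (intro allI) (rule IH)
      then obtain a where a: "\<And>j z. a j z \<in> AA"
        and av: "\<And>j z x y. x \<in> S \<Longrightarrow> y \<in> I \<Longrightarrow> a j z y x = (if x = j \<and> y = z then 1 else 0)"
        by metis
      have afm: "a j z \<in> fm" for j z using a fm by blast
      \<comment> \<open>Column x0 depends linearly on the columns in S, and X j is the contribution
        of column j. It commutes with the algebra because left multiplication acts on all columns
        alike, so \<open>schur\<close> makes it a scalar.\<close>
      define X where "X j = (\<lambda>y z. if z \<in> I then a j z y x0 else 0)" for j
      have Xfm: "X j \<in> fm" for j
        by (rule fmI) (auto simp: X_def fm_zero[OF afm])
      have comm: "X j \<diamond> B = B \<diamond> X j" if j: "j \<in> S" and B: "B \<in> AA" for j B
      proof (rule fm_eqI)
        have Bfm: "B \<in> fm" using B fm by blast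
        show "X j \<diamond> B \<in> fm" "B \<diamond> X j \<in> fm" using Xfm Bfm fm_mm by auto
        fix y z assume y: "y \<in> I" and z: "z \<in> I"
        let ?N = "\<Sum>u\<in>I. mscale (B u z) (a j u)"
        have "(B \<diamond> a j z) y x0 = ?N y x0"
        proof (rule agree)
          show "B \<diamond> a j z \<in> AA" using mult B a by blast
          show "?N \<in> AA" by (intro sumA scale a)
          fix x y assume x: "x \<in> S" and y: "y \<in> I"
          have "(B \<diamond> a j z) y x = (\<Sum>u\<in>I. if u = z then (if x = j then B y z else 0) else 0)"
            unfolding mm_def by (intro sum.cong) (auto simp: av x)
          moreover have "?N y x = (\<Sum>u\<in>I. if u = y then (if x = j then B y z else 0) else 0)"
            unfolding sum_fun_apply2 by (intro sum.cong) (auto simp: av x y)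
          ultimately show "(B \<diamond> a j z) y x = ?N y x" using finI y z by simp
        qed (rule y)
        moreover have "(B \<diamond> X j) y z = (B \<diamond> a j z) y x0"
          using z by (simp add: mm_def X_def)
        moreover have "(X j \<diamond> B) y z = ?N y x0"
          unfolding sum_fun_apply2 mm_def X_def by (intro sum.cong) auto
        ultimately show "(X j \<diamond> B) y z = (B \<diamond> X j) y z" by simp
      qed
      have "\<forall>j\<in>S. \<exists>c. X j = mscale c om" using schur Xfm comm by blast
      then obtain c where c: "\<And>j. j \<in> S \<Longrightarrow> X j = mscale (c j) om" by metis
      \<comment> \<open>Column x0 of every element is thus a fixed combination of its columns in S.
        The identity violates this: its entry at (x0, x0) is 1, but its columns in S vanish in row
        x0.\<close>
      have om_eq: "om x0 x0 = (\<Sum>j\<in>S. a j j) x0 x0"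
      proof (rule agree[of om "\<Sum>j\<in>S. a j j"])
        show "om \<in> AA" by (rule one)
        show "(\<Sum>j\<in>S. a j j) \<in> AA" by (intro sumA a)
        fix x y assume x: "x \<in> S" and y: "y \<in> I"
        have "(\<Sum>j\<in>S. a j j) y x = (\<Sum>j\<in>S. if j = x then (if y = x then 1 else 0) else 0)"
          unfolding sum_fun_apply2 by (intro sum.cong) (auto simp: av x y)
        then show "om y x = (\<Sum>j\<in>S. a j j) y x" using x y S insert.hyps(1) by (auto simp: om_def)
      qed (rule x0)
      have aj: "a j j x0 x0 = 0" if "j \<in> S" for j
      proof -
        have "a j j x0 x0 = X j x0 j" using that S by (auto simp: X_def)
        also have "\<dots> = 0" using c[OF that] that insert.hyps(2) by (auto simp: om_def)
        finally show ?thesis .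
      qed
      have "(\<Sum>j\<in>S. a j j) x0 x0 = 0" unfolding sum_fun_apply2 by (rule sum.neutral) (simp add: aj)
      then have False using om_eq x0 by (simp add: om_def)
      then show ?thesis ..
    qed
  qed
  from this[of I M] obtain A where A: "A \<in> AA" "\<And>x y. x \<in> I \<Longrightarrow> y \<in> I \<Longrightarrow> A y x = M y x" by blast
  have "A = M" by (rule fm_eqI) (use A M fm in auto)
  then show ?thesis using A by simp
qed

end

section \<open>Solving small quadratic fixed point equations\<close>

text \<open>Picard iteration starting at 0. For a bounded biadditive \<beta>, the condition 8 C r
  \<le> 1 makes the iteration preserve the ball of radius 2 r and halve distances there.\<close>

lemma quadratic_fixpoint:
  fixes \<beta> :: "('k \<Rightarrow> complex) \<Rightarrow> ('k \<Rightarrow> complex) \<Rightarrow> 'k \<Rightarrow> complex"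
  assumes K: "finite K"
    and bound: "\<And>u u' a b k. k \<in> K \<Longrightarrow> (\<And>j. j \<in> K \<Longrightarrow> cmod (u j) \<le> a) \<Longrightarrow> (\<And>j. j \<in> K \<Longrightarrow> cmod (u' j) \<le> b)
      \<Longrightarrow> 0 \<le> a \<Longrightarrow> 0 \<le> b \<Longrightarrow> cmod (\<beta> u u' k) \<le> C * a * b"
    and diffl: "\<And>u u' w k. k \<in> K \<Longrightarrow> \<beta> (\<lambda>j. u j - u' j) w k = \<beta> u w k - \<beta> u' w k"
    and diffr: "\<And>u u' w k. k \<in> K \<Longrightarrow> \<beta> w (\<lambda>j. u j - u' j) k = \<beta> w u k - \<beta> w u' k"
    and C: "C > 0" and v: "\<And>k. k \<in> K \<Longrightarrow> cmod (v k) \<le> r" and r: "0 \<le> r" "8 * C * r \<le> 1"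
  shows "\<exists>u. (\<forall>k\<in>K. u k = v k + \<beta> u u k) \<and> (\<forall>k\<in>K. cmod (u k) \<le> 2 * r)"
proof -
  define s where "s = rec_nat (\<lambda>_. 0) (\<lambda>_ u k. v k + \<beta> u u k)"
  have s0: "s 0 = (\<lambda>_. 0)" and sS: "s (Suc n) = (\<lambda>k. v k + \<beta> (s n) (s n) k)" for n
    by (simp_all add: s_def)
  have b: "\<forall>k\<in>K. cmod (s n k) \<le> 2 * r" for n
  proof (induction n)
    case (Suc n)
    show ?case
    proof
      fix k assume k: "k \<in> K"
      have "cmod (\<beta> (s n) (s n) k) \<le> C * (2*r) * (2*r)"
        by (rule bound[OF k]) (use Suc r in auto)
      also have "\<dots> = (8 * C * r) * (r / 2)" by simp
      also have "\<dots> \<le> 1 * (r/2)" by (rule mult_right_mono) (use r in auto)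
      finally have "cmod (\<beta> (s n) (s n) k) \<le> r" using r by simp
      then show "cmod (s (Suc n) k) \<le> 2 * r"
        using v[OF k] norm_triangle_ineq[of "v k" "\<beta> (s n) (s n) k"] by (simp add: sS)
    qed
  qed (use r in \<open>simp add: s0\<close>)
  have split: "\<beta> u u k - \<beta> w w k = \<beta> (\<lambda>j. u j - w j) u k + \<beta> w (\<lambda>j. u j - w j) k" if "k \<in> K" for u w k
    by (simp add: diffl diffr that)
  have lip: "cmod (\<beta> u u k - \<beta> w w k) \<le> e / 2"
    if k: "k \<in> K" and u: "\<forall>j\<in>K. cmod (u j) \<le> 2 * r" and w: "\<forall>j\<in>K. cmod (w j) \<le> 2 * r"
      and d: "\<forall>j\<in>K. cmod (u j - w j) \<le> e" and e: "0 \<le> e" for u w k e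
  proof -
    have "cmod (\<beta> u u k - \<beta> w w k) \<le> C * e * (2 * r) + C * (2 * r) * e"
      unfolding split[OF k]
      by (rule order_trans[OF norm_triangle_ineq add_mono], rule bound[OF k])
         (use u w d e r in \<open>auto intro: bound[OF k]\<close>)
    also have "\<dots> = (8 * C * r) * (e / 2)" by simp
    also have "\<dots> \<le> 1 * (e / 2)" by (rule mult_right_mono) (use r e in auto)
    finally show ?thesis by simp
  qed
  have step: "\<forall>k\<in>K. cmod (s (Suc n) k - s n k) \<le> (4 * r) * (1/2)^n" for n
  proof (induction n)
    case 0
    show ?case
    proof
      fix k assume "k \<in> K"
      then have "cmod (s (Suc 0) k) \<le> 2 * r" using b by blast
      then show "cmod (s (Suc 0) k - s 0 k) \<le> 4 * r * (1/2)^0" using r by (simp add: s0)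
    qed
  next
    case (Suc n)
    show ?case
    proof
      fix k assume k: "k \<in> K"
      have "cmod (s (Suc (Suc n)) k - s (Suc n) k) = cmod (\<beta> (s (Suc n)) (s (Suc n)) k - \<beta> (s n) (s n) k)"
        unfolding sS[of "Suc n"] unfolding sS[of n] by simp
      also have "\<dots> \<le> ((4 * r) * (1/2)^n) / 2"
        by (rule lip[OF k b b Suc.IH]) (use r in simp)
      finally show "cmod (s (Suc (Suc n)) k - s (Suc n) k) \<le> 4 * r * (1/2)^Suc n" by simp
    qed
  qed
  have conv: "convergent (\<lambda>n. s n k)" if k: "k \<in> K" for k
  proof -
    have "summable (\<lambda>n. s (Suc n) k - s n k)"
    proof (rule summable_comparison_test)
      show "\<exists>N. \<forall>n\<ge>N. norm (s (Suc n) k - s n k) \<le> (4 * r) * (1/2)^n" using step k by blast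
      show "summable (\<lambda>n. (4 * r) * (1/2::real)^n)" by (intro summable_mult summable_geometric) simp
    qed
    then have "convergent (\<lambda>n. \<Sum>i<n. s (Suc i) k - s i k)" by (simp add: summable_iff_convergent)
    moreover have "(\<Sum>i<n. s (Suc i) k - s i k) = s n k" for n
      using sum_lessThan_telescope[of "\<lambda>i. s i k" n] by (simp add: s0)
    ultimately show ?thesis by simp
  qed
  define u where "u k = lim (\<lambda>n. s n k)" for k
  have lim: "(\<lambda>n. s n k) \<longlonglongrightarrow> u k" if "k \<in> K" for k
    using conv[OF that] by (simp add: u_def convergent_LIMSEQ_iff)
  have ub: "\<forall>k\<in>K. cmod (u k) \<le> 2 * r"
  proof
    fix k assume k: "k \<in> K"
    show "cmod (u k) \<le> 2 * r"
      by (rule LIMSEQ_le_const2[OF tendsto_norm[OF lim[OF k]]]) (use b k in blast)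
  qed
  have "u k = v k + \<beta> u u k" if k: "k \<in> K" for k
  proof -
    have "(\<lambda>n. \<beta> (s n) (s n) k) \<longlonglongrightarrow> \<beta> u u k"
    proof (rule Lim_null[THEN iffD2], rule Lim_null_comparison)
      let ?e = "\<lambda>n. (\<Sum>j\<in>K. cmod (s n j - u j)) / 2"
      show "\<forall>\<^sub>F n in sequentially. norm (\<beta> (s n) (s n) k - \<beta> u u k) \<le> ?e n"
      proof (rule always_eventually, rule allI)
        fix n
        show "norm (\<beta> (s n) (s n) k - \<beta> u u k) \<le> ?e n"
          by (rule lip[OF k b ub]) (auto intro!: member_le_sum sum_nonneg simp: K)
      qed
      have "(\<lambda>n. (\<Sum>j\<in>K. cmod (s n j - u j)) / 2) \<longlonglongrightarrow> (\<Sum>j\<in>K. cmod (u j - u j)) / 2"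
        by (intro tendsto_intros lim) simp_all
      then show "?e \<longlonglongrightarrow> 0" by simp
    qed
    then have "(\<lambda>n. s (Suc n) k) \<longlonglongrightarrow> v k + \<beta> u u k"
      unfolding sS by (intro tendsto_intros)
    then show ?thesis using LIMSEQ_unique LIMSEQ_Suc[OF lim[OF k]] by blast
  qed
  then show ?thesis using ub by blast
qed

section \<open>The path algebra\<close>

interpretation path_vs: vector_space path_scale
  by (rule vector_space_path_scale)

lemma sum_nat_split: "(\<Sum>k<m + n. F k) = (\<Sum>k<m. F k) + (\<Sum>k<n. F (m + k))"
  for F :: "nat \<Rightarrow> 'a::comm_monoid_add"
  by (induction n) (auto simp: add.assoc)

lemma poly_mapping_singles: "f = (\<Sum>p\<in>Poly_Mapping.keys f. Poly_Mapping.single p (Poly_Mapping.lookup f p))"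
proof (rule poly_mapping_eqI)
  fix q
  have "Poly_Mapping.lookup (\<Sum>p\<in>Poly_Mapping.keys f. Poly_Mapping.single p (Poly_Mapping.lookup f p)) q
    = (\<Sum>p\<in>Poly_Mapping.keys f. if p = q then Poly_Mapping.lookup f q else 0)"
    unfolding lookup_sum lookup_single by (intro sum.cong) (auto simp: when_def)
  also have "\<dots> = Poly_Mapping.lookup f q" by (simp add: in_keys_iff)
  finally show "Poly_Mapping.lookup f q = Poly_Mapping.lookup (\<Sum>p\<in>Poly_Mapping.keys f. Poly_Mapping.single p (Poly_Mapping.lookup f p)) q" by simp
qed

lemma keys_path_scale: "Poly_Mapping.keys (path_scale z f) \<subseteq> Poly_Mapping.keys f"
  by (auto simp: in_keys_iff lookup_path_scale)

lemma path_scale_single: "path_scale z (Poly_Mapping.single p c) = Poly_Mapping.single p (z * c)"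
  by (rule poly_mapping_eqI) (simp add: lookup_path_scale lookup_single when_def)

section \<open>Linear extension of functions on paths, and bilinearity of the path
  operations\<close>

definition lin :: "('a \<Rightarrow> complex) \<Rightarrow> ('a \<Rightarrow>\<^sub>0 complex) \<Rightarrow> complex" where
  "lin h f = (\<Sum>p\<in>Poly_Mapping.keys f. Poly_Mapping.lookup f p * h p)"

lemma lin_superset:
  "finite S \<Longrightarrow> Poly_Mapping.keys f \<subseteq> S \<Longrightarrow> lin h f = (\<Sum>p\<in>S. Poly_Mapping.lookup f p * h p)"
  unfolding lin_def by (rule sum.mono_neutral_left) (auto simp: in_keys_iff)

lemma lin_add: "lin h (f + g) = lin h f + lin h g"
proof -
  let ?S = "Poly_Mapping.keys f \<union> Poly_Mapping.keys g"
  have "lin h (f + g) = (\<Sum>p\<in>?S. Poly_Mapping.lookup (f + g) p * h p)"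
    by (rule lin_superset) (auto simp: Poly_Mapping.keys_add)
  also have "\<dots> = (\<Sum>p\<in>?S. Poly_Mapping.lookup f p * h p) + (\<Sum>p\<in>?S. Poly_Mapping.lookup g p * h p)"
    by (simp add: lookup_add algebra_simps sum.distrib)
  finally show ?thesis by (simp add: lin_superset[of ?S])
qed

lemma lin_scale: "lin h (path_scale z f) = z * lin h f"
  by (subst lin_superset[OF _ keys_path_scale]) (auto simp: lin_def lookup_path_scale sum_distrib_left mult.assoc)

lemma lin_single: "lin h (Poly_Mapping.single p c) = c * h p"
  by (simp add: lin_def)

lemma lin_0: "lin h 0 = 0"
  by (simp add: lin_def)

lemma lin_diff: "lin h (f - g) = lin h f - lin h g"
  using lin_add[of h "f - g" g] by simp

lemma lin_sum: "lin h (\<Sum>i\<in>S. f i) = (\<Sum>i\<in>S. lin h (f i))"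
  by (induction S rule: infinite_finite_induct) (auto simp: lin_0 lin_add)

lemma double_simps [simp]:
  "head (double Q) (Inl a) = head Q a" "head (double Q) (Inr a) = tail Q a"
  "tail (double Q) (Inl a) = tail Q a" "tail (double Q) (Inr a) = head Q a"
  "verts (double Q) = verts Q"
  by (auto simp: double_def)

lemma double_arcs: "arcs (double Q) = Inl ` arcs Q \<union> Inr ` arcs Q"
  by (simp add: double_def)

text \<open>Cancellation can make the keys of a sum smaller than the union of the keys, so
  bilinearity is read off from sums over a common finite superset.\<close>

lemma path_mult_superset:
  assumes "finite S" "Poly_Mapping.keys f \<subseteq> S" "finite T" "Poly_Mapping.keys g \<subseteq> T"
  shows "path_mult Q f g = (\<Sum>p\<in>S. \<Sum>q\<in>T. if path_source Q p = fst q
     then Poly_Mapping.single (fst p, snd p @ snd q) (Poly_Mapping.lookup f p * Poly_Mapping.lookup g q) else 0)"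
proof -
  have "path_mult Q f g = (\<Sum>p\<in>Poly_Mapping.keys f. \<Sum>q\<in>T. if path_source Q p = fst q
     then Poly_Mapping.single (fst p, snd p @ snd q) (Poly_Mapping.lookup f p * Poly_Mapping.lookup g q) else 0)"
    unfolding path_mult_def by (intro sum.cong refl sum.mono_neutral_left assms) (auto simp: in_keys_iff)
  also have "\<dots> = (\<Sum>p\<in>S. \<Sum>q\<in>T. if path_source Q p = fst q
     then Poly_Mapping.single (fst p, snd p @ snd q) (Poly_Mapping.lookup f p * Poly_Mapping.lookup g q) else 0)"
    by (intro sum.mono_neutral_left assms) (auto simp: in_keys_iff intro!: sum.neutral)
  finally show ?thesis .
qed

lemma path_mult_add_left: "path_mult Q (f + f') g = path_mult Q f g + path_mult Q f' g"
proof -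
  let ?S = "Poly_Mapping.keys f \<union> Poly_Mapping.keys f'"
  show ?thesis
    using path_mult_superset[of ?S "f + f'" "Poly_Mapping.keys g" g Q]
      path_mult_superset[of ?S f "Poly_Mapping.keys g" g Q]
      path_mult_superset[of ?S f' "Poly_Mapping.keys g" g Q] Poly_Mapping.keys_add[of f f']
    by (auto simp: lookup_add distrib_right single_add simp flip: sum.distrib intro!: sum.cong)
qed

lemma path_mult_add_right: "path_mult Q g (f + f') = path_mult Q g f + path_mult Q g f'"
proof -
  let ?S = "Poly_Mapping.keys f \<union> Poly_Mapping.keys f'"
  show ?thesis
    using path_mult_superset[of "Poly_Mapping.keys g" g ?S "f + f'" Q]
      path_mult_superset[of "Poly_Mapping.keys g" g ?S f Q]
      path_mult_superset[of "Poly_Mapping.keys g" g ?S f' Q] Poly_Mapping.keys_add[of f f']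
    by (auto simp: lookup_add distrib_left single_add simp flip: sum.distrib intro!: sum.cong)
qed

lemma path_mult_zero [simp]: "path_mult Q 0 g = 0" "path_mult Q f 0 = 0"
  by (simp_all add: path_mult_def)

lemma path_mult_diff_left: "path_mult Q (f - f') g = path_mult Q f g - path_mult Q f' g"
  using path_mult_add_left[of Q "f - f'" f' g] by simp

lemma path_mult_diff_right: "path_mult Q g (f - f') = path_mult Q g f - path_mult Q g f'"
  using path_mult_add_right[of Q g "f - f'" f'] by simp

lemma path_mult_sum_left: "path_mult Q (\<Sum>i\<in>S. f i) g = (\<Sum>i\<in>S. path_mult Q (f i) g)"
  by (induction S rule: infinite_finite_induct) (auto simp: path_mult_add_left)

lemma path_mult_sum_right: "path_mult Q g (\<Sum>i\<in>S. f i) = (\<Sum>i\<in>S. path_mult Q g (f i))"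
  by (induction S rule: infinite_finite_induct) (auto simp: path_mult_add_right)

lemma path_mult_single:
  "path_mult Q (Poly_Mapping.single p a) (Poly_Mapping.single q b)
    = (if path_source Q p = fst q then Poly_Mapping.single (fst p, snd p @ snd q) (a * b) else 0)"
  using path_mult_superset[of "{p}" "Poly_Mapping.single p a" "{q}" "Poly_Mapping.single q b" Q]
  by (auto split: if_splits)

text \<open>The part of \<open>cyclic_deriv\<close> that comes from one path; it makes linearity in
  the coefficients and vanishing on open paths visible.\<close>

definition rotations :: "('v, 'e) pre_digraph \<Rightarrow> 'e + 'e \<Rightarrow> ('v, 'e) path \<Rightarrow> complex \<Rightarrow> ('v, 'e) path_comb" where
  "rotations Q c p z = (if path_source Q p = fst p then \<Sum>k<length (snd p).
     if snd p ! k = c then Poly_Mapping.single (tail (double Q) c, drop (Suc k) (snd p) @ take k (snd p)) z else 0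
     else 0)"

lemma rotations_0 [simp]: "rotations Q c p 0 = 0"
  by (auto simp: rotations_def intro!: sum.neutral)

lemma rotations_add: "rotations Q c p (z + w) = rotations Q c p z + rotations Q c p w"
  unfolding rotations_def by (auto simp: single_add simp flip: sum.distrib intro!: sum.cong)

lemma path_scale_rotations: "path_scale z (rotations Q c p w) = rotations Q c p (z * w)"
  unfolding rotations_def by (auto simp: path_vs.scale_sum_right path_scale_single intro!: sum.cong)

lemma cyclic_deriv_superset:
  assumes "finite S" "Poly_Mapping.keys f \<subseteq> S"
  shows "cyclic_deriv Q c f = (\<Sum>p\<in>S. rotations Q c p (Poly_Mapping.lookup f p))"
proof -
  have "cyclic_deriv Q c f = (\<Sum>p\<in>Poly_Mapping.keys f. rotations Q c p (Poly_Mapping.lookup f p))"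
  proof -
    have "(\<Sum>k\<in>{k. k < length (snd p) \<and> snd p ! k = c}.
        Poly_Mapping.single (tail (double Q) c, drop (Suc k) (snd p) @ take k (snd p)) z)
      = (\<Sum>k<length (snd p). if snd p ! k = c then Poly_Mapping.single (tail (double Q) c, drop (Suc k) (snd p) @ take k (snd p)) z else 0)" for p z
      by (rule sum.mono_neutral_cong_left) auto
    then show ?thesis
      unfolding cyclic_deriv_def rotations_def
      by (intro sum.mono_neutral_cong_left) auto
  qed
  also have "\<dots> = (\<Sum>p\<in>S. rotations Q c p (Poly_Mapping.lookup f p))"
    by (rule sum.mono_neutral_left) (use assms in \<open>auto simp: in_keys_iff\<close>)
  finally show ?thesis .
qed

lemma cyclic_deriv_add: "cyclic_deriv Q c (f + g) = cyclic_deriv Q c f + cyclic_deriv Q c g"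
proof -
  let ?S = "Poly_Mapping.keys f \<union> Poly_Mapping.keys g"
  show ?thesis
    using Poly_Mapping.keys_add[of f g]
    by (simp add: cyclic_deriv_superset[of ?S] lookup_add rotations_add sum.distrib)
qed

lemma cyclic_deriv_single: "cyclic_deriv Q c (Poly_Mapping.single p z) = rotations Q c p z"
  using cyclic_deriv_superset[of "{p}" "Poly_Mapping.single p z" Q c] by auto

lemma cyclic_deriv_0 [simp]: "cyclic_deriv Q c 0 = 0"
  by (simp add: cyclic_deriv_def)

lemma cyclic_deriv_diff: "cyclic_deriv Q c (f - g) = cyclic_deriv Q c f - cyclic_deriv Q c g"
  using cyclic_deriv_add[of Q c "f - g" g] by simp

lemma cyclic_deriv_scale: "cyclic_deriv Q c (path_scale z f) = path_scale z (cyclic_deriv Q c f)"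
  by (subst cyclic_deriv_superset[OF _ keys_path_scale])
     (simp_all add: cyclic_deriv_superset[OF _ subset_refl] lookup_path_scale path_vs.scale_sum_right path_scale_rotations)

section \<open>Paths of the doubled quiver\<close>

locale quiver = fin_digraph Q for Q :: "('v, 'e) pre_digraph" +
  fixes d :: "'v \<Rightarrow> nat"
begin

abbreviation AR where "AR \<equiv> arcs (double Q)"
abbreviation hdc where "hdc c \<equiv> head (double Q) c"
abbreviation tlc where "tlc c \<equiv> tail (double Q) c"
abbreviation AA where "AA \<equiv> path_algebra Q"
abbreviation pmult (infixl "\<star>" 70) where "f \<star> g \<equiv> path_mult Q f g"

lemma finite_AR: "finite AR" by (auto simp: double_arcs)

lemma AR_verts: "c \<in> AR \<Longrightarrow> hdc c \<in> verts Q" "c \<in> AR \<Longrightarrow> tlc c \<in> verts Q"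
  by (auto simp: double_arcs)

lemma paths_Nil: "(i, []) \<in> paths Q \<longleftrightarrow> i \<in> verts Q"
  by (auto simp: paths_def pre_digraph.awalk_def pre_digraph.cas.simps)

text \<open>A path is listed from its end point, so its first arrow is traversed last: to obtain
  \<open>paths_Cons\<close>, walks have to be extended at the far end.\<close>

lemma cas_snoc: "pre_digraph.cas (double Q) j (es @ [c]) i \<longleftrightarrow> pre_digraph.cas (double Q) j es (tlc c) \<and> hdc c = i"
  by (induction es arbitrary: j) (auto simp: pre_digraph.cas.simps simp del: double_simps)

lemma paths_Cons: "(i, c # cs) \<in> paths Q \<longleftrightarrow> c \<in> AR \<and> hdc c = i \<and> (tlc c, cs) \<in> paths Q"
  unfolding paths_def pre_digraph.awalk_def by (simp add: cas_snoc del: double_simps) blast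

lemma path_verts: "(i, cs) \<in> paths Q \<Longrightarrow> i \<in> verts Q"
  by (cases cs) (auto simp: paths_Nil paths_Cons AR_verts simp del: double_simps)

lemma path_source_Nil: "path_source Q (i, []) = i"
  by (simp add: path_source_def)

lemma path_source_Cons: "path_source Q (i, c # cs) = path_source Q (tlc c, cs)"
  by (simp add: path_source_def)

lemma path_source_verts: "(i, cs) \<in> paths Q \<Longrightarrow> path_source Q (i, cs) \<in> verts Q"
  by (induction cs arbitrary: i) (auto simp: paths_Nil paths_Cons path_source_Nil path_source_Cons simp del: double_simps)

lemma path_append:
  "(i, cs) \<in> paths Q \<Longrightarrow> (path_source Q (i, cs), ds) \<in> paths Q \<Longrightarrow>
   (i, cs @ ds) \<in> paths Q \<and> path_source Q (i, cs @ ds) = path_source Q (path_source Q (i, cs), ds)"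
  by (induction cs arbitrary: i) (auto simp: paths_Nil paths_Cons path_source_Nil path_source_Cons simp del: double_simps)

lemma path_split:
  "(i, cs @ ds) \<in> paths Q \<Longrightarrow> (i, cs) \<in> paths Q \<and> (path_source Q (i, cs), ds) \<in> paths Q"
  by (induction cs arbitrary: i)
     (auto simp: paths_Nil paths_Cons path_source_Nil path_source_Cons simp del: double_simps
        dest: path_verts)

end

text \<open>Resolution produces eta-long matrices, in which pointwise simplification would destroy the
  algebraic structure; the pointwise rules are therefore used only on request.\<close>

lemmas pw = zero_fun_apply plus_fun_apply minus_apply mscale_apply

declare pw [simp del]

context quiver
begin

lemma AA_0: "0 \<in> AA" by (simp add: path_algebra_def)

lemma AA_add: "f \<in> AA \<Longrightarrow> g \<in> AA \<Longrightarrow> f + g \<in> AA"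
  using Poly_Mapping.keys_add[of f g] by (auto simp: path_algebra_def)

lemma AA_scale: "f \<in> AA \<Longrightarrow> path_scale z f \<in> AA"
  using keys_path_scale[of z f] by (auto simp: path_algebra_def)

lemma AA_diff: "f \<in> AA \<Longrightarrow> g \<in> AA \<Longrightarrow> f - g \<in> AA"
  using AA_add[of f "path_scale (-1) g"] AA_scale[of g "-1"] by simp

lemma AA_sum: "(\<And>i. i \<in> S \<Longrightarrow> f i \<in> AA) \<Longrightarrow> (\<Sum>i\<in>S. f i) \<in> AA"
  by (induction S rule: infinite_finite_induct) (auto simp: AA_0 AA_add)

lemma AA_single: "p \<in> paths Q \<Longrightarrow> Poly_Mapping.single p z \<in> AA"
  by (auto simp: path_algebra_def split: if_splits)

text \<open>Linear identities on the path algebra reduce by this rule to single paths; bilinear ones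
  use it once for each argument.\<close>

lemma AA_induct [consumes 1, case_names zero single add]:
  assumes "f \<in> AA" "P 0" "\<And>p z. p \<in> paths Q \<Longrightarrow> P (Poly_Mapping.single p z)"
    "\<And>f g. f \<in> AA \<Longrightarrow> g \<in> AA \<Longrightarrow> P f \<Longrightarrow> P g \<Longrightarrow> P (f + g)"
  shows "P f"
proof -
  have "(\<Sum>p\<in>S. Poly_Mapping.single p (Poly_Mapping.lookup f p)) \<in> AA \<and> P (\<Sum>p\<in>S. Poly_Mapping.single p (Poly_Mapping.lookup f p))"
    if "finite S" "S \<subseteq> paths Q" for S
    using that by (induction S rule: finite_induct) (auto simp: AA_0 assms(2,3) AA_add AA_single intro: assms(4))
  from this[of "Poly_Mapping.keys f"] show ?thesis
    using poly_mapping_singles[of f] assms(1) by (simp add: path_algebra_def)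
qed

lemma path_append': "p \<in> paths Q \<Longrightarrow> q \<in> paths Q \<Longrightarrow> path_source Q p = fst q \<Longrightarrow>
  (fst p, snd p @ snd q) \<in> paths Q \<and> path_source Q (fst p, snd p @ snd q) = path_source Q q"
  using path_append[of "fst p" "snd p" "snd q"] by simp

lemma AA_mult: "f \<in> AA \<Longrightarrow> g \<in> AA \<Longrightarrow> f \<star> g \<in> AA"
proof (induction f rule: AA_induct)
  case (single p z)
  show ?case using single(2)
    by (induction g rule: AA_induct)
       (auto simp: path_mult_single path_mult_add_right AA_0 AA_add AA_single path_append'[OF single(1)])
qed (auto simp: AA_0 path_mult_add_left AA_add)

lemma pmult_assoc: "f \<in> AA \<Longrightarrow> g \<in> AA \<Longrightarrow> h \<in> AA \<Longrightarrow> f \<star> g \<star> h = f \<star> (g \<star> h)"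
proof (induction f rule: AA_induct)
  case (single p z)
  note p = single(1)
  show ?case using single(2,3)
  proof (induction g rule: AA_induct)
    case (single q w)
    note q = single(1)
    show ?case using single(2)
    proof (induction h rule: AA_induct)
      case (single r v)
      show ?case
        using path_append'[OF p q] path_append'[OF q single] by (auto simp: path_mult_single mult.assoc)
    qed (auto simp: path_mult_add_right)
  qed (auto simp: path_mult_add_left path_mult_add_right)
qed (auto simp: path_mult_add_left path_mult_add_right)

lemma pmult_scale_left: "f \<in> AA \<Longrightarrow> g \<in> AA \<Longrightarrow> path_scale z f \<star> g = path_scale z (f \<star> g)"
proof (induction f rule: AA_induct)
  case (single p w)
  show ?case using single(2)
    by (induction g rule: AA_induct)
       (auto simp: path_mult_single path_scale_single path_mult_add_right path_vs.scale_right_distrib mult.assoc)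
qed (auto simp: path_mult_add_left path_vs.scale_right_distrib)

lemma pmult_scale_right: "f \<in> AA \<Longrightarrow> g \<in> AA \<Longrightarrow> f \<star> path_scale z g = path_scale z (f \<star> g)"
proof (induction f rule: AA_induct)
  case (single p w)
  show ?case using single(2)
    by (induction g rule: AA_induct)
       (auto simp: path_mult_single path_scale_single path_mult_add_right path_vs.scale_right_distrib mult.left_commute)
qed (auto simp: path_mult_add_left path_vs.scale_right_distrib)

definition vx :: "'v \<Rightarrow> ('v, 'e) path_comb" where
  "vx i = Poly_Mapping.single (i, []) 1"

definition arr :: "'e + 'e \<Rightarrow> ('v, 'e) path_comb" where
  "arr c = Poly_Mapping.single (hdc c, [c]) 1"

definition oneA :: "('v, 'e) path_comb" where
  "oneA = (\<Sum>i\<in>verts Q. vx i)"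

lemma AA_vx: "i \<in> verts Q \<Longrightarrow> vx i \<in> AA"
  by (simp add: vx_def AA_single paths_Nil)

lemma arr_path: "c \<in> AR \<Longrightarrow> (hdc c, [c]) \<in> paths Q"
  by (simp only: paths_Cons paths_Nil AR_verts simp_thms)

lemma AA_arr: "c \<in> AR \<Longrightarrow> arr c \<in> AA"
  by (simp add: arr_def AA_single arr_path del: double_simps)

lemma AA_one: "oneA \<in> AA"
  by (simp add: oneA_def AA_sum AA_vx)

lemma vx_single: "vx i \<star> Poly_Mapping.single q w = (if i = fst q then Poly_Mapping.single q w else 0)"
  by (auto simp: vx_def path_mult_single path_source_Nil)

lemma single_vx: "Poly_Mapping.single q w \<star> vx i = (if path_source Q q = i then Poly_Mapping.single q w else 0)"
  by (auto simp: vx_def path_mult_single)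

lemma oneA_right: "f \<in> AA \<Longrightarrow> f \<star> oneA = f"
proof (induction f rule: AA_induct)
  case (single p z)
  then have "path_source Q p \<in> verts Q" using path_source_verts[of "fst p" "snd p"] by simp
  then show ?case by (simp add: oneA_def path_mult_sum_right single_vx)
qed (auto simp: path_mult_add_left)

lemma vx_vx: "vx i \<star> vx j = (if i = j then vx i else 0)"
  by (auto simp: vx_def path_mult_single path_source_Nil)

section \<open>Matrix representations of the path algebra\<close>

text \<open>The spaces at the vertices are combined into one space with basis \<open>idx\<close>, so that the linear maps
  between them become square matrices, multiplied by the single product \<open>\<diamond>\<close>.\<close>

definition idx :: "('v \<times> nat) set" where
  "idx = Sigma (verts Q) (\<lambda>i. {..<d i})"

sublocale fmat idx
  by unfold_locales (auto simp: idx_def)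

notation mm (infixl "\<diamond>" 70)

lemma idx_iff [simp]: "(i, p) \<in> idx \<longleftrightarrow> i \<in> verts Q \<and> p < d i"
  by (auto simp: idx_def)

type_synonym 'u mtx = "'u \<times> nat \<Rightarrow> 'u \<times> nat \<Rightarrow> complex"

definition proj :: "'v \<Rightarrow> 'v mtx" where
  "proj i = (\<lambda>x y. if x = y \<and> x \<in> idx \<and> fst x = i then 1 else 0)"

lemma fm_proj: "proj i \<in> fm"
  by (auto intro!: fmI simp: proj_def)

lemma proj_mm: "(proj i \<diamond> A) x y = (if x \<in> idx \<and> fst x = i then A x y else 0)"
proof -
  have "(proj i \<diamond> A) x y = (\<Sum>z\<in>idx. if x = z then (if fst x = i then A x y else 0) else 0)"
    unfolding mm_def proj_def by (intro sum.cong) auto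
  then show ?thesis using finI by auto
qed

lemma mm_proj: "(A \<diamond> proj i) x y = (if y \<in> idx \<and> fst y = i then A x y else 0)"
proof -
  have "(A \<diamond> proj i) x y = (\<Sum>z\<in>idx. if z = y then (if fst y = i then A x y else 0) else 0)"
    unfolding mm_def proj_def by (intro sum.cong) auto
  then show ?thesis using finI by auto
qed

lemma proj_proj: "proj i \<diamond> proj j = (if i = j then proj i else 0)"
  by (intro ext, simp add: proj_mm pw) (auto simp: proj_def pw)

lemma om_proj: "om = (\<Sum>i\<in>verts Q. proj i)"
proof (intro ext)
  fix x y
  have "(\<Sum>i\<in>verts Q. proj i) x y = (\<Sum>i\<in>verts Q. if i = fst x then om x y else 0)"
    unfolding sum_fun_apply2 by (intro sum.cong) (auto simp: proj_def om_def)
  also have "\<dots> = om x y" by (cases x) (auto simp: om_def)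
  finally show "om x y = (\<Sum>i\<in>verts Q. proj i) x y" by simp
qed

text \<open>The arrows of a representation as blocks of one large matrix. The support condition
  makes \<open>R\<close> multiplicative even on paths that do not compose.\<close>

definition blk :: "('e + 'e \<Rightarrow> 'v mtx) \<Rightarrow> bool" where
  "blk u \<longleftrightarrow> (\<forall>c\<in>AR. \<forall>x y. u c x y \<noteq> 0 \<longrightarrow> x \<in> idx \<and> y \<in> idx \<and> fst x = hdc c \<and> fst y = tlc c)"

lemma blkD: "blk u \<Longrightarrow> c \<in> AR \<Longrightarrow> u c x y \<noteq> 0 \<Longrightarrow> x \<in> idx \<and> y \<in> idx \<and> fst x = hdc c \<and> fst y = tlc c"
  unfolding blk_def by blast

lemma blk_fm: "blk u \<Longrightarrow> c \<in> AR \<Longrightarrow> u c \<in> fm"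
  unfolding fm_def using blkD by blast

lemma blk_proj_left: "blk u \<Longrightarrow> c \<in> AR \<Longrightarrow> proj i \<diamond> u c = (if i = hdc c then u c else 0)"
  by (intro ext, simp add: proj_mm pw del: double_simps) (use blkD[of u c] in \<open>auto simp: pw simp del: double_simps\<close>)

lemma blk_proj_right: "blk u \<Longrightarrow> c \<in> AR \<Longrightarrow> u c \<diamond> proj i = (if i = tlc c then u c else 0)"
  by (intro ext, simp add: mm_proj pw del: double_simps) (use blkD[of u c] in \<open>auto simp: pw simp del: double_simps\<close>)

fun evw :: "('e + 'e \<Rightarrow> 'v mtx) \<Rightarrow> 'v \<Rightarrow> ('e + 'e) list \<Rightarrow> 'v mtx" where
  "evw u i [] = proj i"
| "evw u i (c # cs) = u c \<diamond> evw u (tlc c) cs"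

text \<open>The algebra homomorphism from the path algebra to matrices given by the representation
  u.\<close>

definition R :: "('e + 'e \<Rightarrow> 'v mtx) \<Rightarrow> ('v, 'e) path_comb \<Rightarrow> 'v mtx" where
  "R u f = (\<lambda>x y. lin (\<lambda>p. evw u (fst p) (snd p) x y) f)"

lemma R_add: "R u (f + g) = R u f + R u g"
  and R_diff: "R u (f - g) = R u f - R u g"
  and R_scale: "R u (path_scale z f) = mscale z (R u f)"
  and R_0 [simp]: "R u 0 = 0"
  and R_single: "R u (Poly_Mapping.single p z) = mscale z (evw u (fst p) (snd p))"
  by (auto simp: fun_eq_iff pw R_def lin_add lin_diff lin_scale lin_0 lin_single)

lemma R_sum: "R u (\<Sum>i\<in>S. f i) = (\<Sum>i\<in>S. R u (f i))"
  by (intro ext) (simp add: R_def lin_sum sum_fun_apply2)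

lemma mscale_simps [simp]: "mscale 1 A = A" "mscale 0 A = 0" "mscale z 0 = 0" "mscale z (mscale w A) = mscale (z * w) A"
  by (auto simp: fun_eq_iff pw)

lemma R_vx: "R u (vx i) = proj i"
  by (simp add: vx_def R_single)

lemma R_one: "R u oneA = om"
  by (simp add: oneA_def R_sum R_vx om_proj)

lemma evw_fm: "blk u \<Longrightarrow> (i, cs) \<in> paths Q \<Longrightarrow> evw u i cs \<in> fm"
  by (induction cs arbitrary: i) (auto simp: fm_proj paths_Cons fm_mm blk_fm simp del: double_simps)

lemma R_fm:
  assumes "blk u" "f \<in> AA" shows "R u f \<in> fm"
  using assms(2) by (induction f rule: AA_induct) (auto simp: fm_0 fm_add R_add R_single fm_scale evw_fm assms(1))

lemma R_arr: "blk u \<Longrightarrow> c \<in> AR \<Longrightarrow> R u (arr c) = u c"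
  by (simp add: arr_def R_single mm_om_right blk_proj_right del: double_simps)

lemma evw_append:
  "blk u \<Longrightarrow> (i, cs) \<in> paths Q \<Longrightarrow> (path_source Q (i, cs), ds) \<in> paths Q \<Longrightarrow>
    evw u i (cs @ ds) = evw u i cs \<diamond> evw u (path_source Q (i, cs)) ds"
proof (induction cs arbitrary: i)
  case Nil
  show ?case
  proof (cases ds)
    case (Cons c ds')
    then show ?thesis using Nil
      by (simp add: path_source_Nil mm_assoc[symmetric] blk_proj_left paths_Cons del: double_simps)
  qed (simp add: path_source_Nil proj_proj)
qed (auto simp: paths_Cons path_source_Cons mm_assoc simp del: double_simps)

lemma evw_proj_left: "blk u \<Longrightarrow> (i, cs) \<in> paths Q \<Longrightarrow> proj j \<diamond> evw u i cs = (if i = j then evw u i cs else 0)"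
  by (cases cs) (auto simp: proj_proj mm_assoc[symmetric] blk_proj_left paths_Cons mm_zero_left simp del: double_simps)

lemma evw_proj_right: "blk u \<Longrightarrow> (i, cs) \<in> paths Q \<Longrightarrow>
  evw u i cs \<diamond> proj j = (if path_source Q (i, cs) = j then evw u i cs else 0)"
  by (induction cs arbitrary: i)
     (auto simp: proj_proj mm_assoc path_source_Nil path_source_Cons paths_Cons mm_zero_right simp del: double_simps)

text \<open>When the words do not compose, a product of projections at two distinct vertices can be
  inserted between their matrices, so both sides vanish.\<close>

lemma R_mult_single:
  assumes "blk u" "p \<in> paths Q" "q \<in> paths Q"
  shows "R u (Poly_Mapping.single p z \<star> Poly_Mapping.single q w) = R u (Poly_Mapping.single p z) \<diamond> R u (Poly_Mapping.single q w)"
proof -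
  obtain i cs where p: "p = (i, cs)" by (cases p)
  obtain j ds where q: "q = (j, ds)" by (cases q)
  show ?thesis
  proof (cases "path_source Q p = j")
    case True
    then show ?thesis using assms evw_append[of u i cs ds]
      by (auto simp: path_mult_single p q R_single mm_scale_left mm_scale_right mult.commute)
  next
    case False
    have "evw u i cs \<diamond> evw u j ds = evw u i cs \<diamond> (proj j \<diamond> evw u j ds)"
      using assms evw_proj_left[of u j ds] q by simp
    also have "\<dots> = 0"
      using assms evw_proj_right[of u i cs j] p False by (simp add: mm_assoc[symmetric] mm_zero_left)
    finally show ?thesis using False
      by (simp add: path_mult_single p q R_single mm_scale_left mm_scale_right)
  qed
qed

lemma R_mult:
  assumes u: "blk u" and f: "f \<in> AA" and g: "g \<in> AA"
  shows "R u (f \<star> g) = R u f \<diamond> R u g"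
  using f
proof (induction f rule: AA_induct)
  case (single p z)
  show ?case using g
    by (induction g rule: AA_induct)
       (simp_all add: R_mult_single u single R_add path_mult_add_right mm_add_right mm_zero_right)
qed (simp_all add: path_mult_add_left R_add mm_add_left mm_zero_left)

lemma tr_R_commute: "blk u \<Longrightarrow> f \<in> AA \<Longrightarrow> g \<in> AA \<Longrightarrow> tr (R u (f \<star> g)) = tr (R u (g \<star> f))"
  by (simp add: R_mult tr_comm)

subsection \<open>Derivations\<close>

fun dw :: "('e + 'e \<Rightarrow> 'v mtx) \<Rightarrow> ('e + 'e \<Rightarrow> 'v mtx) \<Rightarrow> 'v \<Rightarrow> ('e + 'e) list \<Rightarrow> 'v mtx" where
  "dw u v i [] = 0"
| "dw u v i (c # cs) = v c \<diamond> evw u (tlc c) cs + u c \<diamond> dw u v (tlc c) cs"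

text \<open>The derivative of \<open>R\<close> at u in the direction v, and equally the derivation
  along \<open>R u\<close> that is v on arrows and zero at vertices. \<open>R_deriv\<close> gives
  the analytic side, \<open>derivation_eq_dR\<close> the algebraic one.\<close>

definition dR :: "('e + 'e \<Rightarrow> 'v mtx) \<Rightarrow> ('e + 'e \<Rightarrow> 'v mtx) \<Rightarrow> ('v, 'e) path_comb \<Rightarrow> 'v mtx" where
  "dR u v f = (\<lambda>x y. lin (\<lambda>p. dw u v (fst p) (snd p) x y) f)"

lemma dR_add: "dR u v (f + g) = dR u v f + dR u v g"
  and dR_diff: "dR u v (f - g) = dR u v f - dR u v g"
  and dR_scale: "dR u v (path_scale z f) = mscale z (dR u v f)"
  and dR_0 [simp]: "dR u v 0 = 0"
  and dR_single: "dR u v (Poly_Mapping.single p z) = mscale z (dw u v (fst p) (snd p))"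
  by (auto simp: fun_eq_iff pw dR_def lin_add lin_diff lin_scale lin_0 lin_single)

lemma dR_sum: "dR u v (\<Sum>i\<in>S. f i) = (\<Sum>i\<in>S. dR u v (f i))"
  by (intro ext) (simp add: dR_def lin_sum sum_fun_apply2)

text \<open>Vertices and arrows generate the path algebra, and the Leibniz rule determines a
  derivation on products.\<close>

lemma derivation_eq_dR:
  assumes u: "blk u" and f: "f \<in> AA"
    and add: "\<And>f g. f \<in> AA \<Longrightarrow> g \<in> AA \<Longrightarrow> D (f + g) = D f + D g"
    and scale: "\<And>z f. f \<in> AA \<Longrightarrow> D (path_scale z f) = mscale z (D f)"
    and mult: "\<And>f g. f \<in> AA \<Longrightarrow> g \<in> AA \<Longrightarrow> D (f \<star> g) = D f \<diamond> R u g + R u f \<diamond> D g"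
    and vx: "\<And>i. i \<in> verts Q \<Longrightarrow> D (vx i) = 0"
    and arr: "\<And>c. c \<in> AR \<Longrightarrow> D (arr c) = v c"
  shows "D f = dR u v f"
  using f
proof (induction f rule: AA_induct)
  case zero
  show ?case using scale[OF AA_0, of 0] by simp
next
  case (single p z)
  have w: "D (Poly_Mapping.single (i, cs) 1) = dw u v i cs" if "(i, cs) \<in> paths Q" for i cs
    using that
  proof (induction cs arbitrary: i)
    case Nil
    then show ?case using vx by (simp add: paths_Nil vx_def)
  next
    case (Cons c cs)
    then have c: "c \<in> AR" "hdc c = i" and cs: "(tlc c, cs) \<in> paths Q"
      by (auto simp: paths_Cons simp del: double_simps)
    have "Poly_Mapping.single (i, c # cs) 1 = arr c \<star> Poly_Mapping.single (tlc c, cs) (1::complex)"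
      using c by (simp add: arr_def path_mult_single path_source_Cons path_source_Nil del: double_simps)
    then have "D (Poly_Mapping.single (i, c # cs) 1)
      = D (arr c) \<diamond> R u (Poly_Mapping.single (tlc c, cs) 1) + R u (arr c) \<diamond> D (Poly_Mapping.single (tlc c, cs) 1)"
      using mult[OF AA_arr[OF c(1)] AA_single[OF cs]] by simp
    then show ?case using Cons.IH[OF cs] arr[OF c(1)] R_arr[OF u c(1)]
      by (simp add: R_single del: double_simps)
  qed
  have "Poly_Mapping.single p z = path_scale z (Poly_Mapping.single p 1)"
    by (simp add: path_scale_single)
  then show ?case
    using w[of "fst p" "snd p"] single scale[OF AA_single[OF single, of 1], of z] by (simp add: dR_scale dR_single)
next
  case (add f g)
  then show ?case by (simp add: assms(3) dR_add)
qed

lemma dw_append: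
  "blk u \<Longrightarrow> blk v \<Longrightarrow> (i, cs) \<in> paths Q \<Longrightarrow> (path_source Q (i, cs), ds) \<in> paths Q \<Longrightarrow>
    dw u v i (cs @ ds) = dw u v i cs \<diamond> evw u (path_source Q (i, cs)) ds + evw u i cs \<diamond> dw u v (path_source Q (i, cs)) ds"
proof (induction cs arbitrary: i)
  case Nil
  show ?case
  proof (cases ds)
    case (Cons c ds')
    then show ?thesis using Nil
      by (simp add: path_source_Nil mm_assoc[symmetric] mm_add_right mm_zero_left blk_proj_left paths_Cons del: double_simps)
  qed (simp add: path_source_Nil mm_zero_left mm_zero_right)
next
  case (Cons c cs)
  then show ?case
    by (simp add: paths_Cons path_source_Cons evw_append mm_assoc mm_add_left mm_add_right add.assoc del: double_simps)
qed

lemma dw_proj_left: "blk u \<Longrightarrow> blk v \<Longrightarrow> (i, cs) \<in> paths Q \<Longrightarrow> proj j \<diamond> dw u v i cs = (if i = j then dw u v i cs else 0)"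
  by (cases cs) (auto simp: mm_assoc[symmetric] mm_add_right mm_zero_left mm_zero_right blk_proj_left paths_Cons simp del: double_simps)

lemma dw_proj_right: "blk u \<Longrightarrow> blk v \<Longrightarrow> (i, cs) \<in> paths Q \<Longrightarrow>
  dw u v i cs \<diamond> proj j = (if path_source Q (i, cs) = j then dw u v i cs else 0)"
  by (induction cs arbitrary: i)
     (auto simp: mm_assoc path_source_Nil path_source_Cons paths_Cons mm_zero_left mm_zero_right mm_add_left evw_proj_right simp del: double_simps)

lemma dR_mult_single:
  assumes "blk u" "blk v" "p \<in> paths Q" "q \<in> paths Q"
  shows "dR u v (Poly_Mapping.single p z \<star> Poly_Mapping.single q w)
    = dR u v (Poly_Mapping.single p z) \<diamond> R u (Poly_Mapping.single q w) + R u (Poly_Mapping.single p z) \<diamond> dR u v (Poly_Mapping.single q w)"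
proof -
  obtain i cs where p: "p = (i, cs)" by (cases p)
  obtain j ds where q: "q = (j, ds)" by (cases q)
  show ?thesis
  proof (cases "path_source Q p = j")
    case True
    then show ?thesis using assms dw_append[of u v i cs ds]
      by (auto simp: path_mult_single p q R_single dR_single mm_scale_left mm_scale_right fun_eq_iff pw algebra_simps)
  next
    case False
    have "dw u v i cs \<diamond> evw u j ds = dw u v i cs \<diamond> (proj j \<diamond> evw u j ds)"
      using assms evw_proj_left[of u j ds] q by simp
    also have "\<dots> = 0"
      using assms dw_proj_right[of u v i cs j] p False by (simp add: mm_assoc[symmetric] mm_zero_left)
    finally have 1: "dw u v i cs \<diamond> evw u j ds = 0" .
    have "evw u i cs \<diamond> dw u v j ds = evw u i cs \<diamond> (proj j \<diamond> dw u v j ds)"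
      using assms dw_proj_left[of u v j ds] q by simp
    also have "\<dots> = 0"
      using assms evw_proj_right[of u i cs j] p False by (simp add: mm_assoc[symmetric] mm_zero_left)
    finally show ?thesis using False 1
      by (simp add: path_mult_single p q R_single dR_single mm_scale_left mm_scale_right)
  qed
qed

lemma dR_mult:
  assumes u: "blk u" "blk v" and f: "f \<in> AA" and g: "g \<in> AA"
  shows "dR u v (f \<star> g) = dR u v f \<diamond> R u g + R u f \<diamond> dR u v g"
  using f
proof (induction f rule: AA_induct)
  case (single p z)
  show ?case using g
    by (induction g rule: AA_induct)
       (simp_all add: dR_mult_single u single R_add dR_add path_mult_add_right mm_add_right mm_zero_right algebra_simps)
qed (simp_all add: path_mult_add_left R_add dR_add mm_add_left mm_zero_left algebra_simps)

lemma dR_arr: "blk u \<Longrightarrow> blk v \<Longrightarrow> c \<in> AR \<Longrightarrow> dR u v (arr c) = v c"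
  by (simp add: arr_def dR_single mm_zero_right blk_proj_right del: double_simps)

lemma dR_vx: "dR u v (vx i) = 0"
  by (simp add: vx_def dR_single)

lemma dR_fm:
  assumes u: "blk u" "blk v" and f: "f \<in> AA"
  shows "dR u v f \<in> fm"
  using f
proof (induction f rule: AA_induct)
  case (single p z)
  have "dw u v i cs \<in> fm" if "(i, cs) \<in> paths Q" for i cs
    using that u by (induction cs arbitrary: i) (auto simp: fm_0 paths_Cons fm_mm fm_add blk_fm evw_fm simp del: double_simps)
  then show ?case using single by (auto simp: dR_single fm_scale)
qed (auto simp: fm_0 fm_add dR_add)

text \<open>The direction of infinitesimal conjugation by X.\<close>

definition gdir :: "'v mtx \<Rightarrow> ('e + 'e \<Rightarrow> 'v mtx) \<Rightarrow> ('e + 'e \<Rightarrow> 'v mtx)" where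
  "gdir X u = (\<lambda>c. X \<diamond> u c - u c \<diamond> X)"

text \<open>The commutator with X is a derivation along \<open>R u\<close> whose values on arrows
  are \<open>gdir X u\<close>. Commuting with the projections makes it vanish at vertices, so
  uniqueness applies.\<close>

lemma dR_gdir:
  assumes u: "blk u" and X: "X \<in> fm" "\<And>i. i \<in> verts Q \<Longrightarrow> X \<diamond> proj i = proj i \<diamond> X" and f: "f \<in> AA"
  shows "dR u (gdir X u) f = X \<diamond> R u f - R u f \<diamond> X"
proof (rule sym, rule derivation_eq_dR[OF u f])
  fix f g assume "f \<in> AA" "g \<in> AA"
  then show "X \<diamond> R u (f \<star> g) - R u (f \<star> g) \<diamond> X = (X \<diamond> R u f - R u f \<diamond> X) \<diamond> R u g + R u f \<diamond> (X \<diamond> R u g - R u g \<diamond> X)"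
    by (simp add: R_mult u mm_diff_left mm_diff_right mm_assoc)
next
  fix z f
  show "X \<diamond> R u (path_scale z f) - R u (path_scale z f) \<diamond> X = mscale z (X \<diamond> R u f - R u f \<diamond> X)"
    unfolding R_scale mm_scale_left mm_scale_right by (simp add: fun_eq_iff pw algebra_simps)
qed (simp_all add: R_add mm_add_left mm_add_right R_vx X R_arr u gdir_def del: double_simps)

text \<open>The Lie algebra of the product of the general linear groups, before dividing by scalars;
  by \<open>blkd_iff\<close> it is the commutant of the vertex projections.\<close>

definition blkd :: "'v mtx \<Rightarrow> bool" where
  "blkd X \<longleftrightarrow> (\<forall>x y. X x y \<noteq> 0 \<longrightarrow> x \<in> idx \<and> y \<in> idx \<and> fst x = fst y)"

lemma blkd_fm: "blkd X \<Longrightarrow> X \<in> fm"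
  unfolding blkd_def fm_def by blast

lemma blkdD: "blkd X \<Longrightarrow> X x y \<noteq> 0 \<Longrightarrow> x \<in> idx \<and> y \<in> idx \<and> fst x = fst y"
  unfolding blkd_def by blast

lemma blkd_comm:
  assumes "blkd X" shows "X \<diamond> proj i = proj i \<diamond> X"
proof (intro ext)
  fix x y
  show "(X \<diamond> proj i) x y = (proj i \<diamond> X) x y"
    using blkdD[OF assms, of x y] by (cases "X x y = 0") (auto simp: proj_mm mm_proj)
qed

lemma blkd_iff: "blkd X \<longleftrightarrow> X \<in> fm \<and> (\<forall>i\<in>verts Q. X \<diamond> proj i = proj i \<diamond> X)"
proof (intro iffI conjI ballI)
  assume X: "X \<in> fm \<and> (\<forall>i\<in>verts Q. X \<diamond> proj i = proj i \<diamond> X)"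
  show "blkd X" unfolding blkd_def
  proof (intro allI impI)
    fix x y assume n: "X x y \<noteq> 0"
    then have i: "x \<in> idx" "y \<in> idx" using X fm_zero by blast+
    then have "X \<diamond> proj (fst x) = proj (fst x) \<diamond> X" using X by (auto simp: idx_def)
    from fun_cong[OF fun_cong[OF this], of x y] show "x \<in> idx \<and> y \<in> idx \<and> fst x = fst y"
      using i n by (auto simp: proj_mm mm_proj split: if_splits)
  qed
qed (auto simp: blkd_fm blkd_comm)

lemma blk_gdir: "blk u \<Longrightarrow> blkd X \<Longrightarrow> blk (gdir X u)"
  unfolding blk_def
proof (intro ballI allI impI)
  fix c x y assume u: "\<forall>c\<in>AR. \<forall>x y. u c x y \<noteq> 0 \<longrightarrow> x \<in> idx \<and> y \<in> idx \<and> fst x = hdc c \<and> fst y = tlc c"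
    and X: "blkd X" and c: "c \<in> AR" and n: "gdir X u c x y \<noteq> 0"
  have uc: "u c x y \<noteq> 0 \<Longrightarrow> x \<in> idx \<and> y \<in> idx \<and> fst x = hdc c \<and> fst y = tlc c" for x y
    using u c by blast
  have Xb: "X x y \<noteq> 0 \<Longrightarrow> x \<in> idx \<and> y \<in> idx \<and> fst x = fst y" for x y
    by (rule blkdD[OF X])
  have "(\<Sum>z\<in>idx. X x z * u c z y) \<noteq> 0 \<or> (\<Sum>z\<in>idx. u c x z * X z y) \<noteq> 0"
    using n by (auto simp: gdir_def mm_def pw)
  then consider z where "X x z * u c z y \<noteq> 0" | z where "u c x z * X z y \<noteq> 0"
    by (meson sum.not_neutral_contains_not_neutral)
  then show "x \<in> idx \<and> y \<in> idx \<and> fst x = hdc c \<and> fst y = tlc c"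
  proof cases
    case 1
    then have "X x z \<noteq> 0" "u c z y \<noteq> 0" by auto
    from Xb[OF this(1)] uc[OF this(2)] show ?thesis by simp
  next
    case 2
    then have "u c x z \<noteq> 0" "X z y \<noteq> 0" by auto
    from uc[OF this(1)] Xb[OF this(2)] show ?thesis by simp
  qed
qed

subsection \<open>Traces and cyclic derivatives\<close>

lemma AA_rotations: "p \<in> paths Q \<Longrightarrow> c \<in> AR \<Longrightarrow> rotations Q c p z \<in> AA"
proof -
  assume p: "p \<in> paths Q" and c: "c \<in> AR"
  obtain i cs where [simp]: "p = (i, cs)" by (cases p)
  have "(tlc (cs ! k), drop (Suc k) cs @ take k cs) \<in> paths Q" if k: "k < length cs" and cl: "path_source Q (i, cs) = i" for k
  proof -
    have e: "cs = take k cs @ cs ! k # drop (Suc k) cs" using k by (simp add: id_take_nth_drop)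
    have *: "(i, take k cs) \<in> paths Q" "(path_source Q (i, take k cs), cs ! k # drop (Suc k) cs) \<in> paths Q"
      using path_split[of i "take k cs" "cs ! k # drop (Suc k) cs"] p e by auto
    have s: "path_source Q (i, cs) = path_source Q (tlc (cs ! k), drop (Suc k) cs)"
      using path_append[OF *] e by (simp add: path_source_Cons del: double_simps)
    have "(tlc (cs ! k), drop (Suc k) cs) \<in> paths Q"
      using *(2) by (simp add: paths_Cons del: double_simps)
    from path_append[OF this, of "take k cs"] show ?thesis using * s cl by simp
  qed
  then show "rotations Q c p z \<in> AA"
    by (auto simp: rotations_def AA_0 simp del: double_simps intro!: AA_sum AA_single)
qed

lemma AA_cyclic_deriv: "c \<in> AR \<Longrightarrow> f \<in> AA \<Longrightarrow> cyclic_deriv Q c f \<in> AA"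
  unfolding cyclic_deriv_superset[OF finite_keys subset_refl]
  by (rule AA_sum, rule AA_rotations) (auto simp: path_algebra_def)

text \<open>If the paths compose both ways, the two products are rotations of each other and
  positions correspond by a shift. If they compose in one way only, the product is an open path, on
  which the cyclic derivative is zero.\<close>

lemma cyclic_deriv_commute_single:
  assumes "p \<in> paths Q" "q \<in> paths Q"
  shows "cyclic_deriv Q c (Poly_Mapping.single p z \<star> Poly_Mapping.single q w) = cyclic_deriv Q c (Poly_Mapping.single q w \<star> Poly_Mapping.single p z)"
proof -
  obtain i P where p: "p = (i, P)" by (cases p)
  obtain j T where q: "q = (j, T)" by (cases q)
  show ?thesis
  proof (cases "path_source Q p = j \<and> path_source Q q = i")
    case True
    then have s: "path_source Q (i, P @ T) = i" "path_source Q (j, T @ P) = j"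
      using path_append[of i P T] path_append[of j T P] assms by (auto simp: p q)
    let ?F = "\<lambda>X k. if X ! k = c then Poly_Mapping.single (tlc c, drop (Suc k) X @ take k X) (z * w) else 0"
    have 1: "?F (P @ T) k = ?F (T @ P) (length T + k)" if "k < length P" for k
      using that by (auto simp: nth_append Suc_diff_le)
    have 2: "?F (P @ T) (length P + k) = ?F (T @ P) k" if "k < length T" for k
      using that by (auto simp: nth_append Suc_diff_le)
    have "(\<Sum>k<length P + length T. ?F (P @ T) k) = (\<Sum>k<length T + length P. ?F (T @ P) k)"
      unfolding sum_nat_split using 1 2 by (simp add: add.commute)
    then have "rotations Q c (i, P @ T) (z * w) = rotations Q c (j, T @ P) (z * w)"
      unfolding rotations_def fst_conv snd_conv length_append using s by (simp del: double_simps)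
    then show ?thesis using True
      by (simp add: path_mult_single p q cyclic_deriv_single mult.commute)
  next
    case False
    then consider "path_source Q p \<noteq> j" "path_source Q q \<noteq> i"
      | "path_source Q p = j" "path_source Q q \<noteq> i" | "path_source Q p \<noteq> j" "path_source Q q = i" by blast
    then show ?thesis
    proof cases
      case 2
      then have "path_source Q (i, P @ T) \<noteq> i" using path_append[of i P T] assms by (auto simp: p q)
      then show ?thesis using 2 by (simp add: path_mult_single p q cyclic_deriv_single rotations_def)
    next
      case 3
      then have "path_source Q (j, T @ P) \<noteq> j" using path_append[of j T P] assms by (auto simp: p q)
      then show ?thesis using 3 by (simp add: path_mult_single p q cyclic_deriv_single rotations_def)
    qed (simp add: path_mult_single p q)
  qed
qed

lemma cyclic_deriv_commute: "f \<in> AA \<Longrightarrow> g \<in> AA \<Longrightarrow> cyclic_deriv Q c (f \<star> g) = cyclic_deriv Q c (g \<star> f)"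
proof (induction f rule: AA_induct)
  case (single p z)
  show ?case using single(2)
    by (induction g rule: AA_induct)
       (simp_all add: cyclic_deriv_commute_single single path_mult_add_left path_mult_add_right cyclic_deriv_add)
qed (simp_all add: path_mult_add_left path_mult_add_right cyclic_deriv_add)

lemma cyclic_deriv_commutator_span: "f \<in> commutator_span Q \<Longrightarrow> cyclic_deriv Q c f = 0"
  unfolding commutator_span_def
  by (induction f rule: path_vs.span_induct_alt)
     (auto simp: cyclic_deriv_add cyclic_deriv_diff cyclic_deriv_scale cyclic_deriv_commute)

lemma tr_commutator_span:
  assumes u: "blk u" and f: "f \<in> commutator_span Q" shows "tr (R u f) = 0"
  using f unfolding commutator_span_def
  by (induction f rule: path_vs.span_induct_alt)
     (auto simp: R_add R_diff R_scale tr_add tr_diff tr_scale tr_0 tr_R_commute u)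

lemma dw_expand:
  assumes u: "blk u" "blk v"
  shows "(i, cs) \<in> paths Q \<Longrightarrow> dw u v i cs = (\<Sum>k<length cs. evw u i (take k cs) \<diamond> v (cs ! k) \<diamond> evw u (tlc (cs ! k)) (drop (Suc k) cs))"
proof (induction cs arbitrary: i)
  case (Cons c cs)
  then have c: "c \<in> AR" "hdc c = i" "(tlc c, cs) \<in> paths Q" by (auto simp: paths_Cons simp del: double_simps)
  have "proj i \<diamond> (v c \<diamond> X) = v c \<diamond> X" for X
    using blk_proj_left[OF u(2) c(1)] c(2) by (simp add: mm_assoc[symmetric])
  then show ?case using Cons.IH[OF c(3)]
    by (simp add: sum.lessThan_Suc_shift mm_assoc mm_sum_right del: double_simps sum.lessThan_Suc)
qed simp

text \<open>Cyclicity of the trace moves the varied factor to the front, which rotates the rest of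
  the word. For an open path the trace meets only an off-diagonal block.\<close>

lemma tr_dw:
  assumes u: "blk u" "blk v" and p: "(i, cs) \<in> paths Q"
  shows "tr (dw u v i cs) = (\<Sum>c\<in>AR. tr (v c \<diamond> R u (rotations Q c (i, cs) 1)))"
proof (cases "path_source Q (i, cs) = i")
  case False
  have "tr (dw u v i cs) = tr (proj i \<diamond> dw u v i cs)" using dw_proj_left[OF u p, of i] by simp
  also have "\<dots> = tr (dw u v i cs \<diamond> proj i)" by (rule tr_comm)
  also have "\<dots> = 0" using dw_proj_right[OF u p, of i] False by (simp add: tr_0)
  finally show ?thesis using False by (simp add: rotations_def mm_zero_right tr_0)
next
  case True
  have cAR: "cs ! k \<in> AR" if k: "k < length cs" for k
    using p k by (induction cs arbitrary: i k) (auto simp: paths_Cons nth_Cons simp del: double_simps split: nat.splits)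
  have e: "tr (evw u i (take k cs) \<diamond> v (cs ! k) \<diamond> evw u (tlc (cs ! k)) (drop (Suc k) cs))
     = tr (v (cs ! k) \<diamond> evw u (tlc (cs ! k)) (drop (Suc k) cs @ take k cs))" if k: "k < length cs" for k
  proof -
    have e: "cs = take k cs @ cs ! k # drop (Suc k) cs" using k by (simp add: id_take_nth_drop)
    have *: "(i, take k cs) \<in> paths Q" "(path_source Q (i, take k cs), cs ! k # drop (Suc k) cs) \<in> paths Q"
      using path_split[of i "take k cs" "cs ! k # drop (Suc k) cs"] p e by auto
    have s: "path_source Q (tlc (cs ! k), drop (Suc k) cs) = i"
      using path_append[OF *] e True by (simp add: path_source_Cons del: double_simps)
    have "(tlc (cs ! k), drop (Suc k) cs) \<in> paths Q"
      using *(2) by (simp add: paths_Cons del: double_simps)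
    from evw_append[OF u(1) this, of "take k cs"] * s
    have "evw u (tlc (cs ! k)) (drop (Suc k) cs @ take k cs) = evw u (tlc (cs ! k)) (drop (Suc k) cs) \<diamond> evw u i (take k cs)"
      by simp
    then show ?thesis
      using tr_comm[of "evw u i (take k cs)" "v (cs ! k) \<diamond> evw u (tlc (cs ! k)) (drop (Suc k) cs)"]
      by (simp add: mm_assoc del: double_simps)
  qed
  have "(\<Sum>c\<in>AR. tr (v c \<diamond> R u (rotations Q c (i, cs) 1)))
    = (\<Sum>c\<in>AR. \<Sum>k<length cs. if cs ! k = c then tr (v c \<diamond> evw u (tlc c) (drop (Suc k) cs @ take k cs)) else 0)"
    using True by (auto simp: rotations_def R_sum mm_sum_right tr_sum if_distrib[of "R u"] if_distrib[of "\<lambda>x. _ \<diamond> x"]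
        if_distrib[of tr] R_single mm_zero_right tr_0 simp del: double_simps intro!: sum.cong)
  also have "\<dots> = (\<Sum>k<length cs. \<Sum>c\<in>AR. if cs ! k = c then tr (v c \<diamond> evw u (tlc c) (drop (Suc k) cs @ take k cs)) else 0)"
    by (rule sum.swap)
  also have "\<dots> = (\<Sum>k<length cs. tr (v (cs ! k) \<diamond> evw u (tlc (cs ! k)) (drop (Suc k) cs @ take k cs)))"
    using cAR finite_AR by (intro sum.cong) (auto simp del: double_simps)
  also have "\<dots> = tr (dw u v i cs)"
    unfolding dw_expand[OF u p] tr_sum using e by simp
  finally show ?thesis by simp
qed

text \<open>In other words, the cyclic derivatives of f form the gradient of its trace function
  under the trace pairing.\<close>

lemma tr_dR:
  assumes u: "blk u" "blk v" and f: "f \<in> AA"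
  shows "tr (dR u v f) = (\<Sum>c\<in>AR. tr (v c \<diamond> R u (cyclic_deriv Q c f)))"
  using f
proof (induction f rule: AA_induct)
  case (single p z)
  have r: "rotations Q c p z = path_scale z (rotations Q c p 1)" for c by (simp add: path_scale_rotations)
  show ?case
    using tr_dw[of u v "fst p" "snd p"] single u
    by (simp add: dR_single tr_scale cyclic_deriv_single r[of _] R_scale mm_scale_right sum_distrib_left del: double_simps)
qed (simp_all add: tr_0 mm_zero_right dR_add R_add cyclic_deriv_add tr_add mm_add_right sum.distrib)

section \<open>The moment map and Hamiltonian directions\<close>

definition mom :: "('e + 'e \<Rightarrow> 'v mtx) \<Rightarrow> 'v mtx" where
  "mom u = (\<Sum>a\<in>arcs Q. u (Inl a) \<diamond> u (Inr a) - u (Inr a) \<diamond> u (Inl a))"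

definition dmom :: "('e + 'e \<Rightarrow> 'v mtx) \<Rightarrow> ('e + 'e \<Rightarrow> 'v mtx) \<Rightarrow> 'v mtx" where
  "dmom u v = (\<Sum>a\<in>arcs Q. v (Inl a) \<diamond> u (Inr a) + u (Inl a) \<diamond> v (Inr a)
     - (v (Inr a) \<diamond> u (Inl a) + u (Inr a) \<diamond> v (Inl a)))"

text \<open>The element of the path algebra that defines the preprojective algebra. Its value under
  \<open>R\<close> is \<open>mom\<close> and its derivative is \<open>dmom\<close>, so both inherit
  the general facts about \<open>R\<close> and \<open>dR\<close>.\<close>

definition momA :: "('v, 'e) path_comb" where
  "momA = (\<Sum>a\<in>arcs Q. arr (Inl a) \<star> arr (Inr a) - arr (Inr a) \<star> arr (Inl a))"

lemma AR_I: "a \<in> arcs Q \<Longrightarrow> Inl a \<in> AR" "a \<in> arcs Q \<Longrightarrow> Inr a \<in> AR"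
  by (auto simp: double_arcs)

lemma sum_AR: "(\<Sum>c\<in>AR. F c) = (\<Sum>a\<in>arcs Q. F (Inl a) + F (Inr a))" for F :: "'e + 'e \<Rightarrow> 'z::comm_monoid_add"
proof -
  have "(\<Sum>c\<in>AR. F c) = (\<Sum>c\<in>Inl ` arcs Q. F c) + (\<Sum>c\<in>Inr ` arcs Q. F c)"
    unfolding double_arcs by (rule sum.union_disjoint) auto
  then show ?thesis by (simp add: sum.reindex sum.distrib)
qed

lemma AA_mom: "momA \<in> AA"
  unfolding momA_def by (intro AA_sum AA_diff AA_mult AA_arr AR_I)

lemma R_momA: "blk u \<Longrightarrow> R u momA = mom u"
  unfolding momA_def mom_def R_sum
  by (intro sum.cong refl) (simp add: R_diff R_mult AA_arr AR_I R_arr)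

lemma dR_momA: "blk u \<Longrightarrow> blk v \<Longrightarrow> dR u v momA = dmom u v"
  unfolding momA_def dmom_def dR_sum
  by (intro sum.cong refl) (simp add: dR_diff dR_mult AA_arr AR_I R_arr dR_arr add.commute)

lemma blkd_of_AA_mom: 
  assumes u: "blk u" and v: "blk v"
  shows "blkd (mom u)" "blkd (dmom u v)"
proof -
  have vA: "vx i \<star> momA = momA \<star> vx i" for i
    unfolding momA_def path_mult_sum_left path_mult_sum_right
    by (intro sum.cong refl)
       (auto simp: path_mult_diff_left path_mult_diff_right arr_def path_mult_single vx_single single_vx path_source_def)
  have fm: "mom u \<in> fm" "dmom u v \<in> fm"
    using R_fm[OF u AA_mom] dR_fm[OF u v AA_mom] by (simp_all add: R_momA dR_momA u v)
  show "blkd (mom u)"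
    unfolding blkd_iff
  proof (intro conjI ballI fm)
    fix i assume i: "i \<in> verts Q"
    from arg_cong[OF vA[of i], of "R u"] show "mom u \<diamond> proj i = proj i \<diamond> mom u"
      by (simp add: R_mult u AA_vx i AA_mom R_vx R_momA)
  qed
  show "blkd (dmom u v)"
    unfolding blkd_iff
  proof (intro conjI ballI fm)
    fix i assume i: "i \<in> verts Q"
    from arg_cong[OF vA[of i], of "dR u v"] show "dmom u v \<diamond> proj i = proj i \<diamond> dmom u v"
      by (simp add: dR_mult u v AA_vx i AA_mom R_vx dR_momA dR_vx mm_zero_left mm_zero_right)
  qed
qed

lemma blkd_mom: "blk u \<Longrightarrow> blkd (mom u)"
  and blkd_dmom: "blk u \<Longrightarrow> blk v \<Longrightarrow> blkd (dmom u v)"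
  using blkd_of_AA_mom by blast+

text \<open>The defining property of a moment map: the right side is the symplectic pairing of the
  infinitesimal action of Z with the direction v.\<close>

lemma tr_mm_dmom:
  "tr (Z \<diamond> dmom u v) = (\<Sum>a\<in>arcs Q. tr (v (Inr a) \<diamond> gdir Z u (Inl a)) - tr (v (Inl a) \<diamond> gdir Z u (Inr a)))"
proof -
  have e: "tr (Z \<diamond> (v1 \<diamond> u2 + u1 \<diamond> v2 - (v2 \<diamond> u1 + u2 \<diamond> v1)))
      = tr (v2 \<diamond> (Z \<diamond> u1 - u1 \<diamond> Z)) - tr (v1 \<diamond> (Z \<diamond> u2 - u2 \<diamond> Z))" for v1 v2 u1 u2
  proof -
    have "tr (Z \<diamond> (v1 \<diamond> u2)) = tr (v1 \<diamond> (u2 \<diamond> Z))" "tr (Z \<diamond> (u1 \<diamond> v2)) = tr (v2 \<diamond> (Z \<diamond> u1))"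
      "tr (Z \<diamond> (v2 \<diamond> u1)) = tr (v2 \<diamond> (u1 \<diamond> Z))" "tr (Z \<diamond> (u2 \<diamond> v1)) = tr (v1 \<diamond> (Z \<diamond> u2))"
      using tr_comm[of Z "v1 \<diamond> u2"] tr_comm[of "Z \<diamond> u1" v2] tr_comm[of Z "v2 \<diamond> u1"] tr_comm[of "Z \<diamond> u2" v1]
      by (simp_all add: mm_assoc)
    then show ?thesis by (simp add: mm_add_right mm_diff_right tr_add tr_diff)
  qed
  show ?thesis unfolding dmom_def mm_sum_right tr_sum gdir_def e ..
qed

lemma blkd_nondegenerate:
  assumes A: "blkd A" and z: "\<And>Z. blkd Z \<Longrightarrow> tr (Z \<diamond> A) = 0"
  shows "A = 0"
proof (rule fm_eqI)
  fix x y assume xy: "x \<in> idx" "y \<in> idx"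
  show "A x y = 0 x y"
  proof (cases "fst x = fst y")
    case True
    have "blkd (munit y x)" using xy True by (auto simp: blkd_def munit_def)
    then have "tr (A \<diamond> munit y x) = 0" using z tr_comm by metis
    then show ?thesis using tr_mm_munit[OF xy(2,1)] by (simp add: pw)
  next
    case False
    then show ?thesis using blkdD[OF A, of x y] by (auto simp: pw)
  qed
qed (simp_all add: blkd_fm A fm_0)

text \<open>The Hamiltonian vector field of the trace function of \<open>g\<close>, at \<open>u\<close>.\<close>

definition ham :: "('e + 'e \<Rightarrow> 'v mtx) \<Rightarrow> ('v, 'e) path_comb \<Rightarrow> 'e + 'e \<Rightarrow> 'v mtx" where
  "ham u g = (\<lambda>c. case c of Inl a \<Rightarrow> R u (cyclic_deriv Q (Inr a) g) | Inr a \<Rightarrow> - R u (cyclic_deriv Q (Inl a) g))"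

text \<open>Cutting a closed path at c leaves a path from the head of c to its tail. Hence the
  gradient at c has the block shape of the reverse arrow, which is why \<open>ham\<close> is a block
  direction.\<close>

lemma rotations_vx:
  "p \<in> paths Q \<Longrightarrow> c \<in> AR \<Longrightarrow> vx (tlc c) \<star> rotations Q c p z = rotations Q c p z \<and> rotations Q c p z \<star> vx (hdc c) = rotations Q c p z"
proof -
  assume p: "p \<in> paths Q" and c: "c \<in> AR"
  obtain i cs where [simp]: "p = (i, cs)" by (cases p)
  have l: "vx (tlc c) \<star> rotations Q c p z = rotations Q c p z"
    by (auto simp: rotations_def path_mult_sum_right if_distrib[of "\<lambda>x. _ \<star> x"] vx_single simp del: double_simps intro!: sum.cong)
  have "path_source Q (tlc (cs ! k), drop (Suc k) cs @ take k cs) = hdc (cs ! k)" if k: "k < length cs" and cl: "path_source Q (i, cs) = i" for k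
  proof -
    have e: "cs = take k cs @ cs ! k # drop (Suc k) cs" using k by (simp add: id_take_nth_drop)
    have *: "(i, take k cs) \<in> paths Q" "(path_source Q (i, take k cs), cs ! k # drop (Suc k) cs) \<in> paths Q"
      using path_split[of i "take k cs" "cs ! k # drop (Suc k) cs"] p e by auto
    have s: "path_source Q (i, cs) = path_source Q (tlc (cs ! k), drop (Suc k) cs)"
      using path_append[OF *] e by (simp add: path_source_Cons del: double_simps)
    have "(tlc (cs ! k), drop (Suc k) cs) \<in> paths Q"
      using *(2) by (simp add: paths_Cons del: double_simps)
    from path_append[OF this, of "take k cs"] have "path_source Q (tlc (cs ! k), drop (Suc k) cs @ take k cs) = path_source Q (i, take k cs)"
      using * s cl by simp
    also have "\<dots> = hdc (cs ! k)" using *(2) by (simp add: paths_Cons del: double_simps)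
    finally show ?thesis .
  qed
  then have "rotations Q c p z \<star> vx (hdc c) = rotations Q c p z"
    by (auto simp: rotations_def path_mult_sum_left if_distrib[of "\<lambda>x. x \<star> _"] single_vx simp del: double_simps intro!: sum.cong)
  with l show ?thesis by simp
qed

lemma cyclic_deriv_vx:
  assumes "c \<in> AR" "g \<in> AA"
  shows "vx (tlc c) \<star> cyclic_deriv Q c g = cyclic_deriv Q c g" "cyclic_deriv Q c g \<star> vx (hdc c) = cyclic_deriv Q c g"
  unfolding cyclic_deriv_superset[OF finite_keys subset_refl] path_mult_sum_left path_mult_sum_right
  using assms rotations_vx by (auto simp: path_algebra_def simp del: double_simps intro!: sum.cong)

lemma R_cyclic_deriv_supp:
  assumes u: "blk u" and c: "c \<in> AR" and g: "g \<in> AA" and n: "R u (cyclic_deriv Q c g) x y \<noteq> 0"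
  shows "x \<in> idx \<and> y \<in> idx \<and> fst x = tlc c \<and> fst y = hdc c"
proof -
  let ?D = "cyclic_deriv Q c g"
  note D = AA_cyclic_deriv[OF c g]
  have "proj (tlc c) \<diamond> R u ?D = R u ?D"
    using R_mult[OF u AA_vx[OF AR_verts(2)[OF c]] D] cyclic_deriv_vx[OF c g] by (simp add: R_vx del: double_simps)
  then have 1: "(proj (tlc c) \<diamond> R u ?D) x y \<noteq> 0" using n by simp
  have "R u ?D \<diamond> proj (hdc c) = R u ?D"
    using R_mult[OF u D AA_vx[OF AR_verts(1)[OF c]]] cyclic_deriv_vx[OF c g] by (simp add: R_vx del: double_simps)
  then have 2: "(R u ?D \<diamond> proj (hdc c)) x y \<noteq> 0" using n by simp
  show ?thesis using 1 2 by (auto simp: proj_mm mm_proj split: if_splits)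
qed

lemma blk_ham:
  assumes u: "blk u" and g: "g \<in> AA" shows "blk (ham u g)"
  unfolding blk_def
proof (intro ballI allI impI)
  fix c x y assume c: "c \<in> AR" and n: "ham u g c x y \<noteq> 0"
  show "x \<in> idx \<and> y \<in> idx \<and> fst x = hdc c \<and> fst y = tlc c"
  proof (cases c)
    case (Inl a)
    then show ?thesis using R_cyclic_deriv_supp[OF u _ g, of "Inr a" x y] n c by (auto simp: ham_def double_arcs)
  next
    case (Inr a)
    then show ?thesis using R_cyclic_deriv_supp[OF u _ g, of "Inl a" x y] n c by (auto simp: ham_def double_arcs)
  qed
qed

lemma mm_uminus_left: "(- A) \<diamond> B = - (A \<diamond> B)" and mm_uminus_right: "A \<diamond> (- B) = - (A \<diamond> B)" and tr_uminus: "tr (- A) = - tr A"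
  by (auto simp: mm_def tr_def fun_eq_iff sum_negf)

lemma tr_gdir: 
  assumes "blk u" "blkd X" "f \<in> AA" shows "tr (dR u (gdir X u) f) = 0"
  using dR_gdir[OF assms(1) blkd_fm[OF assms(2)] _ assms(3)] blkd_comm[OF assms(2)]
  by (simp add: tr_diff tr_comm[of X])

text \<open>Noether's principle: paired with Z, the left side becomes minus the derivative of the
  trace of g along infinitesimal conjugation by Z, and traces are invariant under
  conjugation.\<close>

lemma dmom_ham:
  assumes u: "blk u" and g: "g \<in> AA" shows "dmom u (ham u g) = 0"
proof (rule blkd_nondegenerate)
  show "blkd (dmom u (ham u g))" by (rule blkd_dmom[OF u blk_ham[OF u g]])
  fix Z assume Z: "blkd Z"
  have "tr (Z \<diamond> dmom u (ham u g)) = - (\<Sum>c\<in>AR. tr (gdir Z u c \<diamond> R u (cyclic_deriv Q c g)))"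
    unfolding tr_mm_dmom sum_AR sum_negf[symmetric]
    by (intro sum.cong refl) (simp add: ham_def mm_uminus_left tr_uminus tr_comm[of "gdir Z u _"])
  also have "\<dots> = - tr (dR u (gdir Z u) g)"
    by (simp add: tr_dR[OF u blk_gdir[OF u Z] g])
  finally show "tr (Z \<diamond> dmom u (ham u g)) = 0" by (simp add: tr_gdir[OF u Z g])
qed

lemma AA_bracket: "f \<in> AA \<Longrightarrow> g \<in> AA \<Longrightarrow> path_bracket Q f g \<in> AA"
  unfolding path_bracket_def by (intro AA_sum AA_diff AA_mult AA_cyclic_deriv AR_I)

text \<open>The path bracket multiplies cyclic derivatives, which are gradients; with the signs of
  \<open>ham\<close> its trace is the derivative of the trace of f along the Hamiltonian field of
  g.\<close>

lemma tr_bracket: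
  assumes u: "blk u" and f: "f \<in> AA" and g: "g \<in> AA"
  shows "tr (R u (path_bracket Q f g)) = tr (dR u (ham u g) f)"
proof -
  have "tr (R u (path_bracket Q f g)) = (\<Sum>a\<in>arcs Q. tr (R u (cyclic_deriv Q (Inl a) f) \<diamond> R u (cyclic_deriv Q (Inr a) g))
     - tr (R u (cyclic_deriv Q (Inr a) f) \<diamond> R u (cyclic_deriv Q (Inl a) g)))"
    unfolding path_bracket_def R_sum tr_sum
    by (intro sum.cong refl) (simp add: R_diff tr_diff R_mult u AA_cyclic_deriv f g AR_I)
  also have "\<dots> = tr (dR u (ham u g) f)"
    unfolding tr_dR[OF u blk_ham[OF u g] f] sum_AR
    by (intro sum.cong refl) (simp add: ham_def mm_uminus_left tr_uminus tr_comm[of "R u (cyclic_deriv Q (Inl _) f)"]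
       tr_comm[of "R u (cyclic_deriv Q (Inr _) f)"])
  finally show ?thesis .
qed

section \<open>Representations with full image\<close>

text \<open>The conclusion of Burnside's theorem, taken as the working form of
  irreducibility.\<close>

definition full :: "('e + 'e \<Rightarrow> 'v mtx) \<Rightarrow> bool" where
  "full u \<longleftrightarrow> blk u \<and> (\<forall>M\<in>fm. \<exists>f\<in>AA. R u f = M)"

lemma full_blk: "full u \<Longrightarrow> blk u" by (simp add: full_def)

lemma idx_fst: "x \<in> idx \<Longrightarrow> fst x \<in> verts Q"
  by (auto simp: idx_def)

lemma full_nondegenerate:
  assumes u: "full u" and A: "A \<in> fm" and z: "\<And>g. g \<in> AA \<Longrightarrow> tr (A \<diamond> R u g) = 0"
  shows "A = 0"
  by (rule tr_nondegenerate[OF A]) (use u z in \<open>auto simp: full_def\<close>)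

lemma full_nondegenerate2:
  assumes u: "full u" and A: "A \<in> fm" "B \<in> fm" and z: "\<And>g. g \<in> AA \<Longrightarrow> tr (A \<diamond> R u g) = tr (B \<diamond> R u g)"
  shows "A = B"
  by (rule tr_nondegenerate2[OF A]) (use u z in \<open>auto simp: full_def\<close>)

text \<open>The lifts of the matrix units are cut down by vertex idempotents inside the path
  algebra, so they stay in their block at every representation and not only at u.\<close>

lemma full_lifts:
  assumes u: "full u"
  obtains F where "\<And>x y. x \<in> idx \<Longrightarrow> y \<in> idx \<Longrightarrow> F x y \<in> AA"
    "\<And>x y. x \<in> idx \<Longrightarrow> y \<in> idx \<Longrightarrow> R u (F x y) = munit x y"
    "\<And>x y. x \<in> idx \<Longrightarrow> y \<in> idx \<Longrightarrow> vx (fst x) \<star> F x y = F x y"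
    "\<And>x y. x \<in> idx \<Longrightarrow> y \<in> idx \<Longrightarrow> F x y \<star> vx (fst y) = F x y"
proof -
  note b = full_blk[OF u]
  have "\<forall>x y. \<exists>f. x \<in> idx \<longrightarrow> y \<in> idx \<longrightarrow> f \<in> AA \<and> R u f = munit x y"
    using u fm_munit unfolding full_def by blast
  then obtain G where G: "\<And>x y. x \<in> idx \<Longrightarrow> y \<in> idx \<Longrightarrow> G x y \<in> AA \<and> R u (G x y) = munit x y" by metis
  have vx: "vx (fst x) \<in> AA" "fst x \<in> verts Q" if "x \<in> idx" for x using that by (auto simp: idx_def AA_vx)
  show ?thesis
  proof (rule that[of "\<lambda>x y. vx (fst x) \<star> (G x y \<star> vx (fst y))"])
    fix x y assume xy: "x \<in> idx" "y \<in> idx"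
    note A = vx(1)[OF xy(1)] vx(1)[OF xy(2)] conjunct1[OF G[OF xy]]
    show "vx (fst x) \<star> (G x y \<star> vx (fst y)) \<in> AA" using A by (intro AA_mult)
    have "R u (vx (fst x) \<star> (G x y \<star> vx (fst y))) = proj (fst x) \<diamond> (munit x y \<diamond> proj (fst y))"
      using G[OF xy] A by (simp add: R_mult[OF b] AA_mult R_vx)
    also have "\<dots> = munit x y"
      by (intro ext, simp add: proj_mm mm_proj) (use xy in \<open>auto simp: munit_def\<close>)
    finally show "R u (vx (fst x) \<star> (G x y \<star> vx (fst y))) = munit x y" .
    show "vx (fst x) \<star> (vx (fst x) \<star> (G x y \<star> vx (fst y))) = vx (fst x) \<star> (G x y \<star> vx (fst y))"
      using A by (simp add: pmult_assoc[symmetric] AA_mult vx_vx)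
    show "vx (fst x) \<star> (G x y \<star> vx (fst y)) \<star> vx (fst y) = vx (fst x) \<star> (G x y \<star> vx (fst y))"
      using A by (simp add: pmult_assoc AA_mult vx_vx)
  qed
qed

lemma center_fm:
  assumes Z: "Z \<in> fm" and c: "\<And>A. A \<in> fm \<Longrightarrow> Z \<diamond> A = A \<diamond> Z"
  shows "\<exists>k. Z = mscale k om"
proof (cases "idx = {}")
  case True
  have "Z = mscale 0 om" by (rule fm_eqI[OF Z fm_scale[OF fm_om]]) (simp add: True)
  then show ?thesis by blast
next
  case False
  then obtain b where b: "b \<in> idx" by blast
  have e: "(if v = y then Z w x else 0) = (if w = x then Z y v else 0)" if "x \<in> idx" "y \<in> idx" for x y w v
    using fun_cong[OF fun_cong[OF c[OF fm_munit[OF that]]], of w v] that by (simp add: mm_munit munit_mm)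
  have "Z = mscale (Z b b) om"
  proof (rule fm_eqI)
    fix x y assume xy: "x \<in> idx" "y \<in> idx"
    show "Z x y = mscale (Z b b) om x y"
    proof (cases "x = y")
      case True
      then show ?thesis using e[where x=b and y=x and w=b and v=x] b xy by (simp add: pw om_def)
    next
      case False
      then show ?thesis using e[where x=y and y=y and w=x and v=y] xy by (simp add: pw om_def)
    qed
  qed (auto simp: Z fm_scale fm_om)
  then show ?thesis by blast
qed

text \<open>An infinitesimal Skolem--Noether theorem.\<close>

lemma trivial_direction:
  assumes u: "full u" and z: "blk z" and t: "\<And>g. g \<in> AA \<Longrightarrow> tr (dR u z g) = 0"
  shows "\<exists>X. blkd X \<and> (\<forall>c\<in>AR. z c = gdir X u c)"
proof (cases "idx = {}")
  case True
  have "\<forall>c\<in>AR. z c = gdir 0 u c"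
  proof
    fix c assume "c \<in> AR"
    then have "z c = 0" by (intro fm_eqI[OF blk_fm[OF z] fm_0]) (simp_all add: True del: double_simps)
    then show "z c = gdir 0 u c" by (simp add: gdir_def mm_zero_left mm_zero_right)
  qed
  moreover have "blkd 0" by (auto simp: blkd_def pw)
  ultimately show ?thesis by blast
next
  case False
  then obtain b where b: "b \<in> idx" by blast
  note bu = full_blk[OF u]
  obtain F where F: "\<And>x y. x \<in> idx \<Longrightarrow> y \<in> idx \<Longrightarrow> F x y \<in> AA" "\<And>x y. x \<in> idx \<Longrightarrow> y \<in> idx \<Longrightarrow> R u (F x y) = munit x y"
     "\<And>x y. x \<in> idx \<Longrightarrow> y \<in> idx \<Longrightarrow> vx (fst x) \<star> F x y = F x y"
     "\<And>x y. x \<in> idx \<Longrightarrow> y \<in> idx \<Longrightarrow> F x y \<star> vx (fst y) = F x y"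
    by (rule full_lifts[OF u]) blast
  \<comment> \<open>The derivation kills the kernel of \<open>R u\<close>, since tr(dR(f) R(g)) =
    tr(dR(f g)) for f in the kernel; so it descends to the matrix algebra.\<close>
  have J: "dR u z f = 0" if f: "f \<in> AA" "R u f = 0" for f
  proof (rule full_nondegenerate[OF u dR_fm[OF bu z f(1)]])
    fix g assume g: "g \<in> AA"
    show "tr (dR u z f \<diamond> R u g) = 0"
      using t[OF AA_mult[OF f(1) g]] dR_mult[OF bu z f(1) g] f(2) by (simp add: mm_zero_left)
  qed
  \<comment> \<open>The classical element implementing a derivation D of a matrix algebra: the sum
    over x of D of the unit at (x, b) times the unit at (b, x).\<close>
  define X where "X = (\<Sum>x\<in>idx. dR u z (F x b) \<diamond> munit b x)"
  have X: "dR u z f = X \<diamond> R u f - R u f \<diamond> X" if f: "f \<in> AA" for f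
  proof -
    have 1: "dR u z (f \<star> F x b) = (\<Sum>y\<in>idx. mscale (R u f y x) (dR u z (F y b)))" if x: "x \<in> idx" for x
    proof -
      let ?k = "f \<star> F x b - (\<Sum>y\<in>idx. path_scale (R u f y x) (F y b))"
      have "R u f \<diamond> munit x b = (\<Sum>y\<in>idx. mscale (R u f y x) (munit y b))"
      proof (intro ext)
        fix p q
        have "(\<Sum>y\<in>idx. mscale (R u f y x) (munit y b)) p q = (\<Sum>y\<in>idx. if y = p then (if q = b then R u f p x else 0) else 0)"
          unfolding sum_fun_apply2 by (intro sum.cong) (auto simp: pw munit_def)
        also have "\<dots> = (R u f \<diamond> munit x b) p q"
          using finI fm_zero[OF R_fm[OF bu f], of p x] by (auto simp: mm_munit[OF x])
        finally show "(R u f \<diamond> munit x b) p q = (\<Sum>y\<in>idx. mscale (R u f y x) (munit y b)) p q" by simp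
      qed
      then have "R u ?k = 0" using F b x f by (simp add: R_diff R_mult bu R_sum R_scale)
      then have "dR u z ?k = 0" by (intro J) (auto intro!: AA_diff AA_mult AA_sum AA_scale F b x f)
      then show ?thesis by (simp add: dR_diff dR_sum dR_scale)
    qed
    have 2: "(\<Sum>x\<in>idx. dR u z (f \<star> F x b) \<diamond> munit b x) = dR u z f + R u f \<diamond> X"
    proof -
      have "(\<Sum>x\<in>idx. dR u z (f \<star> F x b) \<diamond> munit b x)
         = (\<Sum>x\<in>idx. dR u z f \<diamond> munit x x + R u f \<diamond> (dR u z (F x b) \<diamond> munit b x))"
        by (intro sum.cong refl) (simp add: dR_mult[OF bu z f] F b mm_add_left mm_assoc munit_munit)
      also have "\<dots> = dR u z f \<diamond> om + R u f \<diamond> X"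
        by (simp add: sum.distrib om_expand mm_sum_right X_def)
      finally show ?thesis by (simp add: mm_om_right dR_fm[OF bu z f])
    qed
    have "(\<Sum>x\<in>idx. dR u z (f \<star> F x b) \<diamond> munit b x)
      = (\<Sum>x\<in>idx. \<Sum>y\<in>idx. dR u z (F y b) \<diamond> mscale (R u f y x) (munit b x))"
      by (intro sum.cong refl) (simp add: 1 mm_sum_left mm_scale_left mm_scale_right)
    also have "\<dots> = (\<Sum>y\<in>idx. \<Sum>x\<in>idx. dR u z (F y b) \<diamond> mscale (R u f y x) (munit b x))"
      by (rule sum.swap)
    also have "\<dots> = (\<Sum>y\<in>idx. dR u z (F y b) \<diamond> (munit b y \<diamond> R u f))"
    proof (intro sum.cong refl)
      fix y assume y: "y \<in> idx"
      have "(\<Sum>x\<in>idx. mscale (R u f y x) (munit b x)) = munit b y \<diamond> R u f"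
      proof (intro ext)
        fix p q
        have "(\<Sum>x\<in>idx. mscale (R u f y x) (munit b x)) p q = (\<Sum>x\<in>idx. if x = q then (if p = b then R u f y q else 0) else 0)"
          unfolding sum_fun_apply2 by (intro sum.cong) (auto simp: pw munit_def)
        also have "\<dots> = (munit b y \<diamond> R u f) p q"
          using finI fm_zero(2)[OF R_fm[OF bu f], of q y] by (auto simp: munit_mm[OF y])
        finally show "(\<Sum>x\<in>idx. mscale (R u f y x) (munit b x)) p q = (munit b y \<diamond> R u f) p q" .
      qed
      then show "(\<Sum>x\<in>idx. dR u z (F y b) \<diamond> mscale (R u f y x) (munit b x)) = dR u z (F y b) \<diamond> (munit b y \<diamond> R u f)"
        by (simp add: mm_sum_right[symmetric])
    qed
    also have "\<dots> = X \<diamond> R u f" by (simp add: X_def mm_sum_left mm_assoc)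
    finally show ?thesis using 2 by (simp add: algebra_simps)
  qed
  have "X \<in> fm" unfolding X_def by (intro fm_sum fm_mm dR_fm[OF bu z] F fm_munit b)
  moreover have "X \<diamond> proj i = proj i \<diamond> X" if "i \<in> verts Q" for i
    using X[OF AA_vx[OF that]] by (simp add: dR_vx R_vx)
  ultimately have "blkd X" by (simp add: blkd_iff)
  moreover have "z c = gdir X u c" if "c \<in> AR" for c
    using X[OF AA_arr[OF that]] by (simp add: dR_arr bu z that R_arr gdir_def)
  ultimately show ?thesis by blast
qed

text \<open>A Skolem--Noether theorem; \<open>G\<close> is not yet known to be invertible block by block.\<close>

lemma intertwiner:
  assumes u: "full u" and u': "full u'" and t: "\<And>g. g \<in> AA \<Longrightarrow> tr (R u g) = tr (R u' g)"
  shows "\<exists>G. blkd G \<and> (\<forall>c\<in>AR. G \<diamond> u c = u' c \<diamond> G)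
    \<and> (\<forall>z. (\<forall>x\<in>idx. (\<Sum>y\<in>idx. G x y * z y) = 0) \<longrightarrow> (\<forall>y\<in>idx. z y = 0))"
proof (cases "idx = {}")
  case True
  have "blkd 0" by (auto simp: blkd_def pw)
  moreover have "\<forall>c\<in>AR. 0 \<diamond> u c = u' c \<diamond> 0" by (simp add: mm_zero_left mm_zero_right)
  moreover have "\<forall>z. (\<forall>x\<in>idx. (\<Sum>y\<in>idx. 0 x y * z y) = (0::complex)) \<longrightarrow> (\<forall>y\<in>idx. z y = (0::complex))"
    by (simp add: True)
  ultimately show ?thesis by blast
next
  case False
  then obtain b where b: "b \<in> idx" by blast
  note bu = full_blk[OF u] and bu' = full_blk[OF u']
  obtain F where F: "\<And>x y. x \<in> idx \<Longrightarrow> y \<in> idx \<Longrightarrow> F x y \<in> AA" "\<And>x y. x \<in> idx \<Longrightarrow> y \<in> idx \<Longrightarrow> R u (F x y) = munit x y"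
     "\<And>x y. x \<in> idx \<Longrightarrow> y \<in> idx \<Longrightarrow> vx (fst x) \<star> F x y = F x y"
     "\<And>x y. x \<in> idx \<Longrightarrow> y \<in> idx \<Longrightarrow> F x y \<star> vx (fst y) = F x y"
    by (rule full_lifts[OF u]) blast
  \<comment> \<open>The kernel of a full representation is the radical of its trace form, so equal
    traces carry one kernel into the other.\<close>
  have J: "R u' f = 0" if f: "f \<in> AA" "R u f = 0" for f
  proof (rule full_nondegenerate[OF u' R_fm[OF bu' f(1)]])
    fix g assume g: "g \<in> AA"
    show "tr (R u' f \<diamond> R u' g) = 0"
      using t[OF AA_mult[OF f(1) g]] f(2) by (simp add: R_mult bu bu' f g mm_zero_left tr_0)
  qed
  have "tr (R u' (F b b)) = 1" using t[OF F(1)[OF b b]] by (simp add: F b tr_munit)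
  then have "R u' (F b b) \<noteq> 0" by (metis tr_0 zero_neq_one)
  then obtain i j where ij: "R u' (F b b) i j \<noteq> 0" by (auto simp: fun_eq_iff pw)
  \<comment> \<open>At u the lift F y b takes the basis vector at b to the one at y. G sends the
    latter to the image of the basis vector at j under F y b at u'; j is chosen so that G is not
    zero.\<close>
  define G where "G = (\<lambda>x y. if y \<in> idx then R u' (F y b) x j else 0)"
  have G: "blkd G"
    unfolding blkd_def
  proof (intro allI impI)
    fix x y assume n: "G x y \<noteq> 0"
    then have y: "y \<in> idx" by (auto simp: G_def split: if_splits)
    have "R u' (F y b) = proj (fst y) \<diamond> R u' (F y b)"
      using arg_cong[OF F(3)[OF y b], of "R u'"] y by (simp add: R_mult bu' AA_vx idx_fst F(1) b R_vx)
    then have "(proj (fst y) \<diamond> R u' (F y b)) x j \<noteq> 0" using n y by (simp add: G_def)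
    then show "x \<in> idx \<and> y \<in> idx \<and> fst x = fst y" using y by (auto simp: proj_mm split: if_splits)
  qed
  have I: "G \<diamond> R u f = R u' f \<diamond> G" if f: "f \<in> AA" for f
  proof (rule fm_eqI)
    show "G \<diamond> R u f \<in> fm" "R u' f \<diamond> G \<in> fm" using blkd_fm[OF G] R_fm[OF bu f] R_fm[OF bu' f] by (auto intro: fm_mm)
    fix x y assume xy: "x \<in> idx" "y \<in> idx"
    let ?k = "f \<star> F y b - (\<Sum>w\<in>idx. path_scale (R u f w y) (F w b))"
    have "R u f \<diamond> munit y b = (\<Sum>w\<in>idx. mscale (R u f w y) (munit w b))"
    proof (intro ext)
      fix p q
      have "(\<Sum>w\<in>idx. mscale (R u f w y) (munit w b)) p q = (\<Sum>w\<in>idx. if w = p then (if q = b then R u f p y else 0) else 0)"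
        unfolding sum_fun_apply2 by (intro sum.cong) (auto simp: pw munit_def)
      also have "\<dots> = (R u f \<diamond> munit y b) p q"
        using finI fm_zero[OF R_fm[OF bu f], of p y] by (auto simp: mm_munit[OF xy(2)])
      finally show "(R u f \<diamond> munit y b) p q = (\<Sum>w\<in>idx. mscale (R u f w y) (munit w b)) p q" by simp
    qed
    then have "R u ?k = 0" using F b xy f by (simp add: R_diff R_mult bu R_sum R_scale)
    then have "R u' ?k = 0" by (intro J) (auto intro!: AA_diff AA_mult AA_sum AA_scale F b xy f)
    then have e: "R u' f \<diamond> R u' (F y b) = (\<Sum>w\<in>idx. mscale (R u f w y) (R u' (F w b)))"
      using F b xy f by (simp add: R_diff R_mult bu' R_sum R_scale)
    have "(R u' f \<diamond> G) x y = (R u' f \<diamond> R u' (F y b)) x j" using xy by (simp add: mm_def G_def)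
    also have "\<dots> = (G \<diamond> R u f) x y" unfolding e sum_fun_apply2 by (auto simp: mm_def G_def pw intro!: sum.cong)
    finally show "(G \<diamond> R u f) x y = (R u' f \<diamond> G) x y" by simp
  qed
  \<comment> \<open>If a kernel vector had a nonzero coordinate at y0, the unit at (b, y0) would
    turn it into a nonzero multiple of the basis vector at b. Then column b of G would vanish, but
    its entry at i does not.\<close>
  have inj: "\<forall>y\<in>idx. z y = 0" if z: "\<forall>x\<in>idx. (\<Sum>y\<in>idx. G x y * z y) = 0" for z
  proof (rule ccontr)
    assume "\<not> ?thesis"
    then obtain y0 where y0: "y0 \<in> idx" "z y0 \<noteq> 0" by blast
    have "G i b = 0"
    proof -
      have "G \<diamond> munit b y0 = R u' (F b y0) \<diamond> G" using I[OF F(1)[OF b y0(1)]] F(2)[OF b y0(1)] by simp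
      then have "(\<Sum>y\<in>idx. (G \<diamond> munit b y0) i y * z y) = (\<Sum>y\<in>idx. (R u' (F b y0) \<diamond> G) i y * z y)" by simp
      also have "\<dots> = (\<Sum>y\<in>idx. \<Sum>w\<in>idx. R u' (F b y0) i w * (G w y * z y))"
        by (simp add: mm_def sum_distrib_right mult.assoc)
      also have "\<dots> = (\<Sum>w\<in>idx. R u' (F b y0) i w * (\<Sum>y\<in>idx. G w y * z y))"
        by (subst sum.swap) (simp add: sum_distrib_left)
      also have "\<dots> = 0" using z by simp
      finally have "(\<Sum>y\<in>idx. if y = y0 then G i b * z y0 else 0) = 0"
        by (simp add: mm_munit[OF b] if_distrib[of "\<lambda>x. x * _"] cong: if_cong)
      then show ?thesis using finI y0 by simp
    qed
    then show False using ij b by (simp add: G_def)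
  qed
  have "\<forall>c\<in>AR. G \<diamond> u c = u' c \<diamond> G"
    using I[OF AA_arr] by (simp add: R_arr bu bu')
  with G inj show ?thesis by blast
qed

lemma dR_cong_dir:
  assumes v: "\<And>c. c \<in> AR \<Longrightarrow> v c = v' c" and f: "f \<in> AA"
  shows "dR u v f = dR u v' f"
  using f
proof (induction f rule: AA_induct)
  case (single p z)
  have "dw u v i cs = dw u v' i cs" if "(i, cs) \<in> paths Q" for i cs
    using that by (induction cs arbitrary: i) (auto simp: paths_Cons v simp del: double_simps)
  from this[of "fst p" "snd p"] show ?case using single(1) by (simp add: dR_single)
qed (simp_all add: dR_add)

lemma dw_diff_dir: "dw u (\<lambda>c. v c - v' c) i cs = dw u v i cs - dw u v' i cs"
  by (induction cs arbitrary: i) (simp_all add: mm_diff_left mm_diff_right)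

lemma dR_diff_dir: "dR u (\<lambda>c. v c - v' c) f = dR u v f - dR u v' f"
proof (intro ext)
  fix x y
  show "dR u (\<lambda>c. v c - v' c) f x y = (dR u v f - dR u v' f) x y"
    by (simp add: dR_def pw dw_diff_dir lin_def sum_subtractf algebra_simps)
qed

lemma blk_diff: "blk u \<Longrightarrow> blk v \<Longrightarrow> blk (\<lambda>c. u c - v c)"
  unfolding blk_def by (simp add: pw del: double_simps) (metis diff_zero)

subsection \<open>The kernel of the differential of the moment map\<close>

text \<open>A double annihilator. A direction orthogonal to all gradients of traces leaves every
  trace stationary, hence is an infinitesimal conjugation by \<open>trivial_direction\<close>; the
  symplectic form pairs v to zero with these because \<open>dmom u v\<close> is zero. So v
  corresponds to a gradient.\<close>

lemma ker_dmom_ham: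
  assumes u: "full u" and v: "blk v" and m: "dmom u v = 0"
  shows "\<exists>g\<in>AA. \<forall>c\<in>AR. v c = ham u g c"
proof -
  note bu = full_blk[OF u]
  let ?K = "AR \<times> idx \<times> idx"
  \<comment> \<open>Indices are exchanged so that the coordinate pairing becomes the trace
    pairing.\<close>
  define vec where "vec m = (\<lambda>(c, x, y). if (c, x, y) \<in> ?K then m c y x else (0::complex))" for m :: "'e + 'e \<Rightarrow> 'v mtx"
  define W where "W = (\<lambda>g. vec (\<lambda>c. R u (cyclic_deriv Q c g))) ` AA"
  \<comment> \<open>The inverse of the exchange of arrows and signs in \<open>ham\<close>.\<close>
  define w where "w c = (case c of Inl a \<Rightarrow> - v (Inr a) | Inr a \<Rightarrow> v (Inl a))" for c
  have K: "finite ?K" using finite_AR finI by auto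
  have sub: "fun_vs.subspace W"
  proof (rule fun_vs.subspaceI)
    show "0 \<in> W" unfolding W_def
      by (rule image_eqI[of _ _ 0]) (auto simp: vec_def pw AA_0)
    fix x y assume "x \<in> W" "y \<in> W"
    then obtain f g where fg: "f \<in> AA" "g \<in> AA" "x = vec (\<lambda>c. R u (cyclic_deriv Q c f))" "y = vec (\<lambda>c. R u (cyclic_deriv Q c g))"
      unfolding W_def by blast
    then show "x + y \<in> W" unfolding W_def
      by (intro image_eqI[of _ _ "f + g"]) (auto simp: vec_def fun_eq_iff pw AA_add cyclic_deriv_add R_add)
  next
    fix z x assume "x \<in> W"
    then obtain f where f: "f \<in> AA" "x = vec (\<lambda>c. R u (cyclic_deriv Q c f))" unfolding W_def by blast
    then show "fun_scale z x \<in> W" unfolding W_def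
      by (intro image_eqI[of _ _ "path_scale z f"]) (auto simp: vec_def fun_eq_iff pw fun_scale_def AA_scale cyclic_deriv_scale R_scale)
  qed
  have pair: "(\<Sum>k\<in>?K. z k * vec m k) = (\<Sum>c\<in>AR. \<Sum>x\<in>idx. \<Sum>y\<in>idx. z (c, x, y) * m c y x)" for z m
  proof -
    have "(\<Sum>k\<in>?K. z k * vec m k) = (\<Sum>(c,x,y)\<in>?K. z (c, x, y) * m c y x)"
      by (intro sum.cong) (auto simp: vec_def)
    also have "\<dots> = (\<Sum>c\<in>AR. \<Sum>x\<in>idx. \<Sum>y\<in>idx. z (c, x, y) * m c y x)"
      by (simp add: sum.cartesian_product)
    finally show ?thesis .
  qed
  have wsupp: "w c y x \<noteq> 0 \<Longrightarrow> x \<in> idx \<and> y \<in> idx \<and> fst x = hdc c \<and> fst y = tlc c" if c: "c \<in> AR" for c x y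
  proof -
    assume n: "w c y x \<noteq> 0"
    show ?thesis
    proof (cases c)
      case (Inl a)
      then show ?thesis using n c blkD[OF v, of "Inr a" y x] by (auto simp: w_def double_arcs)
    next
      case (Inr a)
      then show ?thesis using n c blkD[OF v, of "Inl a" y x] by (auto simp: w_def double_arcs)
    qed
  qed
  have "vec w \<in> W"
  proof (rule ccontr)
    assume "vec w \<notin> W"
    then obtain z where z: "\<And>g. g \<in> AA \<Longrightarrow> (\<Sum>k\<in>?K. z k * vec (\<lambda>c. R u (cyclic_deriv Q c g)) k) = 0"
      and zw: "(\<Sum>k\<in>?K. z k * vec w k) \<noteq> 0"
      using separating_functional[OF K sub _ _ \<open>vec w \<notin> W\<close>] by (fastforce simp: W_def vec_def)
    define z' where "z' c = (\<lambda>x y. if x \<in> idx \<and> y \<in> idx \<and> fst x = hdc c \<and> fst y = tlc c then z (c, x, y) else 0)" for c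
    have bz: "blk z'" unfolding blk_def z'_def by (auto split: if_splits)
    have tz: "(\<Sum>c\<in>AR. tr (z' c \<diamond> m c)) = (\<Sum>k\<in>?K. z k * vec m k)"
      if m: "\<And>c x y. c \<in> AR \<Longrightarrow> m c y x \<noteq> 0 \<Longrightarrow> fst x = hdc c \<and> fst y = tlc c" for m
      unfolding pair tr_def mm_def
    proof (intro sum.cong refl)
      fix c x y assume "c \<in> AR" "x \<in> idx" "y \<in> idx"
      then show "z' c x y * m c y x = z (c, x, y) * m c y x"
        using m[of c y x] by (cases "m c y x = 0") (simp_all add: z'_def del: double_simps)
    qed
    have "tr (dR u z' g) = 0" if g: "g \<in> AA" for g
      unfolding tr_dR[OF bu bz g] using tz[of "\<lambda>c. R u (cyclic_deriv Q c g)"] z[OF g] R_cyclic_deriv_supp[OF bu _ g] by auto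
    then obtain X where X: "blkd X" "\<And>c. c \<in> AR \<Longrightarrow> z' c = gdir X u c"
      using trivial_direction[OF u bz] by blast
    have "(\<Sum>c\<in>AR. tr (z' c \<diamond> w c)) = (\<Sum>c\<in>AR. tr (gdir X u c \<diamond> w c))" using X(2) by simp
    also have "\<dots> = - tr (X \<diamond> dmom u v)"
      unfolding tr_mm_dmom sum_AR sum_negf[symmetric]
      by (intro sum.cong refl) (simp add: w_def mm_uminus_right tr_uminus tr_comm[of "gdir X u _"])
    also have "\<dots> = 0" by (simp add: m mm_zero_right tr_0)
    finally show False using tz[of w] wsupp zw by auto
  qed
  then obtain g where g: "g \<in> AA" "vec w = vec (\<lambda>c. R u (cyclic_deriv Q c g))" unfolding W_def by blast
  have wg: "w c y x = R u (cyclic_deriv Q c g) y x" if c: "c \<in> AR" for c x y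
  proof (cases "x \<in> idx \<and> y \<in> idx")
    case True
    then show ?thesis using fun_cong[OF g(2), of "(c, x, y)"] c by (simp add: vec_def)
  next
    case False
    then show ?thesis using wsupp[OF c, of y x] R_cyclic_deriv_supp[OF bu c g(1), of y x] by metis
  qed
  have "v c = ham u g c" if c: "c \<in> AR" for c
  proof (cases c)
    case (Inl a)
    then show ?thesis using wg[of "Inr a"] c by (auto simp: w_def ham_def double_arcs fun_eq_iff)
  next
    case (Inr a)
    have "- v (Inr a) = R u (cyclic_deriv Q (Inl a) g)" using wg[of "Inl a"] Inr c by (auto simp: w_def double_arcs fun_eq_iff)
    then have "v (Inr a) = - R u (cyclic_deriv Q (Inl a) g)" by (metis minus_minus)
    then show ?thesis using Inr by (simp add: ham_def)
  qed
  with g show ?thesis by blast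
qed

subsection \<open>Trace functionals that are tangent to the character\<close>

text \<open>On the kernel J of \<open>R u\<close> the functional comes from a bimodule map Y into
  matrices, which exists because \<psi> kills J J. Y extends to a derivation of the whole path
  algebra; \<psi> differs from its trace by a multiple of the character of u, and this multiple is
  zero because \<psi> vanishes at the identity.\<close>

lemma derivation_of_functional:
  assumes u: "full u"
    and add: "\<And>f g. f \<in> AA \<Longrightarrow> g \<in> AA \<Longrightarrow> \<psi> (f + g) = \<psi> f + (\<psi> g :: complex)"
    and scale: "\<And>z f. f \<in> AA \<Longrightarrow> \<psi> (path_scale z f) = z * \<psi> f"
    and cyc: "\<And>f g. f \<in> AA \<Longrightarrow> g \<in> AA \<Longrightarrow> \<psi> (f \<star> g) = \<psi> (g \<star> f)"
    and JJ: "\<And>f g. f \<in> AA \<Longrightarrow> g \<in> AA \<Longrightarrow> R u f = 0 \<Longrightarrow> R u g = 0 \<Longrightarrow> \<psi> (f \<star> g) = 0"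
    and one: "\<psi> oneA = 0"
  shows "\<exists>v. blk v \<and> (\<forall>f\<in>AA. \<psi> f = tr (dR u v f))"
proof (cases "idx = {}")
  case True
  note bu = full_blk[OF u]
  have z: "A = 0" if "A \<in> fm" for A by (rule fm_eqI[OF that fm_0]) (simp add: True)
  have "\<psi> f = tr (dR u (\<lambda>_. 0) f)" if f: "f \<in> AA" for f
  proof -
    \<comment> \<open>The only matrix is zero, so f and the identity both lie in the kernel.\<close>
    have "\<psi> (f \<star> oneA) = 0" using z R_fm[OF bu] f by (intro JJ) (auto simp: AA_one)
    moreover have "tr (dR u (\<lambda>_. 0) f) = 0" unfolding tr_def by (simp add: True)
    ultimately show ?thesis by (simp add: oneA_right f)
  qed
  moreover have "blk (\<lambda>_. 0)" by (auto simp: blk_def pw)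
  ultimately show ?thesis by blast
next
  case False
  then obtain b where b: "b \<in> idx" by blast
  note bu = full_blk[OF u]
  obtain F where F: "\<And>x y. x \<in> idx \<Longrightarrow> y \<in> idx \<Longrightarrow> F x y \<in> AA" "\<And>x y. x \<in> idx \<Longrightarrow> y \<in> idx \<Longrightarrow> R u (F x y) = munit x y"
     "\<And>x y. x \<in> idx \<Longrightarrow> y \<in> idx \<Longrightarrow> vx (fst x) \<star> F x y = F x y"
     "\<And>x y. x \<in> idx \<Longrightarrow> y \<in> idx \<Longrightarrow> F x y \<star> vx (fst y) = F x y"
    by (rule full_lifts[OF u]) blast
  define J where "J = {f \<in> AA. R u f = 0}"
  have JA: "f \<in> J \<Longrightarrow> f \<in> AA" and JR: "f \<in> J \<Longrightarrow> R u f = 0" for f by (auto simp: J_def)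
  have Jl: "g \<in> AA \<Longrightarrow> f \<in> J \<Longrightarrow> g \<star> f \<in> J" and Jr: "g \<in> AA \<Longrightarrow> f \<in> J \<Longrightarrow> f \<star> g \<in> J" for f g
    by (auto simp: J_def AA_mult R_mult bu mm_zero_left mm_zero_right)
  have diff: "\<psi> (f - g) = \<psi> f - \<psi> g" if "f \<in> AA" "g \<in> AA" for f g
    using add[OF AA_diff[OF that] that(2)] by simp
  \<comment> \<open>For f in J the value \<psi>(f g) depends only on the matrix of g, so it is a
    trace against a matrix.\<close>
  have "\<exists>Y\<in>fm. \<forall>g\<in>AA. \<psi> (f \<star> g) = tr (Y \<diamond> R u g)" if f: "f \<in> J" for f
  proof -
    have "\<forall>M\<in>fm. \<exists>g\<in>AA. R u g = M" using u by (simp add: full_def)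
    then obtain s where s: "\<And>M. M \<in> fm \<Longrightarrow> s M \<in> AA \<and> R u (s M) = M" by metis
    have ws: "\<psi> (f \<star> g) = \<psi> (f \<star> g')" if "g \<in> AA" "g' \<in> AA" "R u g = R u g'" for g g'
    proof -
      have "\<psi> (f \<star> (g - g')) = 0" using that by (intro JJ) (auto simp: JA[OF f] JR[OF f] AA_diff R_diff)
      then show ?thesis using that by (simp add: path_mult_diff_right diff AA_mult JA[OF f])
    qed
    define h where "h M = \<psi> (f \<star> s M)" for M
    have hadd: "h (A + B) = h A + h B" if "A \<in> fm" "B \<in> fm" for A B
    proof -
      have "h (A + B) = \<psi> (f \<star> (s A + s B))" unfolding h_def
        by (rule ws) (use s that fm_add[OF that] in \<open>auto simp: AA_add R_add\<close>)
      then show ?thesis using s that by (simp add: path_mult_add_right add AA_mult JA[OF f] h_def)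
    qed
    have hsc: "h (mscale c A) = c * h A" if "A \<in> fm" for A c
    proof -
      have "h (mscale c A) = \<psi> (f \<star> path_scale c (s A))" unfolding h_def
        by (rule ws) (use s that fm_scale[OF that] in \<open>auto simp: AA_scale R_scale\<close>)
      then show ?thesis using s that by (simp add: pmult_scale_right scale AA_mult JA[OF f] h_def)
    qed
    obtain Y where Y: "Y \<in> fm" "\<And>A. A \<in> fm \<Longrightarrow> h A = tr (Y \<diamond> A)"
      using functional_tr[of h, OF hadd hsc] by blast
    have "\<psi> (f \<star> g) = tr (Y \<diamond> R u g)" if g: "g \<in> AA" for g
    proof -
      have "\<psi> (f \<star> g) = h (R u g)" unfolding h_def
        by (rule ws) (use s[OF R_fm[OF bu g]] g in auto)
      then show ?thesis using Y(2)[OF R_fm[OF bu g]] by simp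
    qed
    with Y(1) show ?thesis by blast
  qed
  then obtain Y where Y: "\<And>f. f \<in> J \<Longrightarrow> Y f \<in> fm" "\<And>f g. f \<in> J \<Longrightarrow> g \<in> AA \<Longrightarrow> \<psi> (f \<star> g) = tr (Y f \<diamond> R u g)"
    by metis
  have Jadd: "f \<in> J \<Longrightarrow> g \<in> J \<Longrightarrow> f + g \<in> J" and Jsc: "f \<in> J \<Longrightarrow> path_scale z f \<in> J" and J0: "0 \<in> J" for f g z
    by (auto simp: J_def AA_add R_add AA_scale R_scale AA_0)
  have Yadd: "Y (f + g) = Y f + Y g" if "f \<in> J" "g \<in> J" for f g
    by (rule full_nondegenerate2[OF u]) (use that Y(1) in \<open>auto simp: Jadd fm_add Y(2)[symmetric] mm_add_left tr_add path_mult_add_left add AA_mult JA\<close>)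
  have Ysc: "Y (path_scale z f) = mscale z (Y f)" if "f \<in> J" for f z
    by (rule full_nondegenerate2[OF u]) (use that Y(1) in \<open>auto simp: Jsc fm_scale Y(2)[symmetric] mm_scale_left tr_scale pmult_scale_left scale AA_mult JA\<close>)
  have Yr: "Y (f \<star> h) = Y f \<diamond> R u h" if f: "f \<in> J" and h: "h \<in> AA" for f h
  proof (rule full_nondegenerate2[OF u])
    fix g assume g: "g \<in> AA"
    show "tr (Y (f \<star> h) \<diamond> R u g) = tr (Y f \<diamond> R u h \<diamond> R u g)"
      using Y(2)[OF f AA_mult[OF h g]] Y(2)[OF Jr[OF h f] g]
      by (simp add: pmult_assoc JA[OF f] h g R_mult bu mm_assoc)
  qed (use f h in \<open>auto intro!: Y(1) Jr fm_mm R_fm bu\<close>)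
  have Yl: "Y (h \<star> f) = R u h \<diamond> Y f" if f: "f \<in> J" and h: "h \<in> AA" for f h
  proof (rule full_nondegenerate2[OF u])
    fix g assume g: "g \<in> AA"
    have "tr (Y (h \<star> f) \<diamond> R u g) = \<psi> (h \<star> f \<star> g)" using Y(2)[OF Jl[OF h f] g] by simp
    also have "\<dots> = \<psi> (f \<star> (g \<star> h))"
      using cyc[OF h AA_mult[OF JA[OF f] g]] by (simp add: pmult_assoc JA[OF f] h g)
    also have "\<dots> = tr (Y f \<diamond> (R u g \<diamond> R u h))" using Y(2)[OF f AA_mult[OF g h]] by (simp add: R_mult bu g h)
    also have "\<dots> = tr (R u h \<diamond> Y f \<diamond> R u g)" using tr_comm[of "Y f \<diamond> R u g" "R u h"] by (simp add: mm_assoc)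
    finally show "tr (Y (h \<star> f) \<diamond> R u g) = tr (R u h \<diamond> Y f \<diamond> R u g)" .
  qed (use f h in \<open>auto intro!: Y(1) Jl fm_mm R_fm bu\<close>)
  have Y0: "Y 0 = 0" using Ysc[OF J0, of 0] by simp
  have Ysum: "Y (\<Sum>q\<in>S. f q) = (\<Sum>q\<in>S. Y (f q)) \<and> (\<Sum>q\<in>S. f q) \<in> J" if "\<And>q. q \<in> S \<Longrightarrow> f q \<in> J" for S :: "('v \<times> nat) set" and f
    using that by (induction S rule: infinite_finite_induct) (auto simp: Y0 J0 Yadd Jadd)
  \<comment> \<open>Multiplying the unit at (b, p) by a matrix gives the combination of the units at
    (b, q) with coefficients in row p. \<kappa> f p is the error of this identity for the lifts,
    hence an element of J.\<close>
  define \<kappa> where "\<kappa> f p = F b p \<star> f - (\<Sum>q\<in>idx. path_scale (R u f p q) (F b q))" for f p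
  have row: "munit b p \<diamond> A = (\<Sum>q\<in>idx. mscale (A p q) (munit b q))" if p: "p \<in> idx" and A: "A \<in> fm" for p A
  proof (intro ext)
    fix s t
    have "(\<Sum>q\<in>idx. mscale (A p q) (munit b q)) s t = (\<Sum>q\<in>idx. if q = t then (if s = b then A p t else 0) else 0)"
      unfolding sum_fun_apply2 by (intro sum.cong) (auto simp: pw munit_def)
    also have "\<dots> = (munit b p \<diamond> A) s t"
      using finI fm_zero(2)[OF A, of t p] by (auto simp: munit_mm[OF p])
    finally show "(munit b p \<diamond> A) s t = (\<Sum>q\<in>idx. mscale (A p q) (munit b q)) s t" by simp
  qed
  have col: "A \<diamond> munit q b = (\<Sum>p\<in>idx. mscale (A p q) (munit p b))" if q: "q \<in> idx" and A: "A \<in> fm" for q A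
  proof (intro ext)
    fix s t
    have "(\<Sum>p\<in>idx. mscale (A p q) (munit p b)) s t = (\<Sum>p\<in>idx. if p = s then (if t = b then A s q else 0) else 0)"
      unfolding sum_fun_apply2 by (intro sum.cong) (auto simp: pw munit_def)
    also have "\<dots> = (A \<diamond> munit q b) s t"
      using finI fm_zero(1)[OF A, of s q] by (auto simp: mm_munit[OF q])
    finally show "(A \<diamond> munit q b) s t = (\<Sum>p\<in>idx. mscale (A p q) (munit p b)) s t" by simp
  qed
  have \<kappa>J: "\<kappa> f p \<in> J" if f: "f \<in> AA" and p: "p \<in> idx" for f p
    unfolding J_def \<kappa>_def using f p row[OF p R_fm[OF bu f]]
    by (auto simp: F b R_diff R_mult bu R_sum R_scale intro!: AA_diff AA_mult AA_sum AA_scale)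
  \<comment> \<open>For f in J the matrix of f is zero, and D f collapses to Y f because Y is a
    bimodule map. In general \<kappa> of f g is \<kappa> of f times g plus a combination of the
    \<kappa> of g, which is the Leibniz rule for D.\<close>
  define D where "D f = (\<Sum>p\<in>idx. munit p b \<diamond> Y (\<kappa> f p))" for f
  have Dadd: "D (f + g) = D f + D g" if "f \<in> AA" "g \<in> AA" for f g
  proof -
    have "\<kappa> (f + g) p = \<kappa> f p + \<kappa> g p" for p
      by (simp add: \<kappa>_def path_mult_add_right R_add pw path_vs.scale_left_distrib sum.distrib algebra_simps)
    then show ?thesis by (simp add: D_def Yadd \<kappa>J that mm_add_right sum.distrib)
  qed
  have Dsc: "D (path_scale z f) = mscale z (D f)" if f: "f \<in> AA" for f z
  proof -
    have "\<kappa> (path_scale z f) p = path_scale z (\<kappa> f p)" if "p \<in> idx" for p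
      using F(1)[OF b that] f by (simp add: \<kappa>_def pmult_scale_right R_scale pw path_vs.scale_right_diff_distrib path_vs.scale_sum_right)
    then have "D (path_scale z f) = (\<Sum>p\<in>idx. mscale z (munit p b \<diamond> Y (\<kappa> f p)))"
      unfolding D_def by (intro sum.cong refl) (simp add: Ysc \<kappa>J f mm_scale_right)
    also have "\<dots> = mscale z (D f)" by (simp add: D_def fun_eq_iff pw sum_fun_apply2 sum_distrib_left)
    finally show ?thesis .
  qed
  have Dmult: "D (f \<star> g) = D f \<diamond> R u g + R u f \<diamond> D g" if f: "f \<in> AA" and g: "g \<in> AA" for f g
  proof -
    have k: "\<kappa> (f \<star> g) p = \<kappa> f p \<star> g + (\<Sum>q\<in>idx. path_scale (R u f p q) (\<kappa> g q))" if p: "p \<in> idx" for p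
    proof -
      have "(\<Sum>q\<in>idx. path_scale (R u f p q) (\<kappa> g q)) = (\<Sum>q\<in>idx. path_scale (R u f p q) (F b q \<star> g))
          - (\<Sum>q\<in>idx. \<Sum>r\<in>idx. path_scale (R u f p q * R u g q r) (F b r))"
        by (simp add: \<kappa>_def path_vs.scale_right_diff_distrib path_vs.scale_sum_right sum_subtractf)
      also have "(\<Sum>q\<in>idx. \<Sum>r\<in>idx. path_scale (R u f p q * R u g q r) (F b r)) = (\<Sum>r\<in>idx. path_scale (R u (f \<star> g) p r) (F b r))"
        by (subst sum.swap) (simp add: R_mult bu f g mm_def path_vs.scale_sum_left)
      finally show ?thesis
        using F(1)[OF b] p f g by (simp add: \<kappa>_def path_mult_diff_left path_mult_sum_left pmult_scale_left pmult_assoc)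
    qed
    have "Y (\<kappa> (f \<star> g) p) = Y (\<kappa> f p) \<diamond> R u g + (\<Sum>q\<in>idx. mscale (R u f p q) (Y (\<kappa> g q)))" if p: "p \<in> idx" for p
      using Ysum[of idx "\<lambda>q. path_scale (R u f p q) (\<kappa> g q)"] \<kappa>J[OF g]
      by (simp add: k[OF p] Yadd Yr Jr \<kappa>J[OF f p] g Jsc Ysc)
    then have "D (f \<star> g) = D f \<diamond> R u g + (\<Sum>p\<in>idx. \<Sum>q\<in>idx. mscale (R u f p q) (munit p b \<diamond> Y (\<kappa> g q)))"
      by (simp add: D_def mm_add_right mm_sum_left mm_sum_right mm_assoc mm_scale_right sum.distrib)
    also have "(\<Sum>p\<in>idx. \<Sum>q\<in>idx. mscale (R u f p q) (munit p b \<diamond> Y (\<kappa> g q))) = (\<Sum>q\<in>idx. (R u f \<diamond> munit q b) \<diamond> Y (\<kappa> g q))"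
      by (subst sum.swap, intro sum.cong refl) (simp add: col R_fm bu f mm_sum_left mm_scale_left)
    also have "\<dots> = R u f \<diamond> D g" by (simp add: D_def mm_sum_right mm_assoc)
    finally show ?thesis .
  qed
  have Dfm: "D f \<in> fm" if "f \<in> AA" for f
    unfolding D_def by (intro fm_sum fm_mm fm_munit b Y(1) \<kappa>J that)
  have Dvx: "D (vx i) = 0" if i: "i \<in> verts Q" for i
  proof -
    have "\<kappa> (vx i) p = 0" if p: "p \<in> idx" for p
    proof -
      have "F b p \<star> vx i = (if fst p = i then F b p else 0)"
      proof (cases "fst p = i")
        case True
        then show ?thesis using F(4)[OF b p] by simp
      next
        case False
        then have "F b p \<star> vx (fst p) \<star> vx i = 0"
          by (simp add: pmult_assoc[OF F(1)[OF b p] AA_vx[OF idx_fst[OF p]] AA_vx[OF i]] vx_vx)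
        then show ?thesis using F(4)[OF b p] False by simp
      qed
      moreover have "(\<Sum>q\<in>idx. path_scale (proj i p q) (F b q)) = (\<Sum>q\<in>idx. if q = p then (if fst p = i then F b p else 0) else 0)"
        by (intro sum.cong) (use p in \<open>auto simp: proj_def\<close>)
      ultimately show ?thesis using p finI by (simp add: \<kappa>_def R_vx)
    qed
    then show ?thesis by (simp add: D_def Y0 mm_zero_right)
  qed
  define v where "v c = D (arr c)" for c
  have bv: "blk v"
    unfolding blk_def
  proof (intro ballI allI impI)
    fix c x y assume c: "c \<in> AR" and n: "v c x y \<noteq> 0"
    have a: "vx (hdc c) \<star> arr c = arr c" "arr c \<star> vx (tlc c) = arr c"
      by (simp_all add: arr_def vx_single single_vx path_source_def del: double_simps)
    have "D (arr c) = proj (hdc c) \<diamond> D (arr c)"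
      using Dmult[OF AA_vx[OF AR_verts(1)[OF c]] AA_arr[OF c]] Dvx[OF AR_verts(1)[OF c]]
      unfolding a by (simp add: mm_zero_left R_vx del: double_simps)
    then have 1: "(proj (hdc c) \<diamond> D (arr c)) x y \<noteq> 0" using n by (simp add: v_def)
    have "D (arr c) = D (arr c) \<diamond> proj (tlc c)"
      using Dmult[OF AA_arr[OF c] AA_vx[OF AR_verts(2)[OF c]]] Dvx[OF AR_verts(2)[OF c]]
      unfolding a by (simp add: mm_zero_right R_vx del: double_simps)
    then have 2: "(D (arr c) \<diamond> proj (tlc c)) x y \<noteq> 0" using n by (simp add: v_def)
    show "x \<in> idx \<and> y \<in> idx \<and> fst x = hdc c \<and> fst y = tlc c"
      using 1 2 by (auto simp: proj_mm mm_proj split: if_splits)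
  qed
  have DdR: "D f = dR u v f" if f: "f \<in> AA" for f
    by (rule derivation_eq_dR[OF bu f Dadd Dsc Dmult Dvx]) (simp_all add: v_def)
  have trJ: "tr (D f) = \<psi> f" if f: "f \<in> J" for f
  proof -
    have "D f = (\<Sum>p\<in>idx. munit p b \<diamond> (munit b p \<diamond> Y f))"
      unfolding D_def by (intro sum.cong refl) (simp add: \<kappa>_def JR[OF f] pw Yl f F b)
    also have "\<dots> = om \<diamond> Y f" by (simp add: om_expand mm_sum_left mm_assoc[symmetric] munit_munit b)
    finally have "D f = Y f" using Y(1)[OF f] by (simp add: mm_om_left)
    moreover have "\<psi> f = tr (Y f)" using Y(2)[OF f AA_one] Y(1)[OF f] by (simp add: oneA_right JA f R_one mm_om_right)
    ultimately show ?thesis by simp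
  qed
  \<comment> \<open>This difference vanishes on J, so it is a trace against a matrix Z; it is
    cyclic, so Z is central and hence a scalar.\<close>
  define \<theta> where "\<theta> f = \<psi> f - tr (D f)" for f
  have \<theta>eq: "\<theta> f = \<theta> g" if "f \<in> AA" "g \<in> AA" "R u f = R u g" for f g
  proof -
    have "f - g \<in> J" using that by (auto simp: J_def AA_diff R_diff)
    from trJ[OF this] have "\<psi> (f - g) = tr (D f - D g)" using that by (simp add: DdR AA_diff dR_diff)
    then show ?thesis using that by (simp add: \<theta>_def diff tr_diff algebra_simps)
  qed
  have "\<forall>M\<in>fm. \<exists>g\<in>AA. R u g = M" using u by (simp add: full_def)
  then obtain s where s: "\<And>M. M \<in> fm \<Longrightarrow> s M \<in> AA" "\<And>M. M \<in> fm \<Longrightarrow> R u (s M) = M" by metis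
  have h1: "\<theta> (s (A + B)) = \<theta> (s A) + \<theta> (s B)" if "A \<in> fm" "B \<in> fm" for A B
  proof -
    have "\<theta> (s (A + B)) = \<theta> (s A + s B)"
      by (rule \<theta>eq) (use s that fm_add[OF that] in \<open>auto simp: AA_add R_add\<close>)
    then show ?thesis using s(1) that by (simp add: \<theta>_def add Dadd tr_add)
  qed
  have h2: "\<theta> (s (mscale c A)) = c * \<theta> (s A)" if "A \<in> fm" for A c
  proof -
    have "\<theta> (s (mscale c A)) = \<theta> (path_scale c (s A))"
      by (rule \<theta>eq) (use s that fm_scale[OF that] in \<open>auto simp: AA_scale R_scale\<close>)
    then show ?thesis using s(1) that by (simp add: \<theta>_def scale Dsc tr_scale algebra_simps)
  qed
  obtain Z where Z: "Z \<in> fm" "\<And>A. A \<in> fm \<Longrightarrow> \<theta> (s A) = tr (Z \<diamond> A)"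
    using functional_tr[of "\<lambda>A. \<theta> (s A)", OF h1 h2] by blast
  have \<theta>Z: "\<theta> f = tr (Z \<diamond> R u f)" if f: "f \<in> AA" for f
    using \<theta>eq[OF f s(1)[OF R_fm[OF bu f]]] s(2)[OF R_fm[OF bu f]] Z(2)[OF R_fm[OF bu f]] by simp
  have \<theta>cyc: "\<theta> (f \<star> g) = \<theta> (g \<star> f)" if "f \<in> AA" "g \<in> AA" for f g
    using that by (simp add: \<theta>_def cyc[OF that] Dmult tr_add tr_comm[of "D f"] tr_comm[of "R u f"] add.commute)
  have "Z \<diamond> A = A \<diamond> Z" if A: "A \<in> fm" for A
  proof (rule full_nondegenerate2[OF u])
    fix g assume g: "g \<in> AA"
    have "tr (Z \<diamond> (A \<diamond> R u g)) = tr (Z \<diamond> (R u g \<diamond> A))"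
      using \<theta>cyc[OF s(1)[OF A] g] \<theta>Z[OF AA_mult[OF s(1)[OF A] g]] \<theta>Z[OF AA_mult[OF g s(1)[OF A]]]
      by (simp add: R_mult bu s A g)
    then show "tr (Z \<diamond> A \<diamond> R u g) = tr (A \<diamond> Z \<diamond> R u g)"
      using tr_comm[of "Z \<diamond> R u g" A] by (simp add: mm_assoc)
  qed (auto intro: fm_mm Z A)
  then obtain k where k: "Z = mscale k om" using center_fm[OF Z(1)] by blast
  have \<theta>k: "\<theta> f = k * tr (R u f)" if f: "f \<in> AA" for f
    using \<theta>Z[OF f] by (simp add: k mm_scale_left tr_scale mm_om_left R_fm bu f)
  have "D oneA = 0" using AA_one by (simp add: DdR oneA_def dR_sum dR_vx)
  then have "\<theta> oneA = 0" by (simp add: \<theta>_def one tr_0)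
  then have "k * of_nat (card idx) = 0" using \<theta>k[OF AA_one] by (simp add: R_one tr_om)
  then have "k = 0" using b finI by auto
  then have "\<forall>f\<in>AA. \<psi> f = tr (dR u v f)" using \<theta>k by (simp add: \<theta>_def DdR)
  with bv show ?thesis by blast
qed

text \<open>The polynomial with the roots \<open>ls\<close>, evaluated at \<open>momA\<close>. It
  acts as zero over the orbit when the eigenvalues are among the roots, which gives relations that
  every tangent vector respects.\<close>

primrec pA :: "complex list \<Rightarrow> ('v, 'e) path_comb" where
  "pA [] = oneA"
| "pA (\<mu> # ls) = (momA - path_scale \<mu> oneA) \<star> pA ls"

text \<open>Divided difference of the polynomial with the roots \<open>ls\<close>.\<close>

primrec pq :: "complex list \<Rightarrow> complex \<Rightarrow> complex \<Rightarrow> complex" where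
  "pq [] a b = 0"
| "pq (\<mu> # ls) a b = (\<Prod>\<nu>\<leftarrow>ls. b - \<nu>) + (a - \<mu>) * pq ls a b"

text \<open>On the diagonal the divided difference is the derivative of the polynomial, which does
  not vanish at a simple root.\<close>

lemma pq_nonzero: "distinct ls \<Longrightarrow> a \<in> set ls \<Longrightarrow> pq ls a a \<noteq> 0"
proof (induction ls)
  case (Cons \<mu> ls)
  show ?case
  proof (cases "a = \<mu>")
    case True
    have "(\<Prod>\<nu>\<leftarrow>ls. \<mu> - \<nu>) \<noteq> 0" using Cons.prems by (auto simp: prod_list_zero_iff)
    then show ?thesis using True by simp
  next
    case False
    then have "a \<in> set ls" using Cons.prems by auto
    then have "(\<Prod>\<nu>\<leftarrow>ls. a - \<nu>) = 0" by (auto simp: prod_list_zero_iff)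
    then have "pq (\<mu> # ls) a a = (a - \<mu>) * pq ls a a" by (simp only: pq.simps add_0_left)
    then show ?thesis using False Cons \<open>a \<in> set ls\<close> by (simp del: pq.simps)
  qed
qed simp

lemma AA_pA: "pA ls \<in> AA"
  by (induction ls) (auto intro!: AA_mult AA_diff AA_scale AA_mom AA_one)

definition diag :: "('v \<times> nat \<Rightarrow> complex) \<Rightarrow> 'v mtx" where
  "diag l = (\<lambda>x y. if x = y \<and> x \<in> idx then l x else 0)"

lemma diag_mm: "(diag l \<diamond> A) x y = (if x \<in> idx then l x * A x y else 0)"
proof -
  have "(diag l \<diamond> A) x y = (\<Sum>z\<in>idx. if x = z then l x * A x y else 0)"
    unfolding mm_def diag_def by (intro sum.cong) auto
  then show ?thesis using finI by simp
qed

lemma mm_diag: "(A \<diamond> diag l) x y = (if y \<in> idx then A x y * l y else 0)"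
proof -
  have "(A \<diamond> diag l) x y = (\<Sum>z\<in>idx. if z = y then A x y * l y else 0)"
    unfolding mm_def diag_def by (intro sum.cong) auto
  then show ?thesis using finI by simp
qed

lemma fm_diag: "diag l \<in> fm" by (auto intro!: fmI simp: diag_def)

lemma diag_minus_om: "diag l - mscale \<mu> om = diag (\<lambda>x. l x - \<mu>)"
  by (auto simp: fun_eq_iff pw diag_def om_def)

lemma R_pA:
  assumes u: "blk u" and m: "mom u = diag l"
  shows "R u (pA ls) = diag (\<lambda>x. \<Prod>\<nu>\<leftarrow>ls. l x - \<nu>)"
proof (induction ls)
  case Nil
  show ?case by (simp add: R_one) (auto simp: fun_eq_iff diag_def om_def)
next
  case (Cons \<mu> ls)
  have "R u (pA (\<mu> # ls)) = diag (\<lambda>x. l x - \<mu>) \<diamond> R u (pA ls)"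
    using u by (simp add: R_mult AA_diff AA_mom AA_scale AA_one AA_pA R_diff R_scale R_one R_momA m diag_minus_om)
  also have "\<dots> = diag (\<lambda>x. \<Prod>\<nu>\<leftarrow>\<mu> # ls. l x - \<nu>)"
    unfolding Cons.IH by (intro ext, simp add: diag_mm) (auto simp: diag_def)
  finally show ?case .
qed

text \<open>Differentiating p(M) at a diagonal M multiplies each entry of the direction by the
  divided difference of p at two eigenvalues; the Leibniz rule reproduces the recursion of
  \<open>pq\<close>.\<close>

lemma dR_pA:
  assumes u: "blk u" and v: "blk v" and m: "mom u = diag l" and xy: "x \<in> idx" "y \<in> idx"
  shows "dR u v (pA ls) x y = pq ls (l x) (l y) * dmom u v x y"
proof (induction ls)
  case Nil
  have "dR u v oneA = 0" by (simp add: oneA_def dR_sum dR_vx)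
  then show ?case by (simp add: pw)
next
  case (Cons \<mu> ls)
  have o: "dR u v oneA = 0" by (simp add: oneA_def dR_sum dR_vx)
  have "dR u v (pA (\<mu> # ls)) = dmom u v \<diamond> R u (pA ls) + diag (\<lambda>x. l x - \<mu>) \<diamond> dR u v (pA ls)"
    using u v by (simp add: dR_mult AA_diff AA_mom AA_scale AA_one AA_pA R_diff R_scale R_one R_momA m diag_minus_om
        dR_diff dR_scale o dR_momA)
  then show ?case using xy Cons.IH
    by (simp add: R_pA[OF u m] pw diag_mm mm_diag algebra_simps)
qed

text \<open>A tangent vector at the character of \<open>u\<close> that is compatible with the equations
  \<open>p(\<mu>) = 0\<close>, where \<open>p\<close> is separable, is Hamiltonian: it lifts to a direction \<open>v\<close>, separability
  puts \<open>d\<mu>(v)\<close> into the image of \<open>ad \<mu>(u)\<close>, and after a gauge correction \<open>d\<mu>(v) = 0\<close>.\<close>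

lemma functional_is_hamiltonian:
  assumes u: "full u"
    and add: "\<And>f g. f \<in> AA \<Longrightarrow> g \<in> AA \<Longrightarrow> \<psi> (f + g) = \<psi> f + (\<psi> g :: complex)"
    and scale: "\<And>z f. f \<in> AA \<Longrightarrow> \<psi> (path_scale z f) = z * \<psi> f"
    and cyc: "\<And>f g. f \<in> AA \<Longrightarrow> g \<in> AA \<Longrightarrow> \<psi> (f \<star> g) = \<psi> (g \<star> f)"
    and JJ: "\<And>f g. f \<in> AA \<Longrightarrow> g \<in> AA \<Longrightarrow> R u f = 0 \<Longrightarrow> R u g = 0 \<Longrightarrow> \<psi> (f \<star> g) = 0"
    and one: "\<psi> oneA = 0"
    and m: "mom u = diag l" and ls: "distinct ls" "l ` idx \<subseteq> set ls"
    and p: "\<And>f. f \<in> AA \<Longrightarrow> \<psi> (f \<star> pA ls) = 0"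
  shows "\<exists>g\<in>AA. \<forall>f\<in>AA. \<psi> f = tr (R u (path_bracket Q f g))"
proof -
  note bu = full_blk[OF u]
  obtain v where v: "blk v" "\<And>f. f \<in> AA \<Longrightarrow> \<psi> f = tr (dR u v f)"
    using derivation_of_functional[of u \<psi>] assms by blast
  let ?\<xi> = "dmom u v"
  have R0: "R u (pA ls) = 0"
    unfolding R_pA[OF bu m]
  proof (intro ext)
    fix x y
    show "diag (\<lambda>x. \<Prod>\<nu>\<leftarrow>ls. l x - \<nu>) x y = 0 x y"
      using ls(2) by (auto simp: diag_def pw prod_list_zero_iff)
  qed
  have "dR u v (pA ls) = 0"
  proof (rule full_nondegenerate[OF u dR_fm[OF bu v(1) AA_pA]])
    fix g assume g: "g \<in> AA"
    have "0 = tr (dR u v (g \<star> pA ls))" using v(2)[OF AA_mult[OF g AA_pA]] p[OF g] by simp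
    also have "\<dots> = tr (R u g \<diamond> dR u v (pA ls))"
      by (simp add: dR_mult bu v(1) g AA_pA R0 mm_zero_right)
    finally show "tr (dR u v (pA ls) \<diamond> R u g) = 0" by (simp add: tr_comm)
  qed
  \<comment> \<open>Where two eigenvalues agree, the factor is the derivative of p at a simple root,
    so the entry of \<open>dmom u v\<close> itself vanishes.\<close>
  then have \<xi>0: "?\<xi> x y = 0" if "x \<in> idx" "y \<in> idx" "l x = l y" for x y
    using dR_pA[OF bu v(1) m that(1,2), of ls] pq_nonzero[OF ls(1), of "l x"] ls(2) that by (auto simp: pw)
  have b\<xi>: "blkd ?\<xi>" by (rule blkd_dmom[OF bu v(1)])
  \<comment> \<open>Solves X M - M X = \<open>dmom u v\<close> for the diagonal matrix M =
    \<open>mom u\<close>. Where l x = l y the division yields 0, and the right side is zero there as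
    well.\<close>
  define X where "X x y = ?\<xi> x y / (l y - l x)" for x y
  have X: "blkd X" using blkdD[OF b\<xi>] by (auto simp: blkd_def X_def)
  have X\<xi>: "X \<diamond> mom u - mom u \<diamond> X = ?\<xi>"
  proof (rule fm_eqI)
    fix x y assume xy: "x \<in> idx" "y \<in> idx"
    show "(X \<diamond> mom u - mom u \<diamond> X) x y = ?\<xi> x y"
    proof (cases "l x = l y")
      case True
      then show ?thesis using \<xi>0[OF xy] xy by (simp add: m pw diag_mm mm_diag X_def)
    next
      case False
      then show ?thesis using xy by (simp add: m pw diag_mm mm_diag X_def divide_simps) (simp add: algebra_simps)
    qed
  qed (use blkd_fm[OF X] blkd_fm[OF b\<xi>] in \<open>auto simp: m intro!: fm_diff fm_mm fm_diag\<close>)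
  define v' where "v' c = v c - gdir X u c" for c
  have bv': "blk v'" unfolding v'_def by (rule blk_diff[OF v(1) blk_gdir[OF bu X]])
  have d': "dR u v' f = dR u v f - dR u (gdir X u) f" for f
    unfolding v'_def by (rule dR_diff_dir)
  have "dmom u v' = dR u v' momA" by (simp add: dR_momA bu bv')
  also have "\<dots> = ?\<xi> - (X \<diamond> mom u - mom u \<diamond> X)"
    unfolding d' using dR_gdir[OF bu blkd_fm[OF X] blkd_comm[OF X] AA_mom]
    by (simp add: dR_momA bu v(1) R_momA)
  finally have "dmom u v' = 0" by (simp add: X\<xi>)
  then obtain g where g: "g \<in> AA" "\<And>c. c \<in> AR \<Longrightarrow> v' c = ham u g c"
    using ker_dmom_ham[OF u bv'] by blast
  have "\<psi> f = tr (R u (path_bracket Q f g))" if f: "f \<in> AA" for f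
  proof -
    have "\<psi> f = tr (dR u v' f)" using v(2)[OF f] d'[of f] tr_gdir[OF bu X f] by (simp add: tr_diff)
    also have "\<dots> = tr (dR u (ham u g) f)" using dR_cong_dir[OF g(2) f] by simp
    finally show ?thesis by (simp add: tr_bracket[OF bu f g(1)])
  qed
  with g(1) show ?thesis by blast
qed

subsection \<open>Curves in the fibres of the moment map\<close>

text \<open>A block diagonal matrix orthogonal to the image has zero infinitesimal action, so by
  fullness it commutes with all matrices and is a scalar; scalars pair to zero with traceless
  matrices.\<close>

lemma dmom_surj:
  assumes u: "full u" and y: "blkd y" "tr y = 0"
  shows "\<exists>v. blk v \<and> dmom u v = y"
proof -
  note bu = full_blk[OF u]
  let ?K = "idx \<times> idx"
  define vec where "vec A = (\<lambda>(x, y). A x y)" for A :: "'v mtx"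
  define W where "W = {vec (dmom u v) | v. blk v}"
  have vi: "vec A = vec B \<Longrightarrow> A = B" for A B by (auto simp: vec_def fun_eq_iff)
  have K: "finite ?K" using finI by auto
  have lin: "dmom u (\<lambda>c. v c + w c) = dmom u v + dmom u w" for v w
    unfolding dmom_def sum.distrib[symmetric] by (intro sum.cong refl) (simp add: mm_add_left mm_add_right)
  have sc: "dmom u (\<lambda>c. mscale z (v c)) = mscale z (dmom u v)" for v z
  proof -
    have "mscale z (\<Sum>a\<in>S. f a) = (\<Sum>a\<in>S. mscale z (f a))" for f :: "'e \<Rightarrow> 'v mtx" and S
      by (simp add: fun_eq_iff pw sum_fun_apply2 sum_distrib_left)
    moreover have "mscale z (A + B) = mscale z A + mscale z B" "mscale z (A - B) = mscale z A - mscale z B" for A B :: "'v mtx"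
      by (simp_all add: fun_eq_iff pw algebra_simps)
    ultimately show ?thesis
      unfolding dmom_def by (simp add: mm_scale_left mm_scale_right)
  qed
  have sub: "fun_vs.subspace W"
  proof (rule fun_vs.subspaceI)
    show "0 \<in> W" unfolding W_def
      by (intro CollectI exI[of _ "\<lambda>_. 0"]) (auto simp: vec_def pw blk_def dmom_def mm_zero_left mm_zero_right)
  next
    fix a b assume "a \<in> W" "b \<in> W"
    then obtain v w where vw: "blk v" "blk w" "a = vec (dmom u v)" "b = vec (dmom u w)" unfolding W_def by blast
    have "blk (\<lambda>c. v c + w c)" using vw(1,2) unfolding blk_def by (simp add: pw del: double_simps) (metis add_0)
    moreover have "a + b = vec (dmom u (\<lambda>c. v c + w c))" by (auto simp: lin vec_def pw vw)
    ultimately show "a + b \<in> W" unfolding W_def by blast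
  next
    fix z a assume "a \<in> W"
    then obtain v where v: "blk v" "a = vec (dmom u v)" unfolding W_def by blast
    have "blk (\<lambda>c. mscale z (v c))" using v(1) unfolding blk_def mscale_apply mult_eq_0_iff by blast
    moreover have "fun_scale z a = vec (dmom u (\<lambda>c. mscale z (v c)))" by (auto simp: sc vec_def pw v fun_scale_def)
    ultimately show "fun_scale z a \<in> W" unfolding W_def by blast
  qed
  have "vec y \<in> W"
  proof (rule ccontr)
    assume n: "vec y \<notin> W"
    have s1: "w k = 0" if w: "w \<in> W" and k: "k \<notin> ?K" for w k
    proof -
      obtain v where v: "blk v" "w = vec (dmom u v)" using w unfolding W_def by blast
      then show ?thesis using fm_zero[OF blkd_fm[OF blkd_dmom[OF bu v(1)]]] k by (cases k) (auto simp: vec_def simp del: idx_iff)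
    qed
    have s2: "vec y k = 0" if k: "k \<notin> ?K" for k
      using fm_zero[OF blkd_fm[OF y(1)]] k by (cases k) (auto simp: vec_def simp del: idx_iff)
    have "\<exists>z. (\<forall>w\<in>W. (\<Sum>k\<in>?K. z k * w k) = 0) \<and> (\<Sum>k\<in>?K. z k * vec y k) \<noteq> 0"
      by (rule separating_functional[OF K sub], erule (1) s1, erule s2, rule n)
    then obtain z where z: "\<forall>w\<in>W. (\<Sum>k\<in>?K. z k * w k) = 0" and zy: "(\<Sum>k\<in>?K. z k * vec y k) \<noteq> 0"
      by blast
    define Z where "Z = (\<lambda>x y. if x \<in> idx \<and> y \<in> idx \<and> fst x = fst y then z (y, x) else 0)"
    have bZ: "blkd Z" by (auto simp: blkd_def Z_def)
    have tZ: "tr (Z \<diamond> A) = (\<Sum>k\<in>?K. z k * vec A k)" if A: "blkd A" for A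
    proof -
      have "tr (Z \<diamond> A) = (\<Sum>x\<in>idx. \<Sum>y\<in>idx. z (y, x) * A y x)"
        unfolding tr_def mm_def
      proof (intro sum.cong refl)
        fix x y assume "x \<in> idx" "y \<in> idx"
        then show "Z x y * A y x = z (y, x) * A y x"
          using blkdD[OF A, of y x] by (cases "A y x = 0") (auto simp: Z_def)
      qed
      also have "\<dots> = (\<Sum>y\<in>idx. \<Sum>x\<in>idx. z (y, x) * A y x)" by (rule sum.swap)
      also have "\<dots> = (\<Sum>k\<in>?K. z k * vec A k)" by (simp add: sum.cartesian_product vec_def split_def)
      finally show ?thesis .
    qed
    have t0: "tr (Z \<diamond> dmom u v) = 0" if "blk v" for v
      using tZ[OF blkd_dmom[OF bu that]] z that unfolding W_def by auto
    have g0: "gdir Z u c = 0" if c: "c \<in> AR" for c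
    proof (rule fm_eqI[OF blk_fm[OF blk_gdir[OF bu bZ] c] fm_0])
      have unit: "tr (munit x y \<diamond> A) = A y x" if "x \<in> idx" "y \<in> idx" for x y A
        using tr_mm_munit[OF that, of A] tr_comm[of A] by simp
      fix y x assume yx: "y \<in> idx" "x \<in> idx"
      show "gdir Z u c y x = 0 y x"
      proof (cases "fst y = hdc c \<and> fst x = tlc c")
        case False
        then show ?thesis using blkD[OF blk_gdir[OF bu bZ] c, of y x] by (auto simp: pw)
      next
        case True
        show ?thesis
        proof (cases c)
          case (Inl a)
          have a: "a \<in> arcs Q" using c Inl by (auto simp: double_arcs)
          \<comment> \<open>A test direction on the reverse arrow isolates one entry of
            \<open>gdir Z u\<close> at this arrow.\<close>
          define v where "v c' = (if c' = Inr a then munit x y else 0)" for c' :: "'e + 'e"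
          have bv: "blk v" using True Inl yx by (auto simp: blk_def v_def munit_def pw)
          have "tr (Z \<diamond> dmom u v) = (\<Sum>a'\<in>arcs Q. if a' = a then gdir Z u (Inl a) y x else 0)"
            unfolding tr_mm_dmom by (intro sum.cong refl) (auto simp: v_def unit yx mm_zero_left tr_0)
          then show ?thesis using t0[OF bv] a Inl by (simp add: pw)
        next
          case (Inr a)
          have a: "a \<in> arcs Q" using c Inr by (auto simp: double_arcs)
          define v where "v c' = (if c' = Inl a then munit x y else 0)" for c' :: "'e + 'e"
          have bv: "blk v" using True Inr yx by (auto simp: blk_def v_def munit_def pw)
          have "tr (Z \<diamond> dmom u v) = (\<Sum>a'\<in>arcs Q. if a' = a then - gdir Z u (Inr a) y x else 0)"
            unfolding tr_mm_dmom by (intro sum.cong refl) (auto simp: v_def unit yx mm_zero_left tr_0)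
          then show ?thesis using t0[OF bv] a Inr by (simp add: pw)
        qed
      qed
    qed
    have "Z \<diamond> A = A \<diamond> Z" if A: "A \<in> fm" for A
    proof -
      obtain f where f: "f \<in> AA" "R u f = A" using u A by (auto simp: full_def)
      have "dR u (gdir Z u) f = dR u (\<lambda>_. 0) f" by (rule dR_cong_dir[OF g0 f(1)])
      also have "\<dots> = dR u (\<lambda>c. 0 - 0) f" by simp
      also have "\<dots> = 0" unfolding dR_diff_dir by simp
      finally show ?thesis using dR_gdir[OF bu blkd_fm[OF bZ] blkd_comm[OF bZ] f(1)] f(2) by simp
    qed
    then obtain k where "Z = mscale k om" using center_fm[OF blkd_fm[OF bZ]] by blast
    then have "tr (Z \<diamond> y) = 0" using y(2) blkd_fm[OF y(1)] by (simp add: mm_scale_left tr_scale mm_om_left)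
    then show False using tZ[OF y(1)] zy by simp
  qed
  then obtain v where v: "blk v" "vec y = vec (dmom u v)" unfolding W_def by blast
  then show ?thesis using vi[OF v(2)] by auto
qed

text \<open>Turns arbitrary coordinates into a block direction, so that the fixed point problem
  lives in a plain coordinate space.\<close>

definition dirs :: "(('e + 'e) \<times> ('v \<times> nat) \<times> ('v \<times> nat) \<Rightarrow> complex) \<Rightarrow> 'e + 'e \<Rightarrow> 'v mtx" where
  "dirs s c = (\<lambda>x y. if x \<in> idx \<and> y \<in> idx \<and> fst x = hdc c \<and> fst y = tlc c then s (c, x, y) else 0)"

lemma blk_dirs: "blk (dirs s)"
  by (auto simp: blk_def dirs_def split: if_splits)

text \<open>A bilinear form of the moment map; on the diagonal it is the second-order term in
  \<open>mom_add\<close>.\<close>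

definition qmom :: "('e + 'e \<Rightarrow> 'v mtx) \<Rightarrow> ('e + 'e \<Rightarrow> 'v mtx) \<Rightarrow> 'v mtx" where
  "qmom v w = (\<Sum>a\<in>arcs Q. v (Inl a) \<diamond> w (Inr a) - v (Inr a) \<diamond> w (Inl a))"

lemma mom_add: "mom (\<lambda>c. u c + v c) = mom u + dmom u v + qmom v v"
  unfolding mom_def dmom_def qmom_def sum.distrib[symmetric]
  by (intro sum.cong refl) (simp add: mm_add_left mm_add_right algebra_simps)

lemma qmom_mom: "qmom v v = mom v" by (simp add: qmom_def mom_def)

lemma tr_mom: "tr (mom v) = 0"
  by (simp add: mom_def tr_sum tr_diff tr_comm[of "v (Inl _)"])

lemma cmod_mm_le:
  assumes "\<And>x y. x \<in> idx \<Longrightarrow> y \<in> idx \<Longrightarrow> cmod (A x y) \<le> a" "\<And>x y. x \<in> idx \<Longrightarrow> y \<in> idx \<Longrightarrow> cmod (B x y) \<le> b"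
    and "0 \<le> a" "x \<in> idx" "y \<in> idx"
  shows "cmod ((A \<diamond> B) x y) \<le> real (card idx) * (a * b)"
proof -
  have "cmod ((A \<diamond> B) x y) \<le> (\<Sum>z\<in>idx. cmod (A x z * B z y))" unfolding mm_def by (rule norm_sum)
  also have "\<dots> \<le> (\<Sum>z\<in>idx. a * b)"
    unfolding norm_mult by (intro sum_mono mult_mono assms norm_ge_zero)
  finally show ?thesis by simp
qed

text \<open>Since \<open>\<mu>\<close> is quadratic with surjective differential, with linear right inverse \<open>\<sigma>\<close> say,
  the solution of \<open>s = t v - \<sigma>(\<mu>(s))\<close> stays in the fibre.\<close>

lemma moment_curve:
  assumes u: "full u" and v: "blk v" and dv: "dmom u v = 0"
  shows "\<exists>S \<epsilon>. \<epsilon> > 0 \<and> (\<forall>t. cmod t < \<epsilon> \<longrightarrow> blk (S t) \<and> mom (\<lambda>c. u c + S t c) = mom u)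
    \<and> (\<forall>c\<in>AR. \<forall>x y. S 0 c x y = 0 \<and> ((\<lambda>t. S t c x y) has_field_derivative v c x y) (at 0))"
proof -
  note bu = full_blk[OF u]
  let ?K = "AR \<times> idx \<times> idx" and ?P = "idx \<times> idx"
  have K: "finite ?K" and P: "finite ?P" using finite_AR finI by auto
  define vec where "vec A = (\<lambda>(x, y). A x y)" for A :: "'v mtx"
  define D where "D s = vec (dmom u (dirs s))" for s
  have da: "dirs (s + s') = (\<lambda>c. dirs s c + dirs s' c)" for s s' by (auto simp: dirs_def fun_eq_iff pw)
  have ds: "dirs (fun_scale z s) = (\<lambda>c. mscale z (dirs s c))" for z s by (auto simp: dirs_def fun_eq_iff pw fun_scale_def)
  have dd: "dirs (\<lambda>j. s j - s' j) = (\<lambda>c. dirs s c - dirs s' c)" for s s' by (auto simp: dirs_def fun_eq_iff pw)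
  have msum: "mscale z (\<Sum>a\<in>S. f a) = (\<Sum>a\<in>S. mscale z (f a))" for z and f :: "'e \<Rightarrow> 'v mtx" and S
    by (simp add: fun_eq_iff pw sum_fun_apply2 sum_distrib_left)
  have mad: "mscale z (A + B) = mscale z A + mscale z B" "mscale z (A - B) = mscale z A - mscale z B" for z and A B :: "'v mtx"
    by (simp_all add: fun_eq_iff pw algebra_simps)
  have linD: "Vector_Spaces.linear fun_scale fun_scale D"
  proof (intro Vector_Spaces.linear.intro fun_vs.vector_space_axioms module_hom.intro module_hom_axioms.intro
      fun_vs.module_axioms)
    fix s s' :: "('e + 'e) \<times> ('v \<times> nat) \<times> ('v \<times> nat) \<Rightarrow> complex"
    have "dmom u (\<lambda>c. dirs s c + dirs s' c) = dmom u (dirs s) + dmom u (dirs s')"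
      unfolding dmom_def sum.distrib[symmetric] by (intro sum.cong refl) (simp add: mm_add_left mm_add_right)
    then show "D (s + s') = D s + D s'" by (auto simp: D_def da vec_def fun_eq_iff pw)
  next
    fix z and s :: "('e + 'e) \<times> ('v \<times> nat) \<times> ('v \<times> nat) \<Rightarrow> complex"
    have "dmom u (\<lambda>c. mscale z (dirs s c)) = mscale z (dmom u (dirs s))"
      unfolding dmom_def by (simp add: msum mad mm_scale_left mm_scale_right)
    then show "D (fun_scale z s) = fun_scale z (D s)"
      unfolding D_def ds by (auto simp: vec_def fun_eq_iff pw fun_scale_def)
  qed
  \<comment> \<open>g is linear everywhere but inverts D only on its range. The argument uses this
    at \<open>qmom w w\<close>, which is in the range since it is block diagonal of trace
    zero.\<close>
  obtain g where g: "Vector_Spaces.linear fun_scale fun_scale g" and gD: "\<And>y. y \<in> range D \<Longrightarrow> D (g y) = y"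
    using fun_endo.linear_exists_right_inverse_on[OF linD fun_vs.subspace_UNIV] by blast
  interpret g: Vector_Spaces.linear fun_scale fun_scale g by (rule g)
  have surj: "vec (qmom w w) \<in> range D" if w: "blk w" for w
  proof -
    obtain v where v: "blk v" "dmom u v = qmom w w"
      using dmom_surj[OF u blkd_mom[OF w] tr_mom] by (auto simp: qmom_mom)
    have "dmom u (dirs (\<lambda>(c, x, y). v c x y)) = dmom u v"
    proof -
      have e: "dirs (\<lambda>(c, x, y). v c x y) c = v c" if "c \<in> AR" for c
      proof (intro ext)
        fix x y
        show "dirs (\<lambda>(c, x, y). v c x y) c x y = v c x y"
          using blkD[OF v(1) that, of x y] by (cases "v c x y = 0") (simp_all add: dirs_def)
      qed
      show ?thesis unfolding dmom_def by (intro sum.cong refl) (simp add: e AR_I)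
    qed
    then show ?thesis using v(2) by (intro range_eqI[of _ _ "\<lambda>(c, x, y). v c x y"]) (simp add: D_def)
  qed
  define \<beta> where "\<beta> s s' k = - g (vec (qmom (dirs s) (dirs s'))) k" for s s' k
  \<comment> \<open>\<Gamma> bounds g by the sum of its matrix entries, N bounds the bilinear term,
    and the 1 added in C makes that constant positive.\<close>
  define \<Gamma> where "\<Gamma> = (\<Sum>k\<in>?K. \<Sum>j\<in>?P. cmod (g (\<lambda>i. if i = j then 1 else 0) k))"
  define N where "N = real (card (arcs Q)) * (2 * real (card idx))"
  have \<Gamma>0: "\<Gamma> \<ge> 0" and N0: "N \<ge> 0" by (auto simp: \<Gamma>_def N_def intro!: sum_nonneg)
  define C where "C = \<Gamma> * N + 1"
  have C: "C > 0" using \<Gamma>0 N0 by (simp add: C_def add_nonneg_pos)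
  have gk: "g y k = (\<Sum>j\<in>?P. g (\<lambda>i. if i = j then 1 else 0) k * y j)" if "\<And>j. j \<notin> ?P \<Longrightarrow> y j = 0" for y k
  proof -
    have "Vector_Spaces.linear fun_scale (*) (\<lambda>y. g y k)"
    proof unfold_locales
      show "g (x + y) k = g x k + g y k" for x y by (simp add: g.add pw)
      show "g (fun_scale z x) k = z * g x k" for z x
        unfolding g.scale by (simp add: fun_scale_def)
    qed
    from linear_functional_expand[OF P that this] show ?thesis by simp
  qed
  have qfm: "qmom (dirs s) (dirs s') \<in> fm" for s s'
    unfolding qmom_def by (intro fm_sum fm_diff fm_mm blk_fm[OF blk_dirs] AR_I)
  have qz: "vec (qmom (dirs s) (dirs s')) j = 0" if "j \<notin> ?P" for s s' j
    using fm_zero[OF qfm] that by (cases j) (auto simp: vec_def simp del: idx_iff)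
  have bound: "cmod (\<beta> s s' k) \<le> C * a * b"
    if k: "k \<in> ?K" and s: "\<And>j. j \<in> ?K \<Longrightarrow> cmod (s j) \<le> a" and s': "\<And>j. j \<in> ?K \<Longrightarrow> cmod (s' j) \<le> b" and a: "0 \<le> a" and b: "0 \<le> b"
    for s s' a b k
  proof -
    have d1: "cmod (dirs s c x y) \<le> a" if "c \<in> AR" "x \<in> idx" "y \<in> idx" for c x y
    proof -
      have "(c, x, y) \<in> ?K" using that by simp
      from s[OF this] a show ?thesis
        by (cases "x \<in> idx \<and> y \<in> idx \<and> fst x = hdc c \<and> fst y = tlc c") (unfold dirs_def, auto simp del: idx_iff)
    qed
    have d2: "cmod (dirs s' c x y) \<le> b" if "c \<in> AR" "x \<in> idx" "y \<in> idx" for c x y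
    proof -
      have "(c, x, y) \<in> ?K" using that by simp
      from s'[OF this] b show ?thesis
        by (cases "x \<in> idx \<and> y \<in> idx \<and> fst x = hdc c \<and> fst y = tlc c") (unfold dirs_def, auto simp del: idx_iff)
    qed
    have q: "cmod (vec (qmom (dirs s) (dirs s')) j) \<le> N * (a * b)" if j: "j \<in> ?P" for j
    proof -
      obtain x y where xy: "j = (x, y)" "x \<in> idx" "y \<in> idx" using j by blast
      have "cmod (qmom (dirs s) (dirs s') x y) \<le> (\<Sum>c\<in>arcs Q. cmod ((dirs s (Inl c) \<diamond> dirs s' (Inr c) - dirs s (Inr c) \<diamond> dirs s' (Inl c)) x y))"
        unfolding qmom_def sum_fun_apply2 by (rule norm_sum)
      also have "\<dots> \<le> (\<Sum>c\<in>arcs Q. real (card idx) * (a * b) + real (card idx) * (a * b))"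
      proof (rule sum_mono)
        fix c assume c: "c \<in> arcs Q"
        show "cmod ((dirs s (Inl c) \<diamond> dirs s' (Inr c) - dirs s (Inr c) \<diamond> dirs s' (Inl c)) x y) \<le> real (card idx) * (a * b) + real (card idx) * (a * b)"
          unfolding minus_apply
          by (rule order_trans[OF norm_triangle_ineq4 add_mono]; rule cmod_mm_le[OF d1 d2 a xy(2,3)]) (use AR_I[OF c] in auto)
      qed
      also have "\<dots> = N * (a * b)" by (simp add: N_def)
      finally show ?thesis by (simp add: vec_def xy)
    qed
    have "cmod (\<beta> s s' k) \<le> (\<Sum>j\<in>?P. cmod (g (\<lambda>i. if i = j then 1 else 0) k * vec (qmom (dirs s) (dirs s')) j))"
    proof -
      have "g (vec (qmom (dirs s) (dirs s'))) k = (\<Sum>j\<in>?P. g (\<lambda>i. if i = j then 1 else 0) k * vec (qmom (dirs s) (dirs s')) j)"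
        by (rule gk) (rule qz)
      then show ?thesis unfolding \<beta>_def norm_minus_cancel by (simp only: norm_sum)
    qed
    also have "\<dots> \<le> (\<Sum>j\<in>?P. cmod (g (\<lambda>i. if i = j then 1 else 0) k) * (N * (a * b)))"
      unfolding norm_mult by (intro sum_mono mult_left_mono q) auto
    also have "\<dots> = (\<Sum>j\<in>?P. cmod (g (\<lambda>i. if i = j then 1 else 0) k)) * (N * (a * b))" by (simp add: sum_distrib_right)
    also have "\<dots> \<le> \<Gamma> * (N * (a * b))"
      unfolding \<Gamma>_def by (intro mult_right_mono member_le_sum[OF k, where f = "\<lambda>k. \<Sum>j\<in>?P. cmod (g (\<lambda>i. if i = j then 1 else 0) k)"])
         (use K N0 a b in \<open>auto intro!: sum_nonneg\<close>)
    also have "\<dots> \<le> C * a * b" using a b by (simp add: C_def algebra_simps)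
    finally show ?thesis .
  qed
  have ql: "vec (qmom (\<lambda>c. s c - s' c) w) = vec (qmom s w) + fun_scale (-1) (vec (qmom s' w))" 
    and qr: "vec (qmom w (\<lambda>c. s c - s' c)) = vec (qmom w s) + fun_scale (-1) (vec (qmom w s'))" for s s' w
  proof -
    have 1: "qmom (\<lambda>c. s c - s' c) w = qmom s w - qmom s' w" "qmom w (\<lambda>c. s c - s' c) = qmom w s - qmom w s'"
      unfolding qmom_def sum_subtractf[symmetric] by (intro sum.cong refl, simp add: mm_diff_left mm_diff_right algebra_simps)+
    show "vec (qmom (\<lambda>c. s c - s' c) w) = vec (qmom s w) + fun_scale (-1) (vec (qmom s' w))"
      "vec (qmom w (\<lambda>c. s c - s' c)) = vec (qmom w s) + fun_scale (-1) (vec (qmom w s'))"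
      unfolding 1 by (auto simp: vec_def fun_scale_def pw)
  qed
  have diffl: "\<beta> (\<lambda>j. s j - s' j) w k = \<beta> s w k - \<beta> s' w k" and diffr: "\<beta> w (\<lambda>j. s j - s' j) k = \<beta> w s k - \<beta> w s' k" for s s' w k
    unfolding \<beta>_def dd ql qr g.add g.scale by (simp_all add: pw fun_scale_def)
  define V where "V = (\<lambda>(c, x, y). v c x y)"
  define r where "r = (\<Sum>k\<in>?K. cmod (V k))"
  have r0: "r \<ge> 0" by (simp add: r_def sum_nonneg)
  \<comment> \<open>Small enough for the condition 8 C r \<le> 1 of
    \<open>quadratic_fixpoint\<close>, with \<open>cmod t * r\<close> in place of r; r + 1 avoids
    division by zero.\<close>
  define \<epsilon> where "\<epsilon> = 1 / (8 * C * (r + 1))"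
  have \<epsilon>: "\<epsilon> > 0" using C r0 by (simp add: \<epsilon>_def)
  have ex: "\<exists>s. (\<forall>k\<in>?K. s k = t * V k + \<beta> s s k) \<and> (\<forall>k\<in>?K. cmod (s k) \<le> 2 * (cmod t * r))" if t: "cmod t < \<epsilon>" for t
  proof (rule quadratic_fixpoint[OF K bound diffl diffr C])
    fix k assume "k \<in> ?K"
    then have "cmod (V k) \<le> r" unfolding r_def using K by (intro member_le_sum) auto
    then show "cmod (t * V k) \<le> cmod t * r" by (simp add: norm_mult mult_left_mono)
  next
    have "8 * C * (cmod t * r) \<le> 8 * C * (\<epsilon> * (r + 1))" using t r0 C \<epsilon> by (intro mult_left_mono mult_mono) auto
    also have "\<dots> = 1" using C r0 by (simp add: \<epsilon>_def)
    finally show "8 * C * (cmod t * r) \<le> 1" .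
  qed (use r0 in auto)
  define s where "s t = (SOME s. (\<forall>k\<in>?K. s k = t * V k + \<beta> s s k) \<and> (\<forall>k\<in>?K. cmod (s k) \<le> 2 * (cmod t * r)))" for t
  have s: "s t k = t * V k + \<beta> (s t) (s t) k" "cmod (s t k) \<le> 2 * (cmod t * r)" if "cmod t < \<epsilon>" "k \<in> ?K" for t k
    using someI_ex[OF ex[OF that(1)]] that(2) unfolding s_def by blast+
  define S where "S t = dirs (s t)" for t
  have mS: "mom (\<lambda>c. u c + S t c) = mom u" if t: "cmod t < \<epsilon>" for t
  proof -
    let ?y = "vec (qmom (S t) (S t))"
    have Sc: "S t c = mscale t (v c) - dirs (g ?y) c" if c: "c \<in> AR" for c
    proof (intro ext)
      fix x y
      show "S t c x y = (mscale t (v c) - dirs (g ?y) c) x y"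
      proof (cases "x \<in> idx \<and> y \<in> idx \<and> fst x = hdc c \<and> fst y = tlc c")
        case True
        then show ?thesis using s(1)[OF t, of "(c, x, y)"] c by (simp add: S_def dirs_def \<beta>_def V_def pw)
      next
        case False
        then have "v c x y = 0" using blkD[OF v c] by blast
        then show ?thesis using False by (auto simp: S_def dirs_def pw)
      qed
    qed
    have "dmom u (S t) = mscale t (dmom u v) - dmom u (dirs (g ?y))"
      unfolding dmom_def msum sum_subtractf[symmetric]
      by (intro sum.cong refl, simp only: Sc[OF AR_I(1)] Sc[OF AR_I(2)])
         (simp add: mm_diff_left mm_diff_right mm_scale_left mm_scale_right mad)
    also have "dmom u (dirs (g ?y)) = qmom (S t) (S t)"
    proof -
      have "D (g ?y) = ?y" by (rule gD) (simp add: surj S_def blk_dirs)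
      then show ?thesis by (auto simp: D_def vec_def fun_eq_iff)
    qed
    finally show ?thesis by (simp add: mom_add dv del: uminus_apply)
  qed
  \<comment> \<open>The correction is quadratic in t, so the curve passes through 0 with velocity
    v.\<close>
  have est: "cmod (S t c x y - t * v c x y) \<le> (4 * C * r^2) * (cmod t)^2" if t: "cmod t < \<epsilon>" and c: "c \<in> AR" for t c x y
  proof (cases "x \<in> idx \<and> y \<in> idx \<and> fst x = hdc c \<and> fst y = tlc c")
    case True
    then have k: "(c, x, y) \<in> ?K" using c by blast
    have "S t c x y - t * v c x y = \<beta> (s t) (s t) (c, x, y)"
      using s(1)[OF t k] True by (simp add: S_def dirs_def V_def)
    moreover have "cmod (\<beta> (s t) (s t) (c, x, y)) \<le> C * (2 * (cmod t * r)) * (2 * (cmod t * r))"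
      by (rule bound[OF k s(2)[OF t] s(2)[OF t]]) (use r0 in auto)
    ultimately show ?thesis by (simp add: power2_eq_square mult_ac)
  next
    case False
    then have "v c x y = 0" using blkD[OF v c] by blast
    then show ?thesis using False C by (auto simp: S_def dirs_def)
  qed
  have S0: "S 0 c x y = 0" if c: "c \<in> AR" for c x y using est[of 0 c x y] c \<epsilon> by simp
  have deriv: "((\<lambda>t. S t c x y) has_field_derivative v c x y) (at 0)" if c: "c \<in> AR" for c x y
    unfolding DERIV_def
  proof (rule Lim_null[THEN iffD2], rule Lim_null_comparison)
    show "\<forall>\<^sub>F h in at 0. norm ((S (0 + h) c x y - S 0 c x y) / h - v c x y) \<le> (4 * C * r^2) * cmod h"
    proof (rule eventually_at[THEN iffD2], intro exI[of _ \<epsilon>] conjI \<epsilon> ballI impI)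
      fix h :: complex assume h: "h \<noteq> 0 \<and> dist h 0 < \<epsilon>"
      have "(S (0 + h) c x y - S 0 c x y) / h - v c x y = (S h c x y - h * v c x y) / h"
        using h S0[OF c] by (simp add: diff_divide_distrib)
      then have "norm ((S (0 + h) c x y - S 0 c x y) / h - v c x y) = cmod (S h c x y - h * v c x y) / cmod h"
        by (simp add: norm_divide)
      also have "\<dots> \<le> ((4 * C * r^2) * (cmod h)^2) / cmod h"
        using est[of h c x y] h c by (intro divide_right_mono) auto
      also have "\<dots> = (4 * C * r^2) * cmod h" using h by (simp add: power2_eq_square)
      finally show "norm ((S (0 + h) c x y - S 0 c x y) / h - v c x y) \<le> (4 * C * r^2) * cmod h" .
    qed
    have "((\<lambda>h. (4 * C * r^2) * cmod h) \<longlongrightarrow> (4 * C * r^2) * cmod 0) (at (0::complex))"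
      by (intro tendsto_intros)
    then show "((\<lambda>h. (4 * C * r^2) * cmod h) \<longlongrightarrow> 0) (at (0::complex))" by simp
  qed
  show ?thesis
    by (intro exI[of _ S] exI[of _ \<epsilon>]) (use \<epsilon> mS S0 deriv in \<open>auto simp: S_def blk_dirs simp del: double_simps\<close>)
qed

section \<open>From families of matrices to matrices over the total index set\<close>

lemma sum_block:
  assumes i: "i \<in> verts Q" and z: "\<And>z. z \<in> idx \<Longrightarrow> fst z \<noteq> i \<Longrightarrow> F z = (0::complex)"
  shows "(\<Sum>z\<in>idx. F z) = (\<Sum>k<d i. F (i, k))"
proof -
  have "(\<Sum>z\<in>idx. F z) = (\<Sum>z\<in>Pair i ` {..<d i}. F z)"
  proof (rule sum.mono_neutral_right[OF finI])
    show "Pair i ` {..<d i} \<subseteq> idx" using i by auto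
    show "\<forall>w\<in>idx - Pair i ` {..<d i}. F w = 0"
    proof
      fix w assume w: "w \<in> idx - Pair i ` {..<d i}"
      then have "fst w \<noteq> i" by (cases w) auto
      then show "F w = 0" using z w by blast
    qed
  qed
  also have "\<dots> = (\<Sum>k<d i. F (i, k))" by (subst sum.reindex) (auto simp: inj_on_def)
  finally show ?thesis .
qed

definition bm :: "'v \<Rightarrow> 'v \<Rightarrow> 'v mtx \<Rightarrow> complex mat" where
  "bm i j A = Matrix.mat (d i) (d j) (\<lambda>(p, q). A (i, p) (j, q))"

lemma bm_carrier [simp]: "bm i j A \<in> carrier_mat (d i) (d j)" "dim_row (bm i j A) = d i" "dim_col (bm i j A) = d j"
  by (simp_all add: bm_def)

lemma bm_index [simp]: "p < d i \<Longrightarrow> q < d j \<Longrightarrow> bm i j A $$ (p, q) = A (i, p) (j, q)"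
  by (simp add: bm_def)

lemma bm_mult:
  assumes j: "j \<in> verts Q" and z: "\<And>p z. p < d i \<Longrightarrow> z \<in> idx \<Longrightarrow> fst z \<noteq> j \<Longrightarrow> A (i, p) z = 0"
  shows "bm i k (A \<diamond> B) = bm i j A * bm j k B"
proof (rule eq_matI)
  fix p q assume "p < dim_row (bm i j A * bm j k B)" "q < dim_col (bm i j A * bm j k B)"
  then have pq: "p < d i" "q < d k" by simp_all
  have "(A \<diamond> B) (i, p) (k, q) = (\<Sum>l<d j. A (i, p) (j, l) * B (j, l) (k, q))"
    unfolding mm_def by (rule sum_block[OF j]) (simp add: z[OF pq(1)])
  then show "bm i k (A \<diamond> B) $$ (p, q) = (bm i j A * bm j k B) $$ (p, q)"
    using pq by (simp add: scalar_prod_def atLeast0LessThan)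
qed simp_all

definition gfam :: "'v mtx \<Rightarrow> 'v \<Rightarrow> complex mat" where
  "gfam A = (\<lambda>i\<in>verts Q. bm i i A)"

definition gent :: "('v \<Rightarrow> complex mat) \<Rightarrow> 'v mtx" where
  "gent x = (\<lambda>a b. if a \<in> idx \<and> b \<in> idx \<and> fst a = fst b then x (fst a) $$ (snd a, snd b) else 0)"

definition rho :: "('e + 'e \<Rightarrow> 'v mtx) \<Rightarrow> 'e + 'e \<Rightarrow> complex mat" where
  "rho u = (\<lambda>c\<in>AR. bm (hdc c) (tlc c) (u c))"

text \<open>\<open>ent \<rho>\<close> is a block representation for every \<rho>, also outside
  \<open>rep_space\<close>, so identities between trace functions hold without side conditions. It
  recovers u from \<open>rho u\<close> on arrows only, hence the congruence lemmas.\<close>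

definition ent :: "('e + 'e \<Rightarrow> complex mat) \<Rightarrow> 'e + 'e \<Rightarrow> 'v mtx" where
  "ent \<rho> c = (\<lambda>a b. if a \<in> idx \<and> b \<in> idx \<and> fst a = hdc c \<and> fst b = tlc c then \<rho> c $$ (snd a, snd b) else 0)"

lemma blk_ent: "blk (ent \<rho>)" by (auto simp: blk_def ent_def split: if_splits)

lemma blkd_gent: "blkd (gent x)" by (auto simp: blkd_def gent_def split: if_splits)

lemma rho_in: "rho u \<in> rep_space Q d"
  by (auto simp: rep_space_def mat_families_def rho_def row_dim_def col_dim_def)

lemma gfam_in: "gfam A \<in> mat_families (verts Q) d d"
  by (auto simp: mat_families_def gfam_def)

lemma ent_rho: "blk u \<Longrightarrow> c \<in> AR \<Longrightarrow> ent (rho u) c = u c"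
proof (intro ext)
  fix a b assume u: "blk u" and c: "c \<in> AR"
  show "ent (rho u) c a b = u c a b"
    using blkD[OF u c, of a b] c
    by (cases a; cases b; cases "u c a b = 0") (auto simp: ent_def rho_def)
qed

lemma rho_ent: "\<rho> \<in> rep_space Q d \<Longrightarrow> rho (ent \<rho>) = \<rho>"
proof
  fix c assume r: "\<rho> \<in> rep_space Q d"
  show "rho (ent \<rho>) c = \<rho> c"
  proof (cases "c \<in> AR")
    case True
    then have c: "\<rho> c \<in> carrier_mat (d (hdc c)) (d (tlc c))"
      using r by (auto simp: rep_space_def mat_families_def row_dim_def col_dim_def PiE_iff)
    show ?thesis
      by (rule eq_matI) (use True c AR_verts[OF True] in \<open>auto simp: rho_def ent_def\<close>)
  next
    case False
    then show ?thesis using r by (auto simp: rho_def rep_space_def mat_families_def PiE_iff extensional_def)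
  qed
qed

lemma gent_gfam: "blkd A \<Longrightarrow> gent (gfam A) = A"
proof (intro ext)
  fix a b assume A: "blkd A"
  show "gent (gfam A) a b = A a b"
    using blkdD[OF A, of a b] by (cases a; cases b; cases "A a b = 0") (auto simp: gent_def gfam_def)
qed

lemma gfam_gent: "x \<in> mat_families (verts Q) d d \<Longrightarrow> gfam (gent x) = x"
proof
  fix i assume x: "x \<in> mat_families (verts Q) d d"
  show "gfam (gent x) i = x i"
  proof (cases "i \<in> verts Q")
    case True
    then have "x i \<in> carrier_mat (d i) (d i)" using x by (auto simp: mat_families_def PiE_iff)
    then show ?thesis by (intro eq_matI) (use True in \<open>auto simp: gfam_def gent_def\<close>)
  next
    case False
    then show ?thesis using x by (auto simp: gfam_def mat_families_def PiE_iff extensional_def)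
  qed
qed

lemma rho_cong: "(\<And>c. c \<in> AR \<Longrightarrow> u c = v c) \<Longrightarrow> rho u = rho v"
  by (auto simp: rho_def)

lemma R_cong: "f \<in> AA \<Longrightarrow> (\<And>c. c \<in> AR \<Longrightarrow> u c = v c) \<Longrightarrow> R u f = R v f"
proof (induction f rule: AA_induct)
  case (single p z)
  have "evw u i cs = evw v i cs" if "(i, cs) \<in> paths Q" for i cs
    using that single(2) by (induction cs arbitrary: i) (auto simp: paths_Cons simp del: double_simps)
  from this[of "fst p" "snd p"] show ?case using single(1) by (simp add: R_single)
qed (simp_all add: R_add)

lemma mom_cong: "(\<And>c. c \<in> AR \<Longrightarrow> u c = v c) \<Longrightarrow> mom u = mom v"
  unfolding mom_def by (intro sum.cong refl) (simp add: AR_I)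

lemma mat_trace_bm: "mat_trace (bm i i A) = (\<Sum>k<d i. A (i, k) (i, k))"
  by (simp add: mat_trace_def)

lemma tr_blocks: "tr A = (\<Sum>i\<in>verts Q. mat_trace (bm i i A))"
proof -
  have "tr A = (\<Sum>i\<in>verts Q. \<Sum>k<d i. A (i, k) (i, k))"
  proof -
    have "tr A = (\<Sum>x\<in>Sigma (verts Q) (\<lambda>i. {..<d i}). A x x)" unfolding tr_def by (simp only: idx_def)
    also have "\<dots> = (\<Sum>i\<in>verts Q. \<Sum>k<d i. A (i, k) (i, k))" by (subst sum.Sigma) (auto simp: split_def)
    finally show ?thesis .
  qed
  then show ?thesis by (simp add: mat_trace_bm)
qed

lemma gfam_sg: "gfam A \<in> sg Q d \<longleftrightarrow> tr A = 0"
  using gfam_in[of A] by (simp add: sg_def tr_blocks gfam_def)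

lemma finsum_gl:
  assumes "finite S" "\<And>a. a \<in> S \<Longrightarrow> f a \<in> carrier_mat n n"
  shows "finsum (gl_ring n) f S \<in> carrier_mat n n \<and> (\<forall>p<n. \<forall>q<n. finsum (gl_ring n) f S $$ (p, q) = (\<Sum>a\<in>S. f a $$ (p, q)))"
  using assms
proof (induction S rule: finite_induct)
  interpret gl: ring "gl_ring n" by (rule ring_mat)
  case empty
  show ?case using gl.finsum_empty[of f] by (simp add: ring_mat_simps)
next
  interpret gl: ring "gl_ring n" by (rule ring_mat)
  case (insert a S)
  have "finsum (gl_ring n) f (insert a S) = f a + finsum (gl_ring n) f S"
    using gl.finsum_insert[OF insert.hyps, of f] insert.prems by (auto simp: ring_mat_simps)
  then show ?case using insert by auto
qed

text \<open>In the sum of commutators over all arrows, the block at i sees only products that start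
  and end at i: arrows with head i in the first term, with tail i in the second.\<close>

lemma moment_map_ent:
  assumes r: "\<rho> \<in> rep_space Q d"
  shows "moment_map Q d \<rho> = gfam (mom (ent \<rho>))"
proof
  fix i
  show "moment_map Q d \<rho> i = gfam (mom (ent \<rho>)) i"
  proof (cases "i \<in> verts Q")
    case False
    then show ?thesis by (simp add: moment_map_def gfam_def)
  next
    case i: True
    have c: "\<rho> c = bm (hdc c) (tlc c) (ent \<rho> c)" if "c \<in> AR" for c
      using fun_cong[OF rho_ent[OF r], of c] that by (simp add: rho_def)
    have supp: "ent \<rho> c (a, p) z = 0" if "c \<in> AR" "fst z \<noteq> tlc c \<or> a \<noteq> hdc c" for c a p z
      using that by (auto simp: ent_def)
    let ?h = "\<lambda>a. \<rho> (Inl a) * \<rho> (Inr a)" and ?t = "\<lambda>a. \<rho> (Inr a) * \<rho> (Inl a)"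
    have h: "?h a = bm i i (ent \<rho> (Inl a) \<diamond> ent \<rho> (Inr a))" if "a \<in> {a \<in> arcs Q. head Q a = i}" for a
      using that bm_mult[of "tail Q a" i "ent \<rho> (Inl a)" i "ent \<rho> (Inr a)"] c[OF AR_I(1)[of a]] c[OF AR_I(2)[of a]]
        supp[OF AR_I(1)[of a]] by (auto simp: AR_verts)
    have t: "?t a = bm i i (ent \<rho> (Inr a) \<diamond> ent \<rho> (Inl a))" if "a \<in> {a \<in> arcs Q. tail Q a = i}" for a
      using that bm_mult[of "head Q a" i "ent \<rho> (Inr a)" i "ent \<rho> (Inl a)"] c[OF AR_I(1)[of a]] c[OF AR_I(2)[of a]]
        supp[OF AR_I(2)[of a]] by (auto simp: AR_verts)
    have fin: "finite {a \<in> arcs Q. P a}" for P by simp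
    have H: "finsum (gl_ring (d i)) ?h {a \<in> arcs Q. head Q a = i} \<in> carrier_mat (d i) (d i)"
      "p < d i \<Longrightarrow> q < d i \<Longrightarrow> finsum (gl_ring (d i)) ?h {a \<in> arcs Q. head Q a = i} $$ (p, q) = (\<Sum>a\<in>{a \<in> arcs Q. head Q a = i}. ?h a $$ (p, q))"
      and T: "finsum (gl_ring (d i)) ?t {a \<in> arcs Q. tail Q a = i} \<in> carrier_mat (d i) (d i)"
      "p < d i \<Longrightarrow> q < d i \<Longrightarrow> finsum (gl_ring (d i)) ?t {a \<in> arcs Q. tail Q a = i} $$ (p, q) = (\<Sum>a\<in>{a \<in> arcs Q. tail Q a = i}. ?t a $$ (p, q))"
      for p q
      using finsum_gl[OF fin, of "\<lambda>a. head Q a = i" ?h "d i"] finsum_gl[OF fin, of "\<lambda>a. tail Q a = i" ?t "d i"] h t by auto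
    have mmz: "(ent \<rho> (Inl a) \<diamond> ent \<rho> (Inr a)) (i, p) (i, q) = 0" if "a \<in> arcs Q" "head Q a \<noteq> i" for a p q
      unfolding mm_def by (rule sum.neutral) (use that supp[OF AR_I(1)[of a]] in auto)
    have mmz': "(ent \<rho> (Inr a) \<diamond> ent \<rho> (Inl a)) (i, p) (i, q) = 0" if "a \<in> arcs Q" "tail Q a \<noteq> i" for a p q
      unfolding mm_def by (rule sum.neutral) (use that supp[OF AR_I(2)[of a]] in auto)
    have e: "(\<Sum>a\<in>{a \<in> arcs Q. head Q a = i}. ?h a $$ (p, q)) - (\<Sum>a\<in>{a \<in> arcs Q. tail Q a = i}. ?t a $$ (p, q))
       = mom (ent \<rho>) (i, p) (i, q)" if pq: "p < d i" "q < d i" for p q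
    proof -
      have "(\<Sum>a\<in>{a \<in> arcs Q. head Q a = i}. ?h a $$ (p, q)) = (\<Sum>a\<in>arcs Q. (ent \<rho> (Inl a) \<diamond> ent \<rho> (Inr a)) (i, p) (i, q))"
        by (rule sum.mono_neutral_cong_left) (use h pq mmz in auto)
      moreover have "(\<Sum>a\<in>{a \<in> arcs Q. tail Q a = i}. ?t a $$ (p, q)) = (\<Sum>a\<in>arcs Q. (ent \<rho> (Inr a) \<diamond> ent \<rho> (Inl a)) (i, p) (i, q))"
        by (rule sum.mono_neutral_cong_left) (use t pq mmz' in auto)
      ultimately show ?thesis by (simp add: mom_def sum_fun_apply2 pw sum_subtractf)
    qed
    show ?thesis
      by (rule eq_matI) (use i H T e in \<open>auto simp: moment_map_def gfam_def\<close>)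
  qed
qed

section \<open>The gauge group\<close>

text \<open>An element of the product of general linear groups together with its inverse, so that
  conjugation is written with products only.\<close>

definition inv_pair :: "'v mtx \<Rightarrow> 'v mtx \<Rightarrow> bool" where
  "inv_pair G H \<longleftrightarrow> blkd G \<and> blkd H \<and> G \<diamond> H = om \<and> H \<diamond> G = om"

definition cj :: "'v mtx \<Rightarrow> 'v mtx \<Rightarrow> ('e + 'e \<Rightarrow> 'v mtx) \<Rightarrow> 'e + 'e \<Rightarrow> 'v mtx" where
  "cj G H u = (\<lambda>c. G \<diamond> u c \<diamond> H)"

lemma inv_pair_sym: "inv_pair G H \<Longrightarrow> inv_pair H G" by (auto simp: inv_pair_def)

lemma blkd_mm: "blkd A \<Longrightarrow> blkd B \<Longrightarrow> blkd (A \<diamond> B)"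
  by (simp add: blkd_iff fm_mm mm_assoc) (simp add: mm_assoc[symmetric])

lemma blkd_om: "blkd om" by (auto simp: blkd_def om_def)
lemma blkd_scale: "blkd A \<Longrightarrow> blkd (mscale z A)" unfolding blkd_def mscale_apply mult_eq_0_iff by blast
lemma blkd_add: "blkd A \<Longrightarrow> blkd B \<Longrightarrow> blkd (A + B)" by (simp add: blkd_iff fm_add mm_add_left mm_add_right)
lemma blkd_diff: "blkd A \<Longrightarrow> blkd B \<Longrightarrow> blkd (A - B)" by (simp add: blkd_iff fm_diff mm_diff_left mm_diff_right)

lemma inv_cancel: "inv_pair G H \<Longrightarrow> A \<in> fm \<Longrightarrow> G \<diamond> (H \<diamond> A) = A"
  by (simp add: inv_pair_def mm_assoc[symmetric] mm_om_left)

lemma inv_pair_mult: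
  assumes "inv_pair G H" "inv_pair G' H'" shows "inv_pair (G \<diamond> G') (H' \<diamond> H)"
proof -
  have "G \<diamond> (G' \<diamond> (H' \<diamond> H)) = om" "H' \<diamond> (H \<diamond> (G \<diamond> G')) = om"
    using assms inv_cancel[OF assms(2), of H] inv_cancel[OF inv_pair_sym[OF assms(1)], of G']
    by (auto simp: inv_pair_def blkd_fm)
  then show ?thesis using assms by (simp add: inv_pair_def blkd_mm mm_assoc)
qed

lemma inv_pair_om: "inv_pair om om"
  by (simp add: inv_pair_def blkd_om mm_om_left fm_om)

lemma bm_blkd_mult:
  assumes i: "i \<in> verts Q" and A: "blkd A"
  shows "bm i k (A \<diamond> B) = bm i i A * bm i k B"
proof (rule bm_mult[OF i])
  fix p and z :: "'v \<times> nat" assume "fst z \<noteq> i"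
  then show "A (i, p) z = 0" using blkdD[OF A, of "(i, p)" z] by auto
qed

lemma bm_om: "i \<in> verts Q \<Longrightarrow> bm i i om = 1\<^sub>m (d i)"
  by (rule eq_matI) (auto simp: om_def)

lemma inv_bm:
  assumes "inv_pair G H" "i \<in> verts Q"
  shows "bm i i G \<in> Units (gl_ring (d i))" "inv\<^bsub>gl_ring (d i)\<^esub> (bm i i G) = bm i i H"
proof -
  interpret gl: ring "gl_ring (d i)" by (rule ring_mat)
  have *: "bm i i G * bm i i H = 1\<^sub>m (d i)" "bm i i H * bm i i G = 1\<^sub>m (d i)"
    using assms bm_blkd_mult[of i G i H] bm_blkd_mult[of i H i G] by (auto simp: inv_pair_def bm_om)
  then show "bm i i G \<in> Units (gl_ring (d i))"
    unfolding Units_def by (auto simp: ring_mat_simps intro!: bexI[of _ "bm i i H"])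
  show "inv\<^bsub>gl_ring (d i)\<^esub> (bm i i G) = bm i i H"
    using gl.inv_char[of "bm i i G" "bm i i H"] * by (simp add: ring_mat_simps)
qed

lemma GL_product_carrier: "carrier (GL_product Q d) = (\<Pi>\<^sub>E i\<in>verts Q. Units (gl_ring (d i)))"
  by (simp add: GL_product_def units_of_def)

lemma gfam_GL: "inv_pair G H \<Longrightarrow> gfam G \<in> carrier (GL_product Q d)"
  by (auto simp: GL_product_carrier gfam_def inv_bm)

lemma GL_gfam:
  assumes g: "g \<in> carrier (GL_product Q d)"
  shows "\<exists>G H. inv_pair G H \<and> g = gfam G"
proof -
  have u: "g i \<in> Units (gl_ring (d i))" if "i \<in> verts Q" for i
    using g that by (auto simp: GL_product_carrier PiE_iff)
  define h where "h i = inv\<^bsub>gl_ring (d i)\<^esub> (g i)" for i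
  have gm: "g \<in> mat_families (verts Q) d d"
    using g by (auto simp: GL_product_carrier mat_families_def Units_def ring_mat_simps PiE_iff)
  define G where "G = gent g"
  define H where "H = gent (restrict h (verts Q))"
  have gh: "g i \<in> carrier_mat (d i) (d i)" "h i \<in> carrier_mat (d i) (d i)" "g i * h i = 1\<^sub>m (d i)" "h i * g i = 1\<^sub>m (d i)"
    if i: "i \<in> verts Q" for i
  proof -
    interpret gl: ring "gl_ring (d i)" by (rule ring_mat)
    show "g i \<in> carrier_mat (d i) (d i)" "h i \<in> carrier_mat (d i) (d i)" "g i * h i = 1\<^sub>m (d i)" "h i * g i = 1\<^sub>m (d i)"
      using u[OF i] gl.Units_closed[OF u[OF i]] gl.Units_inv_closed[OF u[OF i]] gl.Units_r_inv[OF u[OF i]] gl.Units_l_inv[OF u[OF i]]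
      by (simp_all add: ring_mat_simps h_def)
  qed
  have hm: "restrict h (verts Q) \<in> mat_families (verts Q) d d" using gh by (auto simp: mat_families_def)
  have b: "blkd G" "blkd H" by (simp_all add: G_def H_def blkd_gent)
  have Gg: "bm i i G = g i" "bm i i H = h i" if "i \<in> verts Q" for i
    using fun_cong[OF gfam_gent[OF gm], of i] fun_cong[OF gfam_gent[OF hm], of i] that by (simp_all add: gfam_def G_def H_def)
  have one: "A = om" if A: "blkd A" and e: "\<And>i. i \<in> verts Q \<Longrightarrow> bm i i A = 1\<^sub>m (d i)" for A
  proof -
    have "gfam A = gfam om" unfolding gfam_def by (rule restrict_ext) (simp only: e bm_om)
    then have "gent (gfam A) = gent (gfam om)" by (rule arg_cong)
    then show ?thesis unfolding gent_gfam[OF A] gent_gfam[OF blkd_om] .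
  qed
  have "G \<diamond> H = om"
  proof (rule one[OF blkd_mm[OF b]])
    fix i assume i: "i \<in> verts Q"
    show "bm i i (G \<diamond> H) = 1\<^sub>m (d i)" unfolding bm_blkd_mult[OF i b(1)] Gg[OF i] by (rule gh(3)[OF i])
  qed
  moreover have "H \<diamond> G = om"
  proof (rule one[OF blkd_mm[OF b(2,1)]])
    fix i assume i: "i \<in> verts Q"
    show "bm i i (H \<diamond> G) = 1\<^sub>m (d i)" unfolding bm_blkd_mult[OF i b(2)] Gg[OF i] by (rule gh(4)[OF i])
  qed
  ultimately have "inv_pair G H" using b by (simp add: inv_pair_def)
  moreover have "g = gfam G" by (simp add: G_def gfam_gent[OF gm])
  ultimately show ?thesis by blast
qed

lemma conj_rep_gfam:
  assumes GH: "inv_pair G H" and r: "\<rho> \<in> rep_space Q d"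
  shows "conj_rep Q d (gfam G) \<rho> = rho (cj G H (ent \<rho>))"
proof
  fix c
  show "conj_rep Q d (gfam G) \<rho> c = rho (cj G H (ent \<rho>)) c"
  proof (cases "c \<in> AR")
    case True
    note v = AR_verts[OF True]
    have c: "\<rho> c = bm (hdc c) (tlc c) (ent \<rho> c)"
      using fun_cong[OF rho_ent[OF r], of c] True by (simp add: rho_def)
    have "bm (hdc c) (tlc c) (G \<diamond> ent \<rho> c \<diamond> H) = bm (hdc c) (tlc c) (G \<diamond> ent \<rho> c) * bm (tlc c) (tlc c) H"
    proof (rule bm_mult[OF v(2)])
      fix p and z :: "'v \<times> nat" assume "fst z \<noteq> tlc c"
      then show "(G \<diamond> ent \<rho> c) (hdc c, p) z = 0" unfolding mm_def by (intro sum.neutral) (auto simp: ent_def)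
    qed
    also have "bm (hdc c) (tlc c) (G \<diamond> ent \<rho> c) = bm (hdc c) (hdc c) G * bm (hdc c) (tlc c) (ent \<rho> c)"
      using GH v by (intro bm_blkd_mult) (auto simp: inv_pair_def)
    finally show ?thesis
      using True v inv_bm(2)[OF GH v(2)] by (simp add: conj_rep_def rho_def cj_def gfam_def flip: c)
  next
    case False
    then show ?thesis by (simp add: conj_rep_def rho_def)
  qed
qed

lemma conj_gl_gfam:
  assumes GH: "inv_pair G H" and x: "x \<in> mat_families (verts Q) d d"
  shows "conj_gl Q d (gfam G) x = gfam (G \<diamond> gent x \<diamond> H)"
proof
  fix i
  show "conj_gl Q d (gfam G) x i = gfam (G \<diamond> gent x \<diamond> H) i"
  proof (cases "i \<in> verts Q")
    case True
    have c: "x i = bm i i (gent x)" using fun_cong[OF gfam_gent[OF x], of i] True by (simp add: gfam_def)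
    have b: "blkd G" "blkd H" using GH by (auto simp: inv_pair_def)
    have "bm i i (G \<diamond> gent x \<diamond> H) = bm i i G * bm i i (gent x) * bm i i H"
      by (simp add: bm_blkd_mult True b blkd_mm blkd_gent)
    then show ?thesis
      using True inv_bm(2)[OF GH True] by (simp add: conj_gl_def gfam_def flip: c)
  qed (simp add: conj_gl_def gfam_def)
qed

lemma inv_pair_scale: "z \<noteq> 0 \<Longrightarrow> inv_pair G H \<Longrightarrow> inv_pair (mscale z G) (mscale (inverse z) H)"
  by (simp add: inv_pair_def blkd_scale mm_scale_left mm_scale_right)

lemma scalar_mult_gfam:
  assumes "inv_pair G H" "z \<noteq> 0"
  shows "scalar_family Q d z \<otimes>\<^bsub>GL_product Q d\<^esub> gfam G = gfam (mscale z G)"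
proof -
  have "(z \<cdot>\<^sub>m 1\<^sub>m (d i)) * bm i i G = bm i i (mscale z G)" for i
  proof -
    have "(z \<cdot>\<^sub>m 1\<^sub>m (d i)) * bm i i G = z \<cdot>\<^sub>m (1\<^sub>m (d i) * bm i i G)"
      by (rule mult_smult_assoc_mat) auto
    also have "\<dots> = bm i i (mscale z G)" by (rule eq_matI) (auto simp: pw)
    finally show ?thesis .
  qed
  then show ?thesis
    by (auto simp: GL_product_def scalar_family_def gfam_def units_of_def ring_mat_simps fun_eq_iff)
qed

lemma cosets:
  assumes GH: "inv_pair G H"
  defines "Hs \<equiv> {scalar_family Q d z | z. z \<noteq> 0}"
  shows "Hs #>\<^bsub>GL_product Q d\<^esub> gfam G = {gfam (mscale z G) | z. z \<noteq> 0}"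
  using scalar_mult_gfam[OF GH] unfolding r_coset_def Hs_def by auto

lemma gauge_carrier:
  "carrier (gauge_group Q d) = {{gfam (mscale z G) | z. z \<noteq> 0} | G. \<exists>H. inv_pair G H}"
proof -
  let ?Hs = "{scalar_family Q d z | z. z \<noteq> 0}"
  have "carrier (gauge_group Q d) = {?Hs #>\<^bsub>GL_product Q d\<^esub> g | g. g \<in> carrier (GL_product Q d)}"
    unfolding gauge_group_def FactGroup_def RCOSETS_def by auto
  also have "\<dots> = {{gfam (mscale z G) | z. z \<noteq> 0} | G. \<exists>H. inv_pair G H}"
  proof (rule equalityI; rule subsetI)
    fix U assume "U \<in> {?Hs #>\<^bsub>GL_product Q d\<^esub> g | g. g \<in> carrier (GL_product Q d)}"
    then obtain g where U: "U = ?Hs #>\<^bsub>GL_product Q d\<^esub> g" and g: "g \<in> carrier (GL_product Q d)" by blast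
    obtain G H where "inv_pair G H" "g = gfam G" using GL_gfam[OF g] by blast
    then show "U \<in> {{gfam (mscale z G) | z. z \<noteq> 0} | G. \<exists>H. inv_pair G H}" using cosets U by blast
  next
    fix U assume "U \<in> {{gfam (mscale z G) | z. z \<noteq> 0} | G. \<exists>H. inv_pair G H}"
    then obtain G H where U: "U = {gfam (mscale z G) | z. z \<noteq> 0}" and GH: "inv_pair G H" by blast
    then show "U \<in> {?Hs #>\<^bsub>GL_product Q d\<^esub> g | g. g \<in> carrier (GL_product Q d)}"
      using cosets[OF GH] gfam_GL[OF GH] by blast
  qed
  finally show ?thesis .
qed

lemma gauge_one: "\<one>\<^bsub>gauge_group Q d\<^esub> = {scalar_family Q d z | z. z \<noteq> 0}"
  by (simp add: gauge_group_def FactGroup_def)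

lemma cj_scale: "z \<noteq> 0 \<Longrightarrow> cj (mscale z G) (mscale (inverse z) H) u = cj G H u"
  by (simp add: cj_def mm_scale_left mm_scale_right)

lemma rep_act_coset:
  assumes GH: "inv_pair G H" and r: "\<rho> \<in> rep_space Q d"
  shows "rep_act Q d {gfam (mscale z G) | z. z \<noteq> 0} \<rho> = rho (cj G H (ent \<rho>))"
proof -
  have "conj_rep Q d (gfam (mscale z G)) \<rho> = rho (cj G H (ent \<rho>))" if "z \<noteq> 0" for z
    using conj_rep_gfam[OF inv_pair_scale[OF that GH] r] cj_scale[OF that] by simp
  then have "(\<lambda>g. conj_rep Q d g \<rho>) ` {gfam (mscale z G) | z. z \<noteq> 0} = (\<lambda>g. rho (cj G H (ent \<rho>))) ` {gfam (mscale z G) | z. z \<noteq> 0}"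
    by (intro image_cong refl) blast
  also have "\<dots> = {rho (cj G H (ent \<rho>))}" by (simp add: image_constant_conv) (use zero_neq_one in metis)
  finally have "(\<lambda>g. conj_rep Q d g \<rho>) ` {gfam (mscale z G) | z. z \<noteq> 0} = {rho (cj G H (ent \<rho>))}" .
  then show ?thesis unfolding rep_act_def coset_act_def by simp
qed

lemma Ad_coset:
  assumes GH: "inv_pair G H" and x: "x \<in> mat_families (verts Q) d d"
  shows "Ad Q d {gfam (mscale z G) | z. z \<noteq> 0} x = gfam (G \<diamond> gent x \<diamond> H)"
proof -
  have "conj_gl Q d (gfam (mscale z G)) x = gfam (G \<diamond> gent x \<diamond> H)" if "z \<noteq> 0" for z
    using conj_gl_gfam[OF inv_pair_scale[OF that GH] x] that by (simp add: mm_scale_left mm_scale_right)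
  then have "(\<lambda>g. conj_gl Q d g x) ` {gfam (mscale z G) | z. z \<noteq> 0} = (\<lambda>g. gfam (G \<diamond> gent x \<diamond> H)) ` {gfam (mscale z G) | z. z \<noteq> 0}"
    by (intro image_cong refl) blast
  also have "\<dots> = {gfam (G \<diamond> gent x \<diamond> H)}" by (simp add: image_constant_conv) (use zero_neq_one in metis)
  finally have "(\<lambda>g. conj_gl Q d g x) ` {gfam (mscale z G) | z. z \<noteq> 0} = {gfam (G \<diamond> gent x \<diamond> H)}" .
  then show ?thesis unfolding Ad_def coset_act_def by simp
qed

lemma rep_orbit:
  assumes r: "\<rho> \<in> rep_space Q d"
  shows "orbit (gauge_group Q d) (rep_act Q d) \<rho> = {rho (cj G H (ent \<rho>)) | G H. inv_pair G H}"
  unfolding orbit_def gauge_carrier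
proof (rule equalityI; rule subsetI)
  fix y assume "y \<in> {rep_act Q d g \<rho> | g. g \<in> {{gfam (mscale z G) | z. z \<noteq> 0} | G. \<exists>H. inv_pair G H}}"
  then obtain G H where GH: "inv_pair G H" and y: "y = rep_act Q d {gfam (mscale z G) | z. z \<noteq> 0} \<rho>" by blast
  show "y \<in> {rho (cj G H (ent \<rho>)) | G H. inv_pair G H}"
    unfolding y rep_act_coset[OF GH r] using GH by blast
next
  fix y assume "y \<in> {rho (cj G H (ent \<rho>)) | G H. inv_pair G H}"
  then obtain G H where GH: "inv_pair G H" and y: "y = rho (cj G H (ent \<rho>))" by blast
  show "y \<in> {rep_act Q d g \<rho> | g. g \<in> {{gfam (mscale z G) | z. z \<noteq> 0} | G. \<exists>H. inv_pair G H}}"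
    unfolding y rep_act_coset[OF GH r, symmetric] using GH by blast
qed

lemma Ad_orbit:
  assumes x: "x \<in> mat_families (verts Q) d d"
  shows "orbit (gauge_group Q d) (Ad Q d) x = {gfam (G \<diamond> gent x \<diamond> H) | G H. inv_pair G H}"
  unfolding orbit_def gauge_carrier
proof (rule equalityI; rule subsetI)
  fix y assume "y \<in> {Ad Q d g x | g. g \<in> {{gfam (mscale z G) | z. z \<noteq> 0} | G. \<exists>H. inv_pair G H}}"
  then obtain G H where GH: "inv_pair G H" and y: "y = Ad Q d {gfam (mscale z G) | z. z \<noteq> 0} x" by blast
  show "y \<in> {gfam (G \<diamond> gent x \<diamond> H) | G H. inv_pair G H}"
    unfolding y Ad_coset[OF GH x] using GH by blast
next
  fix y assume "y \<in> {gfam (G \<diamond> gent x \<diamond> H) | G H. inv_pair G H}"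
  then obtain G H where GH: "inv_pair G H" and y: "y = gfam (G \<diamond> gent x \<diamond> H)" by blast
  show "y \<in> {Ad Q d g x | g. g \<in> {{gfam (mscale z G) | z. z \<noteq> 0} | G. \<exists>H. inv_pair G H}}"
    unfolding y Ad_coset[OF GH x, symmetric] using GH by blast
qed

lemma blk_sandwich: "blkd G \<Longrightarrow> blkd H \<Longrightarrow> blk u \<Longrightarrow> blk (cj G H u)"
proof -
  assume b: "blkd G" "blkd H" and u: "blk u"
  show ?thesis
    unfolding blk_def
  proof (intro ballI allI impI)
    fix c x y assume c: "c \<in> AR" and n: "cj G H u c x y \<noteq> 0"
    have "proj (hdc c) \<diamond> (G \<diamond> u c \<diamond> H) = G \<diamond> (proj (hdc c) \<diamond> u c) \<diamond> H"
      by (simp add: mm_assoc[symmetric] blkd_comm[OF b(1)] del: double_simps)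
    also have "\<dots> = cj G H u c" by (simp add: blk_proj_left u c cj_def del: double_simps)
    finally have 1: "(proj (hdc c) \<diamond> (G \<diamond> u c \<diamond> H)) x y \<noteq> 0" using n by simp
    have "(G \<diamond> u c \<diamond> H) \<diamond> proj (tlc c) = G \<diamond> (u c \<diamond> proj (tlc c)) \<diamond> H"
      by (simp add: mm_assoc blkd_comm[OF b(2)] del: double_simps)
    also have "\<dots> = cj G H u c" by (simp add: blk_proj_right u c cj_def del: double_simps)
    finally have 2: "((G \<diamond> u c \<diamond> H) \<diamond> proj (tlc c)) x y \<noteq> 0" using n by simp
    show "x \<in> idx \<and> y \<in> idx \<and> fst x = hdc c \<and> fst y = tlc c"
      using 1 2 by (auto simp: proj_mm mm_proj split: if_splits)
  qed
qed

lemma blk_cj: "inv_pair G H \<Longrightarrow> blk u \<Longrightarrow> blk (cj G H u)"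
  by (simp add: inv_pair_def blk_sandwich)

lemma R_cj:
  assumes GH: "inv_pair G H" and u: "blk u" and f: "f \<in> AA"
  shows "R (cj G H u) f = G \<diamond> R u f \<diamond> H"
  using f
proof (induction f rule: AA_induct)
  case (single p z)
  have b: "blkd G" "blkd H" using GH by (auto simp: inv_pair_def)
  have "evw (cj G H u) i cs = G \<diamond> evw u i cs \<diamond> H" if "(i, cs) \<in> paths Q" for i cs
    using that
  proof (induction cs arbitrary: i)
    case Nil
    have "G \<diamond> proj i \<diamond> H = proj i \<diamond> (G \<diamond> H)" by (simp add: blkd_comm[OF b(1)] mm_assoc)
    then show ?case using GH by (simp add: inv_pair_def mm_om_right fm_proj)
  next
    case (Cons c cs)
    then have c: "c \<in> AR" "(tlc c, cs) \<in> paths Q" by (auto simp: paths_Cons simp del: double_simps)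
    have "evw (cj G H u) i (c # cs) = G \<diamond> u c \<diamond> (H \<diamond> (G \<diamond> (evw u (tlc c) cs \<diamond> H)))"
      using Cons.IH[OF c(2)] by (simp add: cj_def mm_assoc del: double_simps)
    also have "H \<diamond> (G \<diamond> (evw u (tlc c) cs \<diamond> H)) = evw u (tlc c) cs \<diamond> H"
      by (rule inv_cancel[OF inv_pair_sym[OF GH]]) (intro fm_mm evw_fm u c blkd_fm b)
    finally show ?case by (simp add: mm_assoc)
  qed
  from this[of "fst p" "snd p"] show ?case using single(1)
    by (simp add: R_single mm_scale_left mm_scale_right)
qed (simp_all add: R_add mm_add_left mm_add_right mm_zero_left mm_zero_right)

lemma tr_R_cj:
  assumes GH: "inv_pair G H" and u: "blk u" and f: "f \<in> AA"
  shows "tr (R (cj G H u) f) = tr (R u f)"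
proof -
  have "tr (G \<diamond> R u f \<diamond> H) = tr (H \<diamond> (G \<diamond> R u f))" by (rule tr_comm)
  also have "H \<diamond> (G \<diamond> R u f) = R u f" by (rule inv_cancel[OF inv_pair_sym[OF GH] R_fm[OF u f]])
  finally show ?thesis by (simp add: R_cj[OF assms])
qed

lemma mom_cj: "inv_pair G H \<Longrightarrow> blk u \<Longrightarrow> mom (cj G H u) = G \<diamond> mom u \<diamond> H"
  using R_cj[OF _ _ AA_mom] by (simp add: R_momA blk_cj)

lemma inv_pair_det:
  assumes G: "blkd G" and dt: "\<And>i. i \<in> verts Q \<Longrightarrow> det (bm i i G) \<noteq> 0"
  shows "\<exists>H. inv_pair G H"
proof -
  define h where "h = (\<lambda>i\<in>verts Q. (1 / det (bm i i G)) \<cdot>\<^sub>m adj_mat (bm i i G))"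
  have c: "h i \<in> carrier_mat (d i) (d i)" "bm i i G * h i = 1\<^sub>m (d i)" "h i * bm i i G = 1\<^sub>m (d i)" if i: "i \<in> verts Q" for i
  proof -
    note a = adj_mat[OF bm_carrier(1)[of i i G]]
    show "h i \<in> carrier_mat (d i) (d i)" using a(1) i by (simp add: h_def)
    have "bm i i G * h i = (1 / det (bm i i G)) \<cdot>\<^sub>m (bm i i G * adj_mat (bm i i G))"
      using i a(1) by (simp add: h_def mult_smult_distrib[OF bm_carrier(1)])
    also have "\<dots> = 1\<^sub>m (d i)" unfolding a(2) by (rule eq_matI) (use dt[OF i] in auto)
    finally show "bm i i G * h i = 1\<^sub>m (d i)" .
    have "h i * bm i i G = (1 / det (bm i i G)) \<cdot>\<^sub>m (adj_mat (bm i i G) * bm i i G)"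
      using i a(1) by (simp add: h_def mult_smult_assoc_mat[OF _ bm_carrier(1)])
    also have "\<dots> = 1\<^sub>m (d i)" unfolding a(3) by (rule eq_matI) (use dt[OF i] in auto)
    finally show "h i * bm i i G = 1\<^sub>m (d i)" .
  qed
  have "gfam G \<in> carrier (GL_product Q d)"
    unfolding GL_product_carrier gfam_def
  proof (rule restrict_PiE_iff[THEN iffD2], rule ballI)
    fix i assume i: "i \<in> verts Q"
    show "bm i i G \<in> Units (gl_ring (d i))"
      unfolding Units_def ring_mat_simps using c[OF i] bm_carrier(1)[of i i G] by blast
  qed
  then obtain G' H where "inv_pair G' H" "gfam G = gfam G'" using GL_gfam by blast
  moreover have "G' = G"
  proof -
    have "gent (gfam G) = gent (gfam G')" using calculation by simp
    then show ?thesis using gent_gfam[OF G] gent_gfam[of G'] calculation(1) unfolding inv_pair_def by metis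
  qed
  ultimately show ?thesis by blast
qed

end

section \<open>Points over the closed orbit\<close>

lemma isCont_zero:
  fixes f :: "complex \<Rightarrow> complex"
  assumes "isCont f 0" "\<And>t. t \<noteq> 0 \<Longrightarrow> f t = 0" shows "f 0 = 0"
proof -
  have "(f \<longlongrightarrow> f 0) (at 0)" using assms(1) by (simp add: isCont_def)
  moreover have "(f \<longlongrightarrow> 0) (at 0)"
    by (rule tendsto_eventually) (use assms(2) in \<open>auto simp: eventually_at_filter\<close>)
  ultimately show ?thesis by (rule tendsto_unique[rotated]) simp
qed

lemma polynomial_isCont:
  assumes "F \<in> polynomial_functions K nr nc"
    and "\<And>k p q. k \<in> K \<Longrightarrow> p < nr k \<Longrightarrow> q < nc k \<Longrightarrow> isCont (\<lambda>t. x t k $$ (p, q)) t0"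
  shows "isCont (\<lambda>t. F (x t)) (t0 :: complex)"
  using assms(1) by induction (auto intro: assms(2) continuous_intros)

locale quiver_orbit = quiver Q d for Q :: "('v, 'e) pre_digraph" and d :: "'v \<Rightarrow> nat" +
  fixes \<O> :: "('v \<Rightarrow> complex mat) set"
  assumes orbit: "\<O> \<in> orbits (gauge_group Q d) (sg Q d) (Ad Q d)"
    and closed: "zariski_closed_in_sg Q d \<O>"
    and free: "acts_freely (gauge_group Q d) (rep_act Q d) (moment_preimage Q d \<O>)"
begin

definition Orb :: "'v mtx set" where
  "Orb = {A. blkd A \<and> gfam A \<in> \<O>}"

abbreviation MM where "MM \<equiv> moment_preimage Q d \<O>"

lemma Orb_orbit: "\<exists>X. blkd X \<and> tr X = 0 \<and> Orb = {G \<diamond> X \<diamond> H | G H. inv_pair G H}"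
proof -
  obtain x where x: "x \<in> sg Q d" and O: "\<O> = orbit (gauge_group Q d) (Ad Q d) x"
    using orbit by (auto simp: orbits_def)
  have xm: "x \<in> mat_families (verts Q) d d" using x by (simp add: sg_def)
  let ?X = "gent x"
  have "gfam ?X \<in> sg Q d" using x gfam_gent[OF xm] by simp
  then have t: "tr ?X = 0" by (simp add: gfam_sg)
  have b: "blkd (G \<diamond> ?X \<diamond> H)" if "inv_pair G H" for G H
    using that by (simp add: inv_pair_def blkd_mm blkd_gent)
  have "Orb = {G \<diamond> ?X \<diamond> H | G H. inv_pair G H}"
  proof (rule equalityI; rule subsetI)
    fix A assume "A \<in> Orb"
    then have A: "blkd A" "gfam A \<in> \<O>" by (auto simp: Orb_def)
    then obtain G H where GH: "inv_pair G H" "gfam A = gfam (G \<diamond> ?X \<diamond> H)"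
      unfolding O Ad_orbit[OF xm] by blast
    have "A = G \<diamond> ?X \<diamond> H"
      using arg_cong[OF GH(2), of gent] unfolding gent_gfam[OF A(1)] gent_gfam[OF b[OF GH(1)]] .
    then show "A \<in> {G \<diamond> ?X \<diamond> H | G H. inv_pair G H}" using GH(1) by blast
  next
    fix A assume "A \<in> {G \<diamond> ?X \<diamond> H | G H. inv_pair G H}"
    then obtain G H where GH: "inv_pair G H" "A = G \<diamond> ?X \<diamond> H" by blast
    then have "gfam A \<in> \<O>" unfolding O Ad_orbit[OF xm] by blast
    then show "A \<in> Orb" using b[OF GH(1)] GH(2) by (simp add: Orb_def)
  qed
  then show ?thesis using t blkd_gent by blast
qed

lemma Orb_conj:
  assumes "A \<in> Orb" and GH: "inv_pair G H" shows "G \<diamond> A \<diamond> H \<in> Orb"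
proof -
  obtain X where X: "Orb = {G \<diamond> X \<diamond> H | G H. inv_pair G H}" using Orb_orbit by blast
  then obtain G' H' where G': "inv_pair G' H'" "A = G' \<diamond> X \<diamond> H'" using assms(1) by blast
  have "G \<diamond> A \<diamond> H = (G \<diamond> G') \<diamond> X \<diamond> (H' \<diamond> H)" by (simp add: G'(2) mm_assoc)
  then show ?thesis unfolding X using inv_pair_mult[OF GH G'(1)] by blast
qed

lemma Orb_transitive:
  assumes "A \<in> Orb" "B \<in> Orb" shows "\<exists>G H. inv_pair G H \<and> B = G \<diamond> A \<diamond> H"
proof -
  obtain X where X: "blkd X" "Orb = {G \<diamond> X \<diamond> H | G H. inv_pair G H}" using Orb_orbit by blast
  then obtain G H G' H' where G: "inv_pair G H" "A = G \<diamond> X \<diamond> H" and G': "inv_pair G' H'" "B = G' \<diamond> X \<diamond> H'"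
    using assms by blast
  have Xf: "X \<in> fm" "X \<diamond> H' \<in> fm" "H' \<in> fm" using X(1) G'(1) by (auto simp: inv_pair_def blkd_fm fm_mm)
  have "(G' \<diamond> H) \<diamond> A \<diamond> (G \<diamond> H') = G' \<diamond> (H \<diamond> (G \<diamond> (X \<diamond> (H \<diamond> (G \<diamond> H')))))"
    by (simp add: G(2) mm_assoc)
  also have "\<dots> = B"
    using inv_cancel[OF inv_pair_sym[OF G(1)]] Xf by (simp add: G'(2) mm_assoc)
  finally show ?thesis using inv_pair_mult[OF G'(1) inv_pair_sym[OF G(1)]] by metis
qed

text \<open>A polynomial that vanishes for t \<noteq> 0 along a continuous curve vanishes in the
  limit. Closedness of the orbit enters in this form.\<close>

lemma Orb_closed:
  assumes b: "\<And>t. blkd (A t)" and O: "\<And>t. t \<noteq> 0 \<Longrightarrow> A t \<in> Orb"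
    and c: "\<And>x y. isCont (\<lambda>t. A t x y) (0::complex)"
  shows "A 0 \<in> Orb"
proof -
  obtain P where P: "P \<subseteq> polynomial_functions (verts Q) d d" "\<O> = {x \<in> sg Q d. \<forall>p\<in>P. p x = 0}"
    using closed by (auto simp: zariski_closed_in_sg_def)
  have O': "gfam (A t) \<in> sg Q d" "p \<in> P \<Longrightarrow> p (gfam (A t)) = 0" if "t \<noteq> 0" for t p
    using O[OF that] by (simp_all add: Orb_def) (simp_all add: P(2))
  have "tr (A 0) = 0"
  proof (rule isCont_zero)
    show "isCont (\<lambda>t. tr (A t)) 0" unfolding tr_def by (intro continuous_intros c)
    show "tr (A t) = 0" if "t \<noteq> 0" for t using O'(1)[OF that] by (simp add: gfam_sg)
  qed
  moreover have "p (gfam (A 0)) = 0" if p: "p \<in> P" for p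
  proof (rule isCont_zero)
    show "isCont (\<lambda>t. p (gfam (A t))) 0"
      by (rule polynomial_isCont[of p "verts Q" d d]) (use p P(1) c in \<open>auto simp: gfam_def\<close>)
  qed (use O'(2) p in blast)
  ultimately have "gfam (A 0) \<in> \<O>" unfolding P(2) using b by (simp add: gfam_sg)
  then show ?thesis using b by (simp add: Orb_def)
qed

lemma MM_iff: "\<rho> \<in> MM \<longleftrightarrow> \<rho> \<in> rep_space Q d \<and> mom (ent \<rho>) \<in> Orb"
  by (auto simp: moment_preimage_def Orb_def moment_map_ent blkd_mom blk_ent)

lemma MM_rho: "blk u \<Longrightarrow> rho u \<in> MM \<longleftrightarrow> mom u \<in> Orb"
  using mom_cong[of "ent (rho u)" u] ent_rho by (simp add: MM_iff rho_in)

lemma MM_cj: "\<rho> \<in> MM \<Longrightarrow> inv_pair G H \<Longrightarrow> rho (cj G H (ent \<rho>)) \<in> MM"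
  using MM_rho[OF blk_cj[OF _ blk_ent], of G H \<rho>] Orb_conj[of "mom (ent \<rho>)" G H]
  by (simp add: MM_iff[of \<rho>] mom_cj[OF _ blk_ent])

text \<open>An invertible matrix commuting with the representation gives a coset in its stabilizer,
  and freeness makes this the coset of the scalars.\<close>

lemma MM_free:
  assumes r: "\<rho> \<in> MM" and GH: "inv_pair G H" and c: "\<And>c. c \<in> AR \<Longrightarrow> G \<diamond> ent \<rho> c = ent \<rho> c \<diamond> G"
  shows "\<exists>z. G = mscale z om"
proof -
  have rs: "\<rho> \<in> rep_space Q d" using r by (simp add: MM_iff)
  let ?U = "{gfam (mscale z G) | z. z \<noteq> 0}"
  have "rho (cj G H (ent \<rho>)) = rho (ent \<rho>)"
  proof (rule rho_cong)
    fix a assume a: "a \<in> AR"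
    have "cj G H (ent \<rho>) a = ent \<rho> a \<diamond> (G \<diamond> H)" unfolding cj_def c[OF a] by (rule mm_assoc)
    then show "cj G H (ent \<rho>) a = ent \<rho> a"
      using GH by (simp add: inv_pair_def mm_om_right blk_fm[OF blk_ent a])
  qed
  then have "rep_act Q d ?U \<rho> = \<rho>" using rep_act_coset[OF GH rs] rho_ent[OF rs] by simp
  moreover have "?U \<in> carrier (gauge_group Q d)" unfolding gauge_carrier using GH by blast
  ultimately have "?U \<in> stabilizer (gauge_group Q d) (rep_act Q d) \<rho>" by (simp add: stabilizer_def)
  then have U: "?U = {scalar_family Q d z | z. z \<noteq> 0}"
    using free r by (simp add: acts_freely_def gauge_one)
  have "gfam (mscale 1 G) \<in> ?U" using zero_neq_one by (intro CollectI exI[of _ 1]) simp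
  then obtain z where "gfam G = scalar_family Q d z" unfolding U by auto
  also have "\<dots> = gfam (mscale z om)"
    unfolding scalar_family_def gfam_def
    by (rule restrict_ext, rule eq_matI) (auto simp: om_def pw)
  finally have "gent (gfam G) = gent (gfam (mscale z om))" by simp
  moreover have "blkd G" using GH by (simp add: inv_pair_def)
  ultimately have "G = mscale z om" by (simp only: gent_gfam blkd_scale blkd_om)
  then show ?thesis by blast
qed

text \<open>Subtracting a number that is an eigenvalue of no diagonal block makes X invertible, and
  freeness applies to the shifted matrix.\<close>

lemma MM_schur:
  assumes r: "\<rho> \<in> MM" and X: "X \<in> fm" and c: "\<And>f. f \<in> AA \<Longrightarrow> X \<diamond> R (ent \<rho>) f = R (ent \<rho>) f \<diamond> X"
  shows "\<exists>z. X = mscale z om"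
proof -
  have bX: "blkd X" unfolding blkd_iff using X c[OF AA_vx] by (simp add: R_vx)
  let ?B = "\<Union>i\<in>verts Q. {z. poly (char_poly (bm i i X)) z = 0}"
  have "finite ?B"
  proof (intro finite_UN_I poly_roots_finite)
    fix i
    show "char_poly (bm i i X) \<noteq> 0" using degree_monic_char_poly[OF bm_carrier(1)[of i i X]] by auto
  qed simp
  then obtain z where z: "z \<notin> ?B" using ex_new_if_finite[OF infinite_UNIV_char_0] by blast
  let ?G = "X - mscale z om"
  have bG: "blkd ?G" by (intro blkd_diff bX blkd_scale blkd_om)
  have "det (bm i i ?G) \<noteq> 0" if i: "i \<in> verts Q" for i
  proof -
    have "bm i i ?G = char_matrix (bm i i X) z"
      by (rule eq_matI) (use i in \<open>auto simp: char_matrix_def pw om_def\<close>)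
    then show ?thesis using z i eigenvalue_root_char_poly[OF bm_carrier(1)[of i i X], of z]
        eigenvalue_det[OF bm_carrier(1)[of i i X], of z] by auto
  qed
  then obtain H where GH: "inv_pair ?G H" using inv_pair_det[OF bG] by blast
  have "?G \<diamond> ent \<rho> a = ent \<rho> a \<diamond> ?G" if a: "a \<in> AR" for a
    using c[OF AA_arr[OF a]] blk_fm[OF blk_ent a]
    by (simp add: R_arr[OF blk_ent a] mm_diff_left mm_diff_right mm_scale_left mm_scale_right mm_om_left mm_om_right)
  from MM_free[OF r GH this] obtain w where "?G = mscale w om" by blast
  then have "X = mscale w om + mscale z om" by (simp add: algebra_simps)
  also have "\<dots> = mscale (w + z) om" by (simp add: fun_eq_iff pw algebra_simps)
  finally show ?thesis by blast
qed

text \<open>If \<open>P\<close> projects onto a subrepresentation \<open>W\<close>, conjugation by \<open>t P + (1 - P)\<close> degenerates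
  the representation, as \<open>t \<rightarrow> 0\<close>, to one that still lies over the closed orbit but is
  stabilized by \<open>2 P + (1 - P)\<close>. Freeness makes \<open>P\<close> a scalar.\<close>

lemma MM_irreducible:
  assumes r: "\<rho> \<in> MM" and P: "blkd P"
    and inv: "\<And>f. f \<in> AA \<Longrightarrow> P \<diamond> R (ent \<rho>) f \<diamond> P = R (ent \<rho>) f \<diamond> P"
  shows "\<exists>z. P = mscale z om"
proof -
  let ?u = "ent \<rho>"
  define N where "N = om - P"
  have fP: "P \<in> fm" by (rule blkd_fm[OF P])
  have bN: "blkd N" unfolding N_def by (intro blkd_diff blkd_om P)
  have PP: "P \<diamond> P = P" using inv[OF AA_one] fP by (simp add: R_one mm_om_left mm_om_right)
  have PN: "P \<diamond> N = 0" "N \<diamond> P = 0" "N \<diamond> N = N" "P + N = om"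
    using fP by (simp_all add: N_def mm_diff_left mm_diff_right mm_om_left mm_om_right PP fm_om)
  have PP': "P \<diamond> (P \<diamond> A) = P \<diamond> A" "P \<diamond> (N \<diamond> A) = 0" "N \<diamond> (P \<diamond> A) = 0" "N \<diamond> (N \<diamond> A) = N \<diamond> A" for A
    by (simp_all add: mm_assoc[symmetric] PP PN mm_zero_left)
  have NuP: "N \<diamond> (?u c \<diamond> P) = 0" if c: "c \<in> AR" for c
    using inv[OF AA_arr[OF c]] blk_fm[OF blk_ent c] fP
    by (simp add: R_arr[OF blk_ent c] N_def mm_diff_left mm_om_left fm_mm mm_assoc)
  define G where "G t = mscale t P + N" for t
  have GH: "inv_pair (G t) (G (inverse t))" if "t \<noteq> 0" for t
    using that unfolding inv_pair_def G_def
    by (simp add: blkd_add blkd_scale P bN mm_add_left mm_add_right mm_scale_left mm_scale_right PP PN)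
  \<comment> \<open>Conjugation by G t multiplies P u N by t and N u P by the inverse of t. The
    latter part is zero by invariance, so the family extends to t = 0.\<close>
  define ut where "ut t = (\<lambda>c. (P \<diamond> ?u c \<diamond> P + N \<diamond> ?u c \<diamond> N) + mscale t (P \<diamond> ?u c \<diamond> N))" for t
  have but: "blk (ut t)" for t
  proof -
    have 1: "blk (cj A B ?u)" if "blkd A" "blkd B" for A B by (rule blk_sandwich[OF that blk_ent])
    have add: "blk (\<lambda>c. v c + w c)" if v: "blk v" and w: "blk w" for v w
      unfolding blk_def
    proof (intro ballI allI impI)
      fix c x y assume c: "c \<in> AR" and n: "(v c + w c) x y \<noteq> 0"
      then have "v c x y \<noteq> 0 \<or> w c x y \<noteq> 0" by (auto simp: pw)
      then show "x \<in> idx \<and> y \<in> idx \<and> fst x = hdc c \<and> fst y = tlc c" using blkD[OF v c] blkD[OF w c] by blast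
    qed
    have sc: "blk (\<lambda>c. mscale t (v c))" if "blk v" for v using that unfolding blk_def mscale_apply mult_eq_0_iff by blast
    show ?thesis unfolding ut_def
      using add[OF add[OF 1[OF P P] 1[OF bN bN]] sc[OF 1[OF P bN]]] by (simp add: cj_def)
  qed
  have "mom (ut 0) \<in> Orb"
  proof (rule Orb_closed[of "\<lambda>t. mom (ut t)"])
    show "blkd (mom (ut t))" for t by (rule blkd_mom[OF but])
    show "isCont (\<lambda>t. mom (ut t) x y) 0" for x y
      unfolding mom_def sum_fun_apply2 ut_def mm_def pw by (intro continuous_intros)
    show "mom (ut t) \<in> Orb" if t: "t \<noteq> 0" for t
    proof -
      have "ut t c = cj (G t) (G (inverse t)) ?u c" if c: "c \<in> AR" for c
        using t NuP[OF c]
        by (simp add: cj_def ut_def G_def mm_add_left mm_add_right mm_scale_left mm_scale_right mm_assoc)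
      then have "mom (ut t) = mom (cj (G t) (G (inverse t)) ?u)" by (rule mom_cong)
      then show ?thesis using r GH[OF t] by (simp add: mom_cj blk_ent Orb_conj MM_iff)
    qed
  qed
  then have r0: "rho (ut 0) \<in> MM" by (simp add: MM_rho but)
  \<comment> \<open>The limit is block diagonal for the decomposition by P and N, so each G t
    commutes with it; 2 only has to differ from 0 and 1.\<close>
  have "G 2 \<diamond> ent (rho (ut 0)) c = ent (rho (ut 0)) c \<diamond> G 2" if c: "c \<in> AR" for c
    unfolding ent_rho[OF but c]
    by (simp add: ut_def G_def mm_add_left mm_add_right mm_scale_left mm_scale_right mm_assoc PP' PN PP mm_zero_right)
  then obtain z where z: "G 2 = mscale z om" using MM_free[OF r0 GH[of 2]] by auto
  have "P = mscale (z - 1) om"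
  proof (intro ext)
    fix x y
    have "G 2 x y = P x y + om x y" by (simp add: G_def N_def pw)
    then show "P x y = mscale (z - 1) om x y" unfolding z by (simp add: pw algebra_simps)
  qed
  then show ?thesis by blast
qed

text \<open>For Burnside each nonzero vector must generate the whole space. The submodule W it
  generates is the image of a block diagonal projection, a scalar by \<open>MM_irreducible\<close>;
  it fixes a nonzero vector, so it is the identity.\<close>

lemma MM_full:
  assumes r: "\<rho> \<in> MM" shows "full (ent \<rho>)"
  unfolding full_def
proof (intro conjI ballI)
  let ?u = "ent \<rho>"
  note bu = blk_ent[of \<rho>]
  show "blk ?u" by (rule bu)
  define app where "app A w = (\<lambda>y. if y \<in> idx then \<Sum>z\<in>idx. A y z * w z else (0::complex))" for A :: "'v mtx" and w
  have app_mm: "app (A \<diamond> B) w = app A (app B w)" for A B w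
  proof
    fix y
    have "(\<Sum>z\<in>idx. (A \<diamond> B) y z * w z) = (\<Sum>z\<in>idx. \<Sum>k\<in>idx. A y k * (B k z * w z))"
      by (simp add: mm_def sum_distrib_right mult.assoc)
    also have "\<dots> = (\<Sum>k\<in>idx. A y k * (\<Sum>z\<in>idx. B k z * w z))"
      by (subst sum.swap) (simp add: sum_distrib_left)
    finally show "app (A \<diamond> B) w y = app A (app B w) y" by (simp add: app_def)
  qed
  have irr: "\<exists>A\<in>R ?u ` AA. \<forall>y\<in>idx. (\<Sum>z\<in>idx. A y z * v z) = (w y::complex)" if v: "\<exists>x\<in>idx. v x \<noteq> 0" for v w
  proof -
    define W where "W = {app (R ?u f) v | f. f \<in> AA}"
    have sub: "fun_vs.subspace W"
    proof (rule fun_vs.subspaceI)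
      have "0 = app (R ?u 0) v" by (auto simp: app_def pw)
      then show "0 \<in> W" unfolding W_def using AA_0 by blast
    next
      fix x y assume "x \<in> W" "y \<in> W"
      then obtain f g where fg: "f \<in> AA" "g \<in> AA" "x = app (R ?u f) v" "y = app (R ?u g) v" unfolding W_def by blast
      have "x + y = app (R ?u (f + g)) v" by (auto simp: fg app_def R_add pw algebra_simps sum.distrib)
      then show "x + y \<in> W" unfolding W_def using AA_add[OF fg(1,2)] by blast
    next
      fix z x assume "x \<in> W"
      then obtain f where f: "f \<in> AA" "x = app (R ?u f) v" unfolding W_def by blast
      have "fun_scale z x = app (R ?u (path_scale z f)) v" by (auto simp: f app_def R_scale pw fun_scale_def sum_distrib_left mult.assoc)
      then show "fun_scale z x \<in> W" unfolding W_def using AA_scale[OF f(1)] by blast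
    qed
    have Winv: "app (R ?u f) x \<in> W" if fA: "f \<in> AA" and xW: "x \<in> W" for f x
    proof -
      obtain g where g: "g \<in> AA" "x = app (R ?u g) v" using xW unfolding W_def by blast
      have "app (R ?u f) x = app (R ?u (f \<star> g)) v" by (simp add: g R_mult bu fA app_mm)
      then show ?thesis unfolding W_def using AA_mult[OF fA g(1)] by blast
    qed
    have Wsupp: "x k = 0" if "x \<in> W" "k \<notin> idx" for x k using that unfolding W_def app_def by auto
    have lid: "Vector_Spaces.linear fun_scale fun_scale (\<lambda>x::'v \<times> nat \<Rightarrow> complex. x)" by unfold_locales auto
    obtain g where gW: "\<And>x. g x \<in> W" and g: "Vector_Spaces.linear fun_scale fun_scale g" and gid: "\<And>x. x \<in> W \<Longrightarrow> g x = x"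
      using fun_endo.linear_exists_left_inverse_on[OF lid sub] by (auto simp: inj_on_def)
    interpret g: Vector_Spaces.linear fun_scale fun_scale g by (rule g)
    define \<delta> where "\<delta> x = (\<lambda>j. if j = x then 1 else (0::complex))" for x :: "'v \<times> nat"
    \<comment> \<open>The block diagonal part of the linear retraction g onto W. As W is stable
      under the vertex projections, P still maps into W and fixes W pointwise.\<close>
    define P where "P = (\<lambda>y x. if x \<in> idx \<and> y \<in> idx \<and> fst x = fst y then g (\<delta> x) y else 0)"
    have bP: "blkd P" by (auto simp: blkd_def P_def)
    have pr: "app (proj i) x = (\<lambda>y. if y \<in> idx \<and> fst y = i then x y else 0)" for i x
    proof
      fix y
      have "(\<Sum>z\<in>idx. proj i y z * x z) = (\<Sum>z\<in>idx. if z = y then (if y \<in> idx \<and> fst y = i then x y else 0) else 0)"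
        by (intro sum.cong) (auto simp: proj_def)
      also have "\<dots> = (if y \<in> idx \<and> fst y = i then x y else 0)" using finI by auto
      finally show "app (proj i) x y = (if y \<in> idx \<and> fst y = i then x y else 0)" by (auto simp: app_def)
    qed
    have prW: "app (proj i) x \<in> W" if "i \<in> verts Q" "x \<in> W" for i x
      using Winv[OF AA_vx[OF that(1)] that(2)] by (simp add: R_vx)
    have col: "(\<lambda>y. P y x) \<in> W" if x: "x \<in> idx" for x
    proof -
      have "(\<lambda>y. P y x) = app (proj (fst x)) (g (\<delta> x))" by (auto simp: pr P_def x)
      then show ?thesis using prW[OF idx_fst[OF x] gW] by simp
    qed
    have gexp: "g x y = (\<Sum>z\<in>idx. x z * g (\<delta> z) y)" if "\<And>k. k \<notin> idx \<Longrightarrow> x k = 0" for x y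
    proof -
      have "g x = g (\<Sum>z\<in>idx. fun_scale (x z) (\<delta> z))"
        unfolding \<delta>_def by (rule arg_cong[OF fun_expand[OF finI that]])
      also have "\<dots> = (\<Sum>z\<in>idx. fun_scale (x z) (g (\<delta> z)))" by (simp only: g.sum g.scale)
      finally show ?thesis by (simp add: sum_fun_apply fun_scale_def)
    qed
    have Pid: "app P x = x" if x: "x \<in> W" for x
    proof
      fix y
      show "app P x y = x y"
      proof (cases "y \<in> idx")
        case True
        let ?x = "app (proj (fst y)) x"
        have "?x y = g ?x y" using gid[OF prW[OF idx_fst[OF True] x]] by simp
        also have "\<dots> = (\<Sum>z\<in>idx. ?x z * g (\<delta> z) y)" by (rule gexp) (auto simp: app_def)
        also have "\<dots> = (\<Sum>z\<in>idx. P y z * x z)" by (intro sum.cong refl) (auto simp: pr P_def True)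
        finally show ?thesis using True by (simp add: app_def[of P] pr)
      next
        case False
        then show ?thesis using Wsupp[OF x] by (simp add: app_def)
      qed
    qed
    have inv: "P \<diamond> R ?u f \<diamond> P = R ?u f \<diamond> P" if f: "f \<in> AA" for f
    proof (rule fm_eqI)
      show "P \<diamond> R ?u f \<diamond> P \<in> fm" "R ?u f \<diamond> P \<in> fm" using blkd_fm[OF bP] R_fm[OF bu f] by (auto intro!: fm_mm)
      fix y x assume y: "y \<in> idx" and x: "x \<in> idx"
      have e: "(A \<diamond> B) y x = app A (\<lambda>y. B y x) y" for A B by (simp add: mm_def app_def y)
      have "app (R ?u f) (\<lambda>y. P y x) \<in> W" by (rule Winv[OF f col[OF x]])
      moreover have "(P \<diamond> R ?u f \<diamond> P) y x = app P (app (R ?u f) (\<lambda>y. P y x)) y"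
        unfolding e by (simp add: app_mm)
      ultimately show "(P \<diamond> R ?u f \<diamond> P) y x = (R ?u f \<diamond> P) y x" using Pid by (simp add: e)
    qed
    obtain z where z: "P = mscale z om" using MM_irreducible[OF r bP inv] by blast
    have aom: "app om x = (\<lambda>y. if y \<in> idx then x y else 0)" for x
    proof
      fix y
      have "(\<Sum>k\<in>idx. om y k * x k) = (\<Sum>k\<in>idx. if k = y then (if y \<in> idx then x y else 0) else 0)"
        by (intro sum.cong) (auto simp: om_def)
      also have "\<dots> = (if y \<in> idx then x y else 0)" using finI by auto
      finally show "app om x y = (if y \<in> idx then x y else 0)" by (auto simp: app_def)
    qed
    obtain x0 where x0: "x0 \<in> idx" "v x0 \<noteq> 0" using v by blast
    have "app om v \<in> W" unfolding W_def R_one[of ?u, symmetric] using AA_one by blast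
    from Pid[OF this] have "app P (app om v) x0 = v x0" by (simp add: aom x0)
    moreover have "app P (app om v) x0 = z * v x0"
    proof -
      have "app P (app om v) x0 = z * app om (app om v) x0" using x0 by (simp add: app_def z pw sum_distrib_left mult.assoc)
      then show ?thesis by (simp add: aom x0)
    qed
    ultimately have "z = 1" using x0 by simp
    then have Pom: "P = om" by (simp add: z)
    have dW: "\<delta> x \<in> W" if "x \<in> idx" for x
    proof -
      have "\<delta> x = (\<lambda>y. P y x)" using that by (intro ext) (auto simp: Pom om_def \<delta>_def)
      then show ?thesis using col[OF that] by simp
    qed
    define w' where "w' y = (if y \<in> idx then w y else 0)" for y
    have "w' = (\<Sum>x\<in>idx. fun_scale (w' x) (\<delta> x))"
      unfolding \<delta>_def by (rule fun_expand[OF finI]) (simp add: w'_def)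
    also have "\<dots> \<in> W" by (intro fun_vs.subspace_sum[OF sub] fun_vs.subspace_scale[OF sub] dW)
    finally obtain f where f: "f \<in> AA" "w' = app (R ?u f) v" unfolding W_def by blast
    have "(\<Sum>z\<in>idx. R ?u f y z * v z) = w y" if "y \<in> idx" for y
      using fun_cong[OF f(2), of y] that by (simp add: w'_def app_def)
    then show ?thesis using f(1) by blast
  qed
  fix M assume M: "M \<in> fm"
  have "M \<in> R ?u ` AA"
  proof (rule burnside[of "R ?u ` AA"])
    show "R ?u ` AA \<subseteq> fm" using R_fm[OF bu] by auto
    show "om \<in> R ?u ` AA" using imageI[OF AA_one, of "R ?u"] by (simp add: R_one)
    show "A + B \<in> R ?u ` AA" if "A \<in> R ?u ` AA" "B \<in> R ?u ` AA" for A B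
      using that by (auto simp flip: R_add intro!: imageI AA_add)
    show "mscale c A \<in> R ?u ` AA" if "A \<in> R ?u ` AA" for c A
      using that by (auto simp flip: R_scale intro!: imageI AA_scale)
    show "A \<diamond> B \<in> R ?u ` AA" if "A \<in> R ?u ` AA" "B \<in> R ?u ` AA" for A B
      using that by (auto simp flip: R_mult[OF bu] intro!: imageI AA_mult)
    show "\<exists>c. X = mscale c om" if "X \<in> fm" "\<And>A. A \<in> R ?u ` AA \<Longrightarrow> X \<diamond> A = A \<diamond> X" for X
      by (rule MM_schur[OF r that(1)]) (use that(2) in blast)
    show "M \<in> fm" by (rule M)
  qed (rule irr)
  then show "\<exists>f\<in>AA. R ?u f = M" by force
qed

text \<open>Triangularize the matrices of a point of the orbit; conjugation by \<open>diag (t\<^sup>-\<^sup>k)\<close> then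
  contracts them to their diagonal as \<open>t \<rightarrow> 0\<close>.\<close>

lemma Orb_diag: "\<exists>l. diag l \<in> Orb"
proof -
  obtain X where X: "blkd X" "Orb = {G \<diamond> X \<diamond> H | G H. inv_pair G H}" using Orb_orbit by blast
  have "\<exists>T P S. upper_triangular T \<and> similar_mat_wit (bm i i X) T P S" for i
  proof -
    obtain es where "char_poly (bm i i X) = (\<Prod>a\<leftarrow>es. [:- a, 1:])"
      using char_poly_factorized[OF bm_carrier(1)[of i i X]] by blast
    from schur_decomposition_exists[OF bm_carrier(1) this] show ?thesis by (auto simp: similar_mat_def)
  qed
  then obtain Tm P S where TPS: "\<And>i. upper_triangular (Tm i)" "\<And>i. similar_mat_wit (bm i i X) (Tm i) (P i) (S i)" by metis
  have wit: "P i * S i = 1\<^sub>m (d i)" "S i * P i = 1\<^sub>m (d i)" "bm i i X = P i * Tm i * S i"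
    "Tm i \<in> carrier_mat (d i) (d i)" "P i \<in> carrier_mat (d i) (d i)" "S i \<in> carrier_mat (d i) (d i)" for i
    using similar_mat_witD2[OF bm_carrier(1) TPS(2)] by auto
  have "(\<lambda>i\<in>verts Q. S i) \<in> carrier (GL_product Q d)"
    unfolding GL_product_carrier
  proof (rule restrict_PiE_iff[THEN iffD2], rule ballI)
    fix i
    show "S i \<in> Units (gl_ring (d i))" unfolding Units_def ring_mat_simps using wit[of i] by blast
  qed
  then obtain G H where GH: "inv_pair G H" and S: "(\<lambda>i\<in>verts Q. S i) = gfam G" using GL_gfam by blast
  have bGH: "blkd G" "blkd H" using GH by (auto simp: inv_pair_def)
  define T where "T = G \<diamond> X \<diamond> H"
  have GS: "bm i i G = S i" if "i \<in> verts Q" for i using fun_cong[OF S, of i] that by (simp add: gfam_def)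
  have HP: "bm i i H = P i" if i: "i \<in> verts Q" for i
  proof -
    interpret gl: ring "gl_ring (d i)" by (rule ring_mat)
    show ?thesis using inv_bm(2)[OF GH i] GS[OF i] gl.inv_char[of "S i" "P i"] wit[of i] by (simp add: ring_mat_simps)
  qed
  have bT: "blkd T" unfolding T_def by (intro blkd_mm bGH X(1))
  have "bm i i T = Tm i" if i: "i \<in> verts Q" for i
  proof -
    have "bm i i T = S i * (P i * Tm i * S i) * P i"
      by (simp add: T_def bm_blkd_mult i blkd_mm bGH X(1) GS HP flip: wit(3))
    also have "\<dots> = (S i * P i) * Tm i * (S i * P i)"
      using wit(4-6)[of i] by (simp add: assoc_mult_mat[of _ "d i" "d i" _ "d i" _ "d i"])
    finally show ?thesis using wit[of i] by simp
  qed
  then have up: "T (i, p) (i, q) = 0" if "i \<in> verts Q" "p < d i" "q < p" for i p q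
    using TPS(1)[of i] that bm_index[of p i q i T] wit(4)[of i] by (auto simp: upper_triangular_def)
  have TO: "T \<in> Orb" unfolding X(2) T_def by (intro CollectI exI[of _ G] exI[of _ H] conjI refl GH)
  \<comment> \<open>The conjugate of T without negative powers of t, so that it makes sense at 0;
    the entries left out are zero because T is upper triangular in each block.\<close>
  define A where "A t = (\<lambda>x y. if snd x \<le> snd y then t ^ (snd y - snd x) * T x y else 0)" for t :: complex
  have "A 0 \<in> Orb"
  proof (rule Orb_closed)
    show "blkd (A t)" for t using blkdD[OF bT] by (auto simp: blkd_def A_def split: if_splits)
    show "isCont (\<lambda>t. A t x y) 0" for x y
      by (cases "snd x \<le> snd y") (simp_all add: A_def)
    fix t :: complex assume t: "t \<noteq> 0"
    have dd: "diag l \<diamond> diag m = om" if "\<And>x. l x * m x = 1" for l m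
      using that by (intro ext, simp add: diag_mm) (auto simp: diag_def om_def)
    have "inv_pair (diag (\<lambda>x. (1 / t) ^ snd x)) (diag (\<lambda>x. t ^ snd x))"
      unfolding inv_pair_def
      by (intro conjI dd) (use t in \<open>auto simp: blkd_def diag_def power_divide\<close>)
    from Orb_conj[OF TO this] have "diag (\<lambda>x. (1 / t) ^ snd x) \<diamond> T \<diamond> diag (\<lambda>x. t ^ snd x) \<in> Orb" .
    moreover have "diag (\<lambda>x. (1 / t) ^ snd x) \<diamond> T \<diamond> diag (\<lambda>x. t ^ snd x) = A t"
    proof (intro ext)
      fix x y
      show "(diag (\<lambda>x. (1 / t) ^ snd x) \<diamond> T \<diamond> diag (\<lambda>x. t ^ snd x)) x y = A t x y"
      proof (cases "T x y = 0")
        case True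
        then show ?thesis by (simp add: mm_diag diag_mm A_def)
      next
        case False
        then have xy: "x \<in> idx" "y \<in> idx" "fst x = fst y" using blkdD[OF bT] by blast+
        have "snd x \<le> snd y"
          using up[of "fst x" "snd x" "snd y"] False xy by (cases x; cases y) force
        then show ?thesis using xy t by (simp add: mm_diag diag_mm A_def power_diff power_divide)
      qed
    qed
    ultimately show "A t \<in> Orb" by simp
  qed
  moreover have "A 0 = diag (\<lambda>x. T x x)"
  proof (intro ext)
    fix x y
    show "A 0 x y = diag (\<lambda>x. T x x) x y"
      using blkdD[OF bT, of x y] by (cases x; cases y; cases "T x y = 0") (auto simp: A_def diag_def power_0_left)
  qed
  ultimately show ?thesis by auto
qed

lemma diag_representative:
  assumes "\<rho> \<in> MM" shows "\<exists>G H l. inv_pair G H \<and> mom (cj G H (ent \<rho>)) = diag l"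
proof -
  obtain l where l: "diag l \<in> Orb" using Orb_diag by blast
  have "mom (ent \<rho>) \<in> Orb" using assms by (simp add: MM_iff)
  from Orb_transitive[OF this l] obtain G H where GH: "inv_pair G H" "diag l = G \<diamond> mom (ent \<rho>) \<diamond> H"
    by blast
  then have "mom (cj G H (ent \<rho>)) = diag l" by (simp add: mom_cj blk_ent)
  then show ?thesis using GH(1) by blast
qed

end

section \<open>Invariant polynomials\<close>

context quiver
begin

abbreviation PF where "PF \<equiv> polynomial_functions AR (row_dim Q d) (col_dim Q d)"
abbreviation IP where "IP \<equiv> invariant_polynomials Q d"

lemma fun_alg_PF: "fun_alg PF"
  by (auto simp: fun_alg_def intro: polynomial_functions.const polynomial_functions.add polynomial_functions.mult)

lemma IP_PF: "F \<in> IP \<Longrightarrow> F \<in> PF" by (simp add: invariant_polynomials_def)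

lemma rep_act_in:
  assumes "U \<in> carrier (gauge_group Q d)" "\<rho> \<in> rep_space Q d"
  shows "\<exists>G H. inv_pair G H \<and> rep_act Q d U \<rho> = rho (cj G H (ent \<rho>))"
proof -
  obtain G H where GH: "inv_pair G H" and U: "U = {gfam (mscale z G) | z. z \<noteq> 0}"
    using assms(1) unfolding gauge_carrier by blast
  show ?thesis unfolding U rep_act_coset[OF GH assms(2)] using GH by blast
qed

lemma IP_iff: "F \<in> IP \<longleftrightarrow> F \<in> PF \<and> (\<forall>\<rho>\<in>rep_space Q d. \<forall>G H. inv_pair G H \<longrightarrow> F (rho (cj G H (ent \<rho>))) = F \<rho>)"
proof
  assume F: "F \<in> IP"
  have "F (rho (cj G H (ent \<rho>))) = F \<rho>" if r: "\<rho> \<in> rep_space Q d" and GH: "inv_pair G H" for \<rho> G H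
  proof -
    have "{gfam (mscale z G) | z. z \<noteq> 0} \<in> carrier (gauge_group Q d)" unfolding gauge_carrier using GH by blast
    then have "F (rep_act Q d {gfam (mscale z G) | z. z \<noteq> 0} \<rho>) = F \<rho>"
      using F r unfolding invariant_polynomials_def by blast
    then show ?thesis unfolding rep_act_coset[OF GH r] .
  qed
  then show "F \<in> PF \<and> (\<forall>\<rho>\<in>rep_space Q d. \<forall>G H. inv_pair G H \<longrightarrow> F (rho (cj G H (ent \<rho>))) = F \<rho>)"
    using F by (simp add: IP_PF)
next
  assume F: "F \<in> PF \<and> (\<forall>\<rho>\<in>rep_space Q d. \<forall>G H. inv_pair G H \<longrightarrow> F (rho (cj G H (ent \<rho>))) = F \<rho>)"
  have "F (rep_act Q d U \<rho>) = F \<rho>" if U: "U \<in> carrier (gauge_group Q d)" and r: "\<rho> \<in> rep_space Q d" for U \<rho>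
    using rep_act_in[OF U r] F r by metis
  then show "F \<in> IP" using F by (simp add: invariant_polynomials_def)
qed

lemma fun_alg_IP: "fun_alg IP"
  using fun_alg_PF by (auto simp: fun_alg_def IP_iff)

subsection \<open>Partial derivatives\<close>

definition slice where
  "slice \<rho> c p q z = \<rho>(c := Matrix.mat (row_dim Q d c) (col_dim Q d c)
     (\<lambda>(r, s). if r = p \<and> s = q then z else \<rho> c $$ (r, s)))"

lemma entry_deriv_slice: "entry_deriv Q d c p q F \<rho> = deriv (\<lambda>z. F (slice \<rho> c p q z)) (\<rho> c $$ (p, q))"
  by (simp add: entry_deriv_def slice_def)

lemma rep_carrier: "\<rho> \<in> rep_space Q d \<Longrightarrow> c \<in> AR \<Longrightarrow> \<rho> c \<in> carrier_mat (row_dim Q d c) (col_dim Q d c)"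
  by (auto simp: rep_space_def mat_families_def)

lemma slice_id: "\<rho> \<in> rep_space Q d \<Longrightarrow> c \<in> AR \<Longrightarrow> slice \<rho> c p q (\<rho> c $$ (p, q)) = \<rho>"
  using rep_carrier[of \<rho> c] unfolding slice_def by (intro fun_upd_idem eq_matI) auto

lemma slice_in: "\<rho> \<in> rep_space Q d \<Longrightarrow> c \<in> AR \<Longrightarrow> slice \<rho> c p q z \<in> rep_space Q d"
  by (auto simp: rep_space_def mat_families_def slice_def PiE_def extensional_def)

lemma slice_entry:
  "r < row_dim Q d k \<Longrightarrow> s < col_dim Q d k \<Longrightarrow>
    slice \<rho> c p q z k $$ (r, s) = (if k = c \<and> r = p \<and> s = q then z else \<rho> k $$ (r, s))"
  by (auto simp: slice_def)

lemma slice_differentiable: "F \<in> PF \<Longrightarrow> (\<lambda>z. F (slice \<rho> c p q z)) field_differentiable (at z0)"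
proof (induction rule: polynomial_functions.induct)
  case (entry k r s)
  then show ?case by (cases "k = c"; cases "r = p"; cases "s = q") (simp_all add: slice_entry)
qed (auto intro: field_differentiable_add field_differentiable_mult)

lemma entry_deriv_const: "entry_deriv Q d c p q (\<lambda>_. z) \<rho> = 0"
  by (simp add: entry_deriv_slice)

lemma entry_deriv_entry:
  "r < row_dim Q d k \<Longrightarrow> s < col_dim Q d k \<Longrightarrow>
    entry_deriv Q d c p q (\<lambda>x. x k $$ (r, s)) \<rho> = (if c = k \<and> p = r \<and> q = s then 1 else 0)"
  by (cases "c = k \<and> p = r \<and> q = s") (auto simp: entry_deriv_slice slice_entry)

lemma entry_deriv_add:
  "F \<in> PF \<Longrightarrow> G \<in> PF \<Longrightarrow> entry_deriv Q d c p q (\<lambda>x. F x + G x) \<rho> = entry_deriv Q d c p q F \<rho> + entry_deriv Q d c p q G \<rho>"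
  unfolding entry_deriv_slice by (intro deriv_add slice_differentiable)

lemma entry_deriv_mult:
  assumes "F \<in> PF" "G \<in> PF" "\<rho> \<in> rep_space Q d" "c \<in> AR"
  shows "entry_deriv Q d c p q (\<lambda>x. F x * G x) \<rho> = F \<rho> * entry_deriv Q d c p q G \<rho> + entry_deriv Q d c p q F \<rho> * G \<rho>"
  using deriv_mult[OF slice_differentiable[OF assms(1), of \<rho> c p q "\<rho> c $$ (p, q)"] slice_differentiable[OF assms(2), of \<rho> c p q]]
  unfolding entry_deriv_slice slice_id[OF assms(3,4)] .

lemma entry_deriv_cong:
  assumes "\<rho> \<in> rep_space Q d" "c \<in> AR" "\<And>x. x \<in> rep_space Q d \<Longrightarrow> F x = G x"
  shows "entry_deriv Q d c p q F \<rho> = entry_deriv Q d c p q G \<rho>"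
  unfolding entry_deriv_slice using assms(3)[OF slice_in[OF assms(1,2)]] by simp

text \<open>The directional derivative of F at \<rho> in the direction w.\<close>

definition dpol where
  "dpol F \<rho> w = (\<Sum>c\<in>AR. \<Sum>p<row_dim Q d c. \<Sum>q<col_dim Q d c. entry_deriv Q d c p q F \<rho> * w c p q)"

lemma triple_delta:
  assumes "k \<in> AR" "r < row_dim Q d k" "s < col_dim Q d k"
  shows "(\<Sum>c\<in>AR. \<Sum>p<row_dim Q d c. \<Sum>q<col_dim Q d c. (if c = k \<and> p = r \<and> q = s then 1 else 0) * w c p q) = (w k r s :: complex)"
proof -
  have "(\<Sum>q<col_dim Q d c. (if c = k \<and> p = r \<and> q = s then 1 else 0) * w c p q) = (if p = r then if c = k then w k r s else 0 else 0)" for c p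
  proof (cases "c = k \<and> p = r")
    case True
    then have "(\<Sum>q<col_dim Q d c. (if c = k \<and> p = r \<and> q = s then 1 else 0) * w c p q) = (\<Sum>q<col_dim Q d c. if q = s then w k r q else 0)"
      by (intro sum.cong) auto
    then show ?thesis using True assms by simp
  qed auto
  then have "(\<Sum>c\<in>AR. \<Sum>p<row_dim Q d c. \<Sum>q<col_dim Q d c. (if c = k \<and> p = r \<and> q = s then 1 else 0) * w c p q)
    = (\<Sum>c\<in>AR. \<Sum>p<row_dim Q d c. if p = r then if c = k then w k r s else 0 else 0)" by simp
  also have "\<dots> = (\<Sum>c\<in>AR. if c = k then w k r s else 0)"
    by (intro sum.cong refl) (use assms in auto)
  finally show ?thesis using assms finite_AR by simp
qed

lemma chain_rule:
  assumes F: "F \<in> PF" and r: "\<sigma> t0 \<in> rep_space Q d"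
    and w: "\<And>c p q. c \<in> AR \<Longrightarrow> p < row_dim Q d c \<Longrightarrow> q < col_dim Q d c \<Longrightarrow>
      ((\<lambda>t. \<sigma> t c $$ (p, q)) has_field_derivative w c p q) (at t0)"
  shows "((\<lambda>t. F (\<sigma> t)) has_field_derivative dpol F (\<sigma> t0) w) (at t0)"
  using F
proof (induction rule: polynomial_functions.induct)
  case (const z)
  then show ?case by (simp add: dpol_def entry_deriv_const)
next
  case (entry k p q)
  have "dpol (\<lambda>x. x k $$ (p, q)) (\<sigma> t0) w = w k p q"
    unfolding dpol_def entry_deriv_entry[OF entry(2,3)] by (rule triple_delta[OF entry])
  then show ?case using w[OF entry] by simp
next
  case (add F G)
  have "dpol (\<lambda>x. F x + G x) (\<sigma> t0) w = dpol F (\<sigma> t0) w + dpol G (\<sigma> t0) w"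
    unfolding dpol_def entry_deriv_add[OF add(1,2)] by (simp add: distrib_right sum.distrib)
  then show ?case using DERIV_add[OF add(3,4)] by simp
next
  case (mult F G)
  have "dpol (\<lambda>x. F x * G x) (\<sigma> t0) w = F (\<sigma> t0) * dpol G (\<sigma> t0) w + dpol F (\<sigma> t0) w * G (\<sigma> t0)"
    unfolding dpol_def
    by (simp add: entry_deriv_mult[OF mult(1,2) r] sum.distrib sum_distrib_left sum_distrib_right algebra_simps)
  then show ?case using DERIV_mult'[OF mult(3,4)] by simp
qed

subsection \<open>Trace functions\<close>

lemma evw_deriv:
  assumes U: "\<And>c x y. c \<in> AR \<Longrightarrow> ((\<lambda>t. U t c x y) has_field_derivative v c x y) (at t0)"
  shows "(i, cs) \<in> paths Q \<Longrightarrow> ((\<lambda>t. evw (U t) i cs x y) has_field_derivative dw (U t0) v i cs x y) (at t0)"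
proof (induction cs arbitrary: i x y)
  case Nil
  show ?case by (simp add: pw)
next
  case (Cons c cs)
  then have c: "c \<in> AR" "(tlc c, cs) \<in> paths Q" by (simp_all add: paths_Cons)
  have "((\<lambda>t. \<Sum>z\<in>idx. U t c x z * evw (U t) (tlc c) cs z y) has_field_derivative
     (\<Sum>z\<in>idx. U t0 c x z * dw (U t0) v (tlc c) cs z y + v c x z * evw (U t0) (tlc c) cs z y)) (at t0)"
    by (intro DERIV_sum DERIV_mult' U[OF c(1)] Cons.IH[OF c(2)])
  then show ?case by (simp add: mm_def pw sum.distrib add.commute)
qed

lemma R_deriv:
  assumes U: "\<And>c x y. c \<in> AR \<Longrightarrow> ((\<lambda>t. U t c x y) has_field_derivative v c x y) (at t0)" and f: "f \<in> AA"
  shows "((\<lambda>t. R (U t) f x y) has_field_derivative dR (U t0) v f x y) (at t0)"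
  using f
proof (induction f rule: AA_induct)
  case zero
  show ?case by (simp add: pw)
next
  case (single p z)
  show ?case unfolding R_single dR_single pw
    by (intro DERIV_cmult evw_deriv U) (use single in simp_all)
next
  case (add f g)
  show ?case unfolding R_add dR_add pw by (intro DERIV_add add)
qed

lemma PF_ent: "c \<in> AR \<Longrightarrow> (\<lambda>\<rho>. ent \<rho> c x y) \<in> PF"
proof (cases "x \<in> idx \<and> y \<in> idx \<and> fst x = hdc c \<and> fst y = tlc c")
  case True
  assume c: "c \<in> AR"
  have "snd x < row_dim Q d c" "snd y < col_dim Q d c"
    using True by (cases x; cases y; simp add: row_dim_def col_dim_def)+
  then show ?thesis using True c unfolding ent_def by (simp add: polynomial_functions.entry)
next
  case False
  then have "(\<lambda>\<rho>. ent \<rho> c x y) = (\<lambda>_. 0)" by (auto simp: ent_def)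
  then show ?thesis by (simp add: polynomial_functions.const)
qed

lemma PF_R:
  assumes f: "f \<in> AA" shows "(\<lambda>\<rho>. R (ent \<rho>) f x y) \<in> PF"
proof -
  note PF = fun_alg_const[OF fun_alg_PF] fun_alg_add[OF fun_alg_PF] fun_alg_mult[OF fun_alg_PF]
  have e: "(\<lambda>\<rho>. evw (ent \<rho>) i cs x y) \<in> PF" if "(i, cs) \<in> paths Q" for i cs x y
    using that
  proof (induction cs arbitrary: i x y)
    case Nil
    show ?case by (simp add: PF)
  next
    case (Cons c cs)
    then have c: "c \<in> AR" "(tlc c, cs) \<in> paths Q" by (simp_all add: paths_Cons)
    show ?case unfolding evw.simps mm_def
      by (intro fun_alg_sum[OF fun_alg_PF] PF PF_ent Cons.IH c)
  qed
  show ?thesis using f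
  proof (induction f rule: AA_induct)
    case zero
    show ?case by (simp add: pw PF)
  next
    case (single p z)
    show ?case unfolding R_single pw by (intro PF e) (use single in simp)
  next
    case (add f g)
    show ?case unfolding R_add pw by (intro PF add)
  qed
qed

definition trf :: "('v, 'e) path_comb \<Rightarrow> ('e + 'e \<Rightarrow> complex mat) \<Rightarrow> complex" where
  "trf f \<rho> = tr (R (ent \<rho>) f)"

lemma trf_cj:
  assumes GH: "inv_pair G H" and f: "f \<in> AA"
  shows "trf f (rho (cj G H (ent \<rho>))) = trf f \<rho>"
proof -
  have "R (ent (rho (cj G H (ent \<rho>)))) f = R (cj G H (ent \<rho>)) f"
    by (rule R_cong[OF f]) (rule ent_rho[OF blk_cj[OF GH blk_ent]])
  then show ?thesis by (simp add: trf_def tr_R_cj[OF GH blk_ent f])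
qed

lemma trf_IP:
  assumes f: "f \<in> AA" shows "trf f \<in> IP"
proof -
  have "trf f = (\<lambda>\<rho>. \<Sum>x\<in>idx. R (ent \<rho>) f x x)" by (simp add: trf_def[abs_def] tr_def)
  also have "\<dots> \<in> PF" by (intro fun_alg_sum[OF fun_alg_PF] PF_R f)
  finally show ?thesis unfolding IP_iff using trf_cj f by blast
qed

lemma trf_add: "trf (f + g) \<rho> = trf f \<rho> + trf g \<rho>"
  and trf_scale: "trf (path_scale z f) \<rho> = z * trf f \<rho>"
  by (simp_all add: trf_def R_add R_scale tr_add tr_scale)

text \<open>Varying one matrix entry moves the representation along a matrix unit, and pairing that
  unit with the gradient from \<open>tr_dR\<close> selects the transposed entry.\<close>

lemma entry_deriv_trf:
  assumes r: "\<rho> \<in> rep_space Q d" and c: "c \<in> AR" and p: "p < d (hdc c)" "q < d (tlc c)" and f: "f \<in> AA"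
  shows "entry_deriv Q d c p q (trf f) \<rho> = R (ent \<rho>) (cyclic_deriv Q c f) (tlc c, q) (hdc c, p)"
proof -
  have ix: "(hdc c, p) \<in> idx" "(tlc c, q) \<in> idx" using AR_verts[OF c] p by simp_all
  define v where "v c' = (if c' = c then munit (hdc c, p) (tlc c, q) else (0 :: 'v mtx))" for c'
  have bv: "blk v" using ix by (auto simp: blk_def v_def munit_def pw split: if_splits)
  define U where "U z = ent (slice \<rho> c p q z)" for z
  let ?z = "\<rho> c $$ (p, q)"
  have U0: "U ?z = ent \<rho>" by (simp add: U_def slice_id r c)
  have Ue: "U z c' x y = (if c' = c \<and> x = (hdc c, p) \<and> y = (tlc c, q) then z else ent \<rho> c' x y)" for z c' x y
  proof (cases "x \<in> idx \<and> y \<in> idx \<and> fst x = hdc c' \<and> fst y = tlc c'")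
    case True
    then have "snd x < row_dim Q d c'" "snd y < col_dim Q d c'"
      by (cases x; cases y; simp add: row_dim_def col_dim_def)+
    then show ?thesis using True by (cases x; cases y) (auto simp: U_def ent_def slice_entry)
  next
    case False
    then have "\<not> (c' = c \<and> x = (hdc c, p) \<and> y = (tlc c, q))" using ix by auto
    then show ?thesis using False by (auto simp: U_def ent_def)
  qed
  have dU: "((\<lambda>z. U z c' x y) has_field_derivative v c' x y) (at ?z)" for c' x y
    by (cases "c' = c \<and> x = (hdc c, p) \<and> y = (tlc c, q)") (auto simp: Ue v_def munit_def pw)
  have "((\<lambda>z. \<Sum>x\<in>idx. R (U z) f x x) has_field_derivative (\<Sum>x\<in>idx. dR (U ?z) v f x x)) (at ?z)"
    by (intro DERIV_sum R_deriv dU f)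
  then have "entry_deriv Q d c p q (trf f) \<rho> = tr (dR (ent \<rho>) v f)"
    unfolding entry_deriv_slice trf_def[abs_def] tr_def U0 by (simp add: U_def DERIV_imp_deriv)
  also have "\<dots> = (\<Sum>c'\<in>AR. tr (v c' \<diamond> R (ent \<rho>) (cyclic_deriv Q c' f)))"
    by (rule tr_dR[OF blk_ent bv f])
  also have "\<dots> = (\<Sum>c'\<in>AR. if c' = c then tr (munit (hdc c, p) (tlc c, q) \<diamond> R (ent \<rho>) (cyclic_deriv Q c f)) else 0)"
    by (intro sum.cong refl) (auto simp: v_def mm_zero_left tr_0)
  also have "\<dots> = tr (R (ent \<rho>) (cyclic_deriv Q c f) \<diamond> munit (hdc c, p) (tlc c, q))"
    using finite_AR c by (simp add: tr_comm)
  finally show ?thesis by (simp only: tr_mm_munit[OF ix])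
qed

abbreviation dvec where "dvec v \<equiv> (\<lambda>c p q. v c (hdc c, p) (tlc c, q))"

text \<open>Once the gradient of the trace of g is inserted, the canonical bracket differentiates F
  along \<open>ham\<close>, whose signs are made for this.\<close>

lemma rep_poisson_trf:
  assumes r: "\<rho> \<in> rep_space Q d" and g: "g \<in> AA"
  shows "rep_poisson Q d F (trf g) \<rho> = dpol F \<rho> (dvec (ham (ent \<rho>) g))"
proof -
  have "rep_poisson Q d F (trf g) \<rho> =
    (\<Sum>a\<in>arcs Q. \<Sum>p<d (head Q a). \<Sum>q<d (tail Q a).
       entry_deriv Q d (Inl a) p q F \<rho> * ham (ent \<rho>) g (Inl a) (head Q a, p) (tail Q a, q)
     + entry_deriv Q d (Inr a) q p F \<rho> * ham (ent \<rho>) g (Inr a) (tail Q a, q) (head Q a, p))"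
    unfolding rep_poisson_def
    by (intro sum.cong refl) (simp add: entry_deriv_trf r g AR_I ham_def)
  also have "\<dots> = (\<Sum>a\<in>arcs Q. (\<Sum>p<d (head Q a). \<Sum>q<d (tail Q a).
       entry_deriv Q d (Inl a) p q F \<rho> * ham (ent \<rho>) g (Inl a) (head Q a, p) (tail Q a, q))
     + (\<Sum>q<d (tail Q a). \<Sum>p<d (head Q a). entry_deriv Q d (Inr a) q p F \<rho> * ham (ent \<rho>) g (Inr a) (tail Q a, q) (head Q a, p)))"
    unfolding sum.distrib by (subst (2) sum.swap) simp
  finally show ?thesis by (simp add: dpol_def sum_AR row_dim_def col_dim_def)
qed

lemma dpol_trf:
  assumes r: "\<rho> \<in> rep_space Q d" and f: "f \<in> AA" and g: "g \<in> AA"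
  shows "dpol (trf f) \<rho> (dvec (ham (ent \<rho>) g)) = trf (path_bracket Q f g) \<rho>"
proof -
  let ?u = "ent \<rho>" let ?h = "ham ?u g"
  have "(\<Sum>p<row_dim Q d c. \<Sum>q<col_dim Q d c. entry_deriv Q d c p q (trf f) \<rho> * dvec ?h c p q)
     = tr (?h c \<diamond> R ?u (cyclic_deriv Q c f))" if c: "c \<in> AR" for c
  proof -
    let ?D = "R ?u (cyclic_deriv Q c f)"
    have h0: "?h c x y = 0" if "fst x \<noteq> hdc c \<or> fst y \<noteq> tlc c" for x y
      using blkD[OF blk_ham[OF blk_ent g] c] that by blast
    have "tr (?h c \<diamond> ?D) = (\<Sum>x\<in>idx. \<Sum>y\<in>idx. ?h c x y * ?D y x)" by (simp add: tr_def mm_def)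
    also have "\<dots> = (\<Sum>p<d (hdc c). \<Sum>y\<in>idx. ?h c (hdc c, p) y * ?D y (hdc c, p))"
      by (intro sum_block AR_verts c sum.neutral ballI) (simp add: h0)
    also have "\<dots> = (\<Sum>p<d (hdc c). \<Sum>q<d (tlc c). ?h c (hdc c, p) (tlc c, q) * ?D (tlc c, q) (hdc c, p))"
      by (intro sum.cong refl sum_block AR_verts c) (simp add: h0)
    finally show ?thesis using c f by (simp add: row_dim_def col_dim_def entry_deriv_trf[OF r] mult.commute)
  qed
  then have "dpol (trf f) \<rho> (dvec ?h) = (\<Sum>c\<in>AR. tr (?h c \<diamond> R ?u (cyclic_deriv Q c f)))"
    unfolding dpol_def by (rule sum.cong[OF refl])
  then show ?thesis by (simp add: trf_def tr_bracket[OF blk_ent f g] tr_dR[OF blk_ent blk_ham[OF blk_ent g] f])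
qed

subsection \<open>The trace algebra\<close>

inductive_set TA :: "(('e + 'e \<Rightarrow> complex mat) \<Rightarrow> complex) set" where
  const: "(\<lambda>_. z) \<in> TA"
| trace: "f \<in> AA \<Longrightarrow> trf f \<in> TA"
| add: "F \<in> TA \<Longrightarrow> G \<in> TA \<Longrightarrow> (\<lambda>x. F x + G x) \<in> TA"
| mult: "F \<in> TA \<Longrightarrow> G \<in> TA \<Longrightarrow> (\<lambda>x. F x * G x) \<in> TA"

lemma TA_IP: "F \<in> TA \<Longrightarrow> F \<in> IP"
  by (induction rule: TA.induct) (auto intro: trf_IP fun_alg_const[OF fun_alg_IP] fun_alg_add[OF fun_alg_IP] fun_alg_mult[OF fun_alg_IP])

text \<open>Point derivations of the ring of invariants. The clause about \<open>rep_space\<close>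
  is there because polynomials are functions on all families of matrices. Entry derivatives and
  tangent vectors of the quotient are both instances.\<close>

definition pder :: "('e + 'e \<Rightarrow> complex mat) \<Rightarrow> ((('e + 'e \<Rightarrow> complex mat) \<Rightarrow> complex) \<Rightarrow> complex) \<Rightarrow> bool" where
  "pder \<rho> \<delta> \<longleftrightarrow> (\<forall>F\<in>IP. \<forall>G\<in>IP. \<delta> (\<lambda>x. F x + G x) = \<delta> F + \<delta> G \<and> \<delta> (\<lambda>x. F x * G x) = F \<rho> * \<delta> G + G \<rho> * \<delta> F
     \<and> ((\<forall>x\<in>rep_space Q d. F x = G x) \<longrightarrow> \<delta> F = \<delta> G)) \<and> (\<forall>z. \<delta> (\<lambda>_. z) = 0)"

lemma pderD:
  assumes "pder \<rho> \<delta>"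
  shows "F \<in> IP \<Longrightarrow> G \<in> IP \<Longrightarrow> \<delta> (\<lambda>x. F x + G x) = \<delta> F + \<delta> G"
    "F \<in> IP \<Longrightarrow> G \<in> IP \<Longrightarrow> \<delta> (\<lambda>x. F x * G x) = F \<rho> * \<delta> G + G \<rho> * \<delta> F"
    "F \<in> IP \<Longrightarrow> G \<in> IP \<Longrightarrow> (\<And>x. x \<in> rep_space Q d \<Longrightarrow> F x = G x) \<Longrightarrow> \<delta> F = \<delta> G"
    "\<delta> (\<lambda>_. z) = 0"
  using assms unfolding pder_def by blast+

lemma pder_entry_deriv:
  assumes "\<rho> \<in> rep_space Q d" "c \<in> AR"
  shows "pder \<rho> (\<lambda>F. entry_deriv Q d c p q F \<rho>)"
  unfolding pder_def
proof (intro conjI ballI allI impI)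
  fix F G assume F: "F \<in> IP" and G: "G \<in> IP"
  note FG = IP_PF[OF F] IP_PF[OF G]
  show "entry_deriv Q d c p q (\<lambda>x. F x + G x) \<rho> = entry_deriv Q d c p q F \<rho> + entry_deriv Q d c p q G \<rho>"
    by (rule entry_deriv_add[OF FG])
  show "entry_deriv Q d c p q (\<lambda>x. F x * G x) \<rho> = F \<rho> * entry_deriv Q d c p q G \<rho> + G \<rho> * entry_deriv Q d c p q F \<rho>"
    unfolding entry_deriv_mult[OF FG assms] by (simp only: mult.commute)
  assume "\<forall>x\<in>rep_space Q d. F x = G x"
  then show "entry_deriv Q d c p q F \<rho> = entry_deriv Q d c p q G \<rho>"
    by (intro entry_deriv_cong[OF assms]) blast
qed (rule entry_deriv_const)

lemma pder_trf_add: "pder \<rho> \<delta> \<Longrightarrow> f \<in> AA \<Longrightarrow> g \<in> AA \<Longrightarrow> \<delta> (trf (f + g)) = \<delta> (trf f) + \<delta> (trf g)"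
  using pderD(1)[OF _ trf_IP trf_IP] unfolding trf_add[symmetric] by blast

lemma pder_trf_scale:
  assumes \<delta>: "pder \<rho> \<delta>" and f: "f \<in> AA" shows "\<delta> (trf (path_scale z f)) = z * \<delta> (trf f)"
  using pderD(2)[OF \<delta> fun_alg_const[OF fun_alg_IP] trf_IP[OF f], of z] pderD(4)[OF \<delta>, of z]
  unfolding trf_scale[symmetric] by simp

text \<open>The Leibniz rule at \<rho> turns a product of traces into a combination of traces, with
  values at \<rho> as coefficients. These coefficients are the same for all derivations, hence so is
  f.\<close>

lemma TA_derivation:
  assumes "t \<in> TA" shows "\<exists>f\<in>AA. \<forall>\<delta>. pder \<rho> \<delta> \<longrightarrow> \<delta> t = \<delta> (trf f)"
  using assms
proof (induction rule: TA.induct)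
  case (const z)
  have "\<delta> (trf 0) = 0" if "pder \<rho> \<delta>" for \<delta>
    using pderD(4)[OF that, of 0] by (simp add: trf_def[abs_def] tr_0)
  then show ?case using AA_0 pderD(4) by metis
next
  case (trace f)
  then show ?case by blast
next
  case (add F G)
  then obtain f g where f: "f \<in> AA" "\<forall>\<delta>. pder \<rho> \<delta> \<longrightarrow> \<delta> F = \<delta> (trf f)"
    and g: "g \<in> AA" "\<forall>\<delta>. pder \<rho> \<delta> \<longrightarrow> \<delta> G = \<delta> (trf g)" by blast
  show ?case
  proof (intro bexI[of _ "f + g"] allI impI)
    fix \<delta> assume \<delta>: "pder \<rho> \<delta>"
    show "\<delta> (\<lambda>x. F x + G x) = \<delta> (trf (f + g))"
      unfolding pderD(1)[OF \<delta> TA_IP[OF add(1)] TA_IP[OF add(2)]] pder_trf_add[OF \<delta> f(1) g(1)]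
      f(2)[rule_format, OF \<delta>] g(2)[rule_format, OF \<delta>] ..
  qed (intro AA_add f g)
next
  case (mult F G)
  then obtain f g where f: "f \<in> AA" "\<forall>\<delta>. pder \<rho> \<delta> \<longrightarrow> \<delta> F = \<delta> (trf f)"
    and g: "g \<in> AA" "\<forall>\<delta>. pder \<rho> \<delta> \<longrightarrow> \<delta> G = \<delta> (trf g)" by blast
  show ?case
  proof (intro bexI[of _ "path_scale (F \<rho>) g + path_scale (G \<rho>) f"] allI impI)
    fix \<delta> assume \<delta>: "pder \<rho> \<delta>"
    show "\<delta> (\<lambda>x. F x * G x) = \<delta> (trf (path_scale (F \<rho>) g + path_scale (G \<rho>) f))"
      unfolding pderD(2)[OF \<delta> TA_IP[OF mult(1)] TA_IP[OF mult(2)]] pder_trf_add[OF \<delta> AA_scale[OF g(1)] AA_scale[OF f(1)]]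
        pder_trf_scale[OF \<delta> f(1)] pder_trf_scale[OF \<delta> g(1)]
      f(2)[rule_format, OF \<delta>] g(2)[rule_format, OF \<delta>] by simp
  qed (intro AA_add AA_scale f g)
qed

end

lemma det_zero_column:
  assumes "A \<in> carrier_mat n n" "j < n" "\<And>i. i < n \<Longrightarrow> A $$ (i, j) = 0"
  shows "det A = (0 :: complex)"
  using laplace_expansion_column[OF assms(1,2)] assms(3) by simp

context quiver
begin

subsection \<open>A bordered Gram determinant\<close>

text \<open>The traces of products of \<open>N + 1\<close> elements, where \<open>N\<close> is the dimension of the matrix
  algebra, have vanishing Gram determinant at every representation. Border a pair of dual bases
  by \<open>f\<close> and \<open>g\<close>: as the first row and column vanish at the given point, differentiating the
  determinant leaves only the derivative of the trace of \<open>f \<star> g\<close>.\<close>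

lemma pder_square_zero:
  assumes u: "full (ent \<rho>)" and \<delta>: "pder \<rho> \<delta>"
    and f: "f \<in> AA" "R (ent \<rho>) f = 0" and g: "g \<in> AA" "R (ent \<rho>) g = 0"
  shows "\<delta> (trf (f \<star> g)) = 0"
proof -
  obtain F where F: "\<And>x y. x \<in> idx \<Longrightarrow> y \<in> idx \<Longrightarrow> F x y \<in> AA"
    "\<And>x y. x \<in> idx \<Longrightarrow> y \<in> idx \<Longrightarrow> R (ent \<rho>) (F x y) = munit x y"
    using full_lifts[OF u] by metis
  obtain ks where ks: "set ks = idx \<times> idx" "distinct ks" using finite_distinct_list[of "idx \<times> idx"] finI by auto
  define N where "N = length ks"
  have kI: "fst (ks ! m) \<in> idx" "snd (ks ! m) \<in> idx" if "m < N" for m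
    using nth_mem[of m ks] that ks(1) by (auto simp: N_def mem_Times_iff)
  \<comment> \<open>Index 0 is the border f, g. The other indices run through the lifted matrix
    units and their transposes, which at \<rho> are dual bases for the trace form.\<close>
  define X where "X k = (if k = 0 then f else F (fst (ks ! (k - 1))) (snd (ks ! (k - 1))))" for k
  define Y where "Y k = (if k = 0 then g else F (snd (ks ! (k - 1))) (fst (ks ! (k - 1))))" for k
  have XA: "X k \<in> AA" "Y k \<in> AA" if "k < Suc N" for k
    using that kI[of "k - 1"] by (auto simp: X_def Y_def f(1) g(1) intro!: F(1))
  define M where "M \<sigma> = Matrix.mat (Suc N) (Suc N) (\<lambda>(a, b). trf (X a \<star> Y b) \<sigma>)" for \<sigma>
  have Mc: "M \<sigma> \<in> carrier_mat (Suc N) (Suc N)" for \<sigma> by (simp add: M_def)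
  \<comment> \<open>M factors through a space of dimension N. The factors are made square by a zero
    column and a zero row, so the determinant vanishes at every \<sigma>.\<close>
  have dM: "det (M \<sigma>) = 0" for \<sigma>
  proof -
    let ?v = "ent \<sigma>"
    define U where "U = Matrix.mat (Suc N) (Suc N) (\<lambda>(a, m). if m < N then R ?v (X a) (fst (ks ! m)) (snd (ks ! m)) else 0)"
    define W where "W = Matrix.mat (Suc N) (Suc N) (\<lambda>(m, b). if m < N then R ?v (Y b) (snd (ks ! m)) (fst (ks ! m)) else 0)"
    have "M \<sigma> = U * W"
    proof (rule eq_matI)
      fix a b assume ab: "a < dim_row (U * W)" "b < dim_col (U * W)"
      then have ab: "a < Suc N" "b < Suc N" by (simp_all add: U_def W_def)
      have "trf (X a \<star> Y b) \<sigma> = (\<Sum>x\<in>idx. \<Sum>y\<in>idx. R ?v (X a) x y * R ?v (Y b) y x)"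
        by (simp add: trf_def R_mult[OF blk_ent XA(1)[OF ab(1)] XA(2)[OF ab(2)]] tr_def mm_def)
      also have "\<dots> = (\<Sum>k\<in>idx \<times> idx. R ?v (X a) (fst k) (snd k) * R ?v (Y b) (snd k) (fst k))"
        by (simp add: sum.cartesian_product case_prod_beta)
      also have "\<dots> = (\<Sum>m<N. R ?v (X a) (fst (ks ! m)) (snd (ks ! m)) * R ?v (Y b) (snd (ks ! m)) (fst (ks ! m)))"
        by (rule sum.reindex_bij_betw[symmetric]) (rule bij_betw_nth[OF ks(2)], simp_all add: N_def ks(1))
      also have "\<dots> = (U * W) $$ (a, b)"
        using ab by (simp add: U_def W_def scalar_prod_def atLeast0LessThan)
      finally show "M \<sigma> $$ (a, b) = (U * W) $$ (a, b)" using ab by (simp add: M_def)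
    qed (simp_all add: M_def U_def W_def)
    moreover have "det U = 0" by (rule det_zero_column[of U "Suc N" N]) (simp_all add: U_def)
    moreover have "det (U * W) = det U * det W" by (rule det_mult[of _ "Suc N"]) (simp_all add: U_def W_def)
    ultimately show ?thesis by simp
  qed
  have E: "(\<lambda>\<sigma>. M \<sigma> $$ (a, b)) \<in> IP" if "a < Suc N" "b < Suc N" for a b
  proof -
    have "(\<lambda>\<sigma>. M \<sigma> $$ (a, b)) = trf (X a \<star> Y b)" using that by (auto simp: M_def)
    then show ?thesis using that by (simp add: trf_IP AA_mult XA)
  qed
  have C: "(\<lambda>\<sigma>. cofactor (M \<sigma>) 0 b) \<in> IP" if "b < Suc N" for b
    by (rule fun_alg_cofactor[OF fun_alg_IP Mc E]) (use that in simp_all)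
  have M0: "M \<rho> $$ (0, b) = 0" "M \<rho> $$ (b, 0) = 0" if "b < Suc N" for b
    using that XA[OF that] by (simp_all add: M_def trf_def R_mult blk_ent f g X_def[of 0] Y_def[of 0] mm_zero_left mm_zero_right tr_0)
  have cz: "cofactor (M \<rho>) 0 b = 0" if b: "0 < b" "b < Suc N" for b
  proof -
    have "det (mat_delete (M \<rho>) 0 b) = 0"
    proof (rule det_zero_column[of _ N 0])
      show "mat_delete (M \<rho>) 0 b \<in> carrier_mat N N" using mat_delete_carrier[OF Mc] by simp
      show "mat_delete (M \<rho>) 0 b $$ (i, 0) = 0" if "i < N" for i
        using that b M0(2)[of "Suc i"] Mc[of \<rho>] by (simp add: mat_delete_def)
    qed (use b in simp)
    then show ?thesis by (simp add: cofactor_def)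
  qed
  \<comment> \<open>Dual bases have the identity as Gram matrix.\<close>
  have c0: "cofactor (M \<rho>) 0 0 = 1"
  proof -
    have "mat_delete (M \<rho>) 0 0 = 1\<^sub>m N"
    proof (rule eq_matI)
      fix i j assume "i < dim_row (1\<^sub>m N :: complex mat)" "j < dim_col (1\<^sub>m N :: complex mat)"
      then have ij: "i < N" "j < N" by auto
      have "mat_delete (M \<rho>) 0 0 $$ (i, j) = trf (X (Suc i) \<star> Y (Suc j)) \<rho>"
        using ij Mc[of \<rho>] by (simp add: mat_delete_def M_def)
      also have "\<dots> = (if ks ! i = ks ! j then 1 else 0)"
        using kI[OF ij(1)] kI[OF ij(2)] XA(1)[of "Suc i"] XA(2)[of "Suc j"] ij
        by (simp add: trf_def R_mult[OF blk_ent] X_def Y_def F(2) munit_munit tr_munit tr_0 prod_eq_iff)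
      finally show "mat_delete (M \<rho>) 0 0 $$ (i, j) = 1\<^sub>m N $$ (i, j)"
        using ij nth_eq_iff_index_eq[OF ks(2), of i j] by (simp add: N_def)
    qed (use Mc[of \<rho>] in auto)
    then show ?thesis by (simp add: cofactor_def)
  qed
  \<comment> \<open>Derivatives of cofactors come multiplied by entries of row 0, which vanish at
    \<rho>, so only derivatives of the entries survive.\<close>
  have S: "\<delta> (\<lambda>\<sigma>. \<Sum>b<k. M \<sigma> $$ (0, b) * cofactor (M \<sigma>) 0 b) = (\<Sum>b<k. cofactor (M \<rho>) 0 b * \<delta> (\<lambda>\<sigma>. M \<sigma> $$ (0, b)))"
    if "k \<le> Suc N" for k
    using that
  proof (induction k)
    case 0
    then show ?case using pderD(4)[OF \<delta>, of 0] by simp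
  next
    case (Suc k)
    have "(\<lambda>\<sigma>. \<Sum>b<k. M \<sigma> $$ (0, b) * cofactor (M \<sigma>) 0 b) \<in> IP"
      by (intro fun_alg_sum[OF fun_alg_IP] fun_alg_mult[OF fun_alg_IP] E C) (use Suc.prems in auto)
    from pderD(1)[OF \<delta> this fun_alg_mult[OF fun_alg_IP E C], of 0 k k] Suc
    show ?case by (simp add: pderD(2)[OF \<delta> E C] M0)
  qed
  have "0 = \<delta> (\<lambda>\<sigma>. det (M \<sigma>))" by (simp add: dM pderD(4)[OF \<delta>])
  also have "\<dots> = (\<Sum>b<Suc N. cofactor (M \<rho>) 0 b * \<delta> (\<lambda>\<sigma>. M \<sigma> $$ (0, b)))"
    using S[of "Suc N"] by (simp only: laplace_expansion_row[OF Mc zero_less_Suc] le_refl)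
  also have "\<dots> = \<delta> (\<lambda>\<sigma>. M \<sigma> $$ (0, 0))"
    by (subst sum.lessThan_Suc_shift) (simp add: cz c0)
  also have "\<dots> = \<delta> (trf (f \<star> g))" by (simp add: M_def X_def Y_def)
  finally show ?thesis by simp
qed

subsection \<open>Invariants are local quotients of trace polynomials\<close>

text \<open>\<open>Bl f\<close> is the function \<open>\<xi> f w\<close> of a representation, a vector \<open>w\<close> and a covector \<open>\<xi>\<close>.\<close>

definition Bl :: "('v, 'e) path_comb \<Rightarrow> ('e + 'e \<Rightarrow> complex mat) \<times> ('v \<times> nat + 'v \<times> nat \<Rightarrow> complex) \<Rightarrow> complex" where
  "Bl f x = (\<Sum>a\<in>idx. \<Sum>b\<in>idx. snd x (Inr a) * R (ent (fst x)) f a b * snd x (Inl b))"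

text \<open>Traces together with contractions of words between a covector and a vector: a class of
  expressions large enough to be closed under the Laplacian, and reduced to traces when vector and
  covector are zero.\<close>

inductive_set WW :: "(('e + 'e \<Rightarrow> complex mat) \<times> ('v \<times> nat + 'v \<times> nat \<Rightarrow> complex) \<Rightarrow> complex) set" where
  tra: "t \<in> TA \<Longrightarrow> (\<lambda>x. t (fst x)) \<in> WW"
| bil: "f \<in> AA \<Longrightarrow> Bl f \<in> WW"
| add: "F \<in> WW \<Longrightarrow> G \<in> WW \<Longrightarrow> (\<lambda>x. F x + G x) \<in> WW"
| mult: "F \<in> WW \<Longrightarrow> G \<in> WW \<Longrightarrow> (\<lambda>x. F x * G x) \<in> WW"

lemma fun_alg_WW: "fun_alg WW"
  using WW.tra[OF TA.const] by (auto simp: fun_alg_def intro: WW.add WW.mult)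

lemma Pol_bil: "(\<lambda>z. z (Inr a) * c * z (Inl b)) \<in> Pol"
  by (intro Pol.intros)

lemma WW_Pol: "G \<in> WW \<Longrightarrow> (\<lambda>z. G (\<rho>, z)) \<in> Pol"
proof (induction rule: WW.induct)
  case (bil f)
  show ?case unfolding Bl_def by (intro Pol_sum) (simp add: Pol_bil)
qed (auto intro: Pol.intros)

definition px where "px k G x = pd k (\<lambda>z. G (fst x, z)) (snd x)"

lemma px_tra: "px k (\<lambda>x. t (fst x)) = (\<lambda>_. 0)"
  by (simp add: px_def[abs_def] pd_const)

lemma px_add: "F \<in> WW \<Longrightarrow> G \<in> WW \<Longrightarrow> px k (\<lambda>x. F x + G x) = (\<lambda>x. px k F x + px k G x)"
  by (simp add: px_def[abs_def] pd_add WW_Pol)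

lemma px_mult: "F \<in> WW \<Longrightarrow> G \<in> WW \<Longrightarrow> px k (\<lambda>x. F x * G x) = (\<lambda>x. F x * px k G x + px k F x * G x)"
  by (simp add: px_def[abs_def] pd_mult WW_Pol)

lemma pd_bil: "pd k (\<lambda>z. z (Inr a) * c * z (Inl b)) z =
    (if k = Inl b then z (Inr a) * c else 0) + (if k = Inr a then c * z (Inl b) else 0)"
  by (auto simp: pd_mult pd_coord pd_const Pol.intros)

lemma px_Bl:
  "px (Inl b) (Bl f) x = (if b \<in> idx then \<Sum>a\<in>idx. snd x (Inr a) * R (ent (fst x)) f a b else 0)"
  "px (Inr a) (Bl f) x = (if a \<in> idx then \<Sum>b\<in>idx. R (ent (fst x)) f a b * snd x (Inl b) else 0)"
proof -
  have "px k (Bl f) x = (\<Sum>a\<in>idx. \<Sum>b\<in>idx. pd k (\<lambda>z. z (Inr a) * R (ent (fst x)) f a b * z (Inl b)) (snd x))" for k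
    unfolding px_def Bl_def fst_conv snd_conv
    by (subst pd_sum, intro Pol_sum Pol_bil, intro sum.cong refl, subst pd_sum, rule Pol_bil, rule refl)
  then have e: "px k (Bl f) x = (\<Sum>a\<in>idx. \<Sum>b\<in>idx. (if k = Inl b then snd x (Inr a) * R (ent (fst x)) f a b else 0)
      + (if k = Inr a then R (ent (fst x)) f a b * snd x (Inl b) else 0))" for k
    unfolding pd_bil .
  show "px (Inl b) (Bl f) x = (if b \<in> idx then \<Sum>a\<in>idx. snd x (Inr a) * R (ent (fst x)) f a b else 0)"
    unfolding e using finI by (simp add: sum.distrib)
  have "(\<Sum>b\<in>idx. if a = a' then R (ent (fst x)) f a' b * snd x (Inl b) else 0)
     = (if a = a' then (\<Sum>b\<in>idx. R (ent (fst x)) f a b * snd x (Inl b)) else 0)" for a' by auto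
  then show "px (Inr a) (Bl f) x = (if a \<in> idx then \<Sum>b\<in>idx. R (ent (fst x)) f a b * snd x (Inl b) else 0)"
    unfolding e using finI by (simp add: sum.distrib)
qed

text \<open>A derivation in disguise: the covector \<xi> is moved in the direction \<xi> f. It takes
  \<open>Bl g\<close> to \<open>Bl (f \<star> g)\<close> and kills traces.\<close>

lemma WW_polarize:
  assumes f: "f \<in> AA" and G: "G \<in> WW"
  shows "(\<lambda>x. \<Sum>a\<in>idx. (\<Sum>k\<in>idx. snd x (Inr k) * R (ent (fst x)) f k a) * px (Inr a) G x) \<in> WW"
  using G
proof (induction rule: WW.induct)
  case (tra t)
  show ?case unfolding px_tra using fun_alg_const[OF fun_alg_WW, of 0] by simp
next
  case (bil g)
  have "(\<Sum>a\<in>idx. (\<Sum>k\<in>idx. snd x (Inr k) * R (ent (fst x)) f k a) * px (Inr a) (Bl g) x) = Bl (f \<star> g) x" for x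
  proof -
    let ?u = "ent (fst x)"
    have "(\<Sum>a\<in>idx. (\<Sum>k\<in>idx. snd x (Inr k) * R ?u f k a) * px (Inr a) (Bl g) x)
      = (\<Sum>a\<in>idx. \<Sum>k\<in>idx. \<Sum>b\<in>idx. snd x (Inr k) * R ?u f k a * (R ?u g a b * snd x (Inl b)))"
      by (intro sum.cong refl) (simp add: px_Bl sum_product)
    also have "\<dots> = (\<Sum>k\<in>idx. \<Sum>a\<in>idx. \<Sum>b\<in>idx. snd x (Inr k) * R ?u f k a * (R ?u g a b * snd x (Inl b)))"
      by (rule sum.swap)
    also have "\<dots> = (\<Sum>k\<in>idx. \<Sum>b\<in>idx. \<Sum>a\<in>idx. snd x (Inr k) * R ?u f k a * (R ?u g a b * snd x (Inl b)))"
      by (intro sum.cong refl sum.swap)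
    also have "\<dots> = Bl (f \<star> g) x"
      unfolding Bl_def R_mult[OF blk_ent f bil] mm_def
      by (intro sum.cong refl) (simp add: sum_distrib_left sum_distrib_right mult.assoc)
    finally show ?thesis .
  qed
  then show ?case using WW.bil[OF AA_mult[OF f bil]] by (simp add: fun_eq_iff[symmetric])
next
  case (add F G)
  show ?case unfolding px_add[OF add(1,2)] distrib_left sum.distrib
    by (rule WW.add[OF add(3,4)])
next
  case (mult F G)
  have "(\<Sum>a\<in>idx. (\<Sum>k\<in>idx. snd x (Inr k) * R (ent (fst x)) f k a) * (F x * px (Inr a) G x + px (Inr a) F x * G x))
    = F x * (\<Sum>a\<in>idx. (\<Sum>k\<in>idx. snd x (Inr k) * R (ent (fst x)) f k a) * px (Inr a) G x)
    + G x * (\<Sum>a\<in>idx. (\<Sum>k\<in>idx. snd x (Inr k) * R (ent (fst x)) f k a) * px (Inr a) F x)" for x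
    unfolding sum_distrib_left[of "F x"] sum_distrib_left[of "G x"] sum.distrib[symmetric]
    by (intro sum.cong refl) (simp add: algebra_simps)
  then show ?case unfolding px_mult[OF mult(1,2)]
    using WW.add[OF WW.mult[OF mult(1,4)] WW.mult[OF mult(2,3)]] by simp
qed

text \<open>The product rule in F reduces to generators, and the gradient of \<open>Bl f\<close> in
  the vector is the covector \<xi> f, so \<open>WW_polarize\<close> applies.\<close>

lemma WW_gradient:
  assumes G: "G \<in> WW" and F: "F \<in> WW"
  shows "(\<lambda>x. \<Sum>a\<in>idx. px (Inl a) F x * px (Inr a) G x) \<in> WW"
  using F
proof (induction rule: WW.induct)
  case (tra t)
  show ?case unfolding px_tra using fun_alg_const[OF fun_alg_WW, of 0] by simp
next
  case (bil f)
  have "(\<Sum>a\<in>idx. px (Inl a) (Bl f) x * px (Inr a) G x)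
    = (\<Sum>a\<in>idx. (\<Sum>k\<in>idx. snd x (Inr k) * R (ent (fst x)) f k a) * px (Inr a) G x)" for x
    by (intro sum.cong refl) (simp add: px_Bl)
  then show ?case using WW_polarize[OF bil G] by simp
next
  case (add F F')
  show ?case unfolding px_add[OF add(1,2)] distrib_right sum.distrib
    by (rule WW.add[OF add(3,4)])
next
  case (mult F F')
  have "(\<Sum>a\<in>idx. (F x * px (Inl a) F' x + px (Inl a) F x * F' x) * px (Inr a) G x)
    = F x * (\<Sum>a\<in>idx. px (Inl a) F' x * px (Inr a) G x) + F' x * (\<Sum>a\<in>idx. px (Inl a) F x * px (Inr a) G x)" for x
    unfolding sum_distrib_left[of "F x"] sum_distrib_left[of "F' x"] sum.distrib[symmetric]
    by (intro sum.cong refl) (simp add: algebra_simps)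
  then show ?case unfolding px_mult[OF mult(1,2)]
    using WW.add[OF WW.mult[OF mult(1,4)] WW.mult[OF mult(2,3)]] by simp
qed

text \<open>On a generator \<xi> f w the Laplacian joins the two ends and leaves the trace of f; on
  products \<open>WW_gradient\<close> handles the cross terms.\<close>

lemma WW_Lap:
  assumes G: "G \<in> WW"
  shows "(\<lambda>x. Lap idx (\<lambda>z. G (fst x, z)) (snd x)) \<in> WW"
  using G
proof (induction rule: WW.induct)
  case (tra t)
  show ?case using fun_alg_const[OF fun_alg_WW, of 0] by (simp add: Lap_const)
next
  case (bil f)
  have "Lap idx (\<lambda>z. Bl f (fst x, z)) (snd x) = trf f (fst x)" for x
  proof -
    have "pd (Inr a) (\<lambda>z. Bl f (fst x, z)) = (\<lambda>z. \<Sum>b\<in>idx. R (ent (fst x)) f a b * z (Inl b))" if "a \<in> idx" for a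
      using px_Bl(2)[of a f "(fst x, z)" for z] that by (simp add: px_def fun_eq_iff)
    moreover have "pd (Inl a) (\<lambda>z. \<Sum>b\<in>idx. R (ent (fst x)) f a b * z (Inl b)) (snd x) = R (ent (fst x)) f a a" if "a \<in> idx" for a
    proof -
      have "pd (Inl a) (\<lambda>z. \<Sum>b\<in>idx. R (ent (fst x)) f a b * z (Inl b)) (snd x)
        = (\<Sum>b\<in>idx. if b = a then R (ent (fst x)) f a b else 0)"
        by (subst pd_sum) (auto intro!: Pol.intros sum.cong simp: pd_mult[OF Pol.const Pol.coord] pd_const pd_coord)
      then show ?thesis using that finI by simp
    qed
    ultimately show ?thesis by (simp add: Lap_def trf_def tr_def)
  qed
  then show ?case using WW.tra[OF TA.trace[OF bil]] by simp
next
  case (add F G)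
  show ?case unfolding Lap_add[OF WW_Pol[OF add(1)] WW_Pol[OF add(2)]] by (rule WW.add[OF add(3,4)])
next
  case (mult F G)
  have "Lap idx (\<lambda>z. F (fst x, z) * G (fst x, z)) (snd x) = (Lap idx (\<lambda>z. F (fst x, z)) (snd x) * G x + F x * Lap idx (\<lambda>z. G (fst x, z)) (snd x))
     + (\<Sum>a\<in>idx. px (Inl a) F x * px (Inr a) G x) + (\<Sum>a\<in>idx. px (Inl a) G x * px (Inr a) F x)" for x
    unfolding Lap_mult[OF WW_Pol[OF mult(1)] WW_Pol[OF mult(2)]] px_def by simp
  then show ?case
    by (simp only:) (intro WW.add WW.mult WW_gradient mult)
qed

lemma WW_zero: "G \<in> WW \<Longrightarrow> (\<lambda>\<rho>. G (\<rho>, \<lambda>_. 0)) \<in> TA"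
proof (induction rule: WW.induct)
  case (bil f)
  then show ?case using TA.const[of 0] by (simp add: Bl_def)
qed (auto intro: TA.intros)

text \<open>The Laplacian preserves the class, and setting vector and covector to zero leaves only
  traces.\<close>

lemma WW_project:
  assumes G: "G \<in> WW" shows "(\<lambda>\<rho>. (Lap idx ^^ k) (\<lambda>z. G (\<rho>, z)) (\<lambda>_. 0)) \<in> TA"
proof -
  have "\<exists>G'\<in>WW. \<forall>\<rho>. (\<lambda>z. G' (\<rho>, z)) = (Lap idx ^^ k) (\<lambda>z. G (\<rho>, z))"
  proof (induction k)
    case 0
    then show ?case using G by auto
  next
    case (Suc k)
    then obtain G' where G': "G' \<in> WW" "\<forall>\<rho>. (\<lambda>z. G' (\<rho>, z)) = (Lap idx ^^ k) (\<lambda>z. G (\<rho>, z))" by (rule bexE)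
    show ?case by (intro bexI[OF _ WW_Lap[OF G'(1)]]) (simp add: G'(2))
  qed
  then obtain G' where G': "G' \<in> WW" "\<forall>\<rho>. (\<lambda>z. G' (\<rho>, z)) = (Lap idx ^^ k) (\<lambda>z. G (\<rho>, z))" by (rule bexE)
  show ?thesis using WW_zero[OF G'(1)] unfolding G'(2)[rule_format, symmetric] .
qed

text \<open>The entries of \<tau> have the common denominator \<Delta>, so a polynomial in them has
  a power of it; sums and products add the exponents.\<close>

lemma clear_denominators:
  assumes C: "fun_alg C" and D: "\<Delta> \<in> C"
    and e: "\<And>c p q. c \<in> AR \<Longrightarrow> p < row_dim Q d c \<Longrightarrow> q < col_dim Q d c \<Longrightarrow> \<exists>E\<in>C. \<forall>x\<in>X. \<Delta> x * \<tau> x c $$ (p, q) = E x"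
    and F: "F \<in> PF"
  shows "\<exists>N. \<exists>P\<in>C. \<forall>x\<in>X. \<Delta> x ^ N * F (\<tau> x) = P x"
  using F
proof (induction rule: polynomial_functions.induct)
  case (const z)
  show ?case by (intro exI[of _ 0] bexI[OF _ fun_alg_const[OF C, of z]]) simp
next
  case (entry k p q)
  show ?case by (rule exI[of _ 1]) (use e[OF entry] in \<open>simp only: power_one_right\<close>)
next
  case (add F G)
  from add.IH(1) obtain N P where P: "P \<in> C" "\<forall>x\<in>X. \<Delta> x ^ N * F (\<tau> x) = P x" by (elim exE bexE)
  from add.IH(2) obtain N' P' where P': "P' \<in> C" "\<forall>x\<in>X. \<Delta> x ^ N' * G (\<tau> x) = P' x" by (elim exE bexE)
  show ?case
  proof (intro exI[of _ "N + N'"] bexI[of _ "\<lambda>x. \<Delta> x ^ N' * P x + \<Delta> x ^ N * P' x"] ballI)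
    show "\<Delta> x ^ (N + N') * (F (\<tau> x) + G (\<tau> x)) = \<Delta> x ^ N' * P x + \<Delta> x ^ N * P' x" if "x \<in> X" for x
      unfolding P(2)[rule_format, OF that, symmetric] P'(2)[rule_format, OF that, symmetric]
      by (simp add: power_add algebra_simps)
  qed (intro fun_alg_add[OF C] fun_alg_mult[OF C] fun_alg_power[OF C] D P(1) P'(1))
next
  case (mult F G)
  from mult.IH(1) obtain N P where P: "P \<in> C" "\<forall>x\<in>X. \<Delta> x ^ N * F (\<tau> x) = P x" by (elim exE bexE)
  from mult.IH(2) obtain N' P' where P': "P' \<in> C" "\<forall>x\<in>X. \<Delta> x ^ N' * G (\<tau> x) = P' x" by (elim exE bexE)
  show ?case
  proof (intro exI[of _ "N + N'"] bexI[of _ "\<lambda>x. P x * P' x"] ballI)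
    show "\<Delta> x ^ (N + N') * (F (\<tau> x) * G (\<tau> x)) = P x * P' x" if "x \<in> X" for x
      unfolding P(2)[rule_format, OF that, symmetric] P'(2)[rule_format, OF that, symmetric]
      by (simp add: power_add algebra_simps)
  qed (intro fun_alg_mult[OF C] P(1) P'(1))
qed

end

text \<open>Cramer's rule, by multiplying A B = 1 with the adjugate of A.\<close>

lemma cofactor_inverse:
  assumes A: "A \<in> carrier_mat n n" and B: "B \<in> carrier_mat n n" and AB: "A * B = 1\<^sub>m n" and k: "k < n" "q < n"
  shows "det A * B $$ (k, q) = cofactor A q (k :: nat) * (1 :: complex)"
proof -
  have "adj_mat A = adj_mat A * (A * B)" using adj_mat(1)[OF A] by (simp add: AB)
  also have "\<dots> = det A \<cdot>\<^sub>m 1\<^sub>m n * B"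
    by (simp add: assoc_mult_mat[OF adj_mat(1)[OF A] A B, symmetric] adj_mat(3)[OF A])
  also have "\<dots> = det A \<cdot>\<^sub>m B" using mult_smult_assoc_mat[OF one_carrier_mat B, of "det A"] B by simp
  finally have "adj_mat A $$ (k, q) = (det A \<cdot>\<^sub>m B) $$ (k, q)" by simp
  then show ?thesis using A B k by (simp add: adj_mat_def)
qed

context quiver
begin

text \<open>Lift the matrix units to \<open>F x y\<close> in the path algebra. For a vector \<open>w\<close> and a covector \<open>\<xi>\<close>, the
  vectors \<open>F y b w\<close> and covectors \<open>\<xi> F b y\<close> define endomorphisms \<open>g\<close> and \<open>g'\<close> at any representation,
  and \<open>g' \<rho> g'\<^sup>-\<^sup>1 = (g' \<rho> g) (g' g)\<^sup>-\<^sup>1\<close> has entries that are quotients of polynomials in the \<open>\<xi> f w\<close>.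
  Hence \<open>\<Delta>\<^sup>N H\<close> is such a polynomial, and a power of the Laplacian that pairs \<open>w\<close> with \<open>\<xi>\<close>
  turns it into a trace polynomial.\<close>

lemma local_quotient:
  assumes u0: "full (ent \<rho>0)" and r0: "\<rho>0 \<in> rep_space Q d" and H: "H \<in> IP"
  shows "\<exists>D\<in>TA. \<exists>P\<in>TA. D \<rho>0 \<noteq> 0 \<and> (\<forall>\<rho>\<in>rep_space Q d. D \<rho> * H \<rho> = P \<rho>)"
proof (cases "idx = {}")
  case True
  have "\<rho> = \<rho>0" if "\<rho> \<in> rep_space Q d" for \<rho>
  proof -
    have "rho (ent \<rho>) = rho (ent \<rho>0)" by (rule rho_cong) (simp add: ent_def True)
    then show ?thesis by (simp add: rho_ent that r0)
  qed
  then have "\<forall>\<rho>\<in>rep_space Q d. 1 * H \<rho> = H \<rho>0" by auto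
  then show ?thesis by (intro bexI[OF _ TA.const[of 1]] bexI[OF _ TA.const[of "H \<rho>0"]]) simp
next
  case False
  then obtain b where b: "b \<in> idx" by blast
  obtain F where F: "\<And>x y. x \<in> idx \<Longrightarrow> y \<in> idx \<Longrightarrow> F x y \<in> AA"
    and F0: "\<And>x y. x \<in> idx \<Longrightarrow> y \<in> idx \<Longrightarrow> R (ent \<rho>0) (F x y) = munit x y"
    and Fl: "\<And>x y. x \<in> idx \<Longrightarrow> y \<in> idx \<Longrightarrow> vx (fst x) \<star> F x y = F x y"
    and Fr: "\<And>x y. x \<in> idx \<Longrightarrow> y \<in> idx \<Longrightarrow> F x y \<star> vx (fst y) = F x y"
    by (rule full_lifts[OF u0]) blast
  have Rl: "R (ent \<rho>) (F x y) = proj (fst x) \<diamond> R (ent \<rho>) (F x y)"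
    and Rr: "R (ent \<rho>) (F x y) = R (ent \<rho>) (F x y) \<diamond> proj (fst y)" if "x \<in> idx" "y \<in> idx" for \<rho> x y
    using R_mult[OF blk_ent AA_vx[OF idx_fst[OF that(1)]] F[OF that], of \<rho>]
      R_mult[OF blk_ent F[OF that] AA_vx[OF idx_fst[OF that(2)]], of \<rho>]
    by (simp_all add: Fl Fr that R_vx)
  \<comment> \<open>The i-th diagonal block of g' g, written through \<open>Bl\<close> so that its
    entries visibly lie in \<open>WW\<close>.\<close>
  define Mm where "Mm i x = Matrix.mat (d i) (d i) (\<lambda>(p, q). Bl (F b (i, p) \<star> F (i, q) b) x)" for i x
  define \<Delta> where "\<Delta> x = (\<Prod>i\<in>verts Q. det (Mm i x))" for x
  have Mmc: "Mm i x \<in> carrier_mat (d i) (d i)" for i x by (simp add: Mm_def)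
  have Mme: "(\<lambda>x. Mm i x $$ (p, q)) \<in> WW" if "i \<in> verts Q" "p < d i" "q < d i" for i p q
  proof -
    have "(\<lambda>x. Mm i x $$ (p, q)) = Bl (F b (i, p) \<star> F (i, q) b)" using that by (auto simp: Mm_def)
    then show ?thesis using that b by (simp add: WW.bil AA_mult F)
  qed
  have dW: "(\<lambda>x. det (Mm i x)) \<in> WW" if "i \<in> verts Q" for i
    by (rule fun_alg_det[OF fun_alg_WW Mmc Mme[OF that]])
  have \<Delta>W: "\<Delta> \<in> WW" unfolding \<Delta>_def[abs_def] by (intro fun_alg_prod[OF fun_alg_WW] dW)
  \<comment> \<open>Covector and vector become row b and column b of square matrices, so that \<xi>
    f w is the entry at (b, b) of a matrix product.\<close>
  define \<Xi> where "\<Xi> x = (\<lambda>a k. if a = b then snd x (Inr k) else (0 :: complex))"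
    for x :: "('e + 'e \<Rightarrow> complex mat) \<times> ('v \<times> nat + 'v \<times> nat \<Rightarrow> complex)"
  define W where "W x = (\<lambda>k a. if a = b then snd x (Inl k) else (0 :: complex))"
    for x :: "('e + 'e \<Rightarrow> complex mat) \<times> ('v \<times> nat + 'v \<times> nat \<Rightarrow> complex)"
  have Bl: "Bl f x = (\<Xi> x \<diamond> R (ent (fst x)) f \<diamond> W x) b b" for f x
    unfolding Bl_def by (subst sum.swap) (simp add: mm_def \<Xi>_def W_def sum_distrib_right)
  define g where "g x = (\<lambda>s y. if y \<in> idx then (R (ent (fst x)) (F y b) \<diamond> W x) s b else 0)" for x
  define g' where "g' x = (\<lambda>y s. if y \<in> idx then (\<Xi> x \<diamond> R (ent (fst x)) (F b y)) b s else 0)" for x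
  have bg: "blkd (g x)" for x
  proof -
    have "s \<in> idx \<and> y \<in> idx \<and> fst s = fst y" if "g x s y \<noteq> 0" for s y
    proof -
      have y: "y \<in> idx" and n: "(R (ent (fst x)) (F y b) \<diamond> W x) s b \<noteq> 0" using that by (auto simp: g_def split: if_splits)
      have "R (ent (fst x)) (F y b) \<diamond> W x = proj (fst y) \<diamond> (R (ent (fst x)) (F y b) \<diamond> W x)"
        by (subst Rl[OF y b]) (rule mm_assoc)
      then have "(proj (fst y) \<diamond> (R (ent (fst x)) (F y b) \<diamond> W x)) s b \<noteq> 0" using n by simp
      then show ?thesis unfolding proj_mm using y by (simp split: if_splits)
    qed
    then show ?thesis unfolding blkd_def by blast
  qed
  have bg': "blkd (g' x)" for x
  proof -
    have "y \<in> idx \<and> s \<in> idx \<and> fst y = fst s" if "g' x y s \<noteq> 0" for s y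
    proof -
      have y: "y \<in> idx" and n: "(\<Xi> x \<diamond> R (ent (fst x)) (F b y)) b s \<noteq> 0" using that by (auto simp: g'_def split: if_splits)
      have "\<Xi> x \<diamond> R (ent (fst x)) (F b y) = (\<Xi> x \<diamond> R (ent (fst x)) (F b y)) \<diamond> proj (fst y)"
        by (subst Rr[OF b y]) (rule mm_assoc[symmetric])
      then have "(\<Xi> x \<diamond> R (ent (fst x)) (F b y) \<diamond> proj (fst y)) b s \<noteq> 0" using n by simp
      then show ?thesis unfolding mm_proj using y by (simp split: if_splits)
    qed
    then show ?thesis unfolding blkd_def by blast
  qed
  have sand: "(g' x \<diamond> (A \<diamond> g x)) y y' = (\<Xi> x \<diamond> (R (ent (fst x)) (F b y) \<diamond> (A \<diamond> R (ent (fst x)) (F y' b))) \<diamond> W x) b b"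
    if "y \<in> idx" "y' \<in> idx" for x A y y'
  proof -
    let ?L = "\<Xi> x \<diamond> R (ent (fst x)) (F b y)" and ?r = "R (ent (fst x)) (F y' b) \<diamond> W x"
    have "(A \<diamond> g x) s y' = (A \<diamond> ?r) s b" for s
      unfolding mm_def[of A] using that by (simp add: g_def)
    then have "(g' x \<diamond> (A \<diamond> g x)) y y' = (?L \<diamond> (A \<diamond> ?r)) b b"
      unfolding mm_def[of "g' x"] mm_def[of ?L] using that by (simp add: g'_def)
    then show ?thesis by (simp only: mm_assoc)
  qed
  have Mg: "(g' x \<diamond> g x) y y' = Bl (F b y \<star> F y' b) x" if "y \<in> idx" "y' \<in> idx" for x y y'
    using sand[OF that, of x om] that b
    by (simp add: Bl R_mult[OF blk_ent] F mm_om_left blkd_fm[OF bg] R_fm[OF blk_ent])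
  have Ng: "(g' x \<diamond> (ent (fst x) c \<diamond> g x)) y y' = Bl (F b y \<star> (arr c \<star> F y' b)) x"
    if "y \<in> idx" "y' \<in> idx" "c \<in> AR" for x y y' c
    using sand[OF that(1,2), of x "ent (fst x) c"] that b
    by (simp add: Bl R_mult[OF blk_ent] F AA_arr AA_mult R_arr blk_ent)
  have bmM: "bm i i (g' x \<diamond> g x) = Mm i x" if "i \<in> verts Q" for i x
    by (rule eq_matI) (use that in \<open>simp_all add: Mm_def Mg\<close>)
  have dets: "det (Mm i x) = det (bm i i (g' x)) * det (bm i i (g x))" if "i \<in> verts Q" for i x
    using det_mult[OF bm_carrier(1) bm_carrier(1), of i "g' x" "g x"] bm_blkd_mult[OF that bg', of i x "g x"] bmM[OF that]
    by simp
  \<comment> \<open>On this set g and g' are both invertible, since \<Delta> is the product of the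
    determinants of their blocks.\<close>
  define X where "X = {x. fst x \<in> rep_space Q d \<and> \<Delta> x \<noteq> 0}"
  have inv: "(\<exists>h. inv_pair (g' x) h) \<and> (\<exists>h. inv_pair (g x) h)" if "x \<in> X" for x
  proof -
    have "det (Mm i x) \<noteq> 0" if i: "i \<in> verts Q" for i
      using \<open>x \<in> X\<close> i by (auto simp: X_def \<Delta>_def)
    then show ?thesis using inv_pair_det[OF bg', of x] inv_pair_det[OF bg, of x] by (simp add: dets)
  qed
  define hi where "hi x = (SOME h. inv_pair (g' x) h)" for x
  have hi: "inv_pair (g' x) (hi x)" if "x \<in> X" for x
    unfolding hi_def by (rule someI_ex[OF conjunct1[OF inv[OF that]]])
  define \<tau> where "\<tau> x = rho (cj (g' x) (hi x) (ent (fst x)))" for x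
  have HF: "H \<in> PF" by (rule IP_PF[OF H])
  have H\<tau>: "H (\<tau> x) = H (fst x)" if "x \<in> X" for x
    using H hi[OF that] that unfolding IP_iff by (simp add: \<tau>_def X_def)
  have entry: "\<exists>E\<in>WW. \<forall>x\<in>X. \<Delta> x * \<tau> x c $$ (p, q) = E x"
    if c: "c \<in> AR" and p: "p < row_dim Q d c" and q: "q < col_dim Q d c" for c p q
  proof (intro bexI ballI)
    let ?i = "hdc c" and ?j = "tlc c"
    have v: "?i \<in> verts Q" "?j \<in> verts Q" by (rule AR_verts[OF c])+
    have pq: "p < d ?i" "q < d ?j" using p q by (simp_all add: row_dim_def col_dim_def)
    let ?rest = "\<lambda>x. \<Prod>i\<in>verts Q - {?j}. det (Mm i x)"
    \<comment> \<open>Cramer's rule for the inverse of g' g in the block at the tail; the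
      determinants of the other blocks complete the denominator \<Delta>.\<close>
    let ?E = "\<lambda>x. ?rest x * (\<Sum>k<d ?j. Bl (F b (?i, p) \<star> (arr c \<star> F (?j, k) b)) x * cofactor (Mm ?j x) q k)"
    show "?E \<in> WW"
    proof (intro fun_alg_mult[OF fun_alg_WW] fun_alg_prod[OF fun_alg_WW] fun_alg_sum[OF fun_alg_WW] dW)
      fix k assume "k \<in> {..<d ?j}"
      then have k: "k < d ?j" by simp
      show "Bl (F b (?i, p) \<star> (arr c \<star> F (?j, k) b)) \<in> WW"
        using k pq v b by (intro WW.bil AA_mult AA_arr c F) simp_all
      show "(\<lambda>x. cofactor (Mm ?j x) q k) \<in> WW"
        by (rule fun_alg_cofactor[OF fun_alg_WW Mmc Mme[OF v(2)] pq(2) k])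
    qed auto
    fix x assume x: "x \<in> X"
    let ?u = "ent (fst x)"
    obtain h where h: "inv_pair (g x) h" using inv[OF x] by blast
    let ?B = "h \<diamond> hi x" and ?N = "g' x \<diamond> (?u c \<diamond> g x)"
    have gB: "g x \<diamond> ?B = hi x"
      by (rule inv_cancel[OF h]) (use hi[OF x] in \<open>simp add: inv_pair_def blkd_fm\<close>)
    have "cj (g' x) (hi x) ?u c = ?N \<diamond> ?B" unfolding cj_def by (simp only: mm_assoc gB)
    then have t: "\<tau> x c = bm ?i ?j (?N \<diamond> ?B)" using c by (simp add: \<tau>_def rho_def)
    have "blk (cj (g' x) (g x) ?u)" by (rule blk_sandwich[OF bg' bg blk_ent])
    from blkD[OF this c] have "?N (?i, p) z = 0" if "fst z \<noteq> ?j" for p z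
      using that unfolding cj_def mm_assoc by blast
    then have "bm ?i ?j (?N \<diamond> ?B) = bm ?i ?j ?N * bm ?j ?j ?B" by (intro bm_mult v)
    then have "\<tau> x c $$ (p, q) = (\<Sum>k<d ?j. ?N (?i, p) (?j, k) * bm ?j ?j ?B $$ (k, q))"
      using pq by (simp add: t scalar_prod_def atLeast0LessThan del: bm_index(1)) simp
    also have "\<dots> = (\<Sum>k<d ?j. Bl (F b (?i, p) \<star> (arr c \<star> F (?j, k) b)) x * bm ?j ?j ?B $$ (k, q))"
      using v pq by (intro sum.cong refl) (simp add: Ng c)
    finally have t: "\<tau> x c $$ (p, q) = \<dots>" .
    have "Mm ?j x * bm ?j ?j ?B = bm ?j ?j (g' x \<diamond> g x \<diamond> ?B)"
      by (simp only: bm_blkd_mult[OF v(2) blkd_mm[OF bg' bg]] bmM[OF v(2)])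
    also have "g' x \<diamond> g x \<diamond> ?B = om" using hi[OF x] by (simp only: mm_assoc gB inv_pair_def)
    finally have "Mm ?j x * bm ?j ?j ?B = 1\<^sub>m (d ?j)" by (simp only: bm_om[OF v(2)])
    then have cof: "det (Mm ?j x) * bm ?j ?j ?B $$ (k, q) = cofactor (Mm ?j x) q k" if "k < d ?j" for k
      using cofactor_inverse[OF Mmc bm_carrier(1) _ that pq(2)] by simp
    have "\<Delta> x = ?rest x * det (Mm ?j x)" unfolding \<Delta>_def using v(2) by (simp add: prod.remove[of _ ?j])
    then have "\<Delta> x * \<tau> x c $$ (p, q) = ?rest x * (\<Sum>k<d ?j. Bl (F b (?i, p) \<star> (arr c \<star> F (?j, k) b)) x * (det (Mm ?j x) * bm ?j ?j ?B $$ (k, q)))"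
      unfolding t sum_distrib_left by (intro sum.cong refl) (simp only: mult.assoc mult.left_commute)
    also have "\<dots> = ?E x" using cof by simp
    finally show "\<Delta> x * \<tau> x c $$ (p, q) = ?E x" .
  qed
  have "\<exists>N. \<exists>P\<in>WW. \<forall>x\<in>X. \<Delta> x ^ N * H (\<tau> x) = P x"
    by (rule clear_denominators[where X = X and \<tau> = \<tau>, OF fun_alg_WW \<Delta>W _ HF]) (rule entry)
  then obtain N P where P: "P \<in> WW" "\<forall>x\<in>X. \<Delta> x ^ N * H (\<tau> x) = P x" by (elim exE bexE)
  \<comment> \<open>The additional factor \<Delta> makes the identity hold also where \<Delta> is
    zero, hence for all z, as differentiation in z requires.\<close>
  have key: "\<Delta> (\<rho>, z) ^ Suc N * H \<rho> = \<Delta> (\<rho>, z) * P (\<rho>, z)" if "\<rho> \<in> rep_space Q d" for \<rho> z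
  proof (cases "\<Delta> (\<rho>, z) = 0")
    case False
    then have "(\<rho>, z) \<in> X" using that by (simp add: X_def)
    then show ?thesis using P(2)[rule_format, of "(\<rho>, z)"] H\<tau>[of "(\<rho>, z)"] by simp
  qed simp
  \<comment> \<open>At \<open>\<rho>0\<close> each block of g' g is a scalar, so the power of
    \<Delta> is the n-th power of the product of the b-th coordinates of w and \<xi>. Then n
    Laplacians leave a nonzero constant.\<close>
  define n where "n = (\<Sum>i\<in>verts Q. d i) * Suc N"
  let ?D = "\<lambda>\<rho>. (Lap idx ^^ n) (\<lambda>z. \<Delta> (\<rho>, z) ^ Suc N) (\<lambda>_. 0)"
  let ?P = "\<lambda>\<rho>. (Lap idx ^^ n) (\<lambda>z. \<Delta> (\<rho>, z) * P (\<rho>, z)) (\<lambda>_. 0)"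
  have DW: "(\<lambda>x. \<Delta> x ^ Suc N) \<in> WW" by (rule fun_alg_power[OF fun_alg_WW \<Delta>W])
  have "?D \<in> TA" by (rule WW_project[OF DW])
  moreover have "?P \<in> TA" by (rule WW_project[OF WW.mult[OF \<Delta>W P(1)]])
  moreover have "?D \<rho>0 \<noteq> 0"
  proof -
    have "Mm i (\<rho>0, z) = (z (Inl b) * z (Inr b)) \<cdot>\<^sub>m 1\<^sub>m (d i)" if i: "i \<in> verts Q" for i z
    proof (rule eq_matI)
      fix p q assume "p < dim_row ((z (Inl b) * z (Inr b)) \<cdot>\<^sub>m 1\<^sub>m (d i))" "q < dim_col ((z (Inl b) * z (Inr b)) \<cdot>\<^sub>m 1\<^sub>m (d i))"
      then have pq: "p < d i" "q < d i" by simp_all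
      have e: "R (ent \<rho>0) (F b (i, p) \<star> F (i, q) b) = (if p = q then munit b b else 0)"
        using pq i b by (simp add: R_mult[OF blk_ent] F F0 munit_munit)
      have "Bl (F b (i, p) \<star> F (i, q) b) (\<rho>0, z) = (\<Sum>a\<in>idx. if a = b then \<Sum>k\<in>idx. if k = b then (if p = q then z (Inr b) * z (Inl b) else 0) else 0 else 0)"
        unfolding Bl_def fst_conv snd_conv e by (intro sum.cong refl) (auto simp: munit_def pw intro!: sum.cong)
      also have "\<dots> = (if p = q then z (Inr b) * z (Inl b) else 0)" using finI b by simp
      finally show "Mm i (\<rho>0, z) $$ (p, q) = ((z (Inl b) * z (Inr b)) \<cdot>\<^sub>m 1\<^sub>m (d i)) $$ (p, q)"
        using pq by (simp add: Mm_def)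
    qed (simp_all add: Mm_def)
    then have "\<Delta> (\<rho>0, z) = (z (Inl b) * z (Inr b)) ^ (\<Sum>i\<in>verts Q. d i)" for z
      by (simp add: \<Delta>_def power_sum)
    then have "(\<lambda>z. \<Delta> (\<rho>0, z) ^ Suc N) = (\<lambda>z. (z (Inl b) * z (Inr b)) ^ n)"
      by (simp only: n_def power_mult)
    then show ?thesis using Lap_funpow_power[OF finI b, of n] by auto
  qed
  \<comment> \<open>The value of H does not involve z, so it passes through the Laplacian.\<close>
  moreover have "?D \<rho> * H \<rho> = ?P \<rho>" if r: "\<rho> \<in> rep_space Q d" for \<rho>
  proof -
    have "(\<lambda>z. \<Delta> (\<rho>, z) * P (\<rho>, z)) = (\<lambda>z. H \<rho> * \<Delta> (\<rho>, z) ^ Suc N)"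
      using key[OF r] by (simp only: mult.commute)
    moreover have "(Lap idx ^^ n) (\<lambda>z. H \<rho> * \<Delta> (\<rho>, z) ^ Suc N) = (\<lambda>z. H \<rho> * (Lap idx ^^ n) (\<lambda>z. \<Delta> (\<rho>, z) ^ Suc N) z)"
      using Lap_funpow_cmult[OF WW_Pol[OF DW, of \<rho>]] by blast
    ultimately show ?thesis by (simp only: mult.commute)
  qed
  ultimately show ?thesis by (intro bexI[of _ ?D] bexI[of _ ?P] conjI ballI)
qed

text \<open>The quotient rule for D H = P where D is nonzero. As in \<open>TA_derivation\<close>, f
  depends on the point but not on the derivation.\<close>

lemma IP_derivation:
  assumes u: "full (ent \<rho>)" and r: "\<rho> \<in> rep_space Q d" and H: "H \<in> IP"
  shows "\<exists>f\<in>AA. \<forall>\<delta>. pder \<rho> \<delta> \<longrightarrow> \<delta> H = \<delta> (trf f)"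
proof -
  obtain D P where D: "D \<in> TA" and P: "P \<in> TA" and D0: "D \<rho> \<noteq> 0" and DP: "\<forall>\<sigma>\<in>rep_space Q d. D \<sigma> * H \<sigma> = P \<sigma>"
    using local_quotient[OF u r H] by (elim bexE conjE)
  obtain f where f: "f \<in> AA" "\<forall>\<delta>. pder \<rho> \<delta> \<longrightarrow> \<delta> D = \<delta> (trf f)" using TA_derivation[OF D, of \<rho>] by (elim bexE)
  obtain g where g: "g \<in> AA" "\<forall>\<delta>. pder \<rho> \<delta> \<longrightarrow> \<delta> P = \<delta> (trf g)" using TA_derivation[OF P, of \<rho>] by (elim bexE)
  let ?h = "path_scale (inverse (D \<rho>)) g + path_scale (- (H \<rho> * inverse (D \<rho>))) f"
  show ?thesis
  proof (intro bexI[of _ ?h] allI impI)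
    show "?h \<in> AA" by (intro AA_add AA_scale f g)
    fix \<delta> assume \<delta>: "pder \<rho> \<delta>"
    have "\<delta> (\<lambda>x. D x * H x) = \<delta> P"
      by (rule pderD(3)[OF \<delta> fun_alg_mult[OF fun_alg_IP TA_IP[OF D] H] TA_IP[OF P] DP[rule_format]])
    then have "D \<rho> * \<delta> H + H \<rho> * \<delta> (trf f) = \<delta> (trf g)"
      unfolding pderD(2)[OF \<delta> TA_IP[OF D] H] f(2)[rule_format, OF \<delta>] g(2)[rule_format, OF \<delta>] .
    then have "\<delta> H = inverse (D \<rho>) * \<delta> (trf g) + (- (H \<rho> * inverse (D \<rho>))) * \<delta> (trf f)"
      using D0 by (simp add: field_simps)
    then show "\<delta> H = \<delta> (trf ?h)"
      unfolding pder_trf_add[OF \<delta> AA_scale[OF g(1)] AA_scale[OF f(1)]] pder_trf_scale[OF \<delta> f(1)] pder_trf_scale[OF \<delta> g(1)] .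
  qed
qed

section \<open>The embedding\<close>

lemma rep_poisson_antisym: "rep_poisson Q d F G \<rho> = - rep_poisson Q d G F \<rho>"
  unfolding rep_poisson_def sum_negf[symmetric] by (intro sum.cong refl) (simp add: mult.commute)

lemma rep_poisson_cong:
  assumes "\<And>c p q. c \<in> AR \<Longrightarrow> entry_deriv Q d c p q G \<rho> = entry_deriv Q d c p q G' \<rho>"
  shows "rep_poisson Q d F G \<rho> = rep_poisson Q d F G' \<rho>"
  unfolding rep_poisson_def by (intro sum.cong refl) (simp add: assms AR_I)

lemma trf_bracket_antisym:
  assumes r: "\<rho> \<in> rep_space Q d" and f: "f \<in> AA" and g: "g \<in> AA"
  shows "trf (path_bracket Q g f) \<rho> = - trf (path_bracket Q f g) \<rho>"
  using rep_poisson_antisym[of "trf g" "trf f" \<rho>]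
  by (simp add: rep_poisson_trf r f g dpol_trf)

lemma dpol_const: "dpol (\<lambda>_. z) \<rho> w = 0"
  by (simp add: dpol_def entry_deriv_const)

lemma dpol_add: "F \<in> PF \<Longrightarrow> G \<in> PF \<Longrightarrow> dpol (\<lambda>x. F x + G x) \<rho> w = dpol F \<rho> w + dpol G \<rho> w"
  unfolding dpol_def by (simp add: entry_deriv_add distrib_right sum.distrib)

lemma dpol_mult: "F \<in> PF \<Longrightarrow> G \<in> PF \<Longrightarrow> \<rho> \<in> rep_space Q d \<Longrightarrow>
  dpol (\<lambda>x. F x * G x) \<rho> w = F \<rho> * dpol G \<rho> w + G \<rho> * dpol F \<rho> w"
  unfolding dpol_def by (simp add: entry_deriv_mult sum.distrib sum_distrib_left sum_distrib_right algebra_simps)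

lemma orbit_subset:
  assumes GH: "inv_pair G H"
  shows "{rho (cj A B (ent (rho (cj G H (ent \<rho>))))) | A B. inv_pair A B} \<subseteq> {rho (cj A B (ent \<rho>)) | A B. inv_pair A B}"
proof (rule subsetI)
  fix \<sigma> assume "\<sigma> \<in> {rho (cj A B (ent (rho (cj G H (ent \<rho>))))) | A B. inv_pair A B}"
  then obtain A B where AB: "inv_pair A B" and \<sigma>: "\<sigma> = rho (cj A B (ent (rho (cj G H (ent \<rho>)))))" by blast
  have "\<sigma> = rho (cj (A \<diamond> G) (H \<diamond> B) (ent \<rho>))"
    unfolding \<sigma>
  proof (rule rho_cong)
    fix c assume c: "c \<in> AR"
    show "cj A B (ent (rho (cj G H (ent \<rho>)))) c = cj (A \<diamond> G) (H \<diamond> B) (ent \<rho>) c"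
      unfolding cj_def[of A B] ent_rho[OF blk_cj[OF GH blk_ent] c]
      unfolding cj_def by (simp only: mm_assoc)
  qed
  then show "\<sigma> \<in> {rho (cj A B (ent \<rho>)) | A B. inv_pair A B}" using inv_pair_mult[OF AB GH] by blast
qed

text \<open>The matrix from \<open>intertwiner\<close> is injective on the total space. A kernel
  vector of one diagonal block, extended by zero, would contradict this, so all blocks are
  invertible.\<close>

lemma equal_traces_conj:
  assumes u: "full (ent \<rho>)" and u': "full (ent \<sigma>)" and s: "\<sigma> \<in> rep_space Q d"
    and t: "\<And>f. f \<in> AA \<Longrightarrow> trf f \<rho> = trf f \<sigma>"
  shows "\<exists>G H. inv_pair G H \<and> \<sigma> = rho (cj G H (ent \<rho>))"
proof -
  have ex: "\<exists>G. blkd G \<and> (\<forall>c\<in>AR. G \<diamond> ent \<rho> c = ent \<sigma> c \<diamond> G)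
    \<and> (\<forall>z. (\<forall>x\<in>idx. (\<Sum>y\<in>idx. G x y * z y) = 0) \<longrightarrow> (\<forall>y\<in>idx. z y = 0))"
    by (rule intertwiner[OF u u']) (rule t[unfolded trf_def])
  obtain G where bG: "blkd G" and c: "\<forall>c\<in>AR. G \<diamond> ent \<rho> c = ent \<sigma> c \<diamond> G"
    and inj: "\<forall>z. (\<forall>x\<in>idx. (\<Sum>y\<in>idx. G x y * z y) = 0) \<longrightarrow> (\<forall>y\<in>idx. z y = 0)"
    using ex by (elim exE conjE)
  have "det (bm i i G) \<noteq> 0" if i: "i \<in> verts Q" for i
  proof
    assume "det (bm i i G) = 0"
    then obtain v where v: "v \<in> carrier_vec (d i)" "v \<noteq> 0\<^sub>v (d i)" "bm i i G *\<^sub>v v = 0\<^sub>v (d i)"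
      using det_0_iff_vec_prod_zero[OF bm_carrier(1)[of i i G]] by blast
    define z where "z y = (if fst y = i then vec_index v (snd y) else 0)" for y
    have "(\<Sum>y\<in>idx. G x y * z y) = 0" if x: "x \<in> idx" for x
    proof (cases "fst x = i")
      case True
      have "(\<Sum>y\<in>idx. G x y * z y) = (\<Sum>k<d i. G x (i, k) * z (i, k))"
        by (rule sum_block[OF i]) (simp add: z_def)
      also have "\<dots> = vec_index (bm i i G *\<^sub>v v) (snd x)"
        using v(1) x True by (cases x) (auto simp: scalar_prod_def atLeast0LessThan z_def intro!: sum.cong)
      finally show ?thesis using v(3) x True by (cases x) simp
    next
      case False
      then show ?thesis using blkdD[OF bG, of x] by (intro sum.neutral ballI) (auto simp: z_def)
    qed
    then have "z y = 0" if "y \<in> idx" for y using inj[rule_format, of z] that by blast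
    then have "vec_index v k = 0" if "k < d i" for k using that i by (force simp: z_def)
    then have "v = 0\<^sub>v (d i)" using v(1) by (intro eq_vecI) auto
    then show False using v(2) by simp
  qed
  then obtain H where GH: "inv_pair G H" using inv_pair_det[OF bG] by blast
  have "rho (ent \<sigma>) = rho (cj G H (ent \<rho>))"
  proof (rule rho_cong)
    fix a assume a: "a \<in> AR"
    have "cj G H (ent \<rho>) a = ent \<sigma> a \<diamond> (G \<diamond> H)" unfolding cj_def c[rule_format, OF a] by (rule mm_assoc)
    then show "ent \<sigma> a = cj G H (ent \<rho>) a"
      using GH by (simp add: inv_pair_def mm_om_right blk_fm[OF blk_ent a])
  qed
  then show ?thesis using GH unfolding rho_ent[OF s] by blast
qed

lemma cj_om: "\<rho> \<in> rep_space Q d \<Longrightarrow> rho (cj om om (ent \<rho>)) = \<rho>"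
  using rho_cong[of "cj om om (ent \<rho>)" "ent \<rho>"]
  by (simp add: cj_def mm_om_left mm_om_right blk_fm[OF blk_ent] rho_ent)

subsection \<open>The Lie algebra of classes\<close>

abbreviation "LL \<equiv> quiver_lie_algebra Q"
abbreviation cls where "cls f \<equiv> commutator_rel Q `` {f}"

lemma span_facts:
  "0 \<in> commutator_span Q"
  "f \<in> commutator_span Q \<Longrightarrow> g \<in> commutator_span Q \<Longrightarrow> f + g \<in> commutator_span Q"
  "f \<in> commutator_span Q \<Longrightarrow> path_scale z f \<in> commutator_span Q"
  "f \<in> commutator_span Q \<Longrightarrow> - f \<in> commutator_span Q"
proof -
  show "0 \<in> commutator_span Q" "f \<in> commutator_span Q \<Longrightarrow> g \<in> commutator_span Q \<Longrightarrow> f + g \<in> commutator_span Q"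
    "f \<in> commutator_span Q \<Longrightarrow> path_scale z f \<in> commutator_span Q" "f \<in> commutator_span Q \<Longrightarrow> - f \<in> commutator_span Q"
    unfolding commutator_span_def by (simp_all add: path_vs.span_zero path_vs.span_add path_vs.span_scale path_vs.span_neg)
qed

lemma rel_iff: "(f, g) \<in> commutator_rel Q \<longleftrightarrow> f \<in> AA \<and> g \<in> AA \<and> g - f \<in> commutator_span Q"
  using span_facts(4)[of "f - g"] span_facts(4)[of "g - f"] by (auto simp: commutator_rel_def)

lemma cls_eqI:
  assumes "f \<in> AA" "g \<in> AA" "f - g \<in> commutator_span Q" shows "cls f = cls g"
proof (rule Set.set_eqI)
  fix h
  have "h - f \<in> commutator_span Q \<longleftrightarrow> h - g \<in> commutator_span Q"
    using span_facts(2)[of "h - f" "f - g"] span_facts(2)[of "h - g" "- (f - g)"] span_facts(4)[OF assms(3)] assms(3)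
    by auto
  then show "h \<in> cls f \<longleftrightarrow> h \<in> cls g" using assms by (simp add: rel_iff)
qed

lemma cls_self: "f \<in> AA \<Longrightarrow> f \<in> cls f" by (simp add: rel_iff span_facts(1))

lemma LL_carrier: "lie_carrier LL = {cls f | f. f \<in> AA}"
  by (auto simp: quiver_lie_algebra_def quotient_def)

lemma trf_cls: "f \<in> AA \<Longrightarrow> g \<in> cls f \<Longrightarrow> trf g \<rho> = trf f \<rho>"
  using tr_commutator_span[OF blk_ent, of "g - f" \<rho>] by (simp add: rel_iff trf_def R_diff tr_diff)

lemma trf_some: "f \<in> AA \<Longrightarrow> trf (SOME g. g \<in> cls f) \<rho> = trf f \<rho>"
  by (rule trf_cls) (simp_all only: someI[where P = "\<lambda>g. g \<in> cls f", OF cls_self])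

lemma UN_cls:
  assumes f: "f \<in> AA" and op: "\<And>f'. f' \<in> cls f \<Longrightarrow> op f' \<in> AA \<and> op f' - op f \<in> commutator_span Q"
  shows "(\<Union>f'\<in>cls f. cls (op f')) = cls (op f)"
proof -
  have "cls (op f') = cls (op f)" if "f' \<in> cls f" for f'
    using op[OF that] op[OF cls_self[OF f]] by (intro cls_eqI) auto
  then show ?thesis using cls_self[OF f] by blast
qed

lemma UN_cls2:
  assumes f: "f \<in> AA" and g: "g \<in> AA"
    and op: "\<And>f' g'. f' \<in> cls f \<Longrightarrow> g' \<in> cls g \<Longrightarrow> op f' g' \<in> AA \<and> op f' g' - op f g \<in> commutator_span Q"
  shows "(\<Union>f'\<in>cls f. \<Union>g'\<in>cls g. cls (op f' g')) = cls (op f g)"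
proof -
  have "cls (op f' g') = cls (op f g)" if "f' \<in> cls f" "g' \<in> cls g" for f' g'
    using op[OF that] op[OF cls_self[OF f] cls_self[OF g]] by (intro cls_eqI) auto
  then show ?thesis using cls_self[OF f] cls_self[OF g] by blast
qed

lemma lie_add_cls:
  assumes f: "f \<in> AA" and g: "g \<in> AA" shows "lie_add LL (cls f) (cls g) = cls (f + g)"
proof -
  have "f' + g' \<in> AA \<and> (f' + g') - (f + g) \<in> commutator_span Q" if "f' \<in> cls f" "g' \<in> cls g" for f' g'
    using that f g span_facts(2)[of "f' - f" "g' - g"] by (auto simp: rel_iff AA_add algebra_simps)
  from UN_cls2[where op = "(+)", OF f g this] show ?thesis by (simp add: quiver_lie_algebra_def)
qed

lemma lie_scale_cls:
  assumes f: "f \<in> AA" shows "lie_scale LL z (cls f) = cls (path_scale z f)"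
proof -
  have "path_scale z f' \<in> AA \<and> path_scale z f' - path_scale z f \<in> commutator_span Q" if "f' \<in> cls f" for f'
    using that f span_facts(3)[of "f' - f" z] by (auto simp: rel_iff AA_scale path_vs.scale_right_diff_distrib)
  from UN_cls[where op = "path_scale z", OF f this] show ?thesis by (simp add: quiver_lie_algebra_def)
qed

text \<open>Cyclic derivatives are constant on classes, so the brackets of all representatives are
  literally equal.\<close>

lemma lie_bracket_cls:
  assumes f: "f \<in> AA" and g: "g \<in> AA" shows "lie_bracket LL (cls f) (cls g) = cls (path_bracket Q f g)"
proof -
  have "path_bracket Q f' g' \<in> AA \<and> path_bracket Q f' g' - path_bracket Q f g \<in> commutator_span Q"
    if "f' \<in> cls f" "g' \<in> cls g" for f' g'
  proof -
    have "cyclic_deriv Q c f' = cyclic_deriv Q c f" "cyclic_deriv Q c g' = cyclic_deriv Q c g" for c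
      using that f g cyclic_deriv_commutator_span[of "f' - f" c] cyclic_deriv_commutator_span[of "g' - g" c]
      by (simp_all add: rel_iff cyclic_deriv_diff)
    then have "path_bracket Q f' g' = path_bracket Q f g" by (simp add: path_bracket_def)
    then show ?thesis using AA_bracket[OF f g] span_facts(1) by simp
  qed
  from UN_cls2[where op = "path_bracket Q", OF f g this] show ?thesis by (simp add: quiver_lie_algebra_def)
qed

end

context quiver_orbit
begin

abbreviation "XX \<equiv> quiver_variety Q d \<O>"
abbreviation "QP \<equiv> quiver_points Q d \<O>"

lemma MM_rep: "\<rho> \<in> MM \<Longrightarrow> \<rho> \<in> rep_space Q d" by (simp add: MM_iff)

lemma QP_eq: "QP = (\<lambda>\<rho>. {rho (cj G H (ent \<rho>)) | G H. inv_pair G H}) ` MM"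
proof -
  have "QP = (\<lambda>\<rho>. orbit (gauge_group Q d) (rep_act Q d) \<rho>) ` MM"
    unfolding quiver_points_def orbits_def by (rule Setcompr_eq_image)
  also have "\<dots> = (\<lambda>\<rho>. {rho (cj G H (ent \<rho>)) | G H. inv_pair G H}) ` MM"
    by (rule image_cong[OF refl rep_orbit[OF MM_rep]])
  finally show ?thesis .
qed

section \<open>Functions on the quotient and their lifts\<close>

definition rp :: "('e + 'e \<Rightarrow> complex mat) set \<Rightarrow> 'e + 'e \<Rightarrow> complex mat" where
  "rp x = (SOME \<rho>. \<rho> \<in> MM \<and> x = {rho (cj G H (ent \<rho>)) | G H. inv_pair G H})"

lemma rp:
  assumes "x \<in> QP"
  shows "rp x \<in> MM" "x = {rho (cj G H (ent (rp x))) | G H. inv_pair G H}"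
proof -
  have "\<exists>\<rho>. \<rho> \<in> MM \<and> x = {rho (cj G H (ent \<rho>)) | G H. inv_pair G H}" using assms unfolding QP_eq by blast
  from someI_ex[OF this] show "rp x \<in> MM" "x = {rho (cj G H (ent (rp x))) | G H. inv_pair G H}"
    unfolding rp_def by blast+
qed

lemma rp_rep: "x \<in> QP \<Longrightarrow> rp x \<in> rep_space Q d" using rp(1) MM_rep by blast

lemma IP_const:
  assumes F: "F \<in> IP" and x: "x \<in> QP" and r: "\<rho> \<in> x" shows "F \<rho> = F (rp x)"
proof -
  obtain G H where "inv_pair G H" "\<rho> = rho (cj G H (ent (rp x)))" using r rp(2)[OF x] by blast
  then show ?thesis using F rp_rep[OF x] by (simp add: IP_iff)
qed

lemma QP_MM:
  assumes x: "x \<in> QP" and r: "\<rho> \<in> x" shows "\<rho> \<in> MM"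
proof -
  obtain G H where "inv_pair G H" "\<rho> = rho (cj G H (ent (rp x)))" using r rp(2)[OF x] by blast
  then show ?thesis using MM_cj[OF rp(1)[OF x]] by simp
qed

lemma in_orbit: "\<rho> \<in> MM \<Longrightarrow> \<rho> \<in> {rho (cj G H (ent \<rho>)) | G H. inv_pair G H}"
  using cj_om[OF MM_rep, symmetric] inv_pair_om by blast

lemma MM_QP: "\<rho> \<in> MM \<Longrightarrow> \<exists>x\<in>QP. \<rho> \<in> x"
  unfolding QP_eq by (rule bexI, erule in_orbit, erule imageI)

lemma rp_in: "x \<in> QP \<Longrightarrow> rp x \<in> x"
  using in_orbit[OF rp(1)] by (simp only: rp(2)[symmetric])

text \<open>The function on the quotient to which an invariant polynomial descends; by
  \<open>regular_bar\<close> all regular functions arise so.\<close>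

definition bar where "bar F = (\<lambda>x\<in>QP. F (rp x))"

lemma lifts_bar: "F \<in> IP \<Longrightarrow> F \<in> lifts Q d \<O> (bar F)"
  by (simp add: lifts_def bar_def IP_const)

lemma bar_regular: "F \<in> IP \<Longrightarrow> bar F \<in> quiver_regular Q d \<O>"
  using lifts_bar by (auto simp: quiver_regular_def bar_def)

lemma lifts_eq:
  assumes "F \<in> lifts Q d \<O> h" "h \<in> extensional QP"
  shows "F \<in> IP" "h = bar F"
proof -
  show F: "F \<in> IP" using assms(1) by (simp add: lifts_def)
  show "h = bar F"
  proof (rule extensionalityI[OF assms(2)])
    fix x assume x: "x \<in> QP"
    then show "h x = bar F x" using assms(1) rp_in[OF x] unfolding lifts_def bar_def by simp
  qed (simp add: bar_def)
qed

lemma regular_bar: "h \<in> quiver_regular Q d \<O> \<Longrightarrow> \<exists>F\<in>IP. h = bar F"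
  using lifts_eq unfolding quiver_regular_def by blast

lemma bar_eq_MM:
  assumes "F \<in> IP" "G \<in> IP" "bar F = bar G" "\<rho> \<in> MM" shows "F \<rho> = G \<rho>"
proof -
  obtain x where x: "x \<in> QP" "\<rho> \<in> x" using MM_QP[OF assms(4)] by blast
  have "F (rp x) = G (rp x)" using fun_cong[OF assms(3), of x] x by (simp add: bar_def)
  then show ?thesis by (simp add: IP_const[OF assms(1) x] IP_const[OF assms(2) x])
qed

lemma bar_cong: "(\<And>\<rho>. \<rho> \<in> MM \<Longrightarrow> F \<rho> = G \<rho>) \<Longrightarrow> bar F = bar G"
  unfolding bar_def using rp(1) by (intro restrict_ext) blast

lemma lifts_MM:
  assumes "F \<in> IP" "G \<in> lifts Q d \<O> (bar F)" shows "G \<in> IP" "\<rho> \<in> MM \<Longrightarrow> G \<rho> = F \<rho>"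
proof -
  have "bar F \<in> extensional QP" by (simp add: bar_def)
  from lifts_eq[OF assms(2) this] show "G \<in> IP" "\<rho> \<in> MM \<Longrightarrow> G \<rho> = F \<rho>" using bar_eq_MM assms(1) by auto
qed

text \<open>A curve with velocity v inside the fibre of the moment map stays over the orbit, so F
  and G agree along it and have equal derivatives at its start.\<close>

lemma dpol_MM:
  assumes F: "F \<in> PF" and G: "G \<in> PF" and FG: "\<And>\<sigma>. \<sigma> \<in> MM \<Longrightarrow> F \<sigma> = G \<sigma>" and r: "\<rho> \<in> MM"
    and v: "blk v" "dmom (ent \<rho>) v = 0"
  shows "dpol F \<rho> (dvec v) = dpol G \<rho> (dvec v)"
proof -
  let ?u = "ent \<rho>"
  obtain S \<epsilon> where e: "\<epsilon> > 0" and S: "\<And>t. cmod t < \<epsilon> \<Longrightarrow> blk (S t) \<and> mom (\<lambda>c. ?u c + S t c) = mom ?u"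
    and S0: "\<And>c x y. c \<in> AR \<Longrightarrow> S 0 c x y = 0 \<and> ((\<lambda>t. S t c x y) has_field_derivative v c x y) (at 0)"
    using moment_curve[OF MM_full[OF r] v] by blast
  define \<sigma> where "\<sigma> t = rho (\<lambda>c. ?u c + S t c)" for t
  have \<sigma>0: "\<sigma> 0 = \<rho>"
  proof -
    have "\<sigma> 0 = rho ?u" unfolding \<sigma>_def by (rule rho_cong) (auto simp: fun_eq_iff pw S0)
    then show ?thesis using rho_ent MM_rep[OF r] by simp
  qed
  have \<sigma>M: "\<sigma> t \<in> MM" if t: "cmod t < \<epsilon>" for t
  proof -
    have "blk (\<lambda>c. ?u c + S t c)"
      unfolding blk_def
    proof (intro ballI allI impI)
      fix c x y assume c: "c \<in> AR" and n: "(?u c + S t c) x y \<noteq> 0"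
      then have "?u c x y \<noteq> 0 \<or> S t c x y \<noteq> 0" by (auto simp: pw)
      then show "x \<in> idx \<and> y \<in> idx \<and> fst x = hdc c \<and> fst y = tlc c"
        using blkD[OF blk_ent c] blkD[OF conjunct1[OF S[OF t]] c] by blast
    qed
    then show ?thesis using S[OF t] r unfolding \<sigma>_def by (simp add: MM_rho) (simp add: MM_iff)
  qed
  have ch: "((\<lambda>t. F (\<sigma> t)) has_field_derivative dpol F \<rho> (dvec v)) (at 0)" if "F \<in> PF" for F
  proof -
    have "((\<lambda>t. F (\<sigma> t)) has_field_derivative dpol F (\<sigma> 0) (dvec v)) (at 0)"
    proof (rule chain_rule[OF that])
      show "\<sigma> 0 \<in> rep_space Q d" using \<sigma>0 MM_rep[OF r] by simp
      fix c p q assume c: "c \<in> AR" "p < row_dim Q d c" "q < col_dim Q d c"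
      have "(\<lambda>t. \<sigma> t c $$ (p, q)) = (\<lambda>t. ?u c (hdc c, p) (tlc c, q) + S t c (hdc c, p) (tlc c, q))"
        using c by (simp add: \<sigma>_def rho_def row_dim_def col_dim_def pw)
      moreover have "((\<lambda>t. ?u c (hdc c, p) (tlc c, q) + S t c (hdc c, p) (tlc c, q)) has_field_derivative 0 + dvec v c p q) (at 0)"
        by (intro DERIV_add DERIV_const conjunct2[OF S0[OF c(1)]])
      ultimately show "((\<lambda>t. \<sigma> t c $$ (p, q)) has_field_derivative dvec v c p q) (at 0)" by simp
    qed
    then show ?thesis unfolding \<sigma>0 .
  qed
  have "((\<lambda>t. G (\<sigma> t)) has_field_derivative dpol F \<rho> (dvec v)) (at 0)"
    by (rule has_field_derivative_transform_within[OF ch[OF F] e]) (use FG \<sigma>M in \<open>auto simp: dist_norm\<close>)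
  then show ?thesis using ch[OF G] DERIV_unique by blast
qed

lemma dpol_ham_MM:
  assumes "F \<in> PF" "G \<in> PF" "\<And>\<sigma>. \<sigma> \<in> MM \<Longrightarrow> F \<sigma> = G \<sigma>" "\<rho> \<in> MM" "g \<in> AA"
  shows "dpol F \<rho> (dvec (ham (ent \<rho>) g)) = dpol G \<rho> (dvec (ham (ent \<rho>) g))"
  by (rule dpol_MM[OF assms(1-4)]) (simp_all add: blk_ham dmom_ham blk_ent assms(5))

text \<open>A lift may differ from a trace off the preimage, and its partial derivatives feel this.
  At \<rho>, however, G has the derivatives of some \<open>trf h\<close>, so the bracket with G
  differentiates along a Hamiltonian direction, where F may be replaced by \<open>trf f\<close>;
  antisymmetry then does the same for G.\<close>

lemma poisson_lifts:
  assumes f: "f \<in> AA" and g: "g \<in> AA" and r: "\<rho> \<in> MM"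
    and F: "F \<in> IP" "\<And>\<sigma>. \<sigma> \<in> MM \<Longrightarrow> F \<sigma> = trf f \<sigma>" and G: "G \<in> IP" "\<And>\<sigma>. \<sigma> \<in> MM \<Longrightarrow> G \<sigma> = trf g \<sigma>"
  shows "rep_poisson Q d F G \<rho> = trf (path_bracket Q f g) \<rho>"
proof -
  note rs = MM_rep[OF r]
  note PF = IP_PF[OF trf_IP[OF f]] IP_PF[OF trf_IP[OF g]] IP_PF[OF F(1)] IP_PF[OF G(1)]
  obtain h where h: "h \<in> AA" "\<forall>\<delta>. pder \<rho> \<delta> \<longrightarrow> \<delta> G = \<delta> (trf h)"
    using IP_derivation[OF MM_full[OF r] rs G(1)] by (elim bexE)
  have Gh: "rep_poisson Q d K G \<rho> = rep_poisson Q d K (trf h) \<rho>" for K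
    using h(2)[rule_format, OF pder_entry_deriv[OF rs]] by (rule rep_poisson_cong)
  have "rep_poisson Q d F G \<rho> = rep_poisson Q d (trf f) G \<rho>"
    unfolding Gh rep_poisson_trf[OF rs h(1)] by (rule dpol_ham_MM[OF PF(3,1) F(2) r h(1)])
  also have "\<dots> = - dpol G \<rho> (dvec (ham (ent \<rho>) f))"
    unfolding rep_poisson_antisym[of "trf f"] rep_poisson_trf[OF rs f] ..
  also have "\<dots> = - dpol (trf g) \<rho> (dvec (ham (ent \<rho>) f))"
    using dpol_ham_MM[OF PF(4,2) G(2) r f] by simp
  also have "\<dots> = trf (path_bracket Q f g) \<rho>"
    by (simp add: dpol_trf rs f g trf_bracket_antisym[OF rs f g])
  finally show ?thesis .
qed

lemma quiver_poisson_trf: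
  assumes f: "f \<in> AA" and g: "g \<in> AA"
  shows "quiver_poisson Q d \<O> (bar (trf f)) (bar (trf g)) = bar (trf (path_bracket Q f g))"
  unfolding quiver_poisson_def bar_def[of "trf (path_bracket Q f g)"]
proof (rule restrict_ext)
  fix x assume x: "x \<in> QP"
  have p: "rep_poisson Q d F G \<rho> = trf (path_bracket Q f g) (rp x)"
    if F: "F \<in> lifts Q d \<O> (bar (trf f))" and G: "G \<in> lifts Q d \<O> (bar (trf g))" and r: "\<rho> \<in> x" for F G \<rho>
    using poisson_lifts[OF f g QP_MM[OF x r] lifts_MM[OF trf_IP[OF f] F] lifts_MM[OF trf_IP[OF g] G]]
      IP_const[OF trf_IP[OF AA_bracket[OF f g]] x r] by simp
  show "(THE z. \<forall>F\<in>lifts Q d \<O> (bar (trf f)). \<forall>G\<in>lifts Q d \<O> (bar (trf g)). \<forall>\<rho>\<in>x. rep_poisson Q d F G \<rho> = z)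
    = trf (path_bracket Q f g) (rp x)"
  proof (rule the_equality)
    show "\<forall>F\<in>lifts Q d \<O> (bar (trf f)). \<forall>G\<in>lifts Q d \<O> (bar (trf g)). \<forall>\<rho>\<in>x. rep_poisson Q d F G \<rho> = trf (path_bracket Q f g) (rp x)"
      using p by blast
    fix z assume z: "\<forall>F\<in>lifts Q d \<O> (bar (trf f)). \<forall>G\<in>lifts Q d \<O> (bar (trf g)). \<forall>\<rho>\<in>x. rep_poisson Q d F G \<rho> = z"
    note lf = lifts_bar[OF trf_IP[OF f]] lifts_bar[OF trf_IP[OF g]] rp_in[OF x]
    show "z = trf (path_bracket Q f g) (rp x)"
      using p[OF lf] z[rule_format, OF lf] by simp
  qed
qed

text \<open>The character of a representative as a functional on classes. The choice made by
  \<open>SOME\<close> does not matter because traces kill commutators.\<close>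

definition emb where "emb x = (\<lambda>X\<in>lie_carrier LL. trf (SOME f. f \<in> X) (rp x))"

lemma emb_cls: "f \<in> AA \<Longrightarrow> emb x (cls f) = trf f (rp x)"
proof -
  assume f: "f \<in> AA"
  then have "cls f \<in> lie_carrier LL" unfolding LL_carrier by blast
  then show ?thesis unfolding emb_def by (simp only: restrict_apply' trf_some[OF f])
qed

lemma emb_lie_dual: "emb x \<in> lie_dual LL"
proof -
  have "emb x \<in> extensional (lie_carrier LL)" by (simp add: emb_def)
  moreover have "emb x (lie_add LL X Y) = emb x X + emb x Y" if X: "X \<in> lie_carrier LL" "Y \<in> lie_carrier LL" for X Y
  proof -
    obtain f g where f: "f \<in> AA" "X = cls f" and g: "g \<in> AA" "Y = cls g" using X unfolding LL_carrier by blast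
    show ?thesis unfolding f(2) g(2) by (simp only: lie_add_cls emb_cls f(1) g(1) AA_add trf_add)
  qed
  moreover have "emb x (lie_scale LL z X) = z * emb x X" if X: "X \<in> lie_carrier LL" for X z
  proof -
    obtain f where f: "f \<in> AA" "X = cls f" using X unfolding LL_carrier by blast
    show ?thesis unfolding f(2) by (simp only: lie_scale_cls emb_cls f(1) AA_scale trf_scale)
  qed
  ultimately show ?thesis by (simp add: lie_dual_def)
qed

lemma emb_inj: "inj_on emb QP"
proof (rule inj_onI)
  fix x y assume x: "x \<in> QP" and y: "y \<in> QP" and e: "emb x = emb y"
  have t: "trf f (rp x) = trf f (rp y)" if "f \<in> AA" for f
    using fun_cong[OF e, of "cls f"] by (simp only: emb_cls[OF that])
  have sub: "y \<subseteq> x" if x: "x \<in> QP" and y: "y \<in> QP" and t: "\<And>f. f \<in> AA \<Longrightarrow> trf f (rp x) = trf f (rp y)" for x y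
  proof -
    obtain G H where GH: "inv_pair G H" and ry: "rp y = rho (cj G H (ent (rp x)))"
      using equal_traces_conj[OF MM_full[OF rp(1)[OF x]] MM_full[OF rp(1)[OF y]] rp_rep[OF y] t] by blast
    have "y = {rho (cj A B (ent (rp y))) | A B. inv_pair A B}" by (rule rp(2)[OF y])
    also have "\<dots> \<subseteq> {rho (cj A B (ent (rp x))) | A B. inv_pair A B}" unfolding ry by (rule orbit_subset[OF GH])
    also have "\<dots> = x" by (rule rp(2)[OF x, symmetric])
    finally show ?thesis .
  qed
  show "x = y" using sub[OF x y t] sub[OF y x t[symmetric]] by blast
qed

section \<open>Compatibility with the brackets, and the differential of the embedding\<close>

lemma XX_simps: "points XX = QP" "regular XX = quiver_regular Q d \<O>" "poisson XX = quiver_poisson Q d \<O>"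
  by (simp_all add: quiver_variety_def)

lemma pullback_cls: "f \<in> AA \<Longrightarrow> pullback XX emb (cls f) = bar (trf f)"
  unfolding pullback_def XX_simps bar_def by (rule restrict_ext) (rule emb_cls)

lemma emb_lie_hom: "pullback_lie_hom XX LL emb"
proof -
  have cl: "\<exists>f\<in>AA. X = cls f" if "X \<in> lie_carrier LL" for X using that unfolding LL_carrier by blast
  show ?thesis
    unfolding pullback_lie_hom_def XX_simps
  proof (intro conjI ballI allI)
    fix X assume "X \<in> lie_carrier LL"
    then obtain f where f: "f \<in> AA" "X = cls f" using cl by blast
    show "pullback XX emb X \<in> quiver_regular Q d \<O>"
      unfolding f(2) pullback_cls[OF f(1)] by (rule bar_regular[OF trf_IP[OF f(1)]])
    show "pullback XX emb (lie_scale LL z X) = (\<lambda>x\<in>QP. z * pullback XX emb X x)" for z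
      unfolding f(2) lie_scale_cls[OF f(1)] pullback_cls[OF f(1)] pullback_cls[OF AA_scale[OF f(1)]] bar_def
      by (rule restrict_ext) (simp add: trf_scale)
    fix Y assume "Y \<in> lie_carrier LL"
    then obtain g where g: "g \<in> AA" "Y = cls g" using cl by blast
    show "pullback XX emb (lie_add LL X Y) = (\<lambda>x\<in>QP. pullback XX emb X x + pullback XX emb Y x)"
      unfolding f(2) g(2) lie_add_cls[OF f(1) g(1)] pullback_cls[OF f(1)] pullback_cls[OF g(1)] pullback_cls[OF AA_add[OF f(1) g(1)]] bar_def
      by (rule restrict_ext) (simp add: trf_add)
    show "pullback XX emb (lie_bracket LL X Y) = quiver_poisson Q d \<O> (pullback XX emb X) (pullback XX emb Y)"
      unfolding f(2) g(2) lie_bracket_cls[OF f(1) g(1)] pullback_cls[OF f(1)] pullback_cls[OF g(1)] pullback_cls[OF AA_bracket[OF f(1) g(1)]]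
      by (rule quiver_poisson_trf[OF f(1) g(1), symmetric])
  qed
qed

text \<open>Composition with \<open>bar\<close> makes a tangent vector of the quotient a point
  derivation at any point of the orbit; constants are killed because \<delta>(1) = 2
  \<delta>(1).\<close>

lemma tangent_pder:
  assumes x: "x \<in> QP" and \<delta>: "\<delta> \<in> tangent_space XX x" and r: "\<rho> \<in> x"
  shows "pder \<rho> (\<lambda>F. \<delta> (bar F))"
proof -
  have add: "\<delta> (\<lambda>y\<in>QP. h y + k y) = \<delta> h + \<delta> k"
    and sc: "\<delta> (\<lambda>y\<in>QP. z * h y) = z * \<delta> h"
    and mul: "\<delta> (\<lambda>y\<in>QP. h y * k y) = h x * \<delta> k + k x * \<delta> h"
    if "h \<in> quiver_regular Q d \<O>" "k \<in> quiver_regular Q d \<O>" for h k z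
    using \<delta> that unfolding tangent_space_def XX_simps by blast+
  note C = fun_alg_const[OF fun_alg_IP]
  have badd: "bar (\<lambda>y. F y + G y) = (\<lambda>y\<in>QP. bar F y + bar G y)" for F G
    unfolding bar_def by (rule restrict_ext) simp
  have bmul: "bar (\<lambda>y. F y * G y) = (\<lambda>y\<in>QP. bar F y * bar G y)" for F G
    unfolding bar_def by (rule restrict_ext) simp
  have bx: "bar F x = F \<rho>" if "F \<in> IP" for F using IP_const[OF that x r] x by (simp add: bar_def)
  have one: "\<delta> (bar (\<lambda>_. 1)) = 0"
    using mul[OF bar_regular[OF C[of 1]] bar_regular[OF C[of 1]]] by (simp add: bx C flip: bmul)
  show ?thesis
    unfolding pder_def
  proof (intro conjI ballI allI impI)
    fix F G assume F: "F \<in> IP" and G: "G \<in> IP"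
    show "\<delta> (bar (\<lambda>y. F y + G y)) = \<delta> (bar F) + \<delta> (bar G)"
      unfolding badd by (rule add[OF bar_regular[OF F] bar_regular[OF G]])
    show "\<delta> (bar (\<lambda>y. F y * G y)) = F \<rho> * \<delta> (bar G) + G \<rho> * \<delta> (bar F)"
      unfolding bmul mul[OF bar_regular[OF F] bar_regular[OF G]] bx[OF F] bx[OF G] ..
    assume "\<forall>y\<in>rep_space Q d. F y = G y"
    then have "bar F = bar G" by (intro bar_cong) (use MM_rep in blast)
    then show "\<delta> (bar F) = \<delta> (bar G)" by simp
  next
    fix z :: complex
    have "bar (\<lambda>_. z) = (\<lambda>y\<in>QP. z * bar (\<lambda>_. 1) y)" unfolding bar_def by (rule restrict_ext) simp
    then show "\<delta> (bar (\<lambda>_. z)) = 0" using sc[OF bar_regular[OF C[of 1]] bar_regular[OF C[of 1]], of z] one by simp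
  qed
qed

lemma differential_cls: "f \<in> AA \<Longrightarrow> differential XX LL emb \<delta> (cls f) = \<delta> (bar (trf f))"
proof -
  assume f: "f \<in> AA"
  then have "cls f \<in> lie_carrier LL" unfolding LL_carrier by blast
  then show ?thesis unfolding differential_def by (simp only: restrict_apply' pullback_cls[OF f])
qed

text \<open>The minus sign of the coadjoint action cancels against antisymmetry of the bracket under
  traces, so the class of g acts as its Hamiltonian field.\<close>

lemma coad_cls:
  assumes f: "f \<in> AA" and g: "g \<in> AA" and x: "x \<in> QP"
  shows "coad LL (cls g) (emb x) (cls f) = trf (path_bracket Q f g) (rp x)"
proof -
  have "cls f \<in> lie_carrier LL" using f unfolding LL_carrier by blast
  then have "coad LL (cls g) (emb x) (cls f) = - trf (path_bracket Q g f) (rp x)"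
    unfolding coad_def by (simp only: restrict_apply' lie_bracket_cls[OF g f] emb_cls[OF AA_bracket[OF g f]])
  then show ?thesis by (simp add: trf_bracket_antisym[OF rp_rep[OF x] f g])
qed

lemma LL_extI:
  assumes "\<xi> \<in> extensional (lie_carrier LL)" "\<eta> \<in> extensional (lie_carrier LL)" "\<And>f. f \<in> AA \<Longrightarrow> \<xi> (cls f) = \<eta> (cls f)"
  shows "\<xi> = \<eta>"
  by (rule extensionalityI[OF assms(1,2)]) (use assms(3) in \<open>auto simp only: LL_carrier\<close>)

text \<open>By \<open>IP_derivation\<close> each invariant shares its derivatives with a trace
  function, the same one for all tangent vectors at x, so a tangent vector is determined on
  traces.\<close>

lemma differential_inj:
  assumes x: "x \<in> QP" shows "inj_on (differential XX LL emb) (tangent_space XX x)"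
proof (rule inj_onI)
  fix \<delta> \<epsilon> assume \<delta>: "\<delta> \<in> tangent_space XX x" and \<epsilon>: "\<epsilon> \<in> tangent_space XX x"
    and e: "differential XX LL emb \<delta> = differential XX LL emb \<epsilon>"
  have t: "\<delta> (bar (trf f)) = \<epsilon> (bar (trf f))" if "f \<in> AA" for f
    using fun_cong[OF e, of "cls f"] by (simp only: differential_cls[OF that])
  have ext: "\<delta> \<in> extensional (quiver_regular Q d \<O>)" "\<epsilon> \<in> extensional (quiver_regular Q d \<O>)"
    using \<delta> \<epsilon> by (simp_all add: tangent_space_def XX_simps)
  show "\<delta> = \<epsilon>"
  proof (rule extensionalityI[OF ext])
    fix h assume "h \<in> quiver_regular Q d \<O>"
    then obtain F where F: "F \<in> IP" "h = bar F" using regular_bar by blast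
    obtain f where f: "f \<in> AA" "\<forall>\<delta>. pder (rp x) \<delta> \<longrightarrow> \<delta> F = \<delta> (trf f)"
      using IP_derivation[OF MM_full[OF rp(1)[OF x]] rp_rep[OF x] F(1)] by (elim bexE)
    show "\<delta> h = \<epsilon> h"
      using f(2)[rule_format, OF tangent_pder[OF x \<delta> rp_in[OF x]]] f(2)[rule_format, OF tangent_pder[OF x \<epsilon> rp_in[OF x]]] t[OF f(1)]
      by (simp only: F(2))
  qed
qed

text \<open>At every point over the orbit the moment map is conjugate to the given diagonal matrix,
  so the polynomial \<open>pA ls\<close> with the diagonal entries as roots annihilates it.\<close>

lemma trf_pA:
  assumes l: "diag l \<in> Orb" "l ` idx \<subseteq> set ls" and f: "f \<in> AA" and \<sigma>: "\<sigma> \<in> MM"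
  shows "trf (f \<star> pA ls) \<sigma> = 0"
proof -
  have "mom (ent \<sigma>) \<in> Orb" using \<sigma> by (simp add: MM_iff)
  from Orb_transitive[OF this l(1)] obtain G H where GH: "inv_pair G H" "diag l = G \<diamond> mom (ent \<sigma>) \<diamond> H" by blast
  let ?w = "cj G H (ent \<sigma>)"
  note bw = blk_cj[OF GH(1) blk_ent[of \<sigma>]]
  have m: "mom ?w = diag l" by (simp add: mom_cj GH blk_ent)
  have "(\<Prod>\<nu>\<leftarrow>ls. l y - \<nu>) = 0" if "y \<in> idx" for y
  proof -
    have "l y \<in> set ls" using l(2) that by blast
    then show ?thesis by (auto simp: prod_list_zero_iff)
  qed
  then have "R ?w (pA ls) = 0" unfolding R_pA[OF bw m] by (intro ext) (auto simp: diag_def pw)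
  then have "tr (R ?w (f \<star> pA ls)) = 0" by (simp add: R_mult[OF bw f AA_pA] mm_zero_right tr_0)
  then show ?thesis by (simp add: trf_def tr_R_cj[OF GH(1) blk_ent AA_mult[OF f AA_pA]])
qed

text \<open>\<open>functional_is_hamiltonian\<close> wants a diagonal moment map, so it is applied
  at a conjugate of \<open>rp x\<close>; invariance of traces brings the result back.\<close>

lemma differential_hamiltonian:
  assumes x: "x \<in> QP" and \<delta>: "\<delta> \<in> tangent_space XX x"
  shows "\<exists>g\<in>AA. \<forall>f\<in>AA. \<delta> (bar (trf f)) = trf (path_bracket Q f g) (rp x)"
proof -
  obtain G H l where GH: "inv_pair G H" and l: "mom (cj G H (ent (rp x))) = diag l"
    using diag_representative[OF rp(1)[OF x]] by blast
  define \<rho> where "\<rho> = rho (cj G H (ent (rp x)))"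
  have "\<rho> \<in> {rho (cj G H (ent (rp x))) | G H. inv_pair G H}" unfolding \<rho>_def using GH by blast
  then have rx: "\<rho> \<in> x" by (simp only: rp(2)[OF x, symmetric])
  have rM: "\<rho> \<in> MM" by (rule QP_MM[OF x rx])
  let ?u = "ent \<rho>"
  note full = MM_full[OF rM]
  have m: "mom ?u = diag l"
    unfolding l[symmetric] \<rho>_def by (rule mom_cong) (rule ent_rho[OF blk_cj[OF GH blk_ent]])
  then have lO: "diag l \<in> Orb" using rM by (simp add: MM_iff)
  obtain ls where ls: "set ls = l ` idx" "distinct ls" using finite_distinct_list[of "l ` idx"] finI by blast
  note pd = tangent_pder[OF x \<delta> rx]
  have "\<exists>g\<in>AA. \<forall>f\<in>AA. \<delta> (bar (trf f)) = tr (R ?u (path_bracket Q f g))"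
  proof (rule functional_is_hamiltonian[OF full, of "\<lambda>f. \<delta> (bar (trf f))" l ls])
    show "\<delta> (bar (trf (f + g))) = \<delta> (bar (trf f)) + \<delta> (bar (trf g))" if "f \<in> AA" "g \<in> AA" for f g
      by (rule pder_trf_add[OF pd that])
    show "\<delta> (bar (trf (path_scale z f))) = z * \<delta> (bar (trf f))" if "f \<in> AA" for z f
      by (rule pder_trf_scale[OF pd that])
    show "\<delta> (bar (trf (f \<star> g))) = \<delta> (bar (trf (g \<star> f)))" if "f \<in> AA" "g \<in> AA" for f g
      by (rule arg_cong[of _ _ \<delta>], rule bar_cong) (simp only: trf_def tr_R_commute[OF blk_ent that])
    show "\<delta> (bar (trf (f \<star> g))) = 0" if "f \<in> AA" "g \<in> AA" "R ?u f = 0" "R ?u g = 0" for f g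
      using pder_square_zero[OF full pd] that by blast
    have "trf oneA = (\<lambda>_. tr om)" by (simp add: trf_def[abs_def] R_one)
    then show "\<delta> (bar (trf oneA)) = 0" using pderD(4)[OF pd, of "tr om"] by simp
    show "\<delta> (bar (trf (f \<star> pA ls))) = 0" if "f \<in> AA" for f
    proof -
      have "bar (trf (f \<star> pA ls)) = bar (\<lambda>_. 0)"
        by (rule bar_cong) (rule trf_pA[OF lO _ that], simp add: ls(1))
      then show ?thesis using pderD(4)[OF pd, of 0] by simp
    qed
  qed (simp_all add: m ls)
  then obtain g where g: "g \<in> AA" "\<forall>f\<in>AA. \<delta> (bar (trf f)) = tr (R ?u (path_bracket Q f g))" by blast
  have "tr (R ?u (path_bracket Q f g)) = trf (path_bracket Q f g) (rp x)" if "f \<in> AA" for f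
    using IP_const[OF trf_IP[OF AA_bracket[OF that g(1)]] x rx] by (simp add: trf_def)
  then show ?thesis using g by auto
qed

text \<open>Differentiation along a Hamiltonian direction descends to the quotient, because by
  \<open>dpol_ham_MM\<close> it depends only on the values of a lift over the orbit.\<close>

lemma hamiltonian_tangent:
  assumes x: "x \<in> QP" and g: "g \<in> AA"
  shows "\<exists>\<delta>\<in>tangent_space XX x. \<forall>f\<in>AA. \<delta> (bar (trf f)) = trf (path_bracket Q f g) (rp x)"
proof -
  let ?w = "dvec (ham (ent (rp x)) g)"
  define \<delta> where "\<delta> = (\<lambda>h\<in>quiver_regular Q d \<O>. dpol (SOME F. F \<in> lifts Q d \<O> h) (rp x) ?w)"
  have b: "\<delta> (bar F) = dpol F (rp x) ?w" if F: "F \<in> IP" for F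
  proof -
    have L: "(SOME G. G \<in> lifts Q d \<O> (bar F)) \<in> lifts Q d \<O> (bar F)" 
    proof -
      have "\<exists>G. G \<in> lifts Q d \<O> (bar F)" by (rule exI[of _ F]) (rule lifts_bar[OF F])
      then show ?thesis by (rule someI_ex)
    qed
    have "dpol (SOME G. G \<in> lifts Q d \<O> (bar F)) (rp x) ?w = dpol F (rp x) ?w"
      by (rule dpol_ham_MM[OF IP_PF[OF lifts_MM(1)[OF F L]] IP_PF[OF F] lifts_MM(2)[OF F L] rp(1)[OF x] g])
    then show ?thesis using bar_regular[OF F] by (simp add: \<delta>_def)
  qed
  note C = fun_alg_const[OF fun_alg_IP]
  have "\<delta> \<in> tangent_space XX x"
    unfolding tangent_space_def XX_simps
  proof (intro CollectI conjI ballI allI)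
    show "\<delta> \<in> extensional (quiver_regular Q d \<O>)" by (simp add: \<delta>_def)
    fix h assume "h \<in> quiver_regular Q d \<O>"
    from regular_bar[OF this] obtain F where F: "F \<in> IP" "h = bar F" by (rule bexE)
    have hx: "h x = F (rp x)" using x by (simp add: F(2) bar_def)
    show "\<delta> (\<lambda>y\<in>QP. z * h y) = z * \<delta> h" for z
    proof -
      have "(\<lambda>y\<in>QP. z * h y) = bar (\<lambda>y. z * F y)" unfolding F(2) bar_def by (rule restrict_ext) simp
      then have "\<delta> (\<lambda>y\<in>QP. z * h y) = dpol (\<lambda>y. z * F y) (rp x) ?w"
        by (simp only: b[OF fun_alg_mult[OF fun_alg_IP C F(1)]])
      then show ?thesis
        unfolding F(2) b[OF F(1)] dpol_mult[OF IP_PF[OF C] IP_PF[OF F(1)] rp_rep[OF x]] by (simp add: dpol_const)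
    qed
    fix k assume "k \<in> quiver_regular Q d \<O>"
    from regular_bar[OF this] obtain G where G: "G \<in> IP" "k = bar G" by (rule bexE)
    have kx: "k x = G (rp x)" using x by (simp add: G(2) bar_def)
    have "(\<lambda>y\<in>QP. h y + k y) = bar (\<lambda>y. F y + G y)" unfolding F(2) G(2) bar_def by (rule restrict_ext) simp
    then have "\<delta> (\<lambda>y\<in>QP. h y + k y) = dpol (\<lambda>y. F y + G y) (rp x) ?w"
      by (simp only: b[OF fun_alg_add[OF fun_alg_IP F(1) G(1)]])
    then show "\<delta> (\<lambda>y\<in>QP. h y + k y) = \<delta> h + \<delta> k"
      unfolding F(2) G(2) b[OF F(1)] b[OF G(1)] dpol_add[OF IP_PF[OF F(1)] IP_PF[OF G(1)]] .
    have "(\<lambda>y\<in>QP. h y * k y) = bar (\<lambda>y. F y * G y)" unfolding F(2) G(2) bar_def by (rule restrict_ext) simp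
    then have "\<delta> (\<lambda>y\<in>QP. h y * k y) = dpol (\<lambda>y. F y * G y) (rp x) ?w"
      by (simp only: b[OF fun_alg_mult[OF fun_alg_IP F(1) G(1)]])
    then show "\<delta> (\<lambda>y\<in>QP. h y * k y) = h x * \<delta> k + k x * \<delta> h"
      unfolding hx kx
      unfolding F(2) G(2) b[OF F(1)] b[OF G(1)] dpol_mult[OF IP_PF[OF F(1)] IP_PF[OF G(1)] rp_rep[OF x]] .
  qed
  moreover have "\<delta> (bar (trf f)) = trf (path_bracket Q f g) (rp x)" if "f \<in> AA" for f
    by (simp only: b[OF trf_IP[OF that]] dpol_trf[OF rp_rep[OF x] that g])
  ultimately show ?thesis by blast
qed

lemma differential_image:
  assumes x: "x \<in> QP"
  shows "differential XX LL emb ` tangent_space XX x = (\<lambda>X. coad LL X (emb x)) ` lie_carrier LL"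
proof (rule equalityI; rule subsetI)
  have eq: "differential XX LL emb \<delta> = coad LL (cls g) (emb x)"
    if g: "g \<in> AA" and e: "\<forall>f\<in>AA. \<delta> (bar (trf f)) = trf (path_bracket Q f g) (rp x)" for \<delta> g
  proof (rule LL_extI)
    fix f assume f: "f \<in> AA"
    show "differential XX LL emb \<delta> (cls f) = coad LL (cls g) (emb x) (cls f)"
      unfolding differential_cls[OF f] coad_cls[OF f g x] using e f by blast
  qed (simp_all add: differential_def coad_def)
  fix \<xi>
  {
    assume "\<xi> \<in> differential XX LL emb ` tangent_space XX x"
    then obtain \<delta> where \<delta>: "\<delta> \<in> tangent_space XX x" "\<xi> = differential XX LL emb \<delta>" by blast
    obtain g where g: "g \<in> AA" "\<forall>f\<in>AA. \<delta> (bar (trf f)) = trf (path_bracket Q f g) (rp x)"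
      using differential_hamiltonian[OF x \<delta>(1)] by blast
    show "\<xi> \<in> (\<lambda>X. coad LL X (emb x)) ` lie_carrier LL"
      unfolding \<delta>(2) eq[OF g] LL_carrier using g(1) by blast
  }
  {
    assume "\<xi> \<in> (\<lambda>X. coad LL X (emb x)) ` lie_carrier LL"
    then obtain g where g: "g \<in> AA" "\<xi> = coad LL (cls g) (emb x)" unfolding LL_carrier by blast
    obtain \<delta> where \<delta>: "\<delta> \<in> tangent_space XX x" "\<forall>f\<in>AA. \<delta> (bar (trf f)) = trf (path_bracket Q f g) (rp x)"
      using hamiltonian_tangent[OF x g(1)] by blast
    show "\<xi> \<in> differential XX LL emb ` tangent_space XX x"
      unfolding g(2) eq[OF g(1) \<delta>(2), symmetric] by (rule imageI[OF \<delta>(1)])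
  }
qed

lemma embedded: "embedded_as_coadjoint_orbit XX LL emb"
  unfolding embedded_as_coadjoint_orbit_def XX_simps(1)
  using emb_lie_dual emb_inj emb_lie_hom differential_inj differential_image by blast

end

theorem theorem1p2:
  fixes Q :: "('v, 'e) pre_digraph"
    and d :: "'v \<Rightarrow> nat"
    and \<O> :: "('v \<Rightarrow> complex mat) set"
  assumes "fin_digraph Q"
    and "\<O> \<in> orbits (gauge_group Q d) (sg Q d) (Ad Q d)"
    and "zariski_closed_in_sg Q d \<O>"
    and "acts_freely (gauge_group Q d) (rep_act Q d) (moment_preimage Q d \<O>)"
  shows "\<exists>\<phi>. embedded_as_coadjoint_orbit (quiver_variety Q d \<O>) (quiver_lie_algebra Q) \<phi>"
proof -
  interpret fin_digraph Q by (rule assms(1))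
  interpret quiver_orbit Q d \<O> by unfold_locales (use assms in simp_all)
  show ?thesis by (rule exI) (rule embedded)
qed

end
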